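(* Let $\tau$ be a random time with $\mathbb P[\tau=\infty]=0$, let $\mathbf G$ be the progressive enlargement of $\mathbf F$ with respect to $\tau$, let $(K,L)$ be the representation pair associated with $\tau$, and let $\eta$ be the $\mathbf F$-stopping time associated with $\tau$, as defined in the context. The following statements hold true: (1) Let $X$ be a nonnegative supermartingale on $(\Omega,\mathbf F,\mathbb P)$. Then the process $X^\tau/L^\tau$ is a supermartingale on $(\Omega,\mathbf G,\mathbb P)$. (2) Let $X$ be a nonnegative local martingale on $(\Omega,\mathbf F,\mathbb P)$ such that $[[\eta,\infty[[\,\subseteq\{X=0\}$ holds (modulo evanescence). Then the process $X^\tau/L^\tau$ is a local martingale on $(\Omega,\mathbf G,\mathbb P)$.
   Context: Let $(\Omega,\mathcal F,\mathbf F,\mathbb P)$ be a filtered probability space, where $\mathbf F=(\mathcal F_t)_{t\in\mathbb R_+}$ satisfies the usual hypotheses (right-continuity and saturation by $\mathbb P$-null sets); $\mathcal F_\infty\subseteq\mathcal F$, possibly strictly. For a process $X$, $X^\tau=(X_{\tau\wedge t})_{t\in\mathbb R_+}$. Progressive enlargement. $\tau:\Omega\to[0,\infty]$ is an $\mathcal F$-measurable random time with $\mathbb P[\tau=\infty]=0$. The progressively enlarged filtration $\mathbf G=(\mathcal G_t)_{t\in\mathbb R_+}$ is $$\mathcal G_t=\{B\in\mathcal F : B\cap\{\tau>t\}=B_t\cap\{\tau>t\}\text{ for some }B_t\in\mathcal F_t\}.$$ The stopping time $\eta$. Let $Z$ be the Azéma supermartingale of $\tau$, i.e. the optional projection of $\mathbb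 I_{[[0,\tau[[}$ on $(\Omega,\mathbf F,\mathbb P)$, so $Z_\sigma=\mathbb P[\tau>\sigma\mid\mathcal F_\sigma]$ for all finite $\mathbf F$-stopping times $\sigma$. Let $A$ be the dual optional projection of $\mathbb I_{[[\tau,\infty[[}$ on $(\Omega,\mathbf F,\mathbb P)$ (with $A_{0-}=0$), so $\Delta A_\sigma=\mathbb P[\tau=\sigma\mid\mathcal F_\sigma]$ on $\{\sigma<\infty\}$ for every $\mathbf F$-stopping time $\sigma$. Put $\zeta=\inf\{t\in\mathbb R_+: Z_t=0\}$, $\Lambda=\{\zeta<\infty,\ Z_{\zeta-}>0,\ \Delta A_\zeta=0\}$, and $\eta=\zeta\,\mathbb I_\Lambda+\infty\,\mathbb I_{\Omega\setminus\Lambda}$, an $\mathbf F$-stopping time. Representation pair (known result). There is a pair of processes $(K,L)$, uniquely specified by the following properties: (1) $K$ is $\mathbf F$-adapted, right-continuous, nondecreasing, $0\le K\le1$ (with $K_{0-}=0$); (2) $L$ is a nonnegative local martingale on $(\Omega,\mathbf F,\mathbb P)$ with $L_0=1$; (3) for every nonnegative $\mathbf F$-optional process $V$, $\mathbb E[V_\tau]=\mathbb E\big[\int_{[0,\infty)}V_tL_t\,\mathrm dK_t\big]$; (4) $\int_{[0,\infty)}\mathbb I_{\{K_{t-}=1\}}\,\mathrm dL_t=0$ and $\int_{[0,\infty)}\mathbb I_{\{L_t=0\}}\,\mathrm dK_t=0$ $\mathbb P$-a.s. Moreover $Z=L(1-K)$, and $[[0,\tau]]\subseteq\{L>0\}$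 modulo evanescence, so that $1/L^\tau$ is well defined. *)

theory Defs
  imports "HOL-Probability.Probability"
begin

text \<open>
  Processes are functions \<open>X :: real \<Rightarrow> 'a \<Rightarrow> real\<close> of time and outcome, of which only the times
  \<open>t \<ge> 0\<close> matter.  Filtrations are indexed by \<open>real\<close> in the same way.  Random times take values in
  \<open>[0, \<infinity>]\<close>, rendered by \<^typ>\<open>ennreal\<close>; for this reason the library notion of a stopping time, whose
  values lie in the index type of the filtration, is not used.  Path properties are required up to
  a null set (modulo evanescence).
\<close>

section \<open>Filtrations, stopping times and processes\<close>

locale usual_filtration = prob_space M for M :: "'a measure" +
  fixes F :: "real \<Rightarrow> 'a measure"
  assumes subalgebra_F: "0 \<le> t \<Longrightarrow> subalgebra M (F t)"
    and mono_F: "0 \<le> s \<Longrightarrow> s \<le> t \<Longrightarrow> sets (F s) \<subseteq> sets (F t)"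
    and right_continuous_F: "0 \<le> t \<Longrightarrow> sets (F t) = (\<Inter>s\<in>{t<..}. sets (F s))"
    and saturated_F: "N \<in> null_sets M \<Longrightarrow> A \<subseteq> N \<Longrightarrow> A \<in> sets (F 0)"

definition stop_time :: "'a measure \<Rightarrow> (real \<Rightarrow> 'a measure) \<Rightarrow> ('a \<Rightarrow> ennreal) \<Rightarrow> bool" where
  "stop_time M F T \<longleftrightarrow> (\<forall>t\<ge>0. {\<omega> \<in> space M. T \<omega> \<le> ennreal t} \<in> sets (F t))"

text \<open>For a stopping time the generating collection already is a \<open>\<sigma>\<close>-algebra.\<close>

definition stop_sigma :: "'a measure \<Rightarrow> (real \<Rightarrow> 'a measure) \<Rightarrow> ('a \<Rightarrow> ennreal) \<Rightarrow> 'a measure" where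
  "stop_sigma M F T =
     sigma (space M) {A \<in> sets M. \<forall>t\<ge>0. {\<omega> \<in> A. T \<omega> \<le> ennreal t} \<in> sets (F t)}"

definition at_time :: "(real \<Rightarrow> 'a \<Rightarrow> 'b) \<Rightarrow> ('a \<Rightarrow> ennreal) \<Rightarrow> 'a \<Rightarrow> 'b" where
  "at_time X T \<omega> = X (enn2real (T \<omega>)) \<omega>"

definition stopped :: "('a \<Rightarrow> ennreal) \<Rightarrow> (real \<Rightarrow> 'a \<Rightarrow> 'b) \<Rightarrow> real \<Rightarrow> 'a \<Rightarrow> 'b" where
  "stopped T X t \<omega> = X (enn2real (min (T \<omega>) (ennreal t))) \<omega>"

definition adapted :: "(real \<Rightarrow> 'a measure) \<Rightarrow> (real \<Rightarrow> 'a \<Rightarrow> real) \<Rightarrow> bool" where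
  "adapted F X \<longleftrightarrow> (\<forall>t\<ge>0. X t \<in> borel_measurable (F t))"

definition right_cont_path :: "(real \<Rightarrow> real) \<Rightarrow> bool" where
  "right_cont_path f \<longleftrightarrow> (\<forall>t\<ge>0. (f \<longlongrightarrow> f t) (at_right t))"

definition cadlag_path :: "(real \<Rightarrow> real) \<Rightarrow> bool" where
  "cadlag_path f \<longleftrightarrow> right_cont_path f \<and> (\<forall>t>0. \<exists>l. (f \<longlongrightarrow> l) (at_left t))"

text \<open>The left limit \<open>f(t-)\<close>, where \<open>f(0-)\<close> is the prescribed value \<open>a\<close>.\<close>

definition left_lim :: "real \<Rightarrow> (real \<Rightarrow> real) \<Rightarrow> real \<Rightarrow> real" where
  "left_lim a f t = (if t \<le> 0 then a else Lim (at_left t) f)"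

definition nonneg_process :: "'a measure \<Rightarrow> (real \<Rightarrow> 'a \<Rightarrow> real) \<Rightarrow> bool" where
  "nonneg_process M X \<longleftrightarrow> (AE \<omega> in M. \<forall>t\<ge>0. 0 \<le> X t \<omega>)"


section \<open>Martingales\<close>

definition supermartingale ::
  "'a measure \<Rightarrow> (real \<Rightarrow> 'a measure) \<Rightarrow> (real \<Rightarrow> 'a \<Rightarrow> real) \<Rightarrow> bool" where
  "supermartingale M F X \<longleftrightarrow>
     adapted F X \<and> (AE \<omega> in M. cadlag_path (\<lambda>t. X t \<omega>)) \<and> (\<forall>t\<ge>0. integrable M (X t)) \<and>
     (\<forall>s\<ge>0. \<forall>t\<ge>s. AE \<omega> in M. real_cond_exp M (F s) (X t) \<omega> \<le> X s \<omega>)"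

definition martingale ::
  "'a measure \<Rightarrow> (real \<Rightarrow> 'a measure) \<Rightarrow> (real \<Rightarrow> 'a \<Rightarrow> real) \<Rightarrow> bool" where
  "martingale M F X \<longleftrightarrow>
     adapted F X \<and> (AE \<omega> in M. cadlag_path (\<lambda>t. X t \<omega>)) \<and> (\<forall>t\<ge>0. integrable M (X t)) \<and>
     (\<forall>s\<ge>0. \<forall>t\<ge>s. AE \<omega> in M. real_cond_exp M (F s) (X t) \<omega> = X s \<omega>)"

definition local_martingale ::
  "'a measure \<Rightarrow> (real \<Rightarrow> 'a measure) \<Rightarrow> (real \<Rightarrow> 'a \<Rightarrow> real) \<Rightarrow> bool" where
  "local_martingale M F X \<longleftrightarrow>
     adapted F X \<and> (AE \<omega> in M. cadlag_path (\<lambda>t. X t \<omega>)) \<and>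
     (\<exists>T :: nat \<Rightarrow> 'a \<Rightarrow> ennreal.
        (\<forall>n. stop_time M F (T n)) \<and>
        (AE \<omega> in M. incseq (\<lambda>n. T n \<omega>) \<and> (\<lambda>n. T n \<omega>) \<longlonglongrightarrow> \<infinity>) \<and>
        (\<forall>n. martingale M F (stopped (T n) X)))"


section \<open>Optional processes and increasing processes\<close>

definition optional_sigma :: "'a measure \<Rightarrow> (real \<Rightarrow> 'a measure) \<Rightarrow> (real \<times> 'a) measure" where
  "optional_sigma M F = sigma ({0..} \<times> space M)
     {{(t, \<omega>) \<in> {0..} \<times> space M. X t \<omega> \<in> B} | X B.
        adapted F X \<and> (\<forall>\<omega>\<in>space M. cadlag_path (\<lambda>t. X t \<omega>)) \<and> B \<in> sets borel}"

definition optional :: "'a measure \<Rightarrow> (real \<Rightarrow> 'a measure) \<Rightarrow> (real \<Rightarrow> 'a \<Rightarrow> real) \<Rightarrow> bool" where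
  "optional M F V \<longleftrightarrow> (\<lambda>(t, \<omega>). V t \<omega>) \<in> borel_measurable (optional_sigma M F)"

text \<open>Nondecreasing right-continuous paths, with the convention \<open>k(0-) = 0\<close>.\<close>

definition increasing_path :: "(real \<Rightarrow> real) \<Rightarrow> bool" where
  "increasing_path k \<longleftrightarrow> 0 \<le> k 0 \<and> mono_on {0..} k \<and> right_cont_path k"

text \<open>The Lebesgue--Stieltjes integral \<open>\<integral>\<^bsub>[0,\<infinity>)\<^esub> f dk\<close> with \<open>k(0-) = 0\<close>, so that \<open>dk\<close> has mass \<open>k 0\<close>
  at \<open>0\<close>.\<close>

definition stieltjes_integral :: "(real \<Rightarrow> real) \<Rightarrow> (real \<Rightarrow> real) \<Rightarrow> ennreal" where
  "stieltjes_integral f k =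
     (\<integral>\<^sup>+ t\<in>{0..}. ennreal (f t) \<partial>interval_measure (\<lambda>t. if t < 0 then 0 else k t))"

definition optional_projection ::
  "'a measure \<Rightarrow> (real \<Rightarrow> 'a measure) \<Rightarrow> (real \<Rightarrow> 'a \<Rightarrow> real) \<Rightarrow> (real \<Rightarrow> 'a \<Rightarrow> real) \<Rightarrow> bool" where
  "optional_projection M F X Y \<longleftrightarrow>
     optional M F Y \<and>
     (\<forall>T. stop_time M F T \<longrightarrow>
        (AE \<omega> in M. T \<omega> < \<infinity> \<longrightarrow>
           at_time Y T \<omega> =
             real_cond_exp M (stop_sigma M F T)
               (\<lambda>\<omega>. if T \<omega> < \<infinity> then at_time X T \<omega> else 0) \<omega>))"

definition dual_optional_projection ::
  "'a measure \<Rightarrow> (real \<Rightarrow> 'a measure) \<Rightarrow> (real \<Rightarrow> 'a \<Rightarrow> real) \<Rightarrow> (real \<Rightarrow> 'a \<Rightarrow> real) \<Rightarrow> bool" where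
  "dual_optional_projection M F B A \<longleftrightarrow>
     adapted F A \<and> (AE \<omega> in M. increasing_path (\<lambda>t. A t \<omega>)) \<and>
     (\<forall>V. optional M F V \<and> (\<forall>t\<ge>0. \<forall>\<omega>\<in>space M. 0 \<le> V t \<omega>) \<longrightarrow>
        (\<integral>\<^sup>+ \<omega>. stieltjes_integral (\<lambda>t. V t \<omega>) (\<lambda>t. A t \<omega>) \<partial>M) =
        (\<integral>\<^sup>+ \<omega>. stieltjes_integral (\<lambda>t. V t \<omega>) (\<lambda>t. B t \<omega>) \<partial>M))"


section \<open>Stochastic integration\<close>

text \<open>
  \<open>stochastic_integral M F X H Y\<close>: the process \<open>Y t = \<integral>\<^bsub>(0,t]\<^esub> H dX\<close> is a version of the stochastic
  integral of the bounded predictable process \<open>H\<close> with respect to the semimartingale \<open>X\<close>.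
  This is the usual extension of the elementary integral: the relation is generated by the
  integrals of elementary predictable processes, linearity, and dominated convergence (in
  probability at each time, with a cadlag adapted limit).  By the monotone class theorem, it
  relates every bounded predictable \<open>H\<close> to some \<open>Y\<close>, unique up to indistinguishability.
\<close>

inductive stochastic_integral ::
  "'a measure \<Rightarrow> (real \<Rightarrow> 'a measure) \<Rightarrow> (real \<Rightarrow> 'a \<Rightarrow> real) \<Rightarrow>
   (real \<Rightarrow> 'a \<Rightarrow> real) \<Rightarrow> (real \<Rightarrow> 'a \<Rightarrow> real) \<Rightarrow> bool"
  for M :: "'a measure" and F :: "real \<Rightarrow> 'a measure" and X :: "real \<Rightarrow> 'a \<Rightarrow> real" where
  at_zero:
    "\<xi> \<in> borel_measurable (F 0) \<Longrightarrow> (\<And>\<omega>. \<omega> \<in> space M \<Longrightarrow> \<bar>\<xi> \<omega>\<bar> \<le> C) \<Longrightarrow>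
     stochastic_integral M F X (\<lambda>t \<omega>. if t = 0 then \<xi> \<omega> else 0) (\<lambda>t \<omega>. 0)"
| on_interval:
    "0 \<le> r \<Longrightarrow> r \<le> s \<Longrightarrow>
     \<xi> \<in> borel_measurable (F r) \<Longrightarrow> (\<And>\<omega>. \<omega> \<in> space M \<Longrightarrow> \<bar>\<xi> \<omega>\<bar> \<le> C) \<Longrightarrow>
     stochastic_integral M F X
       (\<lambda>t \<omega>. if r < t \<and> t \<le> s then \<xi> \<omega> else 0)
       (\<lambda>t \<omega>. \<xi> \<omega> * (X (min s t) \<omega> - X (min r t) \<omega>))"
| linear:
    "stochastic_integral M F X H Y \<Longrightarrow> stochastic_integral M F X H' Y' \<Longrightarrow>
     stochastic_integral M F X
       (\<lambda>t \<omega>. a * H t \<omega> + b * H' t \<omega>) (\<lambda>t \<omega>. a * Y t \<omega> + b * Y' t \<omega>)"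
| dominated_limit:
    "(\<And>n :: nat. stochastic_integral M F X (H n) (Y n)) \<Longrightarrow>
     (AE \<omega> in M. \<forall>n. \<forall>t\<ge>0. \<bar>H n t \<omega>\<bar> \<le> C) \<Longrightarrow>
     (AE \<omega> in M. \<forall>t\<ge>0. (\<lambda>n. H n t \<omega>) \<longlonglongrightarrow> H' t \<omega>) \<Longrightarrow>
     adapted F Y' \<Longrightarrow> (AE \<omega> in M. cadlag_path (\<lambda>t. Y' t \<omega>)) \<Longrightarrow>
     (\<And>t e. 0 \<le> t \<Longrightarrow> 0 < e \<Longrightarrow>
        (\<lambda>n. measure M {\<omega> \<in> space M. e < \<bar>Y n t \<omega> - Y' t \<omega>\<bar>}) \<longlonglongrightarrow> 0) \<Longrightarrow>
     stochastic_integral M F X H' Y'"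


section \<open>Random times\<close>

definition progressive_enlargement ::
  "'a measure \<Rightarrow> (real \<Rightarrow> 'a measure) \<Rightarrow> ('a \<Rightarrow> ennreal) \<Rightarrow> real \<Rightarrow> 'a measure" where
  "progressive_enlargement M F \<tau> t = sigma (space M)
     {B \<in> sets M. \<exists>B'\<in>sets (F t).
        B \<inter> {\<omega> \<in> space M. \<tau> \<omega> > ennreal t} = B' \<inter> {\<omega> \<in> space M. \<tau> \<omega> > ennreal t}}"

lemma sets_progressive_enlargement:
  assumes "subalgebra M (F t)"
  shows "sets (progressive_enlargement M F \<tau> t) =
     {B \<in> sets M. \<exists>B'\<in>sets (F t).
        B \<inter> {\<omega> \<in> space M. \<tau> \<omega> > ennreal t} = B' \<inter> {\<omega> \<in> space M. \<tau> \<omega> > ennreal t}}"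
    (is "_ = ?G")
proof -
  define E where "E = {\<omega> \<in> space M. \<tau> \<omega> > ennreal t}"
  have G: "?G = {B \<in> sets M. \<exists>B'\<in>sets (F t). B \<inter> E = B' \<inter> E}"
    by (simp add: E_def)
  have sp: "space (F t) = space M"
    using assms by (simp add: subalgebra_def)
  have "sigma_algebra (space M) ?G"
    unfolding G sigma_algebra_iff2
  proof (intro conjI ballI allI impI)
    show "{B \<in> sets M. \<exists>B'\<in>sets (F t). B \<inter> E = B' \<inter> E} \<subseteq> Pow (space M)"
      using sets.sets_into_space by blast
    show "{} \<in> {B \<in> sets M. \<exists>B'\<in>sets (F t). B \<inter> E = B' \<inter> E}"
      by blast
  next
    fix s assume "s \<in> {B \<in> sets M. \<exists>B'\<in>sets (F t). B \<inter> E = B' \<inter> E}"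
    then obtain B' where s: "s \<in> sets M" and B': "B' \<in> sets (F t)" "s \<inter> E = B' \<inter> E"
      by blast
    have "E \<subseteq> space M" by (auto simp: E_def)
    then have "(space M - s) \<inter> E = (space M - B') \<inter> E"
      using B'(2) by blast
    moreover have "space M - B' \<in> sets (F t)"
      using B'(1) sp by (metis sets.compl_sets)
    ultimately show "space M - s \<in> {B \<in> sets M. \<exists>B'\<in>sets (F t). B \<inter> E = B' \<inter> E}"
      using s by blast
  next
    fix A :: "nat \<Rightarrow> 'a set"
    assume "range A \<subseteq> {B \<in> sets M. \<exists>B'\<in>sets (F t). B \<inter> E = B' \<inter> E}"
    then have A: "\<And>i. A i \<in> sets M" and "\<forall>i. \<exists>B'\<in>sets (F t). A i \<inter> E = B' \<inter> E"
      by blast+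
    then obtain B where B: "\<And>i. B i \<in> sets (F t)" "\<And>i. A i \<inter> E = B i \<inter> E"
      by metis
    have "(\<Union>i. A i) \<inter> E = (\<Union>i. B i) \<inter> E"
      using B(2) by blast
    moreover have "(\<Union>i. B i) \<in> sets (F t)" "(\<Union>i. A i) \<in> sets M"
      using A B(1) by blast+
    ultimately show "(\<Union>i. A i) \<in> {B \<in> sets M. \<exists>B'\<in>sets (F t). B \<inter> E = B' \<inter> E}"
      by blast
  qed
  then show ?thesis
    unfolding progressive_enlargement_def by (rule sigma_algebra.sets_measure_of_eq)
qed

definition azema_supermartingale ::
  "'a measure \<Rightarrow> (real \<Rightarrow> 'a measure) \<Rightarrow> ('a \<Rightarrow> ennreal) \<Rightarrow> (real \<Rightarrow> 'a \<Rightarrow> real) \<Rightarrow> bool" where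
  "azema_supermartingale M F \<tau> Z \<longleftrightarrow>
     optional_projection M F (\<lambda>t \<omega>. if ennreal t < \<tau> \<omega> then 1 else 0) Z"

definition zero_time :: "(real \<Rightarrow> 'a \<Rightarrow> real) \<Rightarrow> 'a \<Rightarrow> ennreal" where
  "zero_time Z \<omega> = Inf {ennreal t | t. 0 \<le> t \<and> Z t \<omega> = 0}"

text \<open>
  The stopping time \<open>\<eta>\<close> built from the Azema supermartingale \<open>Z\<close> and the dual optional projection
  \<open>A\<close> of the indicator of \<open>[[\<tau>, \<infinity>[[\<close>.  The jump of \<open>A\<close> at \<open>0\<close> uses \<open>A(0-) = 0\<close>.  The convention
  \<open>Z(0-) = Z(0)\<close> is immaterial: where \<open>\<zeta> = 0\<close>, almost surely \<open>A(0) = 1 - Z(0) = 1\<close>.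
\<close>

definition eta_time :: "(real \<Rightarrow> 'a \<Rightarrow> real) \<Rightarrow> (real \<Rightarrow> 'a \<Rightarrow> real) \<Rightarrow> 'a \<Rightarrow> ennreal" where
  "eta_time Z A \<omega> =
     (let \<zeta> = zero_time Z \<omega>; z = enn2real \<zeta>
      in if \<zeta> < \<infinity> \<and> left_lim (Z 0 \<omega>) (\<lambda>t. Z t \<omega>) z > 0 \<and>
            A z \<omega> - left_lim 0 (\<lambda>t. A t \<omega>) z = 0
         then \<zeta> else \<infinity>)"

text \<open>
  The integral over \<open>[0, \<infinity>)\<close> with respect to \<open>L\<close> is the limit at infinity of the integral process;
  time \<open>0\<close> does not contribute, since \<open>K(0-) = 0\<close>.
\<close>

definition representation_pair ::
  "'a measure \<Rightarrow> (real \<Rightarrow> 'a measure) \<Rightarrow> ('a \<Rightarrow> ennreal) \<Rightarrow>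
   (real \<Rightarrow> 'a \<Rightarrow> real) \<Rightarrow> (real \<Rightarrow> 'a \<Rightarrow> real) \<Rightarrow> bool" where
  "representation_pair M F \<tau> K L \<longleftrightarrow>
     (adapted F K \<and>
      (AE \<omega> in M. increasing_path (\<lambda>t. K t \<omega>) \<and> (\<forall>t\<ge>0. 0 \<le> K t \<omega> \<and> K t \<omega> \<le> 1))) \<and>
     (local_martingale M F L \<and> nonneg_process M L \<and> (AE \<omega> in M. L 0 \<omega> = 1)) \<and>
     (\<forall>V. optional M F V \<and> (\<forall>t\<ge>0. \<forall>\<omega>\<in>space M. 0 \<le> V t \<omega>) \<longrightarrow>
        (\<integral>\<^sup>+ \<omega>. ennreal (at_time V \<tau> \<omega>) \<partial>M) =
        (\<integral>\<^sup>+ \<omega>. stieltjes_integral (\<lambda>t. V t \<omega> * L t \<omega>) (\<lambda>t. K t \<omega>) \<partial>M)) \<and>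
     (\<exists>Y. stochastic_integral M F L
            (\<lambda>t \<omega>. if left_lim 0 (\<lambda>u. K u \<omega>) t = 1 then 1 else 0) Y \<and>
          (AE \<omega> in M. ((\<lambda>t. Y t \<omega>) \<longlongrightarrow> 0) at_top)) \<and>
     (AE \<omega> in M. stieltjes_integral (\<lambda>t. if L t \<omega> = 0 then 1 else 0) (\<lambda>t. K t \<omega>) = 0)"

end

theory Submission
  imports Defs
begin

text \<open>
  Put \<open>U = X\<^sup>\<tau> / L\<^sup>\<tau>\<close>.  A set of \<open>\<G>\<^sub>s\<close> coincides on \<open>{\<tau> > s}\<close> with some \<open>B \<in> \<F>\<^sub>s\<close>, and \<open>U\<close> is constant
  after \<open>\<tau>\<close>, so only \<open>E[U\<^sub>t; B, \<tau> > s]\<close> matters.  On \<open>{s < \<tau> \<le> t}\<close> the representation property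
  of \<open>(K, L)\<close> turns \<open>X\<^sub>\<tau> / L\<^sub>\<tau>\<close> into \<open>\<integral>\<^bsub>(s,t]\<^esub> X dK\<close>, and on \<open>{\<tau> > t}\<close> the identity
  \<open>P[\<tau> > t | \<F>\<^sub>t] = L\<^sub>t (1 - K\<^sub>t)\<close> turns \<open>X\<^sub>t / L\<^sub>t\<close> into \<open>X\<^sub>t (1 - K\<^sub>t)\<close>, except for the loss of the part
  where \<open>L\<^sub>t = 0\<close>.  By parts, \<open>\<integral>\<^bsub>(s,t]\<^esub> X dK + X\<^sub>t (1 - K\<^sub>t)\<close> has the same expectation on \<open>B\<close> as
  \<open>X\<^sub>s (1 - K\<^sub>s)\<close> if \<open>X\<close> is a martingale, and at most that expectation if \<open>X\<close> is a supermartingale.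

  For local martingales, stop in addition when \<open>L\<close> falls below \<open>1 / (n + 1)\<close>.  If \<open>L\<close> is then zero
  while \<open>K < 1\<close>, it has jumped to zero; \<open>A\<close> has no mass on \<open>{L = 0}\<close>, so the time is \<open>\<eta>\<close>, where \<open>X = 0\<close>,
  and nothing is lost.  Since \<open>L\<close> is positive on \<open>[[0, \<tau>]]\<close>, these times localise up to \<open>\<tau>\<close>.

  \<open>P[\<tau> > \<sigma> | \<F>\<^sub>\<sigma>] = L\<^sub>\<sigma> (1 - K\<^sub>\<sigma>)\<close> at all stopping times gives \<open>Z = L (1 - K)\<close> by optional section.
\<close>

section \<open>Measurable projection and section\<close>

text \<open>\<open>Z\<close> is prescribed only at stopping times, whereas \<zeta>, the left limit
  of \<open>Z\<close> and hence \<eta> are read off its paths. Closing this gap is what calls for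
  the optional section theorem, and through it for capacities. Expectations are kept as integrals of
  nonnegative functions, so that Fatou's lemma always applies and infinite values do no harm; the
  price is that every reverse inequality needs an argument of its own. For \<open>L\<close>, which
  may lose mass, it comes from the total mass given by \<open>L 0 = 1\<close>. For a martingale
  \<open>X\<close> it comes from the truncations at a constant, which are bounded supermartingales.
  Optional stopping is the same integration by parts, with the indicator of
  \<open>[[T, \<infinity>[[\<close> in the place of \<open>K\<close>. Since division by zero yields
  zero, \<open>x / l * l\<close> forgets \<open>x\<close> where \<open>l = 0\<close>; this is how
  the loss enters the computation as an explicit term.\<close>

lemma infinite_branch:
  fixes P :: "'b list \<Rightarrow> bool"
  assumes "P []" and step: "\<And>l. P l \<Longrightarrow> \<exists>j. P (l @ [j])"
  obtains f :: "nat \<Rightarrow> 'b" where "\<And>n. P (map f [0..<n])"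
proof -
  have "\<forall>l. \<exists>j. P l \<longrightarrow> P (l @ [j])"
    using step by blast
  from choice[OF this] obtain j where j: "\<And>l. P l \<Longrightarrow> P (l @ [j l])"
    by blast
  define l where "l = rec_nat [] (\<lambda>_ l. l @ [j l])"
  have [simp]: "l 0 = []" "l (Suc n) = l n @ [j (l n)]" for n
    by (auto simp: l_def)
  have P: "P (l n)" for n
    by (induction n) (auto simp: assms(1) j)
  have l: "l n = map (\<lambda>n. j (l n)) [0..<n]" for n
    by (induction n) auto
  show ?thesis
  proof (rule that)
    show "P (map (\<lambda>n. j (l n)) [0..<n])" for n
      using P[of n] by (subst (asm) l)
  qed
qed

text \<open>Koenig's lemma for trees of bounded branching.\<close>

lemma bounded_branching_limit:
  fixes g :: "nat \<Rightarrow> nat \<Rightarrow> nat"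
  assumes "\<And>k i. i \<le> k \<Longrightarrow> g k i \<le> m i"
  obtains f where "\<And>n. \<exists>k\<ge>n. \<forall>i\<le>n. g k i = f i"
proof -
  \<comment> \<open>A prefix is kept as long as infinitely many rows begin with it. Column
    \<open>length l\<close> is bounded only in the rows \<open>k \<ge> length l\<close>, so the
    finitely many other rows are removed before the pigeonhole principle chooses the next
    entry.\<close>
  define P where "P l \<longleftrightarrow> infinite {k. \<forall>i<length l. g k i = l ! i}" for l
  have "\<exists>j. P (l @ [j])" if l: "P l" for l
  proof -
    define S where "S = {k. \<forall>i<length l. g k i = l ! i} \<inter> {length l..}"
    have "S = {k. \<forall>i<length l. g k i = l ! i} - {..<length l}"
      by (auto simp: S_def)
    then have "infinite S"
      using l by (simp add: P_def Diff_infinite_finite)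
    moreover have "finite ((\<lambda>k. g k (length l)) ` S)"
      by (rule finite_subset[of _ "{..m (length l)}"]) (auto simp: S_def assms)
    ultimately obtain k0 where "k0 \<in> S" "infinite {k\<in>S. g k (length l) = g k0 (length l)}"
      using pigeonhole_infinite by blast
    then have "P (l @ [g k0 (length l)])"
      unfolding P_def S_def
      by (elim infinite_super[rotated]) (auto simp: nth_append less_Suc_eq)
    then show ?thesis ..
  qed
  moreover have "P []"
    by (simp add: P_def)
  ultimately obtain f where f: "\<And>n. P (map f [0..<n])"
    using infinite_branch by metis
  have ex: "\<exists>k\<ge>n. \<forall>i\<le>n. g k i = f i" for n
  proof -
    have "infinite {k. \<forall>i<Suc n. g k i = f i}"
      using f[of "Suc n"] by (simp add: P_def del: upt_Suc)
    then obtain k where "k > n" "k \<in> {k. \<forall>i<Suc n. g k i = f i}"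
      using infinite_nat_iff_unbounded by blast
    then have "k \<ge> n \<and> (\<forall>i\<le>n. g k i = f i)"
      by (simp add: less_Suc_eq_le)
    then show ?thesis ..
  qed
  show ?thesis by (rule that[of f]) (rule ex)
qed

section \<open>Suslin sets over products of compact intervals and measurable sets\<close>

definition boxes :: "'a measure \<Rightarrow> (real \<times> 'a) set set" where
  "boxes N = {{a..b} \<times> A | a b A. A \<in> sets N}"

text \<open>The sets of a Suslin scheme are usually indexed by finite sequences. Here the index is a
  whole sequence of which \<open>K n\<close> may read only the entries 0 to \<open>n\<close>, which
  spares all bookkeeping with lists.\<close>

definition suslin_scheme :: "'a measure \<Rightarrow> (nat \<Rightarrow> (nat \<Rightarrow> nat) \<Rightarrow> (real \<times> 'a) set) \<Rightarrow> bool" where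
  "suslin_scheme N K \<longleftrightarrow>
     (\<forall>n f. K n f \<in> boxes N) \<and> (\<forall>n f g. (\<forall>i\<le>n. f i = g i) \<longrightarrow> K n f = K n g)"

definition suslin_set :: "(nat \<Rightarrow> (nat \<Rightarrow> nat) \<Rightarrow> (real \<times> 'a) set) \<Rightarrow> (real \<times> 'a) set" where
  "suslin_set K = {x. \<exists>f. \<forall>n. x \<in> K n f}"

definition suslin :: "'a measure \<Rightarrow> (real \<times> 'a) set \<Rightarrow> bool" where
  "suslin N E \<longleftrightarrow> (\<exists>K. suslin_scheme N K \<and> E = suslin_set K)"

lemma suslin_schemeI:
  assumes "\<And>n f. K n f \<in> boxes N" "\<And>n f g. (\<And>i. i \<le> n \<Longrightarrow> f i = g i) \<Longrightarrow> K n f = K n g"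
  shows "suslin_scheme N K"
  unfolding suslin_scheme_def
proof (intro conjI allI impI)
  show "K n f \<in> boxes N" for n f by (rule assms(1))
  show "K n f = K n g" if "\<forall>i\<le>n. f i = g i" for n f g
    by (rule assms(2)) (use that in blast)
qed

lemma suslin_schemeD:
  assumes "suslin_scheme N K"
  shows "K n f \<in> boxes N" "(\<And>i. i \<le> n \<Longrightarrow> f i = g i) \<Longrightarrow> K n f = K n g"
  using assms unfolding suslin_scheme_def by blast+

lemma suslin_box: "E \<in> boxes N \<Longrightarrow> suslin N E"
  unfolding suslin_def suslin_scheme_def suslin_set_def by (intro exI[of _ "\<lambda>_ _. E"]) auto

lemma suslin_choice:
  assumes "\<And>i :: nat. suslin N (E i)"
  obtains K where "\<And>i. suslin_scheme N (K i)" "\<And>i. E i = suslin_set (K i)"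
proof -
  have "\<forall>i. \<exists>K. suslin_scheme N K \<and> E i = suslin_set K"
    using assms by (simp add: suslin_def)
  from choice[OF this] show ?thesis
    using that by auto
qed

text \<open>The entry \<open>f 0\<close> codes two things at once: which member of the union is
  meant, and the first entry of the sequence for that member. In this way no level has to be
  shifted.\<close>

lemma suslin_UN:
  assumes "\<And>i :: nat. suslin N (E i)"
  shows "suslin N (\<Union>i. E i)"
proof -
  obtain K where K: "\<And>i. suslin_scheme N (K i)" "\<And>i. E i = suslin_set (K i)"
    using suslin_choice[of N E, OF assms] by (metis (no_types))
  define K' where "K' n f = K (fst (prod_decode (f 0))) n (f(0 := snd (prod_decode (f 0))))" for n f
  have "(\<Union>i. E i) = suslin_set K'"
  proof safe
    fix i t w assume "(t, w) \<in> E i"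
    then obtain f where "\<And>n. (t, w) \<in> K i n f" by (auto simp: K(2) suslin_set_def)
    then have "\<forall>n. (t, w) \<in> K' n (f(0 := prod_encode (i, f 0)))"
      by (simp add: K'_def)
    then show "(t, w) \<in> suslin_set K'" unfolding suslin_set_def by blast
  next
    fix t w assume "(t, w) \<in> suslin_set K'"
    then obtain f where f: "\<And>n. (t, w) \<in> K' n f" by (auto simp: suslin_set_def)
    define i where "i = fst (prod_decode (f 0))"
    have "(t, w) \<in> E i"
      using f unfolding K(2) suslin_set_def K'_def i_def by blast
    then show "(t, w) \<in> (\<Union>i. E i)" by blast
  qed
  moreover have "suslin_scheme N K'"
  proof (rule suslin_schemeI)
    fix n f g assume "\<And>i :: nat. i \<le> n \<Longrightarrow> f i = (g i :: nat)"
    then show "K' n f = K' n g"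
      unfolding K'_def by (auto intro!: suslin_schemeD(2)[OF K(1)])
  qed (simp add: K'_def suslin_schemeD(1)[OF K(1)])
  ultimately show ?thesis
    unfolding suslin_def by blast
qed

text \<open>This keeps the scheme in \<open>suslin_INT\<close> local: level
  \<open>prod_encode (i, n)\<close> reads the entries \<open>prod_encode (i, j)\<close> with
  \<open>j \<le> n\<close>, none of which lies beyond that level.\<close>

lemma prod_encode_mono2: "j \<le> n \<Longrightarrow> prod_encode (i, j) \<le> prod_encode (i, n)"
proof (induction n rule: dec_induct)
  case (step n)
  have "prod_encode (i, n) \<le> prod_encode (i, Suc n)"
    by (simp add: prod_encode_def)
  with step show ?case by linarith
qed simp

text \<open>One sequence stores a sequence for each \<open>i\<close> along the pairing function, and
  level \<open>prod_encode (i, n)\<close> imposes level \<open>n\<close> of the scheme of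
  \<open>E i\<close>.\<close>

lemma suslin_INT:
  assumes "\<And>i :: nat. suslin N (E i)"
  shows "suslin N (\<Inter>i. E i)"
proof -
  obtain K where K: "\<And>i. suslin_scheme N (K i)" "\<And>i. E i = suslin_set (K i)"
    using suslin_choice[of N E, OF assms] by (metis (no_types))
  define K' where "K' k f = (let (i, n) = prod_decode k in K i n (\<lambda>j. f (prod_encode (i, j))))" for k f
  have K'e: "K' (prod_encode (i, n)) f = K i n (\<lambda>j. f (prod_encode (i, j)))" for i n f
    by (simp add: K'_def)
  have *: "\<exists>i n. k = prod_encode (i, n)" for k
    by (metis prod_decode_inverse surj_pair)
  have "(\<Inter>i. E i) = suslin_set K'"
  proof safe
    fix t w assume "(t, w) \<in> (\<Inter>i. E i)"
    then have "\<forall>i. \<exists>f. \<forall>n. (t, w) \<in> K i n f" by (auto simp: K(2) suslin_set_def)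
    from choice[OF this] obtain f where f: "\<forall>i n. (t, w) \<in> K i n (f i)" by blast
    have "(t, w) \<in> K' k (\<lambda>k. f (fst (prod_decode k)) (snd (prod_decode k)))" for k
    proof -
      obtain i n where k: "k = prod_encode (i, n)" using * by blast
      show ?thesis
        using f by (simp add: k K'e)
    qed
    then show "(t, w) \<in> suslin_set K'" unfolding suslin_set_def by blast
  next
    fix t w i assume "(t, w) \<in> suslin_set K'"
    then obtain f where f: "\<And>k. (t, w) \<in> K' k f" by (auto simp: suslin_set_def)
    have "(t, w) \<in> K i n (\<lambda>j. f (prod_encode (i, j)))" for n
      using f[of "prod_encode (i, n)"] by (simp only: K'e)
    then show "(t, w) \<in> E i" unfolding K(2) suslin_set_def by blast
  qed
  moreover have "suslin_scheme N K'"
  proof (rule suslin_schemeI)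
    fix k f g assume fg: "\<And>i :: nat. i \<le> k \<Longrightarrow> f i = (g i :: nat)"
    obtain i n where k: "k = prod_encode (i, n)" using * by blast
    show "K' k f = K' k g"
      unfolding k K'e
      by (intro suslin_schemeD(2)[OF K(1)] fg) (auto simp: k intro: prod_encode_mono2)
  next
    fix k f
    obtain i n where k: "k = prod_encode (i, n)" using * by blast
    show "K' k f \<in> boxes N"
      unfolding k K'e by (rule suslin_schemeD(1)[OF K(1)])
  qed
  ultimately show ?thesis
    unfolding suslin_def by blast
qed

lemma suslin_Un:
  assumes "suslin N A" "suslin N B"
  shows "suslin N (A \<union> B)"
proof -
  have "suslin N (\<Union>i. if i = (0::nat) then A else B)"
    by (rule suslin_UN) (use assms in simp)
  moreover have "(\<Union>i. if i = (0::nat) then A else B) = A \<union> B"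
  proof
    show "A \<union> B \<subseteq> (\<Union>i. if i = (0::nat) then A else B)"
      using UN_upper[of 0 UNIV "\<lambda>i. if i = (0::nat) then A else B"]
        UN_upper[of 1 UNIV "\<lambda>i. if i = (0::nat) then A else B"] by simp
  qed (auto split: if_splits)
  ultimately show ?thesis by simp
qed

lemma strip_eq_UN: "UNIV \<times> A = (\<Union>i::nat. {- real i..real i} \<times> A)"
proof -
  have "(\<Union>i::nat. {- real i..real i}) = UNIV"
  proof (rule UNIV_eq_I[symmetric])
    fix t :: real
    obtain i :: nat where "\<bar>t\<bar> \<le> real i" using real_arch_simple[of "\<bar>t\<bar>"] by auto
    then have "t \<in> {- real i..real i}" by auto
    then show "t \<in> (\<Union>i::nat. {- real i..real i})" by (rule UN_I[OF UNIV_I])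
  qed
  moreover have "(\<Union>i::nat. {- real i..real i} \<times> A) = (\<Union>i::nat. {- real i..real i}) \<times> A"
    by blast
  ultimately show ?thesis by simp
qed

lemma suslin_strip: "A \<in> sets N \<Longrightarrow> suslin N (UNIV \<times> A)"
  unfolding strip_eq_UN by (intro suslin_UN suslin_box) (unfold boxes_def, blast)

text \<open>Suslin sets are stable under countable unions and intersections but not under
  complements. The sets that are Suslin together with their complement therefore form a
  \<sigma>-algebra, and it contains the boxes because the complement of a box is a countable union
  of boxes.\<close>

lemma suslin_sets:
  assumes "E \<in> sets (borel \<Otimes>\<^sub>M N)"
  shows "suslin N E"
proof -
  let ?U = "UNIV \<times> space N :: (real \<times> 'a) set"
  have compl_box: "suslin N (?U - B)" if B': "B \<in> boxes N" for B
  proof -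
    obtain a b A where B: "B = {a..b} \<times> A" and A: "A \<in> sets N"
      using B' by (auto simp: boxes_def)
    \<comment> \<open>An open half-line is exhausted by compact intervals whose two ends move with
      the same index. The index must be large enough for both ends, hence the maxima in the
      proof.\<close>
    have "?U - B = UNIV \<times> (space N - A) \<union> ((\<Union>i::nat. {b + 1 / Suc i .. b + Suc i} \<times> space N) \<union>
        (\<Union>i::nat. {a - Suc i .. a - 1 / Suc i} \<times> space N))" (is "_ = ?R")
    proof
      show "?R \<subseteq> ?U - B"
      proof -
        have ne: "\<not> (b + 1 / Suc i \<le> t \<and> t \<le> b)" "\<not> (a \<le> t \<and> t \<le> a - 1 / Suc i)" for t and i :: nat
          by (smt (verit) divide_pos_pos of_nat_0_less_iff zero_less_Suc)+
        show ?thesis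
          using sets.sets_into_space[OF A] ne unfolding B by fastforce
      qed
      show "?U - B \<subseteq> ?R"
      proof
        fix x assume x: "x \<in> ?U - B"
        obtain t w where tw: "x = (t, w)" by force
        consider "w \<notin> A" | "b < t" | "t < a" using x tw B by fastforce
        then show "x \<in> ?R"
        proof cases
          case 1 then show ?thesis using x tw by auto
        next
          case 2
          then obtain i :: nat where i: "1 / Suc i < t - b" using nat_approx_posE[of "t - b"] by auto
          obtain j :: nat where j: "t - b \<le> real j" using real_arch_simple by blast
          have "1 / Suc (max i j) \<le> 1 / Suc i" by (simp add: frac_le)
          then have "t \<in> {b + 1 / Suc (max i j) .. b + Suc (max i j)}" using i j by auto
          then show ?thesis using x tw by auto
        next
          case 3
          then obtain i :: nat where i: "1 / Suc i < a - t" using nat_approx_posE[of "a - t"] by auto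
          obtain j :: nat where j: "a - t \<le> real j" using real_arch_simple by blast
          have "1 / Suc (max i j) \<le> 1 / Suc i" by (simp add: frac_le)
          then have "t \<in> {a - Suc (max i j) .. a - 1 / Suc (max i j)}" using i j by auto
          then show ?thesis using x tw by auto
        qed
      qed
    qed
    moreover have "suslin N ?R"
      using A by (intro suslin_Un suslin_strip suslin_UN suslin_box) (unfold boxes_def, blast+)
    ultimately show ?thesis by simp
  qed
  define S where "S = {E. E \<subseteq> ?U \<and> suslin N E \<and> suslin N (?U - E)}"
  have box_S: "{a..b} \<times> A \<in> S" if "A \<in> sets N" for a b A
    using that sets.sets_into_space[OF that] compl_box[of "{a..b} \<times> A"] suslin_box[of "{a..b} \<times> A" N]
    unfolding S_def boxes_def by blast
  interpret S: sigma_algebra ?U S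
    unfolding sigma_algebra_iff2
  proof (intro conjI ballI allI impI)
    show "S \<subseteq> Pow ?U" by (auto simp: S_def)
    show "{} \<in> S" using box_S[of "{}"] by simp
    show "?U - E \<in> S" if "E \<in> S" for E
      using that by (auto simp: S_def double_diff)
    show "(\<Union>i::nat. E i) \<in> S" if "range E \<subseteq> S" for E
    proof -
      have eq: "?U - (\<Union>i. E i) = (\<Inter>i. ?U - E i)" by blast
      have E: "E i \<subseteq> ?U" "suslin N (E i)" "suslin N (?U - E i)" for i
        using that unfolding S_def by blast+
      have "suslin N (\<Union>i. E i)" "suslin N (\<Inter>i. ?U - E i)"
        using E by (blast intro: suslin_UN suslin_INT)+
      then show ?thesis
        unfolding S_def mem_Collect_eq eq using E(1) by blast
    qed
  qed
  have rect: "a \<times> A \<in> S" if a: "a \<in> sets (borel :: real measure)" and A: "A \<in> sets N" for a A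
  proof -
    have UA: "UNIV \<times> A \<in> S"
      unfolding strip_eq_UN using box_S[OF A] by blast
    have "a \<in> sigma_sets UNIV (range (\<lambda>(a, b). {a..b}))"
      using a by (simp add: borel_eq_atLeastAtMost)
    then show ?thesis
    proof induction
      case (Basic a)
      then show ?case using A by (auto intro: box_S)
    next
      case Empty
      show ?case by simp
    next
      case (Compl a)
      have "(UNIV - a) \<times> A = UNIV \<times> A - a \<times> A" by blast
      then show ?case using S.Diff[OF UA Compl.IH] by simp
    next
      case (Union a)
      have "(\<Union>i. a i) \<times> A = (\<Union>i. a i \<times> A)" by blast
      moreover have "(\<Union>i. a i \<times> A) \<in> S" using Union.IH by blast
      ultimately show ?case by simp
    qed
  qed
  have "{a \<times> b | a b. a \<in> sets (borel :: real measure) \<and> b \<in> sets N} \<subseteq> S"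
    using rect by blast
  then have "sigma_sets ?U {a \<times> b | a b. a \<in> sets (borel :: real measure) \<and> b \<in> sets N} \<subseteq> S"
    by (rule S.sigma_sets_subset)
  then have "E \<in> S"
    using assms by (simp add: sets_pair_measure subset_iff)
  then show ?thesis
    by (simp add: S_def)
qed

section \<open>The paving by finite unions of boxes, and capacitability\<close>

definition ksets :: "'a measure \<Rightarrow> (real \<times> 'a) set set" where
  "ksets N = {\<Union>U | U. finite U \<and> U \<subseteq> boxes N}"

lemma boxesE:
  assumes "B \<in> boxes N"
  obtains a b A where "B = {a..b} \<times> A" "A \<in> sets N"
  using assms unfolding boxes_def by blast

lemma boxes_Int:
  assumes "B \<in> boxes N" "C \<in> boxes N"
  shows "B \<inter> C \<in> boxes N"
proof -
  obtain a b A c d D where "B = {a..b} \<times> A" "A \<in> sets N" "C = {c..d} \<times> D" "D \<in> sets N"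
    using assms unfolding boxes_def by blast
  then have "B \<inter> C = {max a c..min b d} \<times> (A \<inter> D)" "A \<inter> D \<in> sets N"
    by auto
  then show ?thesis unfolding boxes_def by blast
qed

lemma ksets_box: "B \<in> boxes N \<Longrightarrow> B \<in> ksets N"
  unfolding ksets_def by (auto intro!: exI[of _ "{B}"])

lemma ksets_UN:
  assumes "finite I" "\<And>i. i \<in> I \<Longrightarrow> B i \<in> ksets N"
  shows "(\<Union>i\<in>I. B i) \<in> ksets N"
proof -
  have "\<forall>i\<in>I. \<exists>U. B i = \<Union>U \<and> finite U \<and> U \<subseteq> boxes N"
    using assms(2) unfolding ksets_def by blast
  from bchoice[OF this] obtain U where "\<forall>i\<in>I. B i = \<Union>(U i) \<and> finite (U i) \<and> U i \<subseteq> boxes N"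
    by blast
  then have "(\<Union>i\<in>I. B i) = \<Union>(\<Union>i\<in>I. U i)" "finite (\<Union>i\<in>I. U i)" "(\<Union>i\<in>I. U i) \<subseteq> boxes N"
    using assms(1) by auto
  then show ?thesis
    unfolding ksets_def by (intro CollectI exI[of _ "\<Union>i\<in>I. U i"] conjI)
qed

lemma ksets_Int:
  assumes "B \<in> ksets N" "C \<in> ksets N"
  shows "B \<inter> C \<in> ksets N"
proof -
  obtain U V where UV: "B = \<Union>U" "finite U" "U \<subseteq> boxes N" "C = \<Union>V" "finite V" "V \<subseteq> boxes N"
    using assms unfolding ksets_def by blast
  then have "B \<inter> C = (\<Union>u\<in>U. \<Union>v\<in>V. u \<inter> v)"
    by blast
  moreover have "(\<Union>u\<in>U. \<Union>v\<in>V. u \<inter> v) \<in> ksets N"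
    using UV by (intro ksets_UN ksets_box boxes_Int) auto
  ultimately show ?thesis by simp
qed

lemma ksets_INT:
  assumes "finite I" "I \<noteq> {}" "\<And>i. i \<in> I \<Longrightarrow> B i \<in> ksets N"
  shows "(\<Inter>i\<in>I. B i) \<in> ksets N"
  using assms by (induction I rule: finite_ne_induct) (auto intro: ksets_Int)

lemma compact_section_ksets:
  assumes "B \<in> ksets N"
  shows "compact {t. (t, w) \<in> B}"
proof -
  obtain U where U: "B = \<Union>U" "finite U" "U \<subseteq> boxes N"
    using assms unfolding ksets_def by blast
  have "compact {t. (t, w) \<in> u}" if u: "u \<in> U" for u
  proof -
    have "u \<in> boxes N" using U u by blast
    then obtain a b A where "u = {a..b} \<times> A"
      by (rule boxesE)
    then have "{t. (t, w) \<in> u} = (if w \<in> A then {a..b} else {})"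
      by auto
    then show ?thesis by simp
  qed
  moreover have "{t. (t, w) \<in> B} = (\<Union>u\<in>U. {t. (t, w) \<in> u})"
    using U by auto
  ultimately show ?thesis
    using U by (auto intro: compact_UN)
qed

lemma sets_snd_ksets:
  assumes "B \<in> ksets N"
  shows "snd ` B \<in> sets N"
proof -
  obtain U where U: "B = \<Union>U" "finite U" "U \<subseteq> boxes N"
    using assms unfolding ksets_def by blast
  have "snd ` u \<in> sets N" if u: "u \<in> U" for u
  proof -
    have "u \<in> boxes N" using U u by blast
    then obtain a b A where "u = {a..b} \<times> A" "A \<in> sets N"
      by (rule boxesE)
    then show ?thesis by (cases "{a..b} = {}") auto
  qed
  then show ?thesis
    using U by (auto simp: image_Union intro!: sets.finite_UN)
qed

text \<open>Compactness in time: a point that lies in all the projections has nonempty, nested,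
  compact sections, and these share a time. For general sets only one inclusion holds.\<close>

lemma snd_INT_ksets:
  assumes B: "\<And>k :: nat. B k \<in> ksets N" and "decseq B"
  shows "snd ` (\<Inter>k. B k) = (\<Inter>k. snd ` B k)"
proof
  show "(\<Inter>k. snd ` B k) \<subseteq> snd ` (\<Inter>k. B k)"
  proof
    fix w assume w: "w \<in> (\<Inter>k. snd ` B k)"
    have "(\<Inter>k. {t. (t, w) \<in> B k}) \<noteq> {}"
    proof (rule compact_nest)
      show "compact {t. (t, w) \<in> B k}" for k by (rule compact_section_ksets[OF B])
      show "{t. (t, w) \<in> B k} \<noteq> {}" for k using w by force
      show "{t. (t, w) \<in> B n} \<subseteq> {t. (t, w) \<in> B m}" if "m \<le> n" for m n
        using that \<open>decseq B\<close> by (auto simp: decseq_def)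
    qed
    then show "w \<in> snd ` (\<Inter>k. B k)" by force
  qed
qed auto

text \<open>Choquet's capacitability theorem for the outer measure of the projection, following Sion.\<close>

lemma capacitable:
  assumes "finite_measure N" and E: "E \<in> sets (borel \<Otimes>\<^sub>M N)" and c: "c < outer_measure_of N (snd ` E)"
  obtains B where "\<And>k :: nat. B k \<in> ksets N" "decseq B" "(\<Inter>k. B k) \<subseteq> E"
    "c \<le> emeasure N (snd ` (\<Inter>k. B k))" "snd ` (\<Inter>k. B k) \<in> sets N"
proof -
  interpret finite_measure N by fact
  obtain K where K: "suslin_scheme N K" "E = suslin_set K"
    using suslin_sets[OF E] unfolding suslin_def by blast
  note K_box = suslin_schemeD(1)[OF K(1)] and K_cong = suslin_schemeD(2)[OF K(1)]
  \<comment> \<open>The first entries are bounded by \<open>l\<close> instead of being equal to it.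
    Then \<open>E' (l @ [j])\<close> increases with \<open>j\<close>, and since outer measure is
    continuous along increasing sequences, some bound \<open>j\<close> keeps it above
    \<open>c\<close>.\<close>
  define E' where "E' l = {x. \<exists>f. (\<forall>i<length l. f i \<le> l ! i) \<and> (\<forall>n. x \<in> K n f)}" for l
  have sp: "snd ` E' l \<subseteq> space N" for l
  proof
    fix w assume "w \<in> snd ` E' l"
    then obtain t f where "(t, w) \<in> K 0 f" unfolding E'_def by force
    then show "w \<in> space N"
      using K_box[of 0 f] sets.sets_into_space unfolding boxes_def by blast
  qed
  define P where "P l \<longleftrightarrow> c < outer_measure_of N (snd ` E' l)" for l
  have "P []"
    using c by (simp add: P_def E'_def K(2) suslin_set_def)
  moreover have "\<exists>j. P (l @ [j])" if "P l" for l
  proof -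
    have E'_app: "E' (l @ [j]) = {x. \<exists>f. (\<forall>i<length l. f i \<le> l ! i) \<and> f (length l) \<le> j \<and> (\<forall>n. x \<in> K n f)}" for j
    proof -
      have "(\<forall>i<length (l @ [j]). f i \<le> (l @ [j]) ! i) \<longleftrightarrow> (\<forall>i<length l. f i \<le> l ! i) \<and> f (length l) \<le> j"
        for f :: "nat \<Rightarrow> nat"
        by (auto simp: less_Suc_eq nth_append)
      then show ?thesis unfolding E'_def by blast
    qed
    have "E' l = (\<Union>j. E' (l @ [j]))"
      unfolding E'_app by (auto simp: E'_def)
    then have "snd ` E' l = (\<Union>j. snd ` E' (l @ [j]))"
      by (simp add: image_UN)
    moreover have "incseq (\<lambda>j. snd ` E' (l @ [j]))"
      unfolding incseq_def E'_app by (intro allI impI image_mono) (auto intro: order_trans)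
    ultimately have "(SUP j. outer_measure_of N (snd ` E' (l @ [j]))) = outer_measure_of N (snd ` E' l)"
      using SUP_outer_measure_of_incseq[of "\<lambda>j. snd ` E' (l @ [j])" N] sp by simp
    with that have "c < (SUP j. outer_measure_of N (snd ` E' (l @ [j])))"
      by (simp only: P_def)
    then show ?thesis
      unfolding less_SUP_iff P_def by blast
  qed
  ultimately obtain m where m: "\<And>n. P (map m [0..<n])"
    using infinite_branch[of P] by metis
  \<comment> \<open>All conditions beyond level \<open>k\<close> are dropped. Only finitely many
    prefixes lie below the bounds \<open>m\<close>, so that \<open>B k\<close> becomes a finite
    union of boxes which still contains \<open>E'\<close> for the prefix of \<open>m\<close> of
    length \<open>Suc k\<close>.\<close>
  define B where "B k = (\<Union>f\<in>PiE {..k} (\<lambda>i. {..m i}). \<Inter>n\<le>k. K n f)" for k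
  have BI: "x \<in> B k" if "\<And>i. i \<le> k \<Longrightarrow> f i \<le> m i" "\<And>n. n \<le> k \<Longrightarrow> x \<in> K n f" for x k f
  proof -
    have "restrict f {..k} \<in> PiE {..k} (\<lambda>i. {..m i})"
      using that(1) by auto
    moreover have "K n (restrict f {..k}) = K n f" if "n \<le> k" for n
      by (rule K_cong) (use that in auto)
    ultimately show ?thesis
      unfolding B_def using that(2) by blast
  qed
  have B_k: "B k \<in> ksets N" for k
    unfolding B_def by (intro ksets_UN ksets_INT ksets_box K_box finite_PiE) auto
  have dec: "decseq B"
  proof (rule decseq_SucI, rule subsetI)
    fix x k assume "x \<in> B (Suc k)"
    then obtain f where "f \<in> PiE {..Suc k} (\<lambda>i. {..m i})" "\<And>n. n \<le> Suc k \<Longrightarrow> x \<in> K n f"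
      unfolding B_def by blast
    then show "x \<in> B k"
      by (intro BI[of k f]) (auto simp: PiE_iff)
  qed
  have "E' (map m [0..<Suc k]) \<subseteq> B k" for k
  proof
    fix x assume "x \<in> E' (map m [0..<Suc k])"
    then obtain f where f: "\<And>i. i < Suc k \<Longrightarrow> f i \<le> m i" "\<And>n. x \<in> K n f"
      unfolding E'_def by (auto simp del: upt_Suc)
    then show "x \<in> B k" by (intro BI[of k f]) auto
  qed
  then have "c < outer_measure_of N (snd ` B k)" for k
    using m[of "Suc k"] outer_measure_of_mono[OF image_mono] unfolding P_def by (meson less_le_trans)
  then have less: "c < emeasure N (snd ` B k)" for k
    using sets_snd_ksets[OF B_k] by simp
  have "emeasure N (\<Inter>k. snd ` B k) = (INF k. emeasure N (snd ` B k))"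
    using sets_snd_ksets[OF B_k] dec
    by (intro INF_emeasure_decseq[symmetric]) (auto simp: decseq_def image_mono emeasure_eq_measure)
  moreover have "c \<le> (INF k. emeasure N (snd ` B k))"
    using less by (auto intro: INF_greatest less_imp_le)
  ultimately have "c \<le> emeasure N (snd ` (\<Inter>k. B k))"
    by (simp only: snd_INT_ksets[OF B_k dec])
  \<comment> \<open>A point of all \<open>B k\<close> has for each \<open>k\<close> its own
    sequence, admissible up to level \<open>k\<close> and bounded there by \<open>m\<close>.
    Koenig's lemma extracts one sequence that serves all levels.\<close>
  moreover have "(\<Inter>k. B k) \<subseteq> E"
  proof (rule subsetI)
    fix x assume x: "x \<in> (\<Inter>k. B k)"
    have "\<forall>k. \<exists>g. (\<forall>i\<le>k. g i \<le> m i) \<and> (\<forall>n\<le>k. x \<in> K n g)"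
    proof (rule allI)
      fix k
      have "x \<in> B k" using x by blast
      then obtain f where "f \<in> PiE {..k} (\<lambda>i. {..m i})" "\<And>n. n \<le> k \<Longrightarrow> x \<in> K n f"
        unfolding B_def by blast
      then show "\<exists>g. (\<forall>i\<le>k. g i \<le> m i) \<and> (\<forall>n\<le>k. x \<in> K n g)"
        by (intro exI[of _ f]) (auto simp: PiE_iff)
    qed
    from choice[OF this] obtain g where
      g: "\<forall>k. (\<forall>i\<le>k. g k i \<le> m i) \<and> (\<forall>n\<le>k. x \<in> K n (g k))"
      by (rule exE)
    have g_le: "g k i \<le> m i" if "i \<le> k" for k i
      using g that by simp
    obtain f where f: "\<And>n. \<exists>k\<ge>n. \<forall>i\<le>n. g k i = f i"
      using bounded_branching_limit[of g m, OF g_le] by metis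
    have "x \<in> K n f" for n
    proof -
      obtain k where k: "k \<ge> n" "\<And>i. i \<le> n \<Longrightarrow> g k i = f i"
        using f by blast
      have "K n (g k) = K n f"
        by (rule K_cong) (rule k(2))
      moreover have "x \<in> K n (g k)"
        using g k(1) by blast
      ultimately show ?thesis
        by (simp only:)
    qed
    then show "x \<in> E"
      unfolding K(2) suslin_set_def by blast
  qed
  moreover have "snd ` (\<Inter>k. B k) \<in> sets N"
    using sets_snd_ksets[OF B_k] unfolding snd_INT_ksets[OF B_k dec] by auto
  ultimately show ?thesis
    using that[of B] B_k dec by blast
qed

text \<open>The inner approximation \<open>D\<close> of the projection is in general not all of it, since \<open>N\<close> need not
  be complete.\<close>

lemma measurable_projection_inner:
  fixes E :: "(real \<times> 'a) set"
  assumes N: "finite_measure N" and E: "E \<in> sets (borel \<Otimes>\<^sub>M N)"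
  obtains D where "D \<in> sets N" "D \<subseteq> snd ` E" "emeasure N D = outer_measure_of N (snd ` E)"
proof -
  let ?c = "outer_measure_of N (snd ` E)"
  have "\<exists>D. D \<in> sets N \<and> D \<subseteq> snd ` E \<and> c \<le> emeasure N D" if c: "c < ?c" for c
  proof (rule capacitable[OF N E c])
    fix B :: "nat \<Rightarrow> _"
    assume "(\<Inter>k. B k) \<subseteq> E" "c \<le> emeasure N (snd ` (\<Inter>k. B k))" "snd ` (\<Inter>k. B k) \<in> sets N"
    then show ?thesis by (intro exI[of _ "snd ` (\<Inter>k. B k)"] conjI image_mono)
  qed
  then have "\<forall>c. \<exists>D. c < ?c \<longrightarrow> D \<in> sets N \<and> D \<subseteq> snd ` E \<and> c \<le> emeasure N D"
    by blast
  from choice[OF this] obtain D where D: "\<forall>c. c < ?c \<longrightarrow> D c \<in> sets N \<and> D c \<subseteq> snd ` E \<and> c \<le> emeasure N (D c)"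
    by (rule exE)
  show ?thesis
  proof (cases "?c = 0")
    case True
    then show ?thesis using that[of "{}"] by simp
  next
    case False
    then have "0 < ?c" by (simp add: zero_less_iff_neq_zero)
    from approx_from_below_dense_linorder[OF this] obtain u :: "nat \<Rightarrow> ennreal"
      where u: "(\<forall>n. u n < ?c) \<and> u \<longlonglongrightarrow> ?c" by (rule exE)
    have Du: "D (u n) \<in> sets N" "D (u n) \<subseteq> snd ` E" "u n \<le> emeasure N (D (u n))" for n
      using D[THEN spec, THEN mp, OF u[THEN conjunct1, THEN spec, of n]] by simp_all
    let ?D = "\<Union>n. D (u n)"
    have "?D \<in> sets N" "?D \<subseteq> snd ` E"
      using Du(1,2) by auto
    moreover have "?c \<le> emeasure N ?D"
    proof (rule LIMSEQ_le_const2[OF u[THEN conjunct2]], intro exI allI impI)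
      fix n
      have "u n \<le> emeasure N (D (u n))" by (rule Du)
      also have "\<dots> \<le> emeasure N ?D" using \<open>?D \<in> sets N\<close> by (intro emeasure_mono) auto
      finally show "u n \<le> emeasure N ?D" .
    qed
    moreover have "emeasure N ?D \<le> ?c"
      using outer_measure_of_mono[OF \<open>?D \<subseteq> snd ` E\<close>, of N] \<open>?D \<in> sets N\<close> by simp
    ultimately show ?thesis
      using that[of ?D] by (simp add: antisym)
  qed
qed

text \<open>An inner approximation \<open>C\<close> by ksets has compact time sections, so each
  nonempty section has a least element, and this element is the section. It is measurable because
  \<open>R w \<le> t\<close> says that the part of \<open>C\<close> up to time \<open>t\<close>
  projects onto \<open>w\<close>, and that part is again a decreasing intersection of ksets.\<close>

lemma measurable_section:
  fixes E :: "(real \<times> 'a) set"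
  assumes N: "finite_measure N" and E: "E \<in> sets (borel \<Otimes>\<^sub>M N)" and pos: "0 < outer_measure_of N (snd ` E)"
  obtains D R where "D \<in> sets N" "0 < emeasure N D" "R \<in> borel_measurable N" "\<And>w. w \<in> D \<Longrightarrow> (R w :: real, w) \<in> E"
proof -
  obtain c where c: "0 < c" "c < outer_measure_of N (snd ` E)"
    using dense[OF pos] by blast
  obtain B where B: "\<And>k :: nat. B k \<in> ksets N" "decseq B" "(\<Inter>k. B k) \<subseteq> E"
    "c \<le> emeasure N (snd ` (\<Inter>k. B k))" "snd ` (\<Inter>k. B k) \<in> sets N"
    by (rule capacitable[OF N E c(2)]) (rule that)
  define C where "C = (\<Inter>k. B k)"
  define R where "R w = (if w \<in> snd ` C then Inf {t. (t, w) \<in> C} else 0)" for w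
  have C_sets: "snd ` C \<in> sets N"
    using B(5) by (simp only: C_def)
  have sec: "compact {t. (t, w) \<in> C}" for w
  proof -
    have "{t. (t, w) \<in> C} = (\<Inter>k. {t. (t, w) \<in> B k})" by (auto simp: C_def)
    then show ?thesis
      using compact_section_ksets[OF B(1)] by (auto intro: compact_Inter)
  qed
  have R_in: "(R w, w) \<in> C" if "w \<in> snd ` C" for w
  proof -
    have "{t. (t, w) \<in> C} \<noteq> {}" using that by force
    then have "Inf {t. (t, w) \<in> C} \<in> {t. (t, w) \<in> C}"
      using sec[of w] by (intro closed_contains_Inf) (auto intro: compact_imp_closed bounded_imp_bdd_below compact_imp_bounded)
    then show ?thesis using that by (simp add: R_def)
  qed
  have R_le: "R w \<le> t" if "(t, w) \<in> C" for t w
  proof -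
    have "w \<in> snd ` C" using that by force
    then show ?thesis
      using that sec[of w] by (auto simp: R_def intro!: cInf_lower bounded_imp_bdd_below compact_imp_bounded)
  qed
  have "{w \<in> space N. R w \<le> t} \<in> sets N" for t
  proof -
    have "snd ` (C \<inter> ({..t} \<times> UNIV)) \<in> sets N"
    proof -
      \<comment> \<open>Boxes are bounded, so the half-line \<open>{..t}\<close> cannot be one of
        their sides. As \<open>B 0\<close> is bounded below in time, the interval
        \<open>{b..t}\<close> cuts out the same part of \<open>C\<close>.\<close>
      have bdd: "\<exists>b. \<forall>x\<in>B 0. b \<le> fst x"
      proof -
        obtain U where U: "B 0 = \<Union>U" "finite U" "U \<subseteq> boxes N"
          using B(1)[of 0] unfolding ksets_def by blast
        have "\<forall>u\<in>U. \<exists>b. \<forall>x\<in>u. b \<le> fst x"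
          using U(3) unfolding boxes_def by fastforce
        from bchoice[OF this] obtain b where b: "\<And>u x. u \<in> U \<Longrightarrow> x \<in> u \<Longrightarrow> b u \<le> fst x"
          by blast
        have "Min (insert 0 (b ` U)) \<le> fst x" if x: "x \<in> B 0" for x
        proof -
          obtain u where "u \<in> U" "x \<in> u" using x U(1) by blast
          then have "Min (insert 0 (b ` U)) \<le> b u" using U(2) by (intro Min_le) auto
          then show ?thesis using b[OF \<open>u \<in> U\<close> \<open>x \<in> u\<close>] by simp
        qed
        then show ?thesis by blast
      qed
      then obtain b where b: "\<And>x. x \<in> B 0 \<Longrightarrow> b \<le> fst x" by blast
      define B' where "B' k = B k \<inter> ({b..t} \<times> space N)" for k
      have B': "B' k \<in> ksets N" for k
        unfolding B'_def by (intro ksets_Int B(1) ksets_box) (auto simp: boxes_def)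
      have dec': "decseq B'"
        using B(2) by (auto simp: B'_def decseq_def)
      have "snd ` (\<Inter>k. B' k) \<in> sets N"
        unfolding snd_INT_ksets[OF B' dec'] using sets_snd_ksets[OF B'] by auto
      moreover have "(\<Inter>k. B' k) = C \<inter> ({..t} \<times> UNIV)"
      proof -
        have "w \<in> space N" if "(t, w) \<in> C" for t w
        proof -
          have "w \<in> snd ` (\<Inter>k. B k)" using that by (force simp: C_def)
          then show ?thesis using sets.sets_into_space[OF B(5)] by blast
        qed
        moreover have "b \<le> s" if "(s, w) \<in> C" for s w
          using b[of "(s, w)"] that by (auto simp: C_def)
        ultimately show ?thesis
          unfolding B'_def C_def by auto
      qed
      ultimately show ?thesis by simp
    qed
    moreover have "{w \<in> space N. R w \<le> t} =
      snd ` (C \<inter> ({..t} \<times> UNIV)) \<union> (if 0 \<le> t then space N - snd ` C else {})"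
    proof -
      have "w \<in> space N" if "w \<in> snd ` C" for w
        using that sets.sets_into_space[OF B(5)] by (auto simp: C_def)
      moreover have "w \<in> snd ` (C \<inter> ({..t} \<times> UNIV)) \<longleftrightarrow> R w \<le> t" if "w \<in> snd ` C" for w
      proof
        assume "R w \<le> t"
        then show "w \<in> snd ` (C \<inter> ({..t} \<times> UNIV))"
          using R_in[OF that] by (intro image_eqI[of _ _ "(R w, w)"]) auto
      next
        assume "w \<in> snd ` (C \<inter> ({..t} \<times> UNIV))"
        then obtain s where "(s, w) \<in> C" "s \<le> t" by auto
        then show "R w \<le> t" using R_le by fastforce
      qed
      moreover have "w \<in> snd ` C" if "w \<in> snd ` (C \<inter> ({..t} \<times> UNIV))" for w
        using that by auto
      moreover have "R w = 0" if "w \<notin> snd ` C" for w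
        using that by (simp add: R_def)
      moreover have "w \<in> {w \<in> space N. R w \<le> t} \<longleftrightarrow>
        w \<in> snd ` (C \<inter> ({..t} \<times> UNIV)) \<union> (if 0 \<le> t then space N - snd ` C else {})" for w
        using calculation[of w] 
        by (cases "w \<in> snd ` C"; cases "w \<in> snd ` (C \<inter> ({..t} \<times> UNIV))"; cases "0 \<le> t") simp_all
      ultimately show ?thesis
        by blast
    qed
    moreover have "(if 0 \<le> t then space N - snd ` C else {}) \<in> sets N"
      using C_sets by simp
    ultimately show ?thesis
      by (simp only: sets.Un)
  qed
  then have "R \<in> borel_measurable N"
    by (simp add: borel_measurable_iff_le)
  moreover have "(R w, w) \<in> E" if "w \<in> snd ` C" for w
    using R_in[OF that] B(3) C_def by blast
  moreover have "0 < emeasure N (snd ` C)"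
    using c(1) B(4) unfolding C_def by (rule less_le_trans)
  ultimately show ?thesis
    using that[of "snd ` C" R] C_sets by blast
qed

section \<open>Progressive measurability\<close>

text \<open>The sequence may hit \<open>u\<close> itself, which a limit at \<open>at_right u\<close>
  excludes. Since the limit is the value at \<open>u\<close>, the filter can be enlarged to the
  neighbourhoods within \<open>{u..}\<close>.\<close>

lemma right_cont_seq:
  fixes f :: "real \<Rightarrow> 'b::topological_space"
  assumes "(f \<longlongrightarrow> f u) (at_right u)" "r \<longlonglongrightarrow> u" "\<And>n. u \<le> r n"
  shows "(\<lambda>n. f (r n)) \<longlonglongrightarrow> f u"
proof -
  have "{u..} - {u} = {u<..}" by auto
  then have "at u within {u..} = at_right u"
    by (simp add: at_within_def)
  then have "continuous (at u within {u..}) f"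
    using assms(1) by (simp add: continuous_within)
  then show ?thesis
    by (rule continuous_within_tendsto_compose') (use assms in auto)
qed

text \<open>A time is moved to the next larger point of the grid of mesh \<open>1 / Suc n\<close>:
  upwards because paths are right-continuous, and capped at \<open>t\<close> so that the sampled
  value is still known at time \<open>t\<close>.\<close>

definition rgrid :: "real \<Rightarrow> nat \<Rightarrow> real \<Rightarrow> real" where
  "rgrid t n u = max 0 (min t (real_of_int (\<lfloor>u * Suc n\<rfloor> + 1) / Suc n))"

lemma rgrid:
  assumes "0 \<le> u" "u \<le> t"
  shows "u \<le> rgrid t n u" "0 \<le> rgrid t n u" "rgrid t n u \<le> t" "rgrid t n u \<le> u + 1 / Suc n"
proof -
  let ?x = "real_of_int (\<lfloor>u * Suc n\<rfloor> + 1) / Suc n"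
  have "u * Suc n < real_of_int (\<lfloor>u * Suc n\<rfloor> + 1)" "real_of_int (\<lfloor>u * Suc n\<rfloor> + 1) \<le> u * Suc n + 1"
    by linarith+
  then have "u < ?x" "?x \<le> u + 1 / Suc n"
    by (simp_all add: field_simps del: of_nat_Suc of_int_add)
  then show "u \<le> rgrid t n u" "0 \<le> rgrid t n u" "rgrid t n u \<le> t" "rgrid t n u \<le> u + 1 / Suc n"
    using assms by (auto simp: rgrid_def simp del: of_nat_Suc of_int_add)
qed

lemma rgrid_tendsto:
  assumes "0 \<le> u" "u \<le> t"
  shows "(\<lambda>n. rgrid t n u) \<longlonglongrightarrow> u"
proof (rule tendsto_sandwich[where f = "\<lambda>_. u" and h = "\<lambda>n. u + 1 / real (Suc n)"])
  show "(\<lambda>n. u + 1 / real (Suc n)) \<longlonglongrightarrow> u"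
    using tendsto_add[OF tendsto_const[of u] LIMSEQ_inverse_real_of_nat] by (simp add: inverse_eq_divide)
qed (use rgrid[OF assms] in auto)

context usual_filtration
begin

lemma space_F [simp]: "0 \<le> t \<Longrightarrow> space (F t) = space M"
  using subalgebra_F by (simp add: subalgebra_def)

lemma sets_F_M: "0 \<le> t \<Longrightarrow> A \<in> sets (F t) \<Longrightarrow> A \<in> sets M"
  using subalgebra_F[of t] by (auto simp: subalgebra_def)

lemma measurable_F_M: "0 \<le> t \<Longrightarrow> f \<in> measurable (F t) N \<Longrightarrow> f \<in> measurable M N"
  by (rule measurable_from_subalg[OF subalgebra_F])

lemma measurable_F_mono: "0 \<le> s \<Longrightarrow> s \<le> t \<Longrightarrow> f \<in> measurable (F s) N \<Longrightarrow> f \<in> measurable (F t) N"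
  by (rule measurable_from_subalg[of _ "F s"]) (auto simp: subalgebra_def dest: mono_F)

lemma null_F:
  assumes "AE \<omega> in M. P \<omega>" "0 \<le> t" "\<And>\<omega>. \<omega> \<in> A \<Longrightarrow> \<omega> \<in> space M \<and> \<not> P \<omega>"
  shows "A \<in> sets (F t)"
proof -
  obtain N where "{\<omega>\<in>space M. \<not> P \<omega>} \<subseteq> N" "N \<in> null_sets M"
    using assms(1) unfolding eventually_ae_filter by blast
  then have "A \<in> sets (F 0)"
    using assms(3) by (intro saturated_F) auto
  then show ?thesis
    using mono_F[of 0 t] assms(2) by auto
qed

text \<open>Functions that agree almost surely differ inside a null set, and by saturation every
  subset of that null set already belongs to \<open>F 0\<close>.\<close>

lemma AE_measurable_F:
  assumes f: "f \<in> measurable (F t) N" and eq: "AE \<omega> in M. f \<omega> = g \<omega>" and t: "0 \<le> t"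
    and g: "\<And>\<omega>. \<omega> \<in> space M \<Longrightarrow> g \<omega> \<in> space N"
  shows "g \<in> measurable (F t) N"
proof (rule measurableI)
  fix B assume B: "B \<in> sets N"
  have "{\<omega> \<in> space M. f \<omega> \<noteq> g \<omega>} \<in> sets (F t)"
    by (rule null_F[OF eq t]) auto
  moreover have "{\<omega> \<in> space M. f \<omega> \<noteq> g \<omega> \<and> g \<omega> \<in> B} \<in> sets (F t)"
    by (rule null_F[OF eq t]) auto
  moreover have "f -` B \<inter> space (F t) \<in> sets (F t)"
    using f B by (rule measurable_sets)
  moreover have "g -` B \<inter> space (F t) =
    (f -` B \<inter> space (F t) - {\<omega> \<in> space M. f \<omega> \<noteq> g \<omega>}) \<union> {\<omega> \<in> space M. f \<omega> \<noteq> g \<omega> \<and> g \<omega> \<in> B}"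
    using t by auto
  ultimately show "g -` B \<inter> space (F t) \<in> sets (F t)"
    by (simp only: sets.Un sets.Diff)
qed (use g t in auto)

text \<open>Bad paths are replaced by a constant one. Whether the set of bad paths is measurable
  does not matter, as it lies in a null set and the filtration is saturated.\<close>

lemma regularise:
  fixes X :: "real \<Rightarrow> 'a \<Rightarrow> real"
  assumes X: "adapted F X" and P: "AE \<omega> in M. P (\<lambda>t. X t \<omega>)" and c: "P (\<lambda>t. c)"
  obtains X' where "adapted F X'" "\<And>\<omega>. P (\<lambda>t. X' t \<omega>)" "AE \<omega> in M. \<forall>t. X' t \<omega> = X t \<omega>"
proof -
  define X' where "X' t \<omega> = (if P (\<lambda>t. X t \<omega>) then X t \<omega> else c)" for t \<omega>
  have eq: "AE \<omega> in M. \<forall>t. X' t \<omega> = X t \<omega>"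
    using P by eventually_elim (simp add: X'_def)
  have "adapted F X'"
    unfolding adapted_def
  proof (intro allI impI)
    fix t :: real assume t: "0 \<le> t"
    have "AE \<omega> in M. X t \<omega> = X' t \<omega>"
      using eq by eventually_elim simp
    moreover have "X t \<in> borel_measurable (F t)"
      using X t unfolding adapted_def by blast
    ultimately show "X' t \<in> borel_measurable (F t)"
      using AE_measurable_F[of "X t" t borel "X' t"] t by simp
  qed
  moreover have P': "P (\<lambda>t. X' t \<omega>)" for \<omega>
    using c by (cases "P (\<lambda>t. X t \<omega>)") (simp_all add: X'_def)
  ultimately show ?thesis
    by (intro that[of X', OF _ P' eq])
qed

text \<open>Sampling at the grid point to the right splits \<open>[0, t]\<close> into countably many
  pieces, on each of which the process is frozen at a time no later than \<open>t\<close>;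
  right-continuity then gives the limit.\<close>

lemma progressive:
  fixes X :: "real \<Rightarrow> 'a \<Rightarrow> real"
  assumes X: "adapted F X" "\<And>\<omega>. \<omega> \<in> space M \<Longrightarrow> right_cont_path (\<lambda>t. X t \<omega>)" and t: "0 \<le> t"
  shows "(\<lambda>(u, \<omega>). if 0 \<le> u \<and> u \<le> t then X u \<omega> else 0) \<in> borel_measurable (borel \<Otimes>\<^sub>M F t)"
proof (rule borel_measurable_LIMSEQ_real[where u = "\<lambda>n (u, \<omega>). if 0 \<le> u \<and> u \<le> t then X (rgrid t n u) \<omega> else 0"])
  show "(\<lambda>(u, \<omega>). if 0 \<le> u \<and> u \<le> t then X (rgrid t n u) \<omega> else 0) \<in> borel_measurable (borel \<Otimes>\<^sub>M F t)" for n
  proof -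
    define Y where "Y i p = X (max 0 (min t (real_of_int (i + 1) / Suc n))) (snd p)" for i :: int and p :: "real \<times> 'a"
    have [measurable]: "Y i \<in> borel_measurable (borel \<Otimes>\<^sub>M F t)" for i
    proof -
      define r where "r = max 0 (min t (real_of_int (i + 1) / Suc n))"
      have r: "0 \<le> r" "r \<le> t"
        using t by (auto simp: r_def simp del: of_nat_Suc of_int_add)
      then have "X r \<in> borel_measurable (F r)"
        using X(1) unfolding adapted_def by blast
      then have "X (max 0 (min t (real_of_int (i + 1) / Suc n))) \<in> borel_measurable (F t)"
        unfolding r_def[symmetric] by (rule measurable_F_mono[OF r])
      then show ?thesis
        unfolding Y_def by (rule measurable_compose[OF measurable_snd])
    qed
    have "(\<lambda>p. if 0 \<le> fst p \<and> fst p \<le> t then Y (\<lfloor>fst p * Suc n\<rfloor>) p else 0) \<in> borel_measurable (borel \<Otimes>\<^sub>M F t)"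
      by measurable
    moreover have "(\<lambda>(u, \<omega>). if 0 \<le> u \<and> u \<le> t then X (rgrid t n u) \<omega> else 0) =
      (\<lambda>p. if 0 \<le> fst p \<and> fst p \<le> t then Y (\<lfloor>fst p * Suc n\<rfloor>) p else 0)"
      by (rule ext) (simp add: Y_def rgrid_def case_prod_unfold)
    ultimately show ?thesis by simp
  qed
next
  fix p :: "real \<times> 'a" assume p: "p \<in> space (borel \<Otimes>\<^sub>M F t)"
  obtain u \<omega> where [simp]: "p = (u, \<omega>)" by force
  have w: "\<omega> \<in> space M" using p t by (auto simp: space_pair_measure)
  show "(\<lambda>n. case p of (u, \<omega>) \<Rightarrow> if 0 \<le> u \<and> u \<le> t then X (rgrid t n u) \<omega> else 0)
    \<longlonglongrightarrow> (case p of (u, \<omega>) \<Rightarrow> if 0 \<le> u \<and> u \<le> t then X u \<omega> else 0)"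
  proof (cases "0 \<le> u \<and> u \<le> t")
    case True
    have "(\<lambda>n. X (rgrid t n u) \<omega>) \<longlonglongrightarrow> X u \<omega>"
      using X(2)[OF w] rgrid_tendsto[of u t] rgrid(1)[of u t] True unfolding right_cont_path_def
      by (intro right_cont_seq[of "\<lambda>u. X u \<omega>"]) auto
    then show ?thesis using True by simp
  qed auto
qed

lemma measurable_pair_F_M:
  assumes "0 \<le> t" "f \<in> measurable (borel \<Otimes>\<^sub>M F t) N"
  shows "f \<in> measurable (borel \<Otimes>\<^sub>M M) N"
proof -
  have "(\<lambda>x. x) \<in> measurable M (F t)"
    using assms(1) by (intro measurable_F_M[of t]) auto
  then have "(\<lambda>p. (fst p, snd p)) \<in> measurable (borel \<Otimes>\<^sub>M M) (borel \<Otimes>\<^sub>M F t)"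
    by (intro measurable_Pair measurable_fst measurable_compose[OF measurable_snd])
  then have "(\<lambda>p. p) \<in> measurable (borel \<Otimes>\<^sub>M M) (borel \<Otimes>\<^sub>M F t)"
    by simp
  from measurable_compose[OF this assms(2)] show ?thesis .
qed

lemma measurable_path:
  fixes X :: "real \<Rightarrow> 'a \<Rightarrow> real"
  assumes X: "adapted F X" "\<And>\<omega>. \<omega> \<in> space M \<Longrightarrow> right_cont_path (\<lambda>t. X t \<omega>)"
  shows "(\<lambda>(u, \<omega>). if 0 \<le> u then X u \<omega> else 0) \<in> borel_measurable (borel \<Otimes>\<^sub>M M)"
proof (rule borel_measurable_LIMSEQ_real[where u = "\<lambda>n (u, \<omega>). if 0 \<le> u \<and> u \<le> real n then X u \<omega> else 0"])
  show "(\<lambda>(u, \<omega>). if 0 \<le> u \<and> u \<le> real n then X u \<omega> else 0) \<in> borel_measurable (borel \<Otimes>\<^sub>M M)" for n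
    by (rule measurable_pair_F_M[OF _ progressive[OF X]]) auto
next
  fix p :: "real \<times> 'a"
  obtain u \<omega> where [simp]: "p = (u, \<omega>)" by force
  have "eventually (\<lambda>n. u \<le> real n) sequentially"
    by (rule filterlim_real_sequentially[unfolded filterlim_at_top, rule_format])
  then have "eventually (\<lambda>n. (if 0 \<le> u \<and> u \<le> real n then X u \<omega> else 0) = (if 0 \<le> u then X u \<omega> else 0)) sequentially"
    by eventually_elim simp
  then show "(\<lambda>n. case p of (u, \<omega>) \<Rightarrow> if 0 \<le> u \<and> u \<le> real n then X u \<omega> else 0)
    \<longlonglongrightarrow> (case p of (u, \<omega>) \<Rightarrow> if 0 \<le> u then X u \<omega> else 0)"
    by (simp add: tendsto_eventually)
qed

section \<open>Optional sets and the optional section theorem\<close>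

abbreviation "Opt \<equiv> optional_sigma M F"

lemma space_Opt [simp]: "space Opt = {0..} \<times> space M"
  unfolding optional_sigma_def by (rule space_measure_of) auto

lemma Opt_induct [consumes 1, case_names Basic Compl Union]:
  assumes "E \<in> sets Opt"
    and "\<And>X B. adapted F X \<Longrightarrow> \<forall>\<omega>\<in>space M. cadlag_path (\<lambda>t. X t \<omega>) \<Longrightarrow> B \<in> sets borel \<Longrightarrow>
      P {(t, \<omega>) \<in> {0..} \<times> space M. X t \<omega> \<in> (B :: real set)}"
    and "\<And>E. E \<in> sets Opt \<Longrightarrow> P E \<Longrightarrow> P ({0..} \<times> space M - E)"
    and "\<And>E. (\<And>i :: nat. E i \<in> sets Opt) \<Longrightarrow> (\<And>i. P (E i)) \<Longrightarrow> P (\<Union>i. E i)"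
  shows "P E"
proof -
  let ?G = "{{(t, \<omega>) \<in> {0..} \<times> space M. X t \<omega> \<in> B} | X B.
        adapted F X \<and> (\<forall>\<omega>\<in>space M. cadlag_path (\<lambda>t. X t \<omega>)) \<and> B \<in> sets borel}"
  have sets: "sets Opt = sigma_sets ({0..} \<times> space M) ?G"
    unfolding optional_sigma_def by (rule sets_measure_of) auto
  have "P {(t, \<omega>) \<in> {0..} \<times> space M. (\<lambda>_ _. 0 :: real) t \<omega> \<in> {}}"
    by (rule assms(2)) (auto simp: adapted_def cadlag_path_def right_cont_path_def intro: exI[of _ 0])
  then have e: "P {}" by simp
  have "E \<in> sigma_sets ({0..} \<times> space M) ?G" using assms(1) by (simp only: sets)
  then show ?thesis
  proof induction
    case (Basic a) then show ?case using assms(2) by blast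
  next
    case Empty show ?case by (rule e)
  next
    case (Compl a) then show ?case using assms(3) by (simp only: sets)
  next
    case (Union a) then show ?case using assms(4) by (simp only: sets)
  qed
qed

lemma Opt_basic:
  assumes "adapted F X" "\<forall>\<omega>\<in>space M. cadlag_path (\<lambda>t. X t \<omega>)" "B \<in> sets borel"
  shows "{(t, \<omega>) \<in> {0..} \<times> space M. X t \<omega> \<in> (B :: real set)} \<in> sets Opt"
  unfolding optional_sigma_def by (subst sets_measure_of) (use assms in \<open>auto intro!: sigma_sets.Basic\<close>)

lemma Opt_progressive:
  assumes "E \<in> sets Opt" "0 \<le> t"
  shows "E \<inter> ({..t} \<times> UNIV) \<in> sets (borel \<Otimes>\<^sub>M F t)"
  using assms(1)
proof (induction rule: Opt_induct)
  case (Basic X B)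
  let ?f = "\<lambda>(u, \<omega>). if 0 \<le> u \<and> u \<le> t then X u \<omega> else 0"
  have f: "?f \<in> borel_measurable (borel \<Otimes>\<^sub>M F t)"
    using Basic assms(2) by (intro progressive) (auto simp: cadlag_path_def)
  have "(?f -` B \<inter> space (borel \<Otimes>\<^sub>M F t)) \<inter> ({0..t} \<times> space (F t)) \<in> sets (borel \<Otimes>\<^sub>M F t)"
    using measurable_sets[OF f Basic(3)] by auto
  moreover have "{(t, \<omega>) \<in> {0..} \<times> space M. X t \<omega> \<in> B} \<inter> ({..t} \<times> UNIV) =
    (?f -` B \<inter> space (borel \<Otimes>\<^sub>M F t)) \<inter> ({0..t} \<times> space (F t))"
    using assms(2) by (auto simp: space_pair_measure)
  ultimately show ?case by simp
next
  case (Compl E)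
  have "({0..} \<times> space M - E) \<inter> ({..t} \<times> UNIV) = ({0..t} \<times> space (F t)) - E \<inter> ({..t} \<times> UNIV)"
    using assms(2) by auto
  moreover have "({0..t} \<times> space (F t)) \<in> sets (borel \<Otimes>\<^sub>M F t)" by simp
  ultimately show ?case using Compl(2) by (simp only: sets.Diff)
next
  case (Union E)
  have "(\<Union>i. E i) \<inter> ({..t} \<times> UNIV) = (\<Union>i. E i \<inter> ({..t} \<times> UNIV))" by blast
  then show ?case using sets.countable_nat_UN[of "\<lambda>i. E i \<inter> ({..t} \<times> UNIV)"] Union(2) by auto
qed

lemma Opt_sub: "E \<in> sets Opt \<Longrightarrow> E \<subseteq> {0..} \<times> space M"
  using sets.sets_into_space[of E Opt] by simp

lemma Opt_measurable:
  assumes "E \<in> sets Opt"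
  shows "E \<in> sets (borel \<Otimes>\<^sub>M M)"
proof -
  have "E \<inter> ({..real n} \<times> UNIV) \<in> sets (borel \<Otimes>\<^sub>M M)" for n
  proof -
    have "(\<lambda>x. x) \<in> measurable (borel \<Otimes>\<^sub>M M) (borel \<Otimes>\<^sub>M F (real n))"
      by (rule measurable_pair_F_M[of "real n"]) auto
    from measurable_sets[OF this Opt_progressive[OF assms, of "real n"]]
    have "(\<lambda>x. x) -` (E \<inter> ({..real n} \<times> UNIV)) \<inter> space (borel \<Otimes>\<^sub>M M) \<in> sets (borel \<Otimes>\<^sub>M M)"
      by simp
    moreover have "(\<lambda>x. x) -` (E \<inter> ({..real n} \<times> UNIV)) \<inter> space (borel \<Otimes>\<^sub>M M) = E \<inter> ({..real n} \<times> UNIV)"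
      using Opt_sub[OF assms] by (auto simp: space_pair_measure)
    ultimately show ?thesis by simp
  qed
  then have "(\<Union>n. E \<inter> ({..real n} \<times> UNIV)) \<in> sets (borel \<Otimes>\<^sub>M M)"
    by (intro sets.countable_nat_UN) auto
  moreover have "(\<Union>n. E \<inter> ({..real n} \<times> UNIV)) = E"
  proof -
    have "p \<in> (\<Union>n. E \<inter> ({..real n} \<times> UNIV))" if "p \<in> E" for p
    proof -
      obtain n where "fst p \<le> real n" using real_arch_simple by blast
      then have "p \<in> E \<inter> ({..real n} \<times> UNIV)" using that by (simp add: mem_Times_iff)
      then show ?thesis by (rule UN_I[OF UNIV_I])
    qed
    then show ?thesis by auto
  qed
  ultimately show ?thesis by simp
qed

section \<open>Debuts of optional sets are stopping times\<close>

definition debut :: "(real \<times> 'a) set \<Rightarrow> 'a \<Rightarrow> ennreal" where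
  "debut E \<omega> = Inf {ennreal t | t. (t, \<omega>) \<in> E}"

lemma debut_less_iff: "debut E \<omega> < x \<longleftrightarrow> (\<exists>t. (t, \<omega>) \<in> E \<and> ennreal t < x)"
  unfolding debut_def Inf_less_iff by blast

text \<open>Kernel and hull are formed for the restriction of the measure to \<open>F t\<close>.
  They have the same measure by capacitability, so the projection differs from its kernel by a
  subset of a null set, which saturation places in \<open>F 0\<close>.\<close>

lemma projection_F:
  fixes E :: "(real \<times> 'a) set"
  assumes E: "E \<in> sets (borel \<Otimes>\<^sub>M F t)" and t: "0 \<le> t"
  shows "snd ` E \<in> sets (F t)"
proof -
  let ?N = "restr_to_subalg M (F t)"
  have sub: "subalgebra M (F t)" by (rule subalgebra_F[OF t])
  have sets_N: "sets ?N = sets (F t)" by (rule sets_restr_to_subalg[OF sub])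
  have sp: "snd ` E \<subseteq> space M"
    using sets.sets_into_space[OF E] t by (auto simp: space_pair_measure)
  have N: "finite_measure ?N"
    using finite_measure_restr_to_subalg[OF sub finite_measure_axioms] .
  have "E \<in> sets (borel \<Otimes>\<^sub>M ?N)"
    using E by (simp add: sets_N cong: sets_pair_measure_cong)
  then obtain D where D: "D \<in> sets ?N" "D \<subseteq> snd ` E" "emeasure ?N D = outer_measure_of ?N (snd ` E)"
    using measurable_projection_inner[OF N] by blast
  obtain G where G: "G \<in> sets ?N" "snd ` E \<subseteq> G" "outer_measure_of ?N (snd ` E) = emeasure ?N G"
    using outer_measure_of_attain[of "snd ` E" ?N] sp by (auto simp: space_restr_to_subalg)
  have "D \<subseteq> G" using D(2) G(2) by blast
  have fin: "emeasure ?N A \<noteq> \<infinity>" for A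
    using finite_measure.emeasure_finite[OF N] by simp
  have "emeasure ?N (G - D) = emeasure ?N G - emeasure ?N D"
    by (rule emeasure_Diff[OF fin G(1) D(1) \<open>D \<subseteq> G\<close>])
  also have "\<dots> = 0"
    unfolding D(3) G(3) using fin[of G] by simp
  finally have "G - D \<in> null_sets ?N"
    using D(1) G(1) by auto
  then have "G - D \<in> null_sets M"
    using null_sets_restr_to_subalg[OF sub] by auto
  then have "snd ` E - D \<in> sets (F 0)"
    by (rule saturated_F) (use G(2) in auto)
  then have "snd ` E - D \<in> sets (F t)"
    using mono_F[of 0 t] t by auto
  moreover have "D \<in> sets (F t)" using D(1) sets_N by simp
  ultimately have "D \<union> (snd ` E - D) \<in> sets (F t)" by (intro sets.Un)
  moreover have "D \<union> (snd ` E - D) = snd ` E" using D(2) by blast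
  ultimately show ?thesis by simp
qed

lemma ennreal_le_iff_less_add:
  assumes "0 \<le> t"
  shows "x \<le> ennreal t \<longleftrightarrow> (\<forall>n\<ge>m. x < ennreal (t + 1 / real (Suc n)))"
proof
  assume x: "x \<le> ennreal t"
  have "ennreal t < ennreal (t + 1 / real (Suc n))" for n
    using assms by (intro ennreal_lessI) (simp_all add: add_nonneg_pos)
  with x show "\<forall>n\<ge>m. x < ennreal (t + 1 / real (Suc n))"
    by (blast intro: le_less_trans)
next
  assume *: "\<forall>n\<ge>m. x < ennreal (t + 1 / real (Suc n))"
  have "(\<lambda>n. ennreal (t + 1 / real (Suc n))) \<longlonglongrightarrow> ennreal (t + 0)"
    by (intro tendsto_ennrealI tendsto_add tendsto_const) (use LIMSEQ_inverse_real_of_nat in \<open>simp add: inverse_eq_divide\<close>)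
  then have "x \<le> ennreal (t + 0)"
    by (rule LIMSEQ_le_const) (use * in \<open>blast intro: less_imp_le\<close>)
  then show "x \<le> ennreal t" by simp
qed

text \<open>For every \<open>s > t\<close> the event \<open>T \<le> t\<close> is the intersection of
  the events \<open>T < t + 1 / Suc n\<close>, taken only over those \<open>n\<close> for which this
  time is at most \<open>s\<close>. It thus lies in all later \<sigma>-algebras, and
  right-continuity brings it down to \<open>F t\<close>.\<close>

lemma stop_timeI_less:
  assumes "\<And>t. 0 < t \<Longrightarrow> {\<omega> \<in> space M. T \<omega> < ennreal t} \<in> sets (F t)"
  shows "stop_time M F T"
  unfolding stop_time_def
proof (intro allI impI)
  fix t :: real assume t: "0 \<le> t"
  have "{\<omega> \<in> space M. T \<omega> \<le> ennreal t} \<in> sets (F s)" if s: "t < s" for s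
  proof -
    obtain m :: nat where m: "1 / real (Suc m) < s - t"
      using nat_approx_posE[of "s - t"] s by auto
    have "{\<omega> \<in> space M. T \<omega> < ennreal (t + 1 / real (Suc n))} \<in> sets (F s)" if "n \<ge> m" for n
    proof -
      have "1 / real (Suc n) \<le> 1 / real (Suc m)" using that by (simp add: frac_le)
      then have "t + 1 / real (Suc n) \<le> s" using m by linarith
      moreover have "0 < t + 1 / real (Suc n)" using t by (simp add: add_nonneg_pos)
      ultimately show ?thesis
        using assms[of "t + 1 / real (Suc n)"] mono_F[of "t + 1 / real (Suc n)" s] by auto
    qed
    then have "(\<Inter>n\<in>{m..}. {\<omega> \<in> space M. T \<omega> < ennreal (t + 1 / real (Suc n))}) \<in> sets (F s)"
      by (intro sets.countable_INT') auto
    moreover have "{\<omega> \<in> space M. T \<omega> \<le> ennreal t} = (\<Inter>n\<in>{m..}. {\<omega> \<in> space M. T \<omega> < ennreal (t + 1 / real (Suc n))})"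
      unfolding ennreal_le_iff_less_add[OF t, of _ m] by auto
    ultimately show ?thesis by simp
  qed
  then show "{\<omega> \<in> space M. T \<omega> \<le> ennreal t} \<in> sets (F t)"
    unfolding right_continuous_F[OF t] by blast
qed

text \<open>The strict inequality \<open>debut E < t\<close> is an existence statement, namely that
  \<open>E\<close> has a point before \<open>t\<close>, and so it is a projection. With a weak
  inequality it would not be, as the infimum need not be attained.\<close>

lemma stop_time_debut:
  assumes E: "E \<in> sets Opt"
  shows "stop_time M F (debut E)"
proof (rule stop_timeI_less)
  fix t :: real assume t: "0 < t"
  have "E \<inter> ({..t} \<times> UNIV) \<in> sets (borel \<Otimes>\<^sub>M F t)"
    by (rule Opt_progressive[OF E]) (use t in simp)
  moreover have "{..<t} \<times> space (F t) \<in> sets (borel \<Otimes>\<^sub>M F t)"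
    by (intro pair_measureI) auto
  ultimately have "E \<inter> ({..t} \<times> UNIV) \<inter> ({..<t} \<times> space (F t)) \<in> sets (borel \<Otimes>\<^sub>M F t)"
    by (rule sets.Int)
  then have "snd ` (E \<inter> ({..t} \<times> UNIV) \<inter> ({..<t} \<times> space (F t))) \<in> sets (F t)"
    by (rule projection_F) (use t in simp)
  moreover have "snd ` (E \<inter> ({..t} \<times> UNIV) \<inter> ({..<t} \<times> space (F t))) = {\<omega> \<in> space M. debut E \<omega> < ennreal t}"
  proof -
    have *: "debut E \<omega> < ennreal t \<longleftrightarrow> (\<exists>u. (u, \<omega>) \<in> E \<and> u < t)" for \<omega>
    proof -
      have "ennreal u < ennreal t \<longleftrightarrow> u < t" if "(u, \<omega>) \<in> E" for u
        using that Opt_sub[OF E] by (intro ennreal_less_iff) auto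
      then show ?thesis unfolding debut_less_iff by blast
    qed
    show ?thesis
    proof (intro set_eqI iffI)
      fix \<omega> assume "\<omega> \<in> {\<omega> \<in> space M. debut E \<omega> < ennreal t}"
      then obtain u where "\<omega> \<in> space M" "(u, \<omega>) \<in> E" "u < t" unfolding * by blast
      then show "\<omega> \<in> snd ` (E \<inter> ({..t} \<times> UNIV) \<inter> ({..<t} \<times> space (F t)))"
        using t by (intro image_eqI[of _ snd "(u, \<omega>)"]) auto
    next
      fix \<omega> assume "\<omega> \<in> snd ` (E \<inter> ({..t} \<times> UNIV) \<inter> ({..<t} \<times> space (F t)))"
      then show "\<omega> \<in> {\<omega> \<in> space M. debut E \<omega> < ennreal t}"
        unfolding * using t by auto
    qed
  qed
  ultimately show "{\<omega> \<in> space M. debut E \<omega> < ennreal t} \<in> sets (F t)" by simp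
qed

text \<open>Closedness under limits from the right is what puts the debut into the set.\<close>

definition right_adherent :: "(real \<times> 'a) set \<Rightarrow> real \<Rightarrow> 'a \<Rightarrow> bool" where
  "right_adherent E u \<omega> \<longleftrightarrow> (\<forall>e>0. \<exists>v. u \<le> v \<and> v < u + e \<and> (v, \<omega>) \<in> E)"

definition right_closed :: "(real \<times> 'a) set \<Rightarrow> bool" where
  "right_closed E \<longleftrightarrow> (\<forall>u \<omega>. 0 \<le> u \<longrightarrow> right_adherent E u \<omega> \<longrightarrow> (u, \<omega>) \<in> E)"

lemma right_closedD: "right_closed E \<Longrightarrow> 0 \<le> u \<Longrightarrow> right_adherent E u \<omega> \<Longrightarrow> (u, \<omega>) \<in> E"
  by (simp add: right_closed_def)

lemma right_adherent_mono: "right_adherent E u \<omega> \<Longrightarrow> E \<subseteq> E' \<Longrightarrow> right_adherent E' u \<omega>"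
  unfolding right_adherent_def by (meson subsetD)

lemma right_closed_INT:
  assumes "\<And>i. i \<in> I \<Longrightarrow> right_closed (E i)"
  shows "right_closed (\<Inter>i\<in>I. E i)"
  unfolding right_closed_def
proof (intro allI impI INT_I)
  fix u \<omega> i assume "0 \<le> u" "right_adherent (\<Inter>i\<in>I. E i) u \<omega>" "i \<in> I"
  then show "(u, \<omega>) \<in> E i"
    by (intro right_closedD[OF assms]) (auto elim: right_adherent_mono)
qed

lemma right_closed_Un:
  assumes A: "right_closed A" and B: "right_closed B"
  shows "right_closed (A \<union> B)"
  unfolding right_closed_def
proof (intro allI impI)
  fix u \<omega> assume u: "0 \<le> u" and ex: "right_adherent (A \<union> B) u \<omega>"
  have "right_adherent A u \<omega> \<or> right_adherent B u \<omega>"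
  proof (rule ccontr)
    assume no: "\<not> ?thesis"
    obtain d where d: "0 < d" "\<forall>v. u \<le> v \<and> v < u + d \<longrightarrow> (v, \<omega>) \<notin> A"
      using no unfolding right_adherent_def by meson
    obtain e where e: "0 < e" "\<forall>v. u \<le> v \<and> v < u + e \<longrightarrow> (v, \<omega>) \<notin> B"
      using no unfolding right_adherent_def by meson
    have "\<exists>v. u \<le> v \<and> v < u + min d e \<and> (v, \<omega>) \<in> A \<union> B"
      using ex d(1) e(1) unfolding right_adherent_def by simp
    then obtain v where v: "u \<le> v" "v < u + min d e" "(v, \<omega>) \<in> A \<union> B"
      by (elim exE conjE)
    then show False
      using d(2)[rule_format, of v] e(2)[rule_format, of v] by auto
  qed
  then show "(u, \<omega>) \<in> A \<union> B"
    using right_closedD[OF A u] right_closedD[OF B u] by blast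
qed

lemma right_closed_UN:
  assumes "finite I" "\<And>i. i \<in> I \<Longrightarrow> right_closed (E i)"
  shows "right_closed (\<Union>i\<in>I. E i)"
  using assms
proof (induction I rule: finite_induct)
  case empty
  have "\<not> (\<forall>e>0::real. False)" by (metis zero_less_one)
  then show ?case by (simp add: right_closed_def right_adherent_def)
next
  case (insert i I)
  then show ?case by (simp add: right_closed_Un)
qed


section \<open>Inner regularity of optional sets and the section theorem\<close>

definition inner_approx :: "(real \<times> 'a) measure \<Rightarrow> (real \<times> 'a) set \<Rightarrow> real \<Rightarrow> (real \<times> 'a) set \<Rightarrow> bool" where
  "inner_approx \<mu> E e C \<longleftrightarrow> C \<in> sets Opt \<and> C \<subseteq> E \<and> right_closed C \<and> measure \<mu> (E - C) < e"

definition inner_regular :: "(real \<times> 'a) measure \<Rightarrow> (real \<times> 'a) set \<Rightarrow> bool" where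
  "inner_regular \<mu> E \<longleftrightarrow> E \<in> sets Opt \<and> (\<forall>e>0. \<exists>C. inner_approx \<mu> E e C)"

lemma inner_regularI:
  assumes "E \<in> sets Opt" "\<And>e. 0 < e \<Longrightarrow> \<exists>C. inner_approx \<mu> E e C"
  shows "inner_regular \<mu> E"
  using assms by (simp add: inner_regular_def)

lemma inner_regular_right_closed:
  assumes "E \<in> sets Opt" "right_closed E"
  shows "inner_regular \<mu> E"
proof (rule inner_regularI)
  fix e :: real assume "0 < e"
  then have "inner_approx \<mu> E e E"
    using assms by (simp add: inner_approx_def)
  then show "\<exists>C. inner_approx \<mu> E e C" by (rule exI)
qed (rule assms(1))

lemma inner_regular_choice:
  assumes E: "\<And>i :: nat. inner_regular \<mu> (E i)" and e: "\<And>i. 0 < e i"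
  shows "\<exists>C. \<forall>i. inner_approx \<mu> (E i) (e i) (C i)"
proof (rule choice, rule allI)
  fix i
  show "\<exists>C. inner_approx \<mu> (E i) (e i) C"
    using E[of i] e[of i] by (simp add: inner_regular_def)
qed

end

lemma half_pow_sums: "(\<lambda>i. (e::real) * (1 / 2) ^ Suc i) sums e"
  using sums_mult[OF power_half_series, of e] by simp

context usual_filtration
begin

lemma measure_UN_diff_le:
  assumes "finite_measure \<mu>" and sets: "sets \<mu> = sets Opt" and A: "\<And>i :: nat. A i \<in> sets Opt"
    and le: "\<And>i. measure \<mu> (A i) \<le> e * (1 / 2) ^ Suc i"
  shows "measure \<mu> (\<Union>i. A i) \<le> e"
proof -
  interpret \<mu>: finite_measure \<mu> by fact
  have s: "summable (\<lambda>i. measure \<mu> (A i))"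
    by (rule summable_comparison_test'[OF sums_summable[OF half_pow_sums[of e]], of 0]) (use le in simp)
  have "measure \<mu> (\<Union>i. A i) \<le> (\<Sum>i. measure \<mu> (A i))"
    by (rule \<mu>.finite_measure_subadditive_countably[OF _ s]) (use A sets in auto)
  also have "\<dots> \<le> (\<Sum>i. e * (1 / 2) ^ Suc i)"
    by (rule suminf_le[OF le s sums_summable[OF half_pow_sums]])
  also have "\<dots> = e"
    by (rule sums_unique[OF half_pow_sums, symmetric])
  finally show ?thesis .
qed

lemma inner_regular_INT:
  assumes "finite_measure \<mu>" and sets: "sets \<mu> = sets Opt" and E: "\<And>i :: nat. inner_regular \<mu> (E i)"
  shows "inner_regular \<mu> (\<Inter>i. E i)"
proof (rule inner_regularI)
  interpret \<mu>: finite_measure \<mu> by fact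
  have E_sets: "E i \<in> sets Opt" for i using E[of i] by (simp add: inner_regular_def)
  then show "(\<Inter>i. E i) \<in> sets Opt" by auto
  fix e :: real assume e: "0 < e"
  \<comment> \<open>The errors sum to \<open>e / 2\<close> and not to \<open>e\<close>, because the
    sum is only bounded weakly while \<open>inner_approx\<close> demands a strict
    inequality.\<close>
  have "\<exists>C. \<forall>i. inner_approx \<mu> (E i) ((e / 2) * (1 / 2) ^ Suc i) (C i)"
    by (rule inner_regular_choice[OF E]) (use e in simp)
  then obtain C where C': "\<forall>i. inner_approx \<mu> (E i) ((e / 2) * (1 / 2) ^ Suc i) (C i)"
    by (rule exE)
  have C: "C i \<in> sets Opt" "C i \<subseteq> E i" "right_closed (C i)"
    "measure \<mu> (E i - C i) < (e / 2) * (1 / 2) ^ Suc i" for i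
    using C'[rule_format, of i] by (simp_all add: inner_approx_def)
  have "measure \<mu> ((\<Inter>i. E i) - (\<Inter>i. C i)) \<le> measure \<mu> (\<Union>i. E i - C i)"
    using E_sets C(1) sets by (intro \<mu>.finite_measure_mono) auto
  also have "\<dots> \<le> e / 2"
    by (rule measure_UN_diff_le[OF assms(1) sets]) (use E_sets C(1,4) in \<open>auto intro: less_imp_le\<close>)
  finally have "measure \<mu> ((\<Inter>i. E i) - (\<Inter>i. C i)) < e" using e by simp
  moreover have "(\<Inter>i. C i) \<in> sets Opt" using C(1) by auto
  moreover have "(\<Inter>i. C i) \<subseteq> (\<Inter>i. E i)" using C(2) by blast
  moreover have "right_closed (\<Inter>i. C i)" using C(3) by (intro right_closed_INT)
  ultimately have "inner_approx \<mu> (\<Inter>i. E i) e (\<Inter>i. C i)"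
    unfolding inner_approx_def by (intro conjI)
  then show "\<exists>C. inner_approx \<mu> (\<Inter>i. E i) e C" by (rule exI)
qed

text \<open>Right-closed sets are stable under finite unions only. The countable union of the
  approximations is therefore cut off at a finite index, with continuity of the measure from above
  controlling the remainder.\<close>

lemma inner_regular_UN:
  assumes "finite_measure \<mu>" and sets: "sets \<mu> = sets Opt" and E: "\<And>i :: nat. inner_regular \<mu> (E i)"
  shows "inner_regular \<mu> (\<Union>i. E i)"
proof (rule inner_regularI)
  interpret \<mu>: finite_measure \<mu> by fact
  have E_sets: "E i \<in> sets Opt" for i using E[of i] by (simp add: inner_regular_def)
  then show UE: "(\<Union>i. E i) \<in> sets Opt" by auto
  fix e :: real assume e: "0 < e"
  have "\<exists>C. \<forall>i. inner_approx \<mu> (E i) ((e / 2) * (1 / 2) ^ Suc i) (C i)"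
    by (rule inner_regular_choice[OF E]) (use e in simp)
  then obtain C where C': "\<forall>i. inner_approx \<mu> (E i) ((e / 2) * (1 / 2) ^ Suc i) (C i)"
    by (rule exE)
  have C: "C i \<in> sets Opt" "C i \<subseteq> E i" "right_closed (C i)"
    "measure \<mu> (E i - C i) < (e / 2) * (1 / 2) ^ Suc i" for i
    using C'[rule_format, of i] by (simp_all add: inner_approx_def)
  have "measure \<mu> ((\<Union>i. E i) - (\<Union>i. C i)) \<le> measure \<mu> (\<Union>i. E i - C i)"
    using E_sets C(1) sets by (intro \<mu>.finite_measure_mono) auto
  also have "\<dots> \<le> e / 2"
    by (rule measure_UN_diff_le[OF assms(1) sets]) (use E_sets C(1,4) in \<open>auto intro: less_imp_le\<close>)
  finally have half: "measure \<mu> ((\<Union>i. E i) - (\<Union>i. C i)) \<le> e / 2" .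
  define D where "D n = (\<Union>i. E i) - (\<Union>i\<in>{..<n}. C i)" for n :: nat
  have D_sets: "D n \<in> sets \<mu>" for n
    unfolding D_def sets by (rule sets.Diff[OF UE]) (use C(1) in \<open>simp add: sets.finite_UN\<close>)
  have "decseq D"
    unfolding decseq_def D_def by (intro allI impI Diff_mono UN_mono) auto
  then have "(\<lambda>n. measure \<mu> (D n)) \<longlonglongrightarrow> measure \<mu> (\<Inter>n. D n)"
    using D_sets by (intro \<mu>.finite_Lim_measure_decseq) auto
  moreover have "(\<Inter>n. D n) = (\<Union>i. E i) - (\<Union>i. C i)"
    unfolding D_def by auto
  ultimately have "(\<lambda>n. measure \<mu> (D n)) \<longlonglongrightarrow> measure \<mu> ((\<Union>i. E i) - (\<Union>i. C i))"
    by simp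
  moreover have "measure \<mu> ((\<Union>i. E i) - (\<Union>i. C i)) < e"
    using half e by simp
  ultimately have "eventually (\<lambda>n. measure \<mu> (D n) < e) sequentially"
    by (rule order_tendstoD(2))
  then obtain n where n: "measure \<mu> (D n) < e"
    by (auto simp: eventually_sequentially)
  have "right_closed (\<Union>i\<in>{..<n}. C i)" using C(3) by (intro right_closed_UN) auto
  moreover have "(\<Union>i\<in>{..<n}. C i) \<in> sets Opt" using C(1) by (intro sets.finite_UN) auto
  moreover have "(\<Union>i\<in>{..<n}. C i) \<subseteq> (\<Union>i. E i)" using C(2) by blast
  moreover have "measure \<mu> ((\<Union>i. E i) - (\<Union>i\<in>{..<n}. C i)) < e" using n unfolding D_def .
  ultimately have "inner_approx \<mu> (\<Union>i. E i) e (\<Union>i\<in>{..<n}. C i)"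
    unfolding inner_approx_def by (intro conjI)
  then show "\<exists>C. inner_approx \<mu> (\<Union>i. E i) e C" by (rule exI)
qed

lemma right_closed_vimage:
  assumes X: "\<forall>\<omega>\<in>space M. cadlag_path (\<lambda>t. X t \<omega>)" and B: "closed B"
  shows "right_closed {(t, \<omega>) \<in> {0..} \<times> space M. X t \<omega> \<in> (B :: real set)}"
  unfolding right_closed_def
proof (intro allI impI)
  fix u \<omega> assume u: "(0::real) \<le> u"
    and ex: "right_adherent {(t, \<omega>) \<in> {0..} \<times> space M. X t \<omega> \<in> B} u \<omega>"
  have "\<forall>n. \<exists>v. u \<le> v \<and> v < u + 1 / real (Suc n) \<and> \<omega> \<in> space M \<and> X v \<omega> \<in> B"
  proof
    fix n
    show "\<exists>v. u \<le> v \<and> v < u + 1 / real (Suc n) \<and> \<omega> \<in> space M \<and> X v \<omega> \<in> B"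
      using ex[unfolded right_adherent_def, rule_format, of "1 / real (Suc n)"] by auto
  qed
  from choice[OF this] obtain v where v: "\<forall>n. u \<le> v n \<and> v n < u + 1 / real (Suc n) \<and> \<omega> \<in> space M \<and> X (v n) \<omega> \<in> B"
    by (rule exE)
  have "v \<longlonglongrightarrow> u"
  proof (rule tendsto_sandwich[where f = "\<lambda>_. u" and h = "\<lambda>n. u + 1 / real (Suc n)"])
    show "(\<lambda>n. u + 1 / real (Suc n)) \<longlonglongrightarrow> u"
      using tendsto_add[OF tendsto_const[of u] LIMSEQ_inverse_real_of_nat] by (simp add: inverse_eq_divide)
    show "\<forall>\<^sub>F n in sequentially. u \<le> v n" "\<forall>\<^sub>F n in sequentially. v n \<le> u + 1 / real (Suc n)"
      using v by (intro always_eventually allI; blast intro: less_imp_le)+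
  qed (rule tendsto_const)
  then have "(\<lambda>n. X (v n) \<omega>) \<longlonglongrightarrow> X u \<omega>"
    using X u v unfolding cadlag_path_def right_cont_path_def
    by (intro right_cont_seq[of "\<lambda>t. X t \<omega>"]) auto
  then have "X u \<omega> \<in> B"
    by (rule closed_sequentially[OF B, rotated]) (use v in auto)
  then show "(u, \<omega>) \<in> {(t, \<omega>) \<in> {0..} \<times> space M. X t \<omega> \<in> B}"
    using u v by auto
qed

text \<open>As for Borel sets of a metric space, regularity is carried along for a set and its
  complement together. The start is that the preimage of a closed set under a right-continuous
  process is right-closed. Such approximations are wanted because a right-closed set contains the
  graph of its debut.\<close>

lemma inner_regular_Opt:
  assumes \<mu>: "finite_measure \<mu>" and sets: "sets \<mu> = sets Opt" and E: "E \<in> sets Opt"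
  shows "inner_regular \<mu> E"
proof -
  let ?U = "{0..} \<times> space M :: (real \<times> 'a) set"
  have "inner_regular \<mu> E \<and> inner_regular \<mu> (?U - E)"
    using E
  proof (induction rule: Opt_induct)
    case (Basic X B)
    let ?P = "\<lambda>B. {(t, \<omega>) \<in> ?U. X t \<omega> \<in> B}"
    have closed: "inner_regular \<mu> (?P B)" if "closed B" for B
      using that Basic by (intro inner_regular_right_closed Opt_basic right_closed_vimage borel_closed)
    have diff: "?U - ?P B = ?P (- B)" by auto
    have "B \<in> sigma_sets UNIV (range (\<lambda>a. {..a}))"
      using Basic(3) by (simp add: borel_eq_atMost)
    then have "inner_regular \<mu> (?P B) \<and> inner_regular \<mu> (?P (- B))"
    proof induction
      case (Basic B)
      then obtain a where a: "B = {..a}" by auto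
      have "- {..a} = (\<Union>n::nat. {a + 1 / real (Suc n)..})"
      proof (intro set_eqI iffI)
        fix x assume "x \<in> - {..a}"
        then obtain n :: nat where "1 / real (Suc n) < x - a" using nat_approx_posE[of "x - a"] by auto
        then have "x \<in> {a + 1 / real (Suc n)..}" by simp
        then show "x \<in> (\<Union>n::nat. {a + 1 / real (Suc n)..})" by (rule UN_I[OF UNIV_I])
      next
        fix x assume "x \<in> (\<Union>n::nat. {a + 1 / real (Suc n)..})"
        then obtain n :: nat where "a + 1 / real (Suc n) \<le> x" by auto
        moreover have "0 < 1 / real (Suc n)" by simp
        ultimately have "a < x" by linarith
        then show "x \<in> - {..a}" by simp
      qed
      then have "?P (- B) = (\<Union>n::nat. ?P {a + 1 / real (Suc n)..})"
        unfolding a by auto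
      moreover have "inner_regular \<mu> (\<Union>n::nat. ?P {a + 1 / real (Suc n)..})"
        by (intro inner_regular_UN[OF \<mu> sets] closed closed_atLeast)
      ultimately show ?case
        unfolding a using closed[OF closed_atMost[of a]] by (simp only:)
    next
      case Empty
      show ?case using closed[of "{}"] closed[of UNIV] by simp
    next
      case (Compl B)
      then show ?case by (simp only: Compl_eq_Diff_UNIV[symmetric] double_complement simp_thms conj_comms)
    next
      case (Union B)
      have eq: "?P (\<Union>i. B i) = (\<Union>i. ?P (B i))" "?P (- (\<Union>i. B i)) = (\<Inter>i. ?P (- B i))"
        by auto
      show ?case
        unfolding eq using Union(2) by (blast intro: inner_regular_UN[OF \<mu> sets] inner_regular_INT[OF \<mu> sets])
    qed
    then show ?case unfolding diff .
  next
    case (Compl E)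
    have "?U - (?U - E) = E" using Opt_sub[OF Compl(1)] by (rule double_diff) simp
    then show ?case using Compl(2) by (simp only: simp_thms conj_comms)
  next
    case (Union E)
    have eq: "?U - (\<Union>i. E i) = (\<Inter>i. ?U - E i)" by auto
    show ?case
      unfolding eq using Union(2) by (blast intro: inner_regular_UN[OF \<mu> sets] inner_regular_INT[OF \<mu> sets])
  qed
  then show ?thesis ..
qed

lemma right_adherent_debut:
  assumes E: "E \<subseteq> {0..} \<times> space M" and fin: "debut E \<omega> < \<infinity>"
  shows "right_adherent E (enn2real (debut E \<omega>)) \<omega>"
proof -
  define u where "u = enn2real (debut E \<omega>)"
  have u: "debut E \<omega> = ennreal u" "0 \<le> u"
    using fin by (auto simp: u_def)
  have "\<exists>v. u \<le> v \<and> v < u + e \<and> (v, \<omega>) \<in> E" if e: "0 < e" for e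
  proof -
    have "debut E \<omega> < ennreal (u + e)"
      using u e by (simp add: ennreal_less_iff)
    then obtain v where v: "(v, \<omega>) \<in> E" "ennreal v < ennreal (u + e)"
      unfolding debut_less_iff by blast
    have "0 \<le> v" using v(1) E by auto
    moreover have "\<not> debut E \<omega> > ennreal v"
      using v(1) unfolding debut_def by (auto simp: not_less intro: Inf_lower)
    ultimately show ?thesis
      using v u by (intro exI[of _ v]) (auto simp: ennreal_less_iff not_less)
  qed
  then show ?thesis
    by (simp add: right_adherent_def u_def)
qed

lemma right_closed_debut:
  assumes E: "right_closed E" "E \<subseteq> {0..} \<times> space M" and fin: "debut E \<omega> < \<infinity>"
  shows "(enn2real (debut E \<omega>), \<omega>) \<in> E"
  by (rule right_closedD[OF E(1) enn2real_nonneg right_adherent_debut[OF E(2) fin]])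

text \<open>A measurable section of \<open>H\<close> is not a stopping time, but it transports the
  probability to a measure on the optional \<sigma>-algebra that charges \<open>H\<close>. A
  right-closed optional subset \<open>C\<close> of \<open>H\<close> that is still charged has a
  debut whose graph lies in \<open>C\<close>, and the debut is finite wherever the section meets
  \<open>C\<close>.\<close>

lemma optional_section:
  assumes H: "H \<in> sets Opt" and pos: "0 < outer_measure_of M (snd ` H)"
  obtains T where "stop_time M F T" "\<And>\<omega>. T \<omega> < \<infinity> \<Longrightarrow> (enn2real (T \<omega>), \<omega>) \<in> H"
    "0 < emeasure M {\<omega> \<in> space M. T \<omega> < \<infinity>}"
proof -
  obtain D R where D: "D \<in> sets M" "0 < emeasure M D" and R0: "R \<in> borel_measurable M"
    and R_H: "\<And>\<omega>. \<omega> \<in> D \<Longrightarrow> (R \<omega> :: real, \<omega>) \<in> H"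
    using measurable_section[OF finite_measure_axioms Opt_measurable[OF H] pos] by metis
  \<comment> \<open>Off \<open>D\<close> the value of \<open>R\<close> is arbitrary, and the maximum
    keeps the point in the space of \<open>Opt\<close>. On \<open>D\<close> nothing changes, since
    \<open>H\<close> lives on nonnegative times.\<close>
  define r where "r \<omega> = (max 0 (R \<omega>), \<omega>)" for \<omega>
  have rM: "r \<in> measurable M (borel \<Otimes>\<^sub>M M)"
    unfolding r_def using R0 by measurable
  have r: "r \<in> measurable M Opt"
  proof (rule measurableI)
    fix E assume "E \<in> sets Opt"
    then show "r -` E \<inter> space M \<in> sets M"
      using measurable_sets[OF rM Opt_measurable] by blast
  qed (auto simp: r_def)
  have r_H: "r \<omega> \<in> H" if "\<omega> \<in> D" for \<omega>
    using R_H[OF that] Opt_sub[OF H] by (auto simp: r_def max_def)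
  define \<mu> where "\<mu> = distr (density M (indicator D)) Opt r"
  have "finite_measure (density M (indicator D))"
    using D(1) by (intro finite_measureI) (simp add: emeasure_density)
  moreover have rD: "r \<in> measurable (density M (indicator D)) Opt"
    using r by simp
  ultimately have \<mu>: "finite_measure \<mu>"
    unfolding \<mu>_def by (rule finite_measure.finite_measure_distr)
  have sets: "sets \<mu> = sets Opt" by (simp add: \<mu>_def)
  have em: "emeasure \<mu> E = emeasure M (D \<inter> (r -` E \<inter> space M))" if "E \<in> sets Opt" for E
  proof -
    have "emeasure \<mu> E = emeasure (density M (indicator D)) (r -` E \<inter> space M)"
      unfolding \<mu>_def using emeasure_distr[OF rD that] by simp
    also have "\<dots> = (\<integral>\<^sup>+\<omega>. indicator (D \<inter> (r -` E \<inter> space M)) \<omega> \<partial>M)"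
      using D(1) measurable_sets[OF r that] by (simp add: emeasure_density indicator_inter_arith)
    also have "\<dots> = emeasure M (D \<inter> (r -` E \<inter> space M))"
      by (rule nn_integral_indicator[OF sets.Int[OF D(1) measurable_sets[OF r that]]])
    finally show ?thesis .
  qed
  have "D \<inter> (r -` H \<inter> space M) = D"
    using r_H sets.sets_into_space[OF D(1)] by auto
  then have "0 < emeasure \<mu> H" using em[OF H] D(2) by simp
  then have "0 < measure \<mu> H"
    using finite_measure.emeasure_eq_measure[OF \<mu>] by simp
  then have "\<exists>C. inner_approx \<mu> H (measure \<mu> H) C"
    using inner_regular_Opt[OF \<mu> sets H] unfolding inner_regular_def by blast
  then obtain C where C: "C \<in> sets Opt" "C \<subseteq> H" "right_closed C" "measure \<mu> (H - C) < measure \<mu> H"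
    unfolding inner_approx_def by blast
  have "measure \<mu> (H - C) = measure \<mu> H - measure \<mu> C"
    using C H sets by (intro finite_measure.finite_measure_Diff[OF \<mu>]) auto
  then have "0 < measure \<mu> C" using C(4) by simp
  then have "0 < emeasure \<mu> C"
    using finite_measure.emeasure_eq_measure[OF \<mu>] by simp
  also have "emeasure \<mu> C = emeasure M (D \<inter> (r -` C \<inter> space M))"
    by (rule em[OF C(1)])
  also have "\<dots> \<le> emeasure M {\<omega> \<in> space M. debut C \<omega> < \<infinity>}"
  proof (rule emeasure_mono)
    show "D \<inter> (r -` C \<inter> space M) \<subseteq> {\<omega> \<in> space M. debut C \<omega> < \<infinity>}"
      unfolding debut_less_iff r_def by auto
    have st: "stop_time M F (debut C)" by (rule stop_time_debut[OF C(1)])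
    have "(\<Union>n. {\<omega> \<in> space M. debut C \<omega> \<le> ennreal (real n)}) \<in> sets M"
    proof (intro sets.countable_nat_UN image_subsetI)
      fix n :: nat
      have "{\<omega> \<in> space M. debut C \<omega> \<le> ennreal (real n)} \<in> sets (F (real n))"
        using st unfolding stop_time_def by simp
      then show "{\<omega> \<in> space M. debut C \<omega> \<le> ennreal (real n)} \<in> sets M"
        by (rule sets_F_M[rotated]) simp
    qed
    moreover have "(\<Union>n. {\<omega> \<in> space M. debut C \<omega> \<le> ennreal (real n)}) = {\<omega> \<in> space M. debut C \<omega> < \<infinity>}"
    proof -
      have "(\<exists>n. x \<le> ennreal (real n)) \<longleftrightarrow> x < \<infinity>" for x
      proof
        assume "x < \<infinity>"
        then obtain n where "x < of_nat n" using ennreal_Ex_less_of_nat[of x] by auto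
        then show "\<exists>n. x \<le> ennreal (real n)" by (auto simp: ennreal_of_nat_eq_real_of_nat intro: less_imp_le)
      next
        assume "\<exists>n. x \<le> ennreal (real n)"
        then show "x < \<infinity>" by (auto intro: le_less_trans)
      qed
      then show ?thesis by auto
    qed
    ultimately show "{\<omega> \<in> space M. debut C \<omega> < \<infinity>} \<in> sets M" by simp
  qed
  finally have "0 < emeasure M {\<omega> \<in> space M. debut C \<omega> < \<infinity>}" .
  moreover have "(enn2real (debut C \<omega>), \<omega>) \<in> H" if "debut C \<omega> < \<infinity>" for \<omega>
    by (rule subsetD[OF C(2) right_closed_debut[OF C(3) Opt_sub[OF C(1)] that]])
  ultimately show ?thesis
    by (intro that[of "debut C"] stop_time_debut[OF C(1)])
qed

end

section \<open>Stieltjes measures of increasing processes\<close>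

definition smeas :: "(real \<Rightarrow> real) \<Rightarrow> real measure" where
  "smeas k = interval_measure (\<lambda>t. if t < 0 then 0 else k t)"

lemma sets_smeas [simp, measurable_cong]: "sets (smeas k) = sets borel"
  by (simp add: smeas_def)

lemma space_smeas [simp]: "space (smeas k) = UNIV"
  by (simp add: smeas_def)

lemma stieltjes_integral_smeas: "stieltjes_integral f k = (\<integral>\<^sup>+ t\<in>{0..}. ennreal (f t) \<partial>smeas k)"
  by (simp add: stieltjes_integral_def smeas_def)

lemma increasing_path_mono: "increasing_path k \<Longrightarrow> 0 \<le> s \<Longrightarrow> s \<le> t \<Longrightarrow> k s \<le> k t"
  unfolding increasing_path_def mono_on_def by auto

lemma increasing_path_nonneg: "increasing_path k \<Longrightarrow> 0 \<le> t \<Longrightarrow> 0 \<le> k t"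
  using increasing_path_mono[of k 0 t] by (simp add: increasing_path_def)

lemma emeasure_smeas_Ioc_eq:
  assumes k: "increasing_path k"
  shows "emeasure (smeas k) {a<..b} =
    (if a \<le> b then ennreal ((if b < 0 then 0 else k b) - (if a < 0 then 0 else k a)) else 0)"
proof -
  define G where "G t = (if t < 0 then 0 else k t)" for t
  have mono: "G x \<le> G y" if "x \<le> y" for x y
    using that increasing_path_mono[OF k, of x y] increasing_path_nonneg[OF k, of y] by (simp add: G_def)
  have cont: "continuous (at_right a) G" for a
  proof (cases "a < 0")
    case True
    have "\<forall>\<^sub>F t in at_right a. t < 0"
      using True by (auto simp: eventually_at_right_field)
    then have "\<forall>\<^sub>F t in at_right a. G t = G a"
      by eventually_elim (simp add: G_def True)
    then show ?thesis
      unfolding continuous_within by (rule tendsto_eventually)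
  next
    case False
    then have "(k \<longlongrightarrow> k a) (at_right a)"
      using k by (simp add: increasing_path_def right_cont_path_def)
    moreover have "\<forall>\<^sub>F t in at_right a. k t = G t"
      using eventually_at_right_less[of a] by eventually_elim (use False in \<open>simp add: G_def\<close>)
    ultimately have "(G \<longlongrightarrow> k a) (at_right a)"
      by (rule Lim_transform_eventually)
    moreover have "G a = k a" using False by (simp add: G_def)
    ultimately show ?thesis by (simp add: continuous_within)
  qed
  have "emeasure (smeas k) {a<..b} = (if a \<le> b then G b - G a else 0)"
    using emeasure_interval_measure_Ioc_eq[of G a b, OF mono cont] by (simp add: smeas_def G_def[abs_def])
  then show ?thesis by (simp add: G_def)
qed

lemma emeasure_smeas_Ioc:
  assumes "increasing_path k" "0 \<le> a" "a \<le> b"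
  shows "emeasure (smeas k) {a<..b} = ennreal (k b - k a)"
  using assms by (simp add: emeasure_smeas_Ioc_eq)

lemma emeasure_smeas_Iic:
  assumes k: "increasing_path k"
  shows "emeasure (smeas k) {..b} = ennreal (if b < 0 then 0 else k b)"
proof -
  have "(\<Union>n. {- real (Suc n)<..b}) = {..b}"
  proof (intro set_eqI iffI)
    fix x assume x: "x \<in> {..b}"
    obtain n where "- x \<le> real n" using real_arch_simple by blast
    then have "x \<in> {- real (Suc n)<..b}" using x by simp
    then show "x \<in> (\<Union>n. {- real (Suc n)<..b})" by (rule UN_I[OF UNIV_I])
  qed auto
  moreover have "(SUP n. emeasure (smeas k) {- real (Suc n)<..b}) = emeasure (smeas k) (\<Union>n. {- real (Suc n)<..b})"
    by (rule SUP_emeasure_incseq) (auto simp: incseq_def)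
  moreover have "emeasure (smeas k) {- real (Suc n)<..b} = ennreal (if b < 0 then 0 else k b)" for n
    unfolding emeasure_smeas_Ioc_eq[OF k] using increasing_path_nonneg[OF k, of b] by auto
  ultimately show ?thesis by simp
qed

lemma smeas_neg_null:
  assumes k: "increasing_path k"
  shows "{..<0} \<in> null_sets (smeas k)"
proof -
  have "(\<Union>n. {..- (1 / real (Suc n))}) \<in> null_sets (smeas k)"
    by (intro null_sets_UN null_setsI) (simp_all add: emeasure_smeas_Iic[OF k] del: of_nat_Suc)
  moreover have "(\<Union>n. {..- (1 / real (Suc n))}) = {..<0}"
  proof (intro set_eqI iffI)
    fix x :: real assume "x \<in> {..<0}"
    then obtain n :: nat where "1 / real (Suc n) < - x" using nat_approx_posE[of "- x"] by auto
    then have "x \<in> {..- (1 / real (Suc n))}" by simp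
    then show "x \<in> (\<Union>n. {..- (1 / real (Suc n))})" by (rule UN_I[OF UNIV_I])
  next
    fix x assume "x \<in> (\<Union>n. {..- (1 / real (Suc n))})"
    then obtain n where "x \<le> - (1 / real (Suc n))" by auto
    moreover have "0 < 1 / real (Suc n)" by simp
    ultimately have "x < 0" by linarith
    then show "x \<in> {..<0}" by simp
  qed
  ultimately show ?thesis by simp
qed

lemma emeasure_smeas_Icc0:
  assumes k: "increasing_path k" and b: "0 \<le> b"
  shows "emeasure (smeas k) {0..b} = ennreal (k b)"
proof -
  have "emeasure (smeas k) ({..b} - {..<0}) = emeasure (smeas k) {..b}"
    by (rule emeasure_Diff_null_set[OF smeas_neg_null[OF k]]) simp
  moreover have "{..b} - {..<0} = {0..b}" by auto
  ultimately show ?thesis using b by (simp add: emeasure_smeas_Iic[OF k])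
qed

lemma emeasure_smeas_UNIV: "emeasure (smeas k) UNIV = (SUP n. emeasure (smeas k) {..real n})"
proof -
  have "(\<Union>n. {..real n}) = UNIV"
  proof (intro set_eqI iffI UNIV_I)
    fix x :: real
    obtain n where "x \<le> real n" using real_arch_simple by blast
    then have "x \<in> {..real n}" by simp
    then show "x \<in> (\<Union>n. {..real n})" by (rule UN_I[OF UNIV_I])
  qed
  moreover have "(SUP n. emeasure (smeas k) {..real n}) = emeasure (smeas k) (\<Union>n. {..real n})"
    by (rule SUP_emeasure_incseq) (auto simp: incseq_def)
  ultimately show ?thesis by simp
qed

lemma emeasure_smeas_le_1:
  assumes k: "increasing_path k" and le: "\<And>t. 0 \<le> t \<Longrightarrow> k t \<le> 1"
  shows "emeasure (smeas k) A \<le> 1"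
proof -
  have "emeasure (smeas k) A \<le> emeasure (smeas k) UNIV"
    by (cases "A \<in> sets (smeas k)") (auto intro!: emeasure_mono simp: emeasure_notin_sets)
  also have "\<dots> = (SUP n. emeasure (smeas k) {..real n})"
    by (rule emeasure_smeas_UNIV)
  also have "\<dots> \<le> 1"
    using le by (intro SUP_least) (simp add: emeasure_smeas_Iic[OF k])
  finally show ?thesis .
qed

lemma subprob_space_smeas:
  assumes "increasing_path k" "\<And>t. 0 \<le> t \<Longrightarrow> k t \<le> 1"
  shows "subprob_space (smeas k)"
  by (rule subprob_spaceI) (use emeasure_smeas_le_1[OF assms] in auto)

text \<open>With total mass at most one, the random Stieltjes measures form a subprobability kernel.
  Measurability need only be checked on half-lines, where the mass is the process itself.\<close>

lemma smeas_kernel: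
  assumes C: "\<And>t. 0 \<le> t \<Longrightarrow> C t \<in> borel_measurable M"
    and inc: "\<And>\<omega>. increasing_path (\<lambda>t. C t \<omega>)" and le: "\<And>t \<omega>. 0 \<le> t \<Longrightarrow> C t \<omega> \<le> 1"
  shows "(\<lambda>\<omega>. smeas (\<lambda>t. C t \<omega>)) \<in> measurable M (subprob_algebra borel)"
proof (rule measurable_subprob_algebra_generated[where G = "range (\<lambda>a. {..a})" and \<Omega> = UNIV])
  show "sets borel = sigma_sets UNIV (range (\<lambda>a::real. {..a}))"
    unfolding borel_eq_atMost by simp
  show "Int_stable (range (\<lambda>a::real. {..a}))"
    by (auto simp: Int_stable_def)
  have em: "(\<lambda>\<omega>. emeasure (smeas (\<lambda>t. C t \<omega>)) {..b}) \<in> borel_measurable M" for b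
    unfolding emeasure_smeas_Iic[OF inc] using C[of b] by (cases "b < 0") simp_all
  then show "(\<lambda>\<omega>. emeasure (smeas (\<lambda>t. C t \<omega>)) A) \<in> borel_measurable M" if "A \<in> range (\<lambda>a. {..a})" for A
    using that by auto
  show "(\<lambda>\<omega>. emeasure (smeas (\<lambda>t. C t \<omega>)) UNIV) \<in> borel_measurable M"
    unfolding emeasure_smeas_UNIV by (intro borel_measurable_SUP em) simp_all
qed (use subprob_space_smeas[OF inc le] in simp_all)

lemma measurable_nn_integral_smeas:
  assumes f: "(\<lambda>(t, \<omega>). f t \<omega>) \<in> borel_measurable (borel \<Otimes>\<^sub>M M)"
    and C: "\<And>t. 0 \<le> t \<Longrightarrow> C t \<in> borel_measurable M"
    and inc: "\<And>\<omega>. increasing_path (\<lambda>t. C t \<omega>)" and le: "\<And>t \<omega>. 0 \<le> t \<Longrightarrow> C t \<omega> \<le> 1"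
  shows "(\<lambda>\<omega>. \<integral>\<^sup>+t. (f t \<omega> :: ennreal) \<partial>smeas (\<lambda>t. C t \<omega>)) \<in> borel_measurable M"
proof (rule nn_integral_measurable_subprob_algebra2[OF _ smeas_kernel[OF C inc le]])
  have "(\<lambda>p. (snd p, fst p)) \<in> measurable (M \<Otimes>\<^sub>M borel) (borel \<Otimes>\<^sub>M M)"
    by simp
  from measurable_compose[OF this f]
  show "(\<lambda>(\<omega>, t). f t \<omega>) \<in> borel_measurable (M \<Otimes>\<^sub>M borel)"
    by (simp add: case_prod_unfold)
qed

lemma emeasure_smeas_step:
  assumes "0 \<le> T"
  shows "AE t in smeas (\<lambda>t. if T \<le> t then 1 else 0). t = T"
    and "emeasure (smeas (\<lambda>t. if T \<le> t then 1 else 0)) {T} = 1"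
proof -
  let ?k = "\<lambda>t. if T \<le> t then 1 else 0 :: real"
  let ?\<mu> = "smeas ?k"
  have k: "increasing_path ?k"
    unfolding increasing_path_def right_cont_path_def
  proof (intro conjI allI impI)
    fix t :: real assume "0 \<le> t"
    show "(?k \<longlongrightarrow> ?k t) (at_right t)"
    proof (rule tendsto_eventually, cases "T \<le> t")
      case True
      show "\<forall>\<^sub>F x in at_right t. ?k x = ?k t"
        using eventually_at_right_less[of t] by eventually_elim (use True in simp)
    next
      case False
      have "\<forall>\<^sub>F x in at_right t. x < T"
        using False by (auto simp: eventually_at_right_field intro!: exI[of _ T])
      then show "\<forall>\<^sub>F x in at_right t. ?k x = ?k t"
        by eventually_elim (use False in simp)
    qed
  qed (auto simp: mono_on_def)
  have "{T<..} = (\<Union>n. {T<..T + real n})"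
  proof (intro set_eqI iffI)
    fix x assume x: "x \<in> {T<..}"
    obtain n where "x - T \<le> real n" using real_arch_simple by blast
    then have "x \<in> {T<..T + real n}" using x by simp
    then show "x \<in> (\<Union>n. {T<..T + real n})" by (rule UN_I[OF UNIV_I])
  qed auto
  moreover have "(\<Union>n. {T<..T + real n}) \<in> null_sets ?\<mu>"
    using assms by (intro null_sets_UN null_setsI) (simp_all add: emeasure_smeas_Ioc[OF k])
  ultimately have gt: "{T<..} \<in> null_sets ?\<mu>" by simp
  have "{..<T} = (\<Union>n. {..T - 1 / real (Suc n)})"
  proof (intro set_eqI iffI)
    fix x :: real assume "x \<in> {..<T}"
    then obtain n :: nat where "1 / real (Suc n) < T - x" using nat_approx_posE[of "T - x"] by auto
    then have "x \<in> {..T - 1 / real (Suc n)}" by simp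
    then show "x \<in> (\<Union>n. {..T - 1 / real (Suc n)})" by (rule UN_I[OF UNIV_I])
  next
    fix x assume "x \<in> (\<Union>n. {..T - 1 / real (Suc n)})"
    then obtain n where "x \<le> T - 1 / real (Suc n)" by auto
    moreover have "0 < 1 / real (Suc n)" by simp
    ultimately have "x < T" by linarith
    then show "x \<in> {..<T}" by simp
  qed
  moreover have "(\<Union>n. {..T - 1 / real (Suc n)}) \<in> null_sets ?\<mu>"
  proof (intro null_sets_UN null_setsI)
    fix n
    have "0 < 1 / real (Suc n)" by simp
    then show "emeasure ?\<mu> {..T - 1 / real (Suc n)} = 0"
      unfolding emeasure_smeas_Iic[OF k] by simp
  qed simp
  ultimately have lt: "{..<T} \<in> null_sets ?\<mu>" by simp
  have un: "{T<..} \<union> {..<T} \<in> null_sets ?\<mu>" using gt lt by (rule null_sets.Un)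
  show "AE t in ?\<mu>. t = T"
    by (rule AE_I'[OF un]) auto
  have "emeasure ?\<mu> ({..T} - {..<T}) = emeasure ?\<mu> {..T}"
    by (rule emeasure_Diff_null_set[OF lt]) simp
  moreover have "{..T} - {..<T} = {T}" by auto
  ultimately show "emeasure ?\<mu> {T} = 1"
    using assms by (simp add: emeasure_smeas_Iic[OF k])
qed

lemma increasing_path_left_lim:
  assumes k: "increasing_path k" and t: "0 < t"
  shows "(k \<longlongrightarrow> left_lim 0 k t) (at_left t)"
proof -
  let ?l = "Sup (k ` {0..<t})"
  have bdd: "bdd_above (k ` {0..<t})"
    by (rule bdd_aboveI2[of _ _ "k t"]) (use increasing_path_mono[OF k] in auto)
  have "(k \<longlongrightarrow> ?l) (at_left t)"
  proof (rule order_tendstoI)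
    fix a assume "a < ?l"
    then obtain s where s: "s \<in> {0..<t}" "a < k s"
      using less_cSup_iff[OF _ bdd] t by auto
    have "a < k u" if "s < u" "u < t" for u
      using increasing_path_mono[OF k, of s u] s that by simp
    then show "\<forall>\<^sub>F u in at_left t. a < k u"
      using s(1) by (auto simp: eventually_at_left_field intro!: exI[of _ s])
  next
    fix a assume a: "?l < a"
    have "k u < a" if "0 < u" "u < t" for u
      using cSup_upper[OF _ bdd, of "k u"] that a by auto
    then show "\<forall>\<^sub>F u in at_left t. k u < a"
      using t by (auto simp: eventually_at_left_field intro!: exI[of _ 0])
  qed
  moreover from this have "Lim (at_left t) k = ?l"
    by (intro tendsto_Lim) simp_all
  ultimately show ?thesis
    using t by (simp add: left_lim_def)
qed

lemma left_grid_tendsto: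
  assumes "(f \<longlongrightarrow> l) (at_left t)" "0 < t"
  shows "(\<lambda>n. f (max 0 (t - 1 / real (Suc n)))) \<longlonglongrightarrow> l"
proof (rule filterlim_compose[OF assms(1)])
  have "(\<lambda>n. t - 1 / real (Suc n)) \<longlonglongrightarrow> t - 0"
    by (intro tendsto_intros) (use LIMSEQ_inverse_real_of_nat in \<open>simp add: inverse_eq_divide\<close>)
  then have "(\<lambda>n. max 0 (t - 1 / real (Suc n))) \<longlonglongrightarrow> max 0 t"
    by (intro tendsto_max tendsto_const) simp
  then have "(\<lambda>n. max 0 (t - 1 / real (Suc n))) \<longlonglongrightarrow> t"
    using assms(2) by simp
  moreover have "max 0 (t - 1 / real (Suc n)) < t" for n
    using assms(2) by simp
  ultimately show "filterlim (\<lambda>n. max 0 (t - 1 / real (Suc n))) (at_left t) sequentially"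
    by (intro filterlim_at_withinI always_eventually allI) (auto simp: less_imp_neq)
qed

lemma emeasure_smeas_point:
  assumes k: "increasing_path k" and t: "0 < t"
  shows "emeasure (smeas k) {t} = ennreal (k t - left_lim 0 k t)"
proof -
  let ?A = "\<lambda>n. {max 0 (t - 1 / real (Suc n))<..t}"
  have em: "emeasure (smeas k) (?A n) = ennreal (k t - k (max 0 (t - 1 / real (Suc n))))" for n
    using t by (intro emeasure_smeas_Ioc[OF k]) auto
  have "(\<lambda>n. emeasure (smeas k) (?A n)) \<longlonglongrightarrow> emeasure (smeas k) (\<Inter>n. ?A n)"
  proof (rule Lim_emeasure_decseq)
    show "decseq ?A"
    proof (rule decseq_SucI)
      fix n
      have "1 / real (Suc (Suc n)) \<le> 1 / real (Suc n)" by (simp add: frac_le)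
      then show "?A (Suc n) \<subseteq> ?A n" by auto
    qed
    show "emeasure (smeas k) (?A n) \<noteq> \<infinity>" for n
      unfolding em by simp
  qed auto
  moreover have "(\<Inter>n. ?A n) = {t}"
  proof (intro set_eqI iffI)
    fix x assume x: "x \<in> (\<Inter>n. ?A n)"
    show "x \<in> {t}"
    proof (rule ccontr)
      assume "x \<notin> {t}"
      then have "x < t" using x by auto
      then obtain n :: nat where "1 / real (Suc n) < t - x" using nat_approx_posE[of "t - x"] by auto
      moreover have "max 0 (t - 1 / real (Suc n)) < x" using x by simp
      ultimately show False by simp
    qed
  qed (use t in auto)
  moreover have "(\<lambda>n. emeasure (smeas k) (?A n)) \<longlonglongrightarrow> ennreal (k t - left_lim 0 k t)"
    unfolding em by (intro tendsto_ennrealI tendsto_diff tendsto_const left_grid_tendsto increasing_path_left_lim k t)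
  ultimately show ?thesis
    by (metis LIMSEQ_unique)
qed

section \<open>Supermartingales integrated against increasing processes\<close>

context usual_filtration
begin

text \<open>Path properties are demanded for every outcome, which removes almost-sure quantifiers
  from the core of the proof; \<open>regular_version\<close> reduces the general case to this
  one.\<close>

definition regular :: "(real \<Rightarrow> 'a \<Rightarrow> real) \<Rightarrow> bool" where
  "regular X \<longleftrightarrow> adapted F X \<and> (\<forall>\<omega>. cadlag_path (\<lambda>t. X t \<omega>) \<and> (\<forall>t\<ge>0. 0 \<le> X t \<omega>))"

definition increasing_process :: "(real \<Rightarrow> 'a \<Rightarrow> real) \<Rightarrow> bool" where
  "increasing_process C \<longleftrightarrow> adapted F C \<and> (\<forall>\<omega>. increasing_path (\<lambda>t. C t \<omega>) \<and> (\<forall>t\<ge>0. C t \<omega> \<le> 1))"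

text \<open>The supermartingale inequality is tested against nonnegative weights and is meaningful
  for infinite integrals. This form passes to limits by Fatou's lemma, and so it is also available
  for nonnegative local martingales.\<close>

definition nn_super :: "(real \<Rightarrow> 'a \<Rightarrow> real) \<Rightarrow> bool" where
  "nn_super X \<longleftrightarrow> (\<forall>s t f. 0 \<le> s \<longrightarrow> s \<le> t \<longrightarrow> f \<in> borel_measurable (F s) \<longrightarrow>
     (\<integral>\<^sup>+\<omega>. f \<omega> * ennreal (X t \<omega>) \<partial>M) \<le> (\<integral>\<^sup>+\<omega>. f \<omega> * ennreal (X s \<omega>) \<partial>M))"

definition nn_mart :: "(real \<Rightarrow> 'a \<Rightarrow> real) \<Rightarrow> bool" where
  "nn_mart X \<longleftrightarrow> (\<forall>s t f. 0 \<le> s \<longrightarrow> s \<le> t \<longrightarrow> f \<in> borel_measurable (F s) \<longrightarrow>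
     (\<integral>\<^sup>+\<omega>. f \<omega> * ennreal (X t \<omega>) \<partial>M) = (\<integral>\<^sup>+\<omega>. f \<omega> * ennreal (X s \<omega>) \<partial>M))"

lemma nn_superD: "nn_super X \<Longrightarrow> 0 \<le> s \<Longrightarrow> s \<le> t \<Longrightarrow> f \<in> borel_measurable (F s) \<Longrightarrow>
    (\<integral>\<^sup>+\<omega>. f \<omega> * ennreal (X t \<omega>) \<partial>M) \<le> (\<integral>\<^sup>+\<omega>. f \<omega> * ennreal (X s \<omega>) \<partial>M)"
  unfolding nn_super_def by blast

lemma nn_martD: "nn_mart X \<Longrightarrow> 0 \<le> s \<Longrightarrow> s \<le> t \<Longrightarrow> f \<in> borel_measurable (F s) \<Longrightarrow>
    (\<integral>\<^sup>+\<omega>. f \<omega> * ennreal (X t \<omega>) \<partial>M) = (\<integral>\<^sup>+\<omega>. f \<omega> * ennreal (X s \<omega>) \<partial>M)"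
  unfolding nn_mart_def by blast

lemma nn_mart_super: "nn_mart X \<Longrightarrow> nn_super X"
  unfolding nn_super_def by (intro allI impI) (rule eq_refl, rule nn_martD)

lemma regularD:
  assumes "regular X"
  shows "adapted F X" "cadlag_path (\<lambda>t. X t \<omega>)" "right_cont_path (\<lambda>t. X t \<omega>)" "0 \<le> t \<Longrightarrow> 0 \<le> X t \<omega>"
    "0 \<le> t \<Longrightarrow> X t \<in> borel_measurable (F t)" "0 \<le> t \<Longrightarrow> X t \<in> borel_measurable M"
proof -
  show "adapted F X" "cadlag_path (\<lambda>t. X t \<omega>)" "0 \<le> t \<Longrightarrow> 0 \<le> X t \<omega>"
    using assms unfolding regular_def by blast+
  then show "right_cont_path (\<lambda>t. X t \<omega>)" "0 \<le> t \<Longrightarrow> X t \<in> borel_measurable (F t)"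
    unfolding cadlag_path_def adapted_def by blast+
  then show "0 \<le> t \<Longrightarrow> X t \<in> borel_measurable M"
    using measurable_F_M by blast
qed

lemma increasing_processD:
  assumes "increasing_process C"
  shows "adapted F C" "increasing_path (\<lambda>t. C t \<omega>)" "0 \<le> t \<Longrightarrow> C t \<omega> \<le> 1"
    "0 \<le> t \<Longrightarrow> C t \<in> borel_measurable (F t)" "0 \<le> t \<Longrightarrow> C t \<in> borel_measurable M"
    "0 \<le> t \<Longrightarrow> 0 \<le> C t \<omega>" "0 \<le> s \<Longrightarrow> s \<le> t \<Longrightarrow> C s \<omega> \<le> C t \<omega>"
proof -
  show C: "adapted F C" "increasing_path (\<lambda>t. C t \<omega>)" "0 \<le> t \<Longrightarrow> C t \<omega> \<le> 1"
    using assms unfolding increasing_process_def by blast+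
  then show "0 \<le> t \<Longrightarrow> C t \<in> borel_measurable (F t)"
    unfolding adapted_def by blast
  then show "0 \<le> t \<Longrightarrow> C t \<in> borel_measurable M"
    using measurable_F_M by blast
  show "0 \<le> t \<Longrightarrow> 0 \<le> C t \<omega>" "0 \<le> s \<Longrightarrow> s \<le> t \<Longrightarrow> C s \<omega> \<le> C t \<omega>"
    by (rule increasing_path_nonneg[OF C(2)] increasing_path_mono[OF C(2)]; assumption)+
qed

text \<open>Discrete integration by parts; the weights \<open>f * (C (u (Suc i)) - C (u i))\<close> are known at time \<open>u (Suc i)\<close>.\<close>

lemma discrete_parts_super:
  assumes X: "regular X" "nn_super X" and C: "increasing_process C"
    and u: "\<And>i. 0 \<le> u i" "\<And>i. u i \<le> u (Suc i)" and f: "f \<in> borel_measurable (F (u 0))"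
  shows "(\<integral>\<^sup>+\<omega>. f \<omega> * ((\<Sum>i<n. ennreal (X (u (Suc i)) \<omega>) * ennreal (C (u (Suc i)) \<omega> - C (u i) \<omega>)) +
      ennreal (X (u n) \<omega>) * ennreal (1 - C (u n) \<omega>)) \<partial>M)
    \<le> (\<integral>\<^sup>+\<omega>. f \<omega> * (ennreal (X (u 0) \<omega>) * ennreal (1 - C (u 0) \<omega>)) \<partial>M)"
proof (induction n)
  case (Suc n)
  have u_mono: "u 0 \<le> u i" for i
    using lift_Suc_mono_le[of u 0 i] u(2) by simp
  have fM: "f \<in> borel_measurable M" and fn: "f \<in> borel_measurable (F (u n))"
    using f u(1) u_mono measurable_F_M measurable_F_mono by blast+
  note [measurable] = fM regularD(6)[OF X(1) u(1)] increasing_processD(5)[OF C u(1)]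
  let ?S = "\<lambda>\<omega>. \<Sum>i<n. ennreal (X (u (Suc i)) \<omega>) * ennreal (C (u (Suc i)) \<omega> - C (u i) \<omega>)"
  have "f \<omega> * ((\<Sum>i<Suc n. ennreal (X (u (Suc i)) \<omega>) * ennreal (C (u (Suc i)) \<omega> - C (u i) \<omega>)) +
      ennreal (X (u (Suc n)) \<omega>) * ennreal (1 - C (u (Suc n)) \<omega>)) =
      f \<omega> * ?S \<omega> + (f \<omega> * ennreal (1 - C (u n) \<omega>)) * ennreal (X (u (Suc n)) \<omega>)" for \<omega>
  proof -
    have "ennreal (C (u (Suc n)) \<omega> - C (u n) \<omega>) + ennreal (1 - C (u (Suc n)) \<omega>) = ennreal (1 - C (u n) \<omega>)"
      using increasing_processD(3,7)[OF C] u by (subst ennreal_plus[symmetric]) auto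
    then have "ennreal (X (u (Suc n)) \<omega>) * ennreal (C (u (Suc n)) \<omega> - C (u n) \<omega>) +
        ennreal (X (u (Suc n)) \<omega>) * ennreal (1 - C (u (Suc n)) \<omega>) = ennreal (X (u (Suc n)) \<omega>) * ennreal (1 - C (u n) \<omega>)"
      by (simp flip: distrib_left)
    then show ?thesis by (simp add: distrib_left add.assoc mult_ac)
  qed
  then have "(\<integral>\<^sup>+\<omega>. f \<omega> * ((\<Sum>i<Suc n. ennreal (X (u (Suc i)) \<omega>) * ennreal (C (u (Suc i)) \<omega> - C (u i) \<omega>)) +
      ennreal (X (u (Suc n)) \<omega>) * ennreal (1 - C (u (Suc n)) \<omega>)) \<partial>M) =
    (\<integral>\<^sup>+\<omega>. f \<omega> * ?S \<omega> \<partial>M) + (\<integral>\<^sup>+\<omega>. (f \<omega> * ennreal (1 - C (u n) \<omega>)) * ennreal (X (u (Suc n)) \<omega>) \<partial>M)"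
    by (simp only:) (rule nn_integral_add; measurable)
  also have "\<dots> \<le> (\<integral>\<^sup>+\<omega>. f \<omega> * ?S \<omega> \<partial>M) + (\<integral>\<^sup>+\<omega>. (f \<omega> * ennreal (1 - C (u n) \<omega>)) * ennreal (X (u n) \<omega>) \<partial>M)"
  proof (intro add_left_mono nn_superD[OF X(2) u])
    note [measurable] = fn increasing_processD(4)[OF C u(1)]
    show "(\<lambda>\<omega>. f \<omega> * ennreal (1 - C (u n) \<omega>)) \<in> borel_measurable (F (u n))"
      by measurable
  qed
  also have "\<dots> = (\<integral>\<^sup>+\<omega>. f \<omega> * ?S \<omega> + (f \<omega> * ennreal (1 - C (u n) \<omega>)) * ennreal (X (u n) \<omega>) \<partial>M)"
    by (rule nn_integral_add[symmetric]; measurable)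
  also have "\<dots> = (\<integral>\<^sup>+\<omega>. f \<omega> * (?S \<omega> + ennreal (X (u n) \<omega>) * ennreal (1 - C (u n) \<omega>)) \<partial>M)"
    by (simp add: distrib_left mult_ac)
  also note Suc.IH
  finally show ?case .
qed simp

text \<open>The weights, namely the increments of \<open>C\<close> and the final
  \<open>1 - C (u n)\<close>, add up to \<open>1 - C (u 0)\<close>. Multiply this identity by the
  terminal value \<open>X (u n)\<close>; in the \<open>i\<close>-th term the weight is known at
  \<open>u (Suc i)\<close>, so the supermartingale inequality may move \<open>X\<close> back to that
  time.\<close>

lemma discrete_parts_lower:
  assumes X: "regular X" "nn_super X" and C: "increasing_process C"
    and u: "\<And>i. 0 \<le> u i" "\<And>i. u i \<le> u (Suc i)" and f: "f \<in> borel_measurable (F (u 0))"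
  shows "(\<integral>\<^sup>+\<omega>. f \<omega> * ennreal (1 - C (u 0) \<omega>) * ennreal (X (u n) \<omega>) \<partial>M)
    \<le> (\<integral>\<^sup>+\<omega>. f \<omega> * ((\<Sum>i<n. ennreal (X (u (Suc i)) \<omega>) * ennreal (C (u (Suc i)) \<omega> - C (u i) \<omega>)) +
      ennreal (X (u n) \<omega>) * ennreal (1 - C (u n) \<omega>)) \<partial>M)"
proof -
  have u_mono: "u i \<le> u j" if "i \<le> j" for i j
    using lift_Suc_mono_le[of u i j] u(2) that by simp
  have fM: "f \<in> borel_measurable M" and fi: "f \<in> borel_measurable (F (u i))" for i
    using f u(1) u_mono[of 0] measurable_F_M measurable_F_mono by blast+
  note [measurable] = fM regularD(6)[OF X(1) u(1)] increasing_processD(5)[OF C u(1)]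
  have "ennreal (1 - C (u 0) \<omega>) = (\<Sum>i<n. ennreal (C (u (Suc i)) \<omega> - C (u i) \<omega>)) + ennreal (1 - C (u n) \<omega>)" for \<omega>
  proof -
    have "(\<Sum>i<n. ennreal (C (u (Suc i)) \<omega> - C (u i) \<omega>)) = ennreal (\<Sum>i<n. C (u (Suc i)) \<omega> - C (u i) \<omega>)"
      using increasing_processD(7)[OF C] u by (intro sum_ennreal) auto
    also have "(\<Sum>i<n. C (u (Suc i)) \<omega> - C (u i) \<omega>) = C (u n) \<omega> - C (u 0) \<omega>"
      by (rule sum_lessThan_telescope)
    finally show ?thesis
      using increasing_processD(3,7)[OF C] u u_mono[of 0 n] by (simp add: ennreal_plus[symmetric] del: ennreal_plus)
  qed
  then have "(\<integral>\<^sup>+\<omega>. f \<omega> * ennreal (1 - C (u 0) \<omega>) * ennreal (X (u n) \<omega>) \<partial>M) =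
    (\<integral>\<^sup>+\<omega>. (\<Sum>i<n. f \<omega> * ennreal (C (u (Suc i)) \<omega> - C (u i) \<omega>) * ennreal (X (u n) \<omega>)) +
      f \<omega> * ennreal (1 - C (u n) \<omega>) * ennreal (X (u n) \<omega>) \<partial>M)"
    by (simp add: distrib_left distrib_right sum_distrib_left sum_distrib_right)
  also have "\<dots> = (\<Sum>i<n. \<integral>\<^sup>+\<omega>. f \<omega> * ennreal (C (u (Suc i)) \<omega> - C (u i) \<omega>) * ennreal (X (u n) \<omega>) \<partial>M) +
      (\<integral>\<^sup>+\<omega>. f \<omega> * ennreal (1 - C (u n) \<omega>) * ennreal (X (u n) \<omega>) \<partial>M)"
    by (subst nn_integral_add, measurable, subst nn_integral_sum, measurable)
  also have "\<dots> \<le> (\<Sum>i<n. \<integral>\<^sup>+\<omega>. f \<omega> * ennreal (C (u (Suc i)) \<omega> - C (u i) \<omega>) * ennreal (X (u (Suc i)) \<omega>) \<partial>M) +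
      (\<integral>\<^sup>+\<omega>. f \<omega> * ennreal (1 - C (u n) \<omega>) * ennreal (X (u n) \<omega>) \<partial>M)"
  proof (intro add_right_mono sum_mono nn_superD[OF X(2) u(1)])
    fix i assume "i \<in> {..<n}"
    then show "u (Suc i) \<le> u n" by (intro u_mono) auto
    have [measurable]: "C (u i) \<in> borel_measurable (F (u (Suc i)))"
      by (rule measurable_F_mono[OF u increasing_processD(4)[OF C u(1)]])
    note [measurable] = fi increasing_processD(4)[OF C u(1)]
    show "(\<lambda>\<omega>. f \<omega> * ennreal (C (u (Suc i)) \<omega> - C (u i) \<omega>)) \<in> borel_measurable (F (u (Suc i)))"
      by measurable
  qed
  also have "\<dots> = (\<integral>\<^sup>+\<omega>. (\<Sum>i<n. f \<omega> * ennreal (C (u (Suc i)) \<omega> - C (u i) \<omega>) * ennreal (X (u (Suc i)) \<omega>)) +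
      f \<omega> * ennreal (1 - C (u n) \<omega>) * ennreal (X (u n) \<omega>) \<partial>M)"
    by (subst nn_integral_add, measurable, subst nn_integral_sum, measurable)
  also have "\<dots> = (\<integral>\<^sup>+\<omega>. f \<omega> * ((\<Sum>i<n. ennreal (X (u (Suc i)) \<omega>) * ennreal (C (u (Suc i)) \<omega> - C (u i) \<omega>)) +
      ennreal (X (u n) \<omega>) * ennreal (1 - C (u n) \<omega>)) \<partial>M)"
    by (simp add: distrib_left sum_distrib_left mult_ac)
  finally show ?thesis .
qed

end

section \<open>Riemann sums and the passage to continuous time\<close>

definition gridpt :: "real \<Rightarrow> real \<Rightarrow> nat \<Rightarrow> nat \<Rightarrow> real" where
  "gridpt s t n i = s + min (real i) (real n) * (t - s) / real n"

text \<open>The minimum in \<open>gridpt\<close> freezes the grid at \<open>t\<close> from index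
  \<open>n\<close> on. Hence it is monotone along all indices, as the discrete lemmas
  require.\<close>

lemma gridpt:
  assumes "s \<le> t" "0 < n"
  shows "gridpt s t n 0 = s" "gridpt s t n n = t" "gridpt s t n i \<le> gridpt s t n (Suc i)"
    "s \<le> gridpt s t n i" "gridpt s t n (Suc i) \<le> gridpt s t n i + (t - s) / n"
proof -
  show "gridpt s t n 0 = s" "gridpt s t n n = t"
    using assms by (simp_all add: gridpt_def)
  have "min (real i) (real n) * ((t - s) / n) \<le> min (real (Suc i)) (real n) * ((t - s) / n)"
    using assms by (intro mult_right_mono) auto
  then show "gridpt s t n i \<le> gridpt s t n (Suc i)"
    by (simp add: gridpt_def)
  show "s \<le> gridpt s t n i"
    using assms by (simp add: gridpt_def)
  have "min (real (Suc i)) (real n) * ((t - s) / n) \<le> (min (real i) (real n) + 1) * ((t - s) / n)"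
    using assms by (intro mult_right_mono) auto
  then show "gridpt s t n (Suc i) \<le> gridpt s t n i + (t - s) / n"
    by (simp add: gridpt_def algebra_simps)
qed

text \<open>The value is taken at the right end of each interval. This matches the discrete
  integration by parts, where an increment of the integrator is known only at the right end, and
  right-continuity of \<open>x\<close> makes the sums converge pointwise.\<close>

definition riemann_step :: "real \<Rightarrow> real \<Rightarrow> nat \<Rightarrow> (real \<Rightarrow> real) \<Rightarrow> real \<Rightarrow> ennreal" where
  "riemann_step s t n x u =
     (\<Sum>i<n. ennreal (x (gridpt s t n (Suc i))) * indicator {gridpt s t n i<..gridpt s t n (Suc i)} u)"

lemma nn_integral_riemann_step:
  assumes k: "increasing_path k" and s: "0 \<le> s" "s \<le> t" "0 < n"
  shows "(\<integral>\<^sup>+u. riemann_step s t n x u \<partial>smeas k) =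
    (\<Sum>i<n. ennreal (x (gridpt s t n (Suc i))) * ennreal (k (gridpt s t n (Suc i)) - k (gridpt s t n i)))"
proof -
  have "(\<integral>\<^sup>+u. riemann_step s t n x u \<partial>smeas k) =
    (\<Sum>i<n. \<integral>\<^sup>+u. ennreal (x (gridpt s t n (Suc i))) * indicator {gridpt s t n i<..gridpt s t n (Suc i)} u \<partial>smeas k)"
    unfolding riemann_step_def by (rule nn_integral_sum) simp
  also have "\<dots> = (\<Sum>i<n. ennreal (x (gridpt s t n (Suc i))) * ennreal (k (gridpt s t n (Suc i)) - k (gridpt s t n i)))"
  proof (rule sum.cong[OF refl])
    fix i
    have "(\<integral>\<^sup>+u. ennreal (x (gridpt s t n (Suc i))) * indicator {gridpt s t n i<..gridpt s t n (Suc i)} u \<partial>smeas k) =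
      ennreal (x (gridpt s t n (Suc i))) * emeasure (smeas k) {gridpt s t n i<..gridpt s t n (Suc i)}"
      by (rule nn_integral_cmult_indicator) simp
    also have "emeasure (smeas k) {gridpt s t n i<..gridpt s t n (Suc i)} =
        ennreal (k (gridpt s t n (Suc i)) - k (gridpt s t n i))"
      using gridpt(3,4)[OF s(2,3), of i] s(1) by (intro emeasure_smeas_Ioc[OF k]) auto
    finally show "(\<integral>\<^sup>+u. ennreal (x (gridpt s t n (Suc i))) * indicator {gridpt s t n i<..gridpt s t n (Suc i)} u \<partial>smeas k) =
      ennreal (x (gridpt s t n (Suc i))) * ennreal (k (gridpt s t n (Suc i)) - k (gridpt s t n i))" .
  qed
  finally show ?thesis .
qed

lemma riemann_step_eq:
  assumes s: "s \<le> t" "0 < n" and u: "u \<in> {s<..t}"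
  obtains v where "u \<le> v" "v \<le> u + (t - s) / n" "v \<le> t" "riemann_step s t n x u = ennreal (x v)"
proof -
  let ?g = "gridpt s t n"
  have mono: "?g i \<le> ?g j" if "i \<le> j" for i j
    using lift_Suc_mono_le[of ?g i j] gridpt(3)[OF s] that by simp
  define j where "j = (LEAST j. u \<le> ?g j)"
  have ex: "u \<le> ?g n" using u gridpt(2)[OF s] by simp
  have j: "u \<le> ?g j" unfolding j_def by (rule LeastI[of _ n]) (rule ex)
  have jn: "j \<le> n" unfolding j_def by (rule Least_le) (rule ex)
  have "j \<noteq> 0"
  proof
    assume "j = 0"
    then have "u \<le> s" using j gridpt(1)[OF s] by simp
    then show False using u by simp
  qed
  then obtain i where i: "j = Suc i" using not0_implies_Suc by blast
  have "i < (LEAST j. u \<le> ?g j)" using i unfolding j_def by linarith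
  then have "\<not> u \<le> ?g i" by (rule not_less_Least)
  then have gi: "?g i < u" by simp
  have "riemann_step s t n x u = (\<Sum>k<n. if k = i then ennreal (x (?g (Suc i))) else 0)"
    unfolding riemann_step_def
  proof (rule sum.cong[OF refl])
    fix k
    have "u \<in> {?g k<..?g (Suc k)} \<longleftrightarrow> k = i"
    proof
      assume k: "u \<in> {?g k<..?g (Suc k)}"
      show "k = i"
      proof (rule ccontr)
        assume "k \<noteq> i"
        then consider "Suc k \<le> i" | "Suc i \<le> k" by linarith
        then show False
          by cases (use mono[of "Suc k" i] mono[of "Suc i" k] k gi j i in auto)
      qed
    qed (use gi j i in auto)
    then show "ennreal (x (?g (Suc k))) * indicator {?g k<..?g (Suc k)} u = (if k = i then ennreal (x (?g (Suc i))) else 0)"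
      by (auto simp: indicator_def)
  qed
  also have "\<dots> = ennreal (x (?g (Suc i)))"
    using jn i by simp
  finally have "riemann_step s t n x u = ennreal (x (?g (Suc i)))" .
  moreover have "?g (Suc i) \<le> t" using mono[of j n] jn gridpt(2)[OF s] i by simp
  ultimately show ?thesis
    using that[of "?g (Suc i)"] j i gi gridpt(5)[OF s, of i] by simp
qed

lemma riemann_step_outside: "s \<le> t \<Longrightarrow> 0 < n \<Longrightarrow> u \<notin> {s<..t} \<Longrightarrow> riemann_step s t n x u = 0"
proof -
  assume s: "s \<le> t" "0 < n" and u: "u \<notin> {s<..t}"
  have mono: "gridpt s t n i \<le> gridpt s t n j" if "i \<le> j" for i j
    using lift_Suc_mono_le[of "gridpt s t n" i j] gridpt(3)[OF s] that by simp
  have "u \<notin> {gridpt s t n i<..gridpt s t n (Suc i)}" if "i < n" for i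
    using mono[of 0 i] mono[of "Suc i" n] that u gridpt(1,2)[OF s] by auto
  then show "riemann_step s t n x u = 0"
    by (simp add: riemann_step_def)
qed

lemma riemann_step_tendsto:
  assumes x: "right_cont_path x" and s: "0 \<le> s" "s \<le> t"
  shows "(\<lambda>n. riemann_step s t (Suc n) x u) \<longlonglongrightarrow> ennreal (x u) * indicator {s<..t} u"
proof (cases "u \<in> {s<..t}")
  case False
  then show ?thesis using riemann_step_outside[OF s(2) _ False] by simp
next
  case True
  have "\<forall>n. \<exists>v. u \<le> v \<and> v \<le> u + (t - s) / Suc n \<and> riemann_step s t (Suc n) x u = ennreal (x v)"
    using riemann_step_eq[OF s(2) _ True] by (metis zero_less_Suc)
  from choice[OF this] obtain v where
    v: "\<forall>n. u \<le> v n \<and> v n \<le> u + (t - s) / Suc n \<and> riemann_step s t (Suc n) x u = ennreal (x (v n))"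
    by (rule exE)
  have "v \<longlonglongrightarrow> u"
  proof (rule tendsto_sandwich[where f = "\<lambda>_. u" and h = "\<lambda>n. u + (t - s) / Suc n"])
    have "(\<lambda>n. u + (t - s) * (1 / Suc n)) \<longlonglongrightarrow> u + (t - s) * 0"
      by (intro tendsto_intros) (use LIMSEQ_inverse_real_of_nat in \<open>simp add: inverse_eq_divide\<close>)
    then show "(\<lambda>n. u + (t - s) / Suc n) \<longlonglongrightarrow> u" by simp
    show "\<forall>\<^sub>F n in sequentially. u \<le> v n" "\<forall>\<^sub>F n in sequentially. v n \<le> u + (t - s) / Suc n"
      using v by (intro always_eventually allI; blast)+
  qed (rule tendsto_const)
  then have "(\<lambda>n. x (v n)) \<longlonglongrightarrow> x u"
    using x s True v unfolding right_cont_path_def by (intro right_cont_seq[of x]) auto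
  then have "(\<lambda>n. ennreal (x (v n))) \<longlonglongrightarrow> ennreal (x u)"
    by (rule tendsto_ennrealI)
  moreover have "riemann_step s t (Suc n) x u = ennreal (x (v n))" for n
    using v by blast
  ultimately show ?thesis using True by simp
qed

lemma smeas_cong: "(\<And>t. 0 \<le> t \<Longrightarrow> k t = k' t) \<Longrightarrow> smeas k = smeas k'"
  unfolding smeas_def by (rule arg_cong[where f = interval_measure]) (auto simp: fun_eq_iff)

lemma measurable_riemann_step: "riemann_step s t n x \<in> borel_measurable (smeas k)"
proof -
  have "(\<lambda>u. riemann_step s t n x u) \<in> borel_measurable borel"
    unfolding riemann_step_def by measurable
  then show ?thesis by (simp cong: measurable_cong_sets)
qed

lemma liminf_add_const_le:
  fixes a :: "nat \<Rightarrow> ennreal"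
  shows "liminf a + b \<le> liminf (\<lambda>n. a n + b)"
proof -
  have "liminf a + b = (SUP n. (INF m\<in>{n..}. a m) + b)"
    unfolding liminf_SUP_INF by (rule ennreal_SUP_add_left[symmetric]) simp
  also have "\<dots> \<le> (SUP n. INF m\<in>{n..}. a m + b)"
    by (intro SUP_mono' INF_greatest add_right_mono INF_lower)
  finally show ?thesis unfolding liminf_SUP_INF .
qed

context usual_filtration
begin

lemma measurable_sint:
  assumes g: "(\<lambda>(u, \<omega>). g u \<omega>) \<in> borel_measurable (borel \<Otimes>\<^sub>M M)" and C: "increasing_process C"
  shows "(\<lambda>\<omega>. \<integral>\<^sup>+u. (g u \<omega> :: ennreal) \<partial>smeas (\<lambda>t. C t \<omega>)) \<in> borel_measurable M"
  by (rule measurable_nn_integral_smeas[OF g increasing_processD(5)[OF C] increasing_processD(2)[OF C] increasing_processD(3)[OF C]])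

lemma measurable_path_indicator:
  assumes X: "regular X" and s: "0 \<le> s"
  shows "(\<lambda>(u, \<omega>). ennreal (X u \<omega>) * indicator {s<..t} u) \<in> borel_measurable (borel \<Otimes>\<^sub>M M)"
proof -
  note [measurable] = measurable_path[OF regularD(1)[OF X] regularD(3)[OF X]]
  have "(\<lambda>p. ennreal (case p of (u, \<omega>) \<Rightarrow> if 0 \<le> u then X u \<omega> else 0) * indicator {s<..t} (fst p)) \<in> borel_measurable (borel \<Otimes>\<^sub>M M)"
    by measurable
  moreover have "(\<lambda>(u, \<omega>). ennreal (X u \<omega>) * indicator {s<..t} u) =
    (\<lambda>p. ennreal (case p of (u, \<omega>) \<Rightarrow> if 0 \<le> u then X u \<omega> else 0) * indicator {s<..t} (fst p))"
    using s by (intro ext) (auto simp: indicator_def)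
  ultimately show ?thesis by simp
qed

definition sint :: "(real \<Rightarrow> 'a \<Rightarrow> real) \<Rightarrow> (real \<Rightarrow> 'a \<Rightarrow> real) \<Rightarrow> real \<Rightarrow> real \<Rightarrow> 'a \<Rightarrow> ennreal" where
  "sint X C s t \<omega> = (\<integral>\<^sup>+u. ennreal (X u \<omega>) * indicator {s<..t} u \<partial>smeas (\<lambda>t. C t \<omega>))"

lemma sint_measurable: "regular X \<Longrightarrow> increasing_process C \<Longrightarrow> 0 \<le> s \<Longrightarrow> sint X C s t \<in> borel_measurable M"
  unfolding sint_def by (rule measurable_sint[OF measurable_path_indicator])

lemma sint_le_liminf:
  assumes X: "regular X" and s: "0 \<le> s" "s \<le> t"
  shows "sint X C s t \<omega> \<le> liminf (\<lambda>n. \<integral>\<^sup>+u. riemann_step s t (Suc n) (\<lambda>u. X u \<omega>) u \<partial>smeas (\<lambda>t. C t \<omega>))"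
proof -
  have "ennreal (X u \<omega>) * indicator {s<..t} u = liminf (\<lambda>n. riemann_step s t (Suc n) (\<lambda>u. X u \<omega>) u)" for u
    by (rule lim_imp_Liminf[symmetric]) (auto intro: riemann_step_tendsto regularD(3)[OF X] s)
  then show ?thesis
    unfolding sint_def by (simp only:) (rule nn_integral_liminf, rule measurable_riemann_step)
qed

text \<open>Fatou's lemma is applied twice, to the Stieltjes integral of each path and to the
  expectation. Both times it loses in the direction that the inequality allows.\<close>

lemma parts_super:
  assumes X: "regular X" "nn_super X" and C: "increasing_process C"
    and s: "0 \<le> s" "s \<le> t" and B: "B \<in> sets (F s)"
  shows "(\<integral>\<^sup>+\<omega>. indicator B \<omega> * (sint X C s t \<omega> + ennreal (X t \<omega>) * ennreal (1 - C t \<omega>)) \<partial>M)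
    \<le> (\<integral>\<^sup>+\<omega>. indicator B \<omega> * (ennreal (X s \<omega>) * ennreal (1 - C s \<omega>)) \<partial>M)"
proof -
  define S where "S n \<omega> = (\<Sum>i<Suc n. ennreal (X (gridpt s t (Suc n) (Suc i)) \<omega>) *
    ennreal (C (gridpt s t (Suc n) (Suc i)) \<omega> - C (gridpt s t (Suc n) i) \<omega>))" for n \<omega>
  have S: "(\<integral>\<^sup>+u. riemann_step s t (Suc n) (\<lambda>u. X u \<omega>) u \<partial>smeas (\<lambda>t. C t \<omega>)) = S n \<omega>" for n \<omega>
    unfolding S_def by (rule nn_integral_riemann_step[OF increasing_processD(2)[OF C] s]) simp
  let ?b = "\<lambda>\<omega>. ennreal (X t \<omega>) * ennreal (1 - C t \<omega>)"
  have g0: "0 \<le> gridpt s t (Suc n) i" for n i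
    using gridpt(4)[OF s(2), of "Suc n" i] s(1) by simp
  have t: "0 \<le> t" using s by simp
  have [measurable]: "B \<in> sets M" by (rule sets_F_M[OF s(1) B])
  note [measurable] = regularD(6)[OF X(1) g0] increasing_processD(5)[OF C g0] regularD(6)[OF X(1) t] increasing_processD(5)[OF C t]
  have [measurable]: "S n \<in> borel_measurable M" for n
    unfolding S_def by measurable
  have "indicator B \<omega> * (sint X C s t \<omega> + ?b \<omega>) \<le> liminf (\<lambda>n. indicator B \<omega> * (S n \<omega> + ?b \<omega>))" for \<omega>
  proof (cases "\<omega> \<in> B")
    case True
    have "sint X C s t \<omega> + ?b \<omega> \<le> liminf (\<lambda>n. S n \<omega>) + ?b \<omega>"
      using sint_le_liminf[OF X(1) s, of C \<omega>] unfolding S by (rule add_right_mono)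
    also have "\<dots> \<le> liminf (\<lambda>n. S n \<omega> + ?b \<omega>)" by (rule liminf_add_const_le)
    finally show ?thesis using True by simp
  qed simp
  then have "(\<integral>\<^sup>+\<omega>. indicator B \<omega> * (sint X C s t \<omega> + ?b \<omega>) \<partial>M) \<le> (\<integral>\<^sup>+\<omega>. liminf (\<lambda>n. indicator B \<omega> * (S n \<omega> + ?b \<omega>)) \<partial>M)"
    by (rule nn_integral_mono)
  also have "\<dots> \<le> liminf (\<lambda>n. \<integral>\<^sup>+\<omega>. indicator B \<omega> * (S n \<omega> + ?b \<omega>) \<partial>M)"
    by (rule nn_integral_liminf) measurable
  also have "\<dots> \<le> liminf (\<lambda>n. \<integral>\<^sup>+\<omega>. indicator B \<omega> * (ennreal (X s \<omega>) * ennreal (1 - C s \<omega>)) \<partial>M)"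
  proof (rule Liminf_mono, rule always_eventually, rule allI)
    fix n
    have f: "indicator B \<in> borel_measurable (F (gridpt s t (Suc n) 0))"
      using B gridpt(1)[OF s(2), of "Suc n"] by simp
    show "(\<integral>\<^sup>+\<omega>. indicator B \<omega> * (S n \<omega> + ?b \<omega>) \<partial>M) \<le> (\<integral>\<^sup>+\<omega>. indicator B \<omega> * (ennreal (X s \<omega>) * ennreal (1 - C s \<omega>)) \<partial>M)"
      using discrete_parts_super[OF X C g0 gridpt(3)[OF s(2)] f, of "Suc n"] gridpt(1,2)[OF s(2), of "Suc n"]
      unfolding S_def by simp
  qed
  also have "\<dots> = (\<integral>\<^sup>+\<omega>. indicator B \<omega> * (ennreal (X s \<omega>) * ennreal (1 - C s \<omega>)) \<partial>M)"
    by (rule Liminf_const) simp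
  finally show ?thesis .
qed

text \<open>Applied to the truncations of a martingale, this lower bound turns \<open>parts_super\<close> into an equality.\<close>

lemma parts_bounded_lower:
  assumes X: "regular X" "nn_super X" and C: "increasing_process C"
    and s: "0 \<le> s" "s \<le> t" and B: "B \<in> sets (F s)" and c: "\<And>t \<omega>. 0 \<le> t \<Longrightarrow> X t \<omega> \<le> c"
  shows "(\<integral>\<^sup>+\<omega>. indicator B \<omega> * ennreal (1 - C s \<omega>) * ennreal (X t \<omega>) \<partial>M)
    \<le> (\<integral>\<^sup>+\<omega>. indicator B \<omega> * (sint X C s t \<omega> + ennreal (X t \<omega>) * ennreal (1 - C t \<omega>)) \<partial>M)"
proof -
  define S where "S n \<omega> = (\<Sum>i<Suc n. ennreal (X (gridpt s t (Suc n) (Suc i)) \<omega>) *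
    ennreal (C (gridpt s t (Suc n) (Suc i)) \<omega> - C (gridpt s t (Suc n) i) \<omega>))" for n \<omega>
  have S: "(\<integral>\<^sup>+u. riemann_step s t (Suc n) (\<lambda>u. X u \<omega>) u \<partial>smeas (\<lambda>t. C t \<omega>)) = S n \<omega>" for n \<omega>
    unfolding S_def by (rule nn_integral_riemann_step[OF increasing_processD(2)[OF C] s]) simp
  let ?b = "\<lambda>\<omega>. ennreal (X t \<omega>) * ennreal (1 - C t \<omega>)"
  have g0: "0 \<le> gridpt s t (Suc n) i" for n i
    using gridpt(4)[OF s(2), of "Suc n" i] s(1) by simp
  have t: "0 \<le> t" using s by simp
  have [measurable]: "B \<in> sets M" by (rule sets_F_M[OF s(1) B])
  note [measurable] = regularD(6)[OF X(1) g0] increasing_processD(5)[OF C g0] regularD(6)[OF X(1) t] increasing_processD(5)[OF C t]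
    sint_measurable[OF X(1) C s(1)]
  have [measurable]: "S n \<in> borel_measurable M" for n
    unfolding S_def by measurable
  have le1: "emeasure (smeas (\<lambda>t. C t \<omega>)) UNIV \<le> 1" for \<omega>
    by (rule emeasure_smeas_le_1[OF increasing_processD(2)[OF C] increasing_processD(3)[OF C]])
  \<comment> \<open>As \<open>C\<close> has total mass at most one, the constant \<open>c\<close>
    dominates both the integrands and their Stieltjes integrals; this is what replaces Fatou's lemma
    by dominated convergence.\<close>
  have cint: "(\<integral>\<^sup>+u. ennreal c \<partial>smeas (\<lambda>t. C t \<omega>)) \<le> ennreal c" for \<omega>
    using mult_left_mono[OF le1, of "ennreal c"] by simp
  have rs: "riemann_step s t (Suc n) (\<lambda>u. X u \<omega>) u \<le> ennreal c" for n u \<omega>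
  proof (cases "u \<in> {s<..t}")
    case True
    show ?thesis
    proof (rule riemann_step_eq[OF s(2) _ True])
      fix v assume "u \<le> v" and eq: "riemann_step s t (Suc n) (\<lambda>u. X u \<omega>) u = ennreal (X v \<omega>)"
      then have "0 \<le> v" using True s by simp
      then show ?thesis unfolding eq by (intro ennreal_leI c)
    qed simp
  qed (simp add: riemann_step_outside[OF s(2)])
  have S_le: "S n \<omega> \<le> ennreal c" for n \<omega>
    unfolding S[symmetric] by (rule order_trans[OF nn_integral_mono cint]) (rule rs)
  have S_lim: "(\<lambda>n. S n \<omega>) \<longlonglongrightarrow> sint X C s t \<omega>" for \<omega>
    unfolding S[symmetric] sint_def
  proof (rule nn_integral_dominated_convergence[where w = "\<lambda>_. ennreal c"])
    show "(\<lambda>u. ennreal (X u \<omega>) * indicator {s<..t} u) \<in> borel_measurable (smeas (\<lambda>t. C t \<omega>))"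
    proof (rule borel_measurable_LIMSEQ_order[where u = "\<lambda>n. riemann_step s t (Suc n) (\<lambda>u. X u \<omega>)"])
      show "(\<lambda>n. riemann_step s t (Suc n) (\<lambda>u. X u \<omega>) u) \<longlonglongrightarrow> ennreal (X u \<omega>) * indicator {s<..t} u" for u
        by (rule riemann_step_tendsto[OF regularD(3)[OF X(1)] s])
    qed (rule measurable_riemann_step)
    show "(\<integral>\<^sup>+u. ennreal c \<partial>smeas (\<lambda>t. C t \<omega>)) < \<infinity>"
      using cint[of \<omega>] by (rule le_less_trans) simp
    show "AE u in smeas (\<lambda>t. C t \<omega>). (\<lambda>n. riemann_step s t (Suc n) (\<lambda>u. X u \<omega>) u) \<longlonglongrightarrow> ennreal (X u \<omega>) * indicator {s<..t} u"
      by (rule AE_I2) (rule riemann_step_tendsto[OF regularD(3)[OF X(1)] s])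
    show "AE u in smeas (\<lambda>t. C t \<omega>). riemann_step s t (Suc n) (\<lambda>u. X u \<omega>) u \<le> ennreal c" for n
      by (rule AE_I2) (rule rs)
  qed (simp_all add: measurable_riemann_step)
  have "(\<lambda>n. \<integral>\<^sup>+\<omega>. indicator B \<omega> * (S n \<omega> + ?b \<omega>) \<partial>M) \<longlonglongrightarrow> (\<integral>\<^sup>+\<omega>. indicator B \<omega> * (sint X C s t \<omega> + ?b \<omega>) \<partial>M)"
  proof (rule nn_integral_dominated_convergence[where w = "\<lambda>_. ennreal c + ennreal c"])
    have "?b \<omega> \<le> ennreal c" for \<omega>
    proof -
      have "?b \<omega> \<le> ennreal c * 1"
        using c[OF t] increasing_processD(6)[OF C t] by (intro mult_mono ennreal_leI) auto
      then show ?thesis by simp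
    qed
    then have "indicator B \<omega> * (S n \<omega> + ?b \<omega>) \<le> ennreal c + ennreal c" for n \<omega>
      using add_mono[OF S_le] by (cases "\<omega> \<in> B") simp_all
    then show "AE \<omega> in M. indicator B \<omega> * (S n \<omega> + ?b \<omega>) \<le> ennreal c + ennreal c" for n
      by simp
    have "(\<lambda>n. indicator B \<omega> * (S n \<omega> + ?b \<omega>)) \<longlonglongrightarrow> indicator B \<omega> * (sint X C s t \<omega> + ?b \<omega>)" for \<omega>
      using tendsto_add[OF S_lim tendsto_const] by (cases "\<omega> \<in> B") simp_all
    then show "AE \<omega> in M. (\<lambda>n. indicator B \<omega> * (S n \<omega> + ?b \<omega>)) \<longlonglongrightarrow> indicator B \<omega> * (sint X C s t \<omega> + ?b \<omega>)"
      by simp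
    show "(\<integral>\<^sup>+\<omega>. ennreal c + ennreal c \<partial>M) < \<infinity>"
      by (simp add: emeasure_space_1)
  qed measurable
  moreover have "(\<integral>\<^sup>+\<omega>. indicator B \<omega> * ennreal (1 - C s \<omega>) * ennreal (X t \<omega>) \<partial>M) \<le> (\<integral>\<^sup>+\<omega>. indicator B \<omega> * (S n \<omega> + ?b \<omega>) \<partial>M)" for n
  proof -
    have f: "indicator B \<in> borel_measurable (F (gridpt s t (Suc n) 0))"
      using B gridpt(1)[OF s(2), of "Suc n"] by simp
    show ?thesis
      using discrete_parts_lower[OF X C g0 gridpt(3)[OF s(2)] f, of "Suc n"] gridpt(1,2)[OF s(2), of "Suc n"]
      unfolding S_def by simp
  qed
  ultimately show ?thesis
    by (intro LIMSEQ_le_const) auto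
qed

lemma cadlag_path_min:
  assumes "cadlag_path f"
  shows "cadlag_path (\<lambda>t. min (f t) c)"
  unfolding cadlag_path_def right_cont_path_def
proof (intro conjI allI impI)
  fix t :: real assume "0 \<le> t"
  then show "((\<lambda>t. min (f t) c) \<longlongrightarrow> min (f t) c) (at_right t)"
    using assms by (intro tendsto_min tendsto_const) (auto simp: cadlag_path_def right_cont_path_def)
next
  fix t :: real assume "0 < t"
  then obtain l where "(f \<longlongrightarrow> l) (at_left t)" using assms by (auto simp: cadlag_path_def)
  then have "((\<lambda>t. min (f t) c) \<longlongrightarrow> min l c) (at_left t)" by (intro tendsto_min tendsto_const)
  then show "\<exists>l. ((\<lambda>t. min (f t) c) \<longlongrightarrow> l) (at_left t)" by (rule exI)
qed

lemma regular_min: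
  assumes X: "regular X" and c: "0 \<le> c"
  shows "regular (\<lambda>t \<omega>. min (X t \<omega>) c)"
  unfolding regular_def adapted_def
proof (intro conjI allI impI)
  fix t :: real assume t: "0 \<le> t"
  note [measurable] = regularD(5)[OF X t]
  show "(\<lambda>\<omega>. min (X t \<omega>) c) \<in> borel_measurable (F t)" by measurable
  show "0 \<le> min (X t \<omega>) c" for \<omega> using regularD(4)[OF X t] c by simp
qed (rule cadlag_path_min[OF regularD(2)[OF X]])

text \<open>Split according to \<open>X s \<le> c\<close>, an event known at time \<open>s\<close>.
  There the minimum at time \<open>t\<close> is bounded by \<open>X t\<close>, elsewhere by
  \<open>c\<close>, and these bounds lead exactly to the minimum at time \<open>s\<close>.\<close>

lemma nn_super_min:
  assumes X: "regular X" "nn_super X" and c: "0 \<le> c"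
  shows "nn_super (\<lambda>t \<omega>. min (X t \<omega>) c)"
  unfolding nn_super_def
proof (intro allI impI)
  fix s t :: real and f :: "'a \<Rightarrow> ennreal"
  assume s: "0 \<le> s" "s \<le> t" and f[measurable]: "f \<in> borel_measurable (F s)"
  have t: "0 \<le> t" using s by simp
  have fM[measurable]: "f \<in> borel_measurable M" by (rule measurable_F_M[OF s(1) f])
  have Xs[measurable]: "X s \<in> borel_measurable (F s)" by (rule regularD(5)[OF X(1) s(1)])
  note [measurable] = regularD(6)[OF X(1) s(1)] regularD(6)[OF X(1) t]
  let ?g = "\<lambda>\<omega>. f \<omega> * (if X s \<omega> \<le> c then 1 else 0)" and ?h = "\<lambda>\<omega>. f \<omega> * (if X s \<omega> \<le> c then 0 else ennreal c)"
  have "(\<integral>\<^sup>+\<omega>. f \<omega> * ennreal (min (X t \<omega>) c) \<partial>M) \<le> (\<integral>\<^sup>+\<omega>. ?g \<omega> * ennreal (X t \<omega>) + ?h \<omega> \<partial>M)"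
    by (intro nn_integral_mono) (auto intro!: mult_left_mono ennreal_leI)
  also have "\<dots> = (\<integral>\<^sup>+\<omega>. ?g \<omega> * ennreal (X t \<omega>) \<partial>M) + (\<integral>\<^sup>+\<omega>. ?h \<omega> \<partial>M)"
    by (rule nn_integral_add) measurable
  also have "\<dots> \<le> (\<integral>\<^sup>+\<omega>. ?g \<omega> * ennreal (X s \<omega>) \<partial>M) + (\<integral>\<^sup>+\<omega>. ?h \<omega> \<partial>M)"
    by (intro add_right_mono nn_superD[OF X(2) s]) measurable
  also have "\<dots> = (\<integral>\<^sup>+\<omega>. ?g \<omega> * ennreal (X s \<omega>) + ?h \<omega> \<partial>M)"
    by (rule nn_integral_add[symmetric]) measurable
  also have "\<dots> = (\<integral>\<^sup>+\<omega>. f \<omega> * ennreal (min (X s \<omega>) c) \<partial>M)"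
    by (intro nn_integral_cong) (simp add: min_def)
  finally show "(\<integral>\<^sup>+\<omega>. f \<omega> * ennreal (min (X t \<omega>) c) \<partial>M) \<le> (\<integral>\<^sup>+\<omega>. f \<omega> * ennreal (min (X s \<omega>) c) \<partial>M)" .
qed

text \<open>For the lower bound, \<open>X\<close> is truncated at \<open>n\<close>. The truncations
  are bounded supermartingales, so \<open>parts_bounded_lower\<close> applies to them; monotone
  convergence restores \<open>X t\<close> on the left, and only there does the martingale property
  enter, to replace \<open>X t\<close> by \<open>X s\<close>.\<close>

lemma parts_mart:
  assumes X: "regular X" "nn_mart X" and C: "increasing_process C"
    and s: "0 \<le> s" "s \<le> t" and B: "B \<in> sets (F s)"
  shows "(\<integral>\<^sup>+\<omega>. indicator B \<omega> * (sint X C s t \<omega> + ennreal (X t \<omega>) * ennreal (1 - C t \<omega>)) \<partial>M)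
    = (\<integral>\<^sup>+\<omega>. indicator B \<omega> * (ennreal (X s \<omega>) * ennreal (1 - C s \<omega>)) \<partial>M)" (is "?I = _")
proof (rule antisym)
  show "?I \<le> (\<integral>\<^sup>+\<omega>. indicator B \<omega> * (ennreal (X s \<omega>) * ennreal (1 - C s \<omega>)) \<partial>M)"
    by (rule parts_super[OF X(1) nn_mart_super[OF X(2)] C s B])
  have t: "0 \<le> t" using s by simp
  have BM[measurable]: "B \<in> sets M" by (rule sets_F_M[OF s(1) B])
  note [measurable] = regularD(6)[OF X(1) s(1)] regularD(6)[OF X(1) t] increasing_processD(5)[OF C s(1)]
  define Y where "Y n t \<omega> = min (X t \<omega>) (real n)" for n t \<omega>
  have Y: "regular (Y n)" "nn_super (Y n)" for n
    unfolding Y_def by (intro regular_min nn_super_min X(1) nn_mart_super[OF X(2)], simp)+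
  have "(\<integral>\<^sup>+\<omega>. indicator B \<omega> * ennreal (1 - C s \<omega>) * ennreal (Y n t \<omega>) \<partial>M) \<le> ?I" for n
  proof -
    have "(\<integral>\<^sup>+\<omega>. indicator B \<omega> * ennreal (1 - C s \<omega>) * ennreal (Y n t \<omega>) \<partial>M) \<le>
      (\<integral>\<^sup>+\<omega>. indicator B \<omega> * (sint (Y n) C s t \<omega> + ennreal (Y n t \<omega>) * ennreal (1 - C t \<omega>)) \<partial>M)"
      by (rule parts_bounded_lower[OF Y C s B, of _ "real n"]) (simp add: Y_def)
    also have "\<dots> \<le> ?I"
      unfolding sint_def
      by (intro nn_integral_mono mult_left_mono add_mono mult_right_mono ennreal_leI) (simp_all add: Y_def)
    finally show ?thesis .
  qed
  moreover have "(\<lambda>n. \<integral>\<^sup>+\<omega>. indicator B \<omega> * ennreal (1 - C s \<omega>) * ennreal (Y n t \<omega>) \<partial>M) \<longlonglongrightarrow>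
    (\<integral>\<^sup>+\<omega>. indicator B \<omega> * ennreal (1 - C s \<omega>) * ennreal (X t \<omega>) \<partial>M)"
  proof (rule nn_integral_LIMSEQ)
    show "incseq (\<lambda>n \<omega>. indicator B \<omega> * ennreal (1 - C s \<omega>) * ennreal (Y n t \<omega>))"
      by (intro incseq_SucI le_funI mult_left_mono ennreal_leI) (simp_all add: Y_def)
    show "(\<lambda>\<omega>. indicator B \<omega> * ennreal (1 - C s \<omega>) * ennreal (Y n t \<omega>)) \<in> borel_measurable M" for n
      unfolding Y_def by measurable
    fix \<omega>
    obtain m where m: "X t \<omega> \<le> real m" using real_arch_simple[of "X t \<omega>"] by (rule exE)
    have "Y n t \<omega> = X t \<omega>" if "m \<le> n" for n
    proof -
      have "real m \<le> real n" using that by simp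
      then have "X t \<omega> \<le> real n" using m by linarith
      then show ?thesis unfolding Y_def by (rule min_absorb1)
    qed
    then have "\<forall>\<^sub>F n in sequentially. indicator B \<omega> * ennreal (1 - C s \<omega>) * ennreal (Y n t \<omega>) =
      indicator B \<omega> * ennreal (1 - C s \<omega>) * ennreal (X t \<omega>)"
      unfolding eventually_sequentially by (intro exI[of _ m]) simp
    then show "(\<lambda>n. indicator B \<omega> * ennreal (1 - C s \<omega>) * ennreal (Y n t \<omega>)) \<longlonglongrightarrow>
      indicator B \<omega> * ennreal (1 - C s \<omega>) * ennreal (X t \<omega>)"
      by (rule tendsto_eventually)
  qed
  ultimately have "(\<integral>\<^sup>+\<omega>. indicator B \<omega> * ennreal (1 - C s \<omega>) * ennreal (X t \<omega>) \<partial>M) \<le> ?I"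
    by (intro LIMSEQ_le_const2) auto
  moreover have "(\<integral>\<^sup>+\<omega>. indicator B \<omega> * ennreal (1 - C s \<omega>) * ennreal (X t \<omega>) \<partial>M) =
    (\<integral>\<^sup>+\<omega>. indicator B \<omega> * ennreal (1 - C s \<omega>) * ennreal (X s \<omega>) \<partial>M)"
  proof (rule nn_martD[OF X(2) s])
    note [measurable] = B increasing_processD(4)[OF C s(1)]
    show "(\<lambda>\<omega>. indicator B \<omega> * ennreal (1 - C s \<omega>)) \<in> borel_measurable (F s)" by measurable
  qed
  ultimately show "(\<integral>\<^sup>+\<omega>. indicator B \<omega> * (ennreal (X s \<omega>) * ennreal (1 - C s \<omega>)) \<partial>M) \<le> ?I"
    by (simp add: mult_ac)
qed

end

section \<open>Optional stopping\<close>

lemma enn2real_min: "0 \<le> t \<Longrightarrow> enn2real (min T (ennreal t)) = (if T \<le> ennreal t then enn2real T else t)"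
  by (auto simp: min_def)

lemma stopped_eq:
  assumes "0 \<le> t"
  shows "stopped T X t \<omega> = (if T \<omega> \<le> ennreal t then X (enn2real (T \<omega>)) \<omega> else X t \<omega>)"
  using assms by (simp add: stopped_def enn2real_min)

lemma le_ennreal_iff: "0 \<le> t \<Longrightarrow> T < \<infinity> \<Longrightarrow> T \<le> ennreal t \<longleftrightarrow> enn2real T \<le> t"
  by (cases T) (auto simp: ennreal_le_iff2 top_unique)

lemma cadlag_path_stopped:
  assumes f: "cadlag_path f"
  shows "cadlag_path (\<lambda>t. f (enn2real (min T (ennreal t))))"
proof (cases "T = \<infinity>")
  case True
  then have eq: "f (enn2real (min T (ennreal t))) = f t" if "0 \<le> t" for t
    using that by (simp add: enn2real_min top_unique)
  show ?thesis
    unfolding cadlag_path_def right_cont_path_def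
  proof (intro conjI allI impI)
    fix t :: real assume t: "0 \<le> t"
    have "\<forall>\<^sub>F u in at_right t. f u = f (enn2real (min T (ennreal u)))"
      using eventually_at_right_less[of t] by eventually_elim (use t eq in simp)
    moreover have "(f \<longlongrightarrow> f t) (at_right t)"
      using f t by (simp add: cadlag_path_def right_cont_path_def)
    ultimately show "((\<lambda>t. f (enn2real (min T (ennreal t)))) \<longlongrightarrow> f (enn2real (min T (ennreal t)))) (at_right t)"
      unfolding eq[OF t] by (rule Lim_transform_eventually[rotated])
  next
    fix t :: real assume t: "0 < t"
    obtain l where l: "(f \<longlongrightarrow> l) (at_left t)" using f t by (auto simp: cadlag_path_def)
    have "\<forall>\<^sub>F u in at_left t. 0 < u" using t by (auto simp: eventually_at_left_field)
    then have "\<forall>\<^sub>F u in at_left t. f u = f (enn2real (min T (ennreal u)))"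
      by eventually_elim (use eq in simp)
    then have "((\<lambda>t. f (enn2real (min T (ennreal t)))) \<longlongrightarrow> l) (at_left t)"
      using l by (rule Lim_transform_eventually[rotated])
    then show "\<exists>l. ((\<lambda>t. f (enn2real (min T (ennreal t)))) \<longlongrightarrow> l) (at_left t)" by (rule exI)
  qed
next
  case False
  define r where "r = enn2real T"
  have r: "0 \<le> r" by (simp add: r_def)
  have eq: "f (enn2real (min T (ennreal t))) = (if r \<le> t then f r else f t)" if "0 \<le> t" for t
    using that False by (simp add: enn2real_min le_ennreal_iff top.not_eq_extremum r_def)
  show ?thesis
    unfolding cadlag_path_def right_cont_path_def
  proof (intro conjI allI impI)
    fix t :: real assume t: "0 \<le> t"
    show "((\<lambda>t. f (enn2real (min T (ennreal t)))) \<longlongrightarrow> f (enn2real (min T (ennreal t)))) (at_right t)"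
    proof (cases "r \<le> t")
      case True
      have "\<forall>\<^sub>F u in at_right t. f (enn2real (min T (ennreal u))) = f r"
        using eventually_at_right_less[of t] by eventually_elim (use t eq True in simp)
      then have "((\<lambda>t. f (enn2real (min T (ennreal t)))) \<longlongrightarrow> f r) (at_right t)"
        by (rule tendsto_eventually)
      then show ?thesis using eq[OF t] True by simp
    next
      case False
      have "\<forall>\<^sub>F u in at_right t. t < u \<and> u < r"
        using False by (auto simp: eventually_at_right_field intro!: exI[of _ r])
      then have "\<forall>\<^sub>F u in at_right t. f u = f (enn2real (min T (ennreal u)))"
        by eventually_elim (use t eq in auto)
      moreover have "(f \<longlongrightarrow> f t) (at_right t)"
        using f t by (simp add: cadlag_path_def right_cont_path_def)
      ultimately have "((\<lambda>t. f (enn2real (min T (ennreal t)))) \<longlongrightarrow> f t) (at_right t)"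
        by (rule Lim_transform_eventually[rotated])
      then show ?thesis using eq[OF t] False by simp
    qed
  next
    fix t :: real assume t: "0 < t"
    show "\<exists>l. ((\<lambda>t. f (enn2real (min T (ennreal t)))) \<longlongrightarrow> l) (at_left t)"
    proof (cases "r < t")
      case True
      have "\<forall>\<^sub>F u in at_left t. r < u"
        using True by (auto simp: eventually_at_left_field)
      then have "\<forall>\<^sub>F u in at_left t. f (enn2real (min T (ennreal u))) = f r"
        by eventually_elim (use r eq in auto)
      then have "((\<lambda>t. f (enn2real (min T (ennreal t)))) \<longlongrightarrow> f r) (at_left t)"
        by (rule tendsto_eventually)
      then show ?thesis by (rule exI)
    next
      case False
      obtain l where l: "(f \<longlongrightarrow> l) (at_left t)" using f t by (auto simp: cadlag_path_def)
      have "\<forall>\<^sub>F u in at_left t. 0 < u \<and> u < t" using t by (auto simp: eventually_at_left_field intro!: exI[of _ 0])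
      then have "\<forall>\<^sub>F u in at_left t. f u = f (enn2real (min T (ennreal u)))"
        by eventually_elim (use eq False in auto)
      then have "((\<lambda>t. f (enn2real (min T (ennreal t)))) \<longlongrightarrow> l) (at_left t)"
        using l by (rule Lim_transform_eventually[rotated])
      then show ?thesis by (rule exI)
    qed
  qed
qed

context usual_filtration
begin

lemma stop_timeD: "stop_time M F T \<Longrightarrow> 0 \<le> t \<Longrightarrow> {\<omega> \<in> space M. T \<omega> \<le> ennreal t} \<in> sets (F t)"
  by (simp add: stop_time_def)

lemma stop_timeD_gt:
  assumes "stop_time M F T" "0 \<le> t"
  shows "{\<omega> \<in> space M. ennreal t < T \<omega>} \<in> sets (F t)"
proof -
  have "space (F t) - {\<omega> \<in> space M. T \<omega> \<le> ennreal t} \<in> sets (F t)"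
    by (rule sets.compl_sets[OF stop_timeD[OF assms]])
  moreover have "space (F t) - {\<omega> \<in> space M. T \<omega> \<le> ennreal t} = {\<omega> \<in> space M. ennreal t < T \<omega>}"
    using assms(2) by auto
  ultimately show ?thesis by simp
qed

lemma measurable_min_time:
  assumes T: "stop_time M F T" and t: "0 \<le> t"
  shows "(\<lambda>\<omega>. enn2real (min (T \<omega>) (ennreal t))) \<in> borel_measurable (F t)"
  unfolding borel_measurable_iff_le
proof
  fix a :: real
  consider "a < 0" | "0 \<le> a" "a < t" | "t \<le> a" by linarith
  then show "{\<omega> \<in> space (F t). enn2real (min (T \<omega>) (ennreal t)) \<le> a} \<in> sets (F t)"
  proof cases
    case 1
    have "\<not> enn2real (min (T \<omega>) (ennreal t)) \<le> a" for \<omega>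
      using 1 enn2real_nonneg[of "min (T \<omega>) (ennreal t)"] by linarith
    then show ?thesis by simp
  next
    case 2
    have "enn2real (min (T \<omega>) (ennreal t)) \<le> a \<longleftrightarrow> T \<omega> \<le> ennreal a" for \<omega>
    proof (cases "T \<omega> = \<infinity>")
      case False
      then have fin: "T \<omega> < \<infinity>" by (simp add: top.not_eq_extremum)
      show ?thesis
        unfolding enn2real_min[OF t] le_ennreal_iff[OF t fin] le_ennreal_iff[OF 2(1) fin] using 2 by auto
    qed (use 2 t in \<open>simp add: enn2real_min top_unique\<close>)
    then have "{\<omega> \<in> space (F t). enn2real (min (T \<omega>) (ennreal t)) \<le> a} = {\<omega> \<in> space M. T \<omega> \<le> ennreal a}"
      using t by simp
    then show ?thesis
      using stop_timeD[OF T 2(1)] mono_F[OF 2(1), of t] 2 by auto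
  next
    case 3
    have "enn2real (min (T \<omega>) (ennreal t)) \<le> a" for \<omega>
    proof -
      have "enn2real (min (T \<omega>) (ennreal t)) \<le> enn2real (ennreal t)"
        by (rule enn2real_mono) simp_all
      then show ?thesis using 3 t by simp
    qed
    then show ?thesis by simp
  qed
qed

lemma adapted_stopped:
  assumes X: "adapted F X" "\<And>\<omega>. right_cont_path (\<lambda>t. X t \<omega>)" and T: "stop_time M F T"
  shows "adapted F (stopped T X)"
  unfolding adapted_def
proof (intro allI impI)
  fix t :: real assume t: "0 \<le> t"
  have "(\<lambda>\<omega>. (enn2real (min (T \<omega>) (ennreal t)), \<omega>)) \<in> measurable (F t) (borel \<Otimes>\<^sub>M F t)"
    using measurable_min_time[OF T t] by (intro measurable_Pair) auto
  from measurable_compose[OF this progressive[OF X t]]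
  have "(\<lambda>\<omega>. case (enn2real (min (T \<omega>) (ennreal t)), \<omega>) of (u, \<omega>) \<Rightarrow> if 0 \<le> u \<and> u \<le> t then X u \<omega> else 0) \<in> borel_measurable (F t)" .
  moreover have "enn2real (min (T \<omega>) (ennreal t)) \<le> t" for \<omega>
  proof -
    have "enn2real (min (T \<omega>) (ennreal t)) \<le> enn2real (ennreal t)"
      by (rule enn2real_mono) simp_all
    then show ?thesis using t by simp
  qed
  ultimately show "stopped T X t \<in> borel_measurable (F t)"
    by (simp add: stopped_def[abs_def])
qed

lemma regular_stopped:
  assumes X: "regular X" and T: "stop_time M F T"
  shows "regular (stopped T X)"
  unfolding regular_def
proof (intro conjI allI impI)
  show "adapted F (stopped T X)"
    by (rule adapted_stopped[OF regularD(1)[OF X] regularD(3)[OF X] T])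
  show "cadlag_path (\<lambda>t. stopped T X t \<omega>)" for \<omega>
    unfolding stopped_def by (rule cadlag_path_stopped[OF regularD(2)[OF X]])
  show "0 \<le> stopped T X t \<omega>" for t \<omega>
    unfolding stopped_def by (rule regularD(4)[OF X]) simp
qed

text \<open>Integration by parts against this process is optional stopping at
  \<open>T\<close>.\<close>

definition time_indicator :: "('a \<Rightarrow> ennreal) \<Rightarrow> real \<Rightarrow> 'a \<Rightarrow> real" where
  "time_indicator T t \<omega> = (if T \<omega> \<le> ennreal t then 1 else 0)"

lemma increasing_path_step: "increasing_path (\<lambda>t. if T \<le> ennreal t then 1 else 0)"
  unfolding increasing_path_def right_cont_path_def
proof (intro conjI allI impI)
  fix t :: real assume t: "0 \<le> t"
  show "((\<lambda>t. if T \<le> ennreal t then 1 else 0 :: real) \<longlongrightarrow> (if T \<le> ennreal t then 1 else 0)) (at_right t)"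
  proof (rule tendsto_eventually, cases "T \<le> ennreal t")
    case True
    show "\<forall>\<^sub>F u in at_right t. (if T \<le> ennreal u then 1 else 0 :: real) = (if T \<le> ennreal t then 1 else 0)"
      using eventually_at_right_less[of t]
    proof eventually_elim
      case (elim u)
      then have "T \<le> ennreal u" using True by (meson ennreal_leI less_imp_le order_trans)
      then show ?case using True by simp
    qed
  next
    case False
    then have "ennreal t < T" by simp
    then obtain r where r: "ennreal t < ennreal r" "ennreal r < T" "0 \<le> r"
      by (metis dense ennreal_cases less_top not_less_iff_gr_or_eq top_greatest)
    then have "t < r" using t by (simp add: ennreal_less_iff)
    then have "\<forall>\<^sub>F u in at_right t. u < r" by (auto simp: eventually_at_right_field)
    then show "\<forall>\<^sub>F u in at_right t. (if T \<le> ennreal u then 1 else 0 :: real) = (if T \<le> ennreal t then 1 else 0)"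
    proof eventually_elim
      case (elim u)
      have "ennreal u \<le> ennreal r" using elim by (intro ennreal_leI) simp
      then have "\<not> T \<le> ennreal u" using r(2) by simp
      then show ?case using False by simp
    qed
  qed
next
  show "mono_on {0..} (\<lambda>t. if T \<le> ennreal t then 1 else 0 :: real)"
  proof (rule mono_onI)
    fix s t :: real assume "s \<le> t"
    then have "ennreal s \<le> ennreal t" by (rule ennreal_leI)
    then show "(if T \<le> ennreal s then 1 else 0 :: real) \<le> (if T \<le> ennreal t then 1 else 0)"
      by auto
  qed
qed simp

lemma smeas_time:
  assumes "T < \<infinity>"
  shows "AE u in smeas (\<lambda>t. if T \<le> ennreal t then 1 else 0). u = enn2real T"
    and "emeasure (smeas (\<lambda>t. if T \<le> ennreal t then 1 else 0)) {enn2real T} = 1"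
proof -
  have eq: "smeas (\<lambda>t. if T \<le> ennreal t then 1 else 0) = smeas (\<lambda>t. if enn2real T \<le> t then 1 else 0)"
    by (rule smeas_cong) (simp add: le_ennreal_iff[OF _ assms])
  show "AE u in smeas (\<lambda>t. if T \<le> ennreal t then 1 else 0). u = enn2real T"
    unfolding eq by (rule emeasure_smeas_step(1)) simp
  show "emeasure (smeas (\<lambda>t. if T \<le> ennreal t then 1 else 0)) {enn2real T} = 1"
    unfolding eq by (rule emeasure_smeas_step(2)) simp
qed

lemma increasing_process_time_indicator:
  assumes "stop_time M F T"
  shows "increasing_process (time_indicator T)"
  unfolding increasing_process_def adapted_def
proof (intro conjI allI impI)
  fix t :: real assume t: "0 \<le> t"
  have "indicator {\<omega> \<in> space M. T \<omega> \<le> ennreal t} \<in> borel_measurable (F t)"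
    using stop_timeD[OF assms t] by simp
  then show "time_indicator T t \<in> borel_measurable (F t)"
    by (rule measurable_cong[THEN iffD1, rotated]) (use t in \<open>simp add: time_indicator_def\<close>)
next
  show "increasing_path (\<lambda>t. time_indicator T t \<omega>)" for \<omega>
    unfolding time_indicator_def by (rule increasing_path_step)
  show "time_indicator T t \<omega> \<le> 1" for t \<omega> by (simp add: time_indicator_def)
qed

text \<open>The integrator has a unit atom at \<open>T\<close>. If it lies in \<open>(s, t]\<close>,
  the integral picks the value of \<open>X\<close> at \<open>T\<close> and the second term vanishes;
  if \<open>T\<close> is later than \<open>t\<close>, only the second term is left.\<close>

lemma sint_time_indicator:
  assumes s: "0 \<le> s" "s \<le> t" and T: "ennreal s < T \<omega>"
  shows "sint X (time_indicator T) s t \<omega> + ennreal (X t \<omega>) * ennreal (1 - time_indicator T t \<omega>) =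
    ennreal (stopped T X t \<omega>)"
proof (cases "T \<omega> \<le> ennreal t")
  case True
  let ?\<mu> = "smeas (\<lambda>t. time_indicator T t \<omega>)" and ?r = "enn2real (T \<omega>)"
  have fin: "T \<omega> < \<infinity>" using True by (rule le_less_trans) simp
  have r: "s < ?r" "?r \<le> t"
    using True T s le_ennreal_iff[OF _ fin] by (auto simp: not_le[symmetric])
  have "sint X (time_indicator T) s t \<omega> = (\<integral>\<^sup>+u. ennreal (X ?r \<omega>) * indicator {?r} u \<partial>?\<mu>)"
    unfolding sint_def
  proof (rule nn_integral_cong_AE)
    have "AE u in ?\<mu>. u = ?r"
      unfolding time_indicator_def by (rule smeas_time(1)[OF fin])
    then show "AE u in ?\<mu>. ennreal (X u \<omega>) * indicator {s<..t} u = ennreal (X ?r \<omega>) * indicator {?r} u"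
      by eventually_elim (use r in simp)
  qed
  also have "\<dots> = ennreal (X ?r \<omega>) * emeasure ?\<mu> {?r}"
    by (rule nn_integral_cmult_indicator) simp
  also have "emeasure ?\<mu> {?r} = 1"
    unfolding time_indicator_def by (rule smeas_time(2)[OF fin])
  finally have "sint X (time_indicator T) s t \<omega> = ennreal (X ?r \<omega>)" by simp
  moreover have "time_indicator T t \<omega> = 1" using True by (simp add: time_indicator_def)
  moreover have "stopped T X t \<omega> = X ?r \<omega>" using True s by (simp add: stopped_eq)
  ultimately show ?thesis by simp
next
  case False
  let ?\<mu> = "smeas (\<lambda>t. time_indicator T t \<omega>)"
  have "emeasure ?\<mu> {s<..t} = ennreal (time_indicator T t \<omega> - time_indicator T s \<omega>)"
    using s increasing_path_step[of "T \<omega>"] by (intro emeasure_smeas_Ioc) (simp_all add: time_indicator_def)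
  also have "\<dots> = 0"
    using False T by (simp add: time_indicator_def)
  finally have "{s<..t} \<in> null_sets ?\<mu>" by (intro null_setsI) simp_all
  then have "AE u in ?\<mu>. u \<notin> {s<..t}" by (rule AE_not_in)
  then have "AE u in ?\<mu>. ennreal (X u \<omega>) * indicator {s<..t} u = 0"
    by eventually_elim simp
  then have "sint X (time_indicator T) s t \<omega> = 0"
    unfolding sint_def by (subst nn_integral_cong_AE[where v = "\<lambda>_. 0"]) simp_all
  moreover have "time_indicator T t \<omega> = 0" using False by (simp add: time_indicator_def)
  moreover have "stopped T X t \<omega> = X t \<omega>" using False s by (simp add: stopped_eq)
  ultimately show ?thesis by simp
qed

text \<open>Both sides are additive and monotonically continuous in the weight, so the inequality
  extends from indicators without any subtraction.\<close>

lemma weighted_le: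
  assumes sub: "subalgebra M N" and g: "g \<in> borel_measurable M" and h: "h \<in> borel_measurable M"
    and B: "\<And>B. B \<in> sets N \<Longrightarrow> (\<integral>\<^sup>+\<omega>. indicator B \<omega> * g \<omega> \<partial>M) \<le> (\<integral>\<^sup>+\<omega>. indicator B \<omega> * h \<omega> \<partial>M)"
    and f: "f \<in> borel_measurable N"
  shows "(\<integral>\<^sup>+\<omega>. f \<omega> * g \<omega> \<partial>M) \<le> (\<integral>\<^sup>+\<omega>. f \<omega> * (h \<omega> :: ennreal) \<partial>M)"
  using f
proof (induction rule: borel_measurable_induct)
  case (cong f f')
  have "(\<integral>\<^sup>+\<omega>. f \<omega> * g \<omega> \<partial>M) = (\<integral>\<^sup>+\<omega>. f' \<omega> * g \<omega> \<partial>M)" "(\<integral>\<^sup>+\<omega>. f \<omega> * h \<omega> \<partial>M) = (\<integral>\<^sup>+\<omega>. f' \<omega> * h \<omega> \<partial>M)"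
    by (intro nn_integral_cong; use cong sub in \<open>simp add: subalgebra_def\<close>)+
  then show ?case using cong by simp
next
  case (set A)
  then show ?case by (rule B)
next
  case (mult u c)
  have u[measurable]: "u \<in> borel_measurable M" by (rule measurable_from_subalg[OF sub mult(2)])
  note [measurable] = g h
  have "(\<integral>\<^sup>+\<omega>. c * (u \<omega> * g \<omega>) \<partial>M) = c * (\<integral>\<^sup>+\<omega>. u \<omega> * g \<omega> \<partial>M)" "(\<integral>\<^sup>+\<omega>. c * (u \<omega> * h \<omega>) \<partial>M) = c * (\<integral>\<^sup>+\<omega>. u \<omega> * h \<omega> \<partial>M)"
    by (rule nn_integral_cmult, measurable)+
  then show ?case
    using mult_left_mono[OF mult.IH, of c] by (simp add: mult.assoc)
next
  case (add u v)
  have uv[measurable]: "u \<in> borel_measurable M" "v \<in> borel_measurable M"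
    by (rule measurable_from_subalg[OF sub]; fact)+
  note [measurable] = g h
  have "(\<integral>\<^sup>+\<omega>. v \<omega> * g \<omega> + u \<omega> * g \<omega> \<partial>M) = (\<integral>\<^sup>+\<omega>. v \<omega> * g \<omega> \<partial>M) + (\<integral>\<^sup>+\<omega>. u \<omega> * g \<omega> \<partial>M)"
    "(\<integral>\<^sup>+\<omega>. v \<omega> * h \<omega> + u \<omega> * h \<omega> \<partial>M) = (\<integral>\<^sup>+\<omega>. v \<omega> * h \<omega> \<partial>M) + (\<integral>\<^sup>+\<omega>. u \<omega> * h \<omega> \<partial>M)"
    by (rule nn_integral_add; measurable)+
  then show ?case
    using add_mono[OF add.IH(2,1)] by (simp add: distrib_right)
next
  case (seq U)
  have U[measurable]: "U i \<in> borel_measurable M" for i by (rule measurable_from_subalg[OF sub seq(1)])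
  have sup: "(\<integral>\<^sup>+\<omega>. (SUP i. U i \<omega>) * k \<omega> \<partial>M) = (SUP i. \<integral>\<^sup>+\<omega>. U i \<omega> * k \<omega> \<partial>M)"
    if k[measurable]: "k \<in> borel_measurable M" for k
  proof -
    have "(\<integral>\<^sup>+\<omega>. (SUP i. U i \<omega>) * k \<omega> \<partial>M) = (\<integral>\<^sup>+\<omega>. (SUP i. U i \<omega> * k \<omega>) \<partial>M)"
      by (intro nn_integral_cong SUP_mult_right_ennreal)
    also have "\<dots> = (SUP i. \<integral>\<^sup>+\<omega>. U i \<omega> * k \<omega> \<partial>M)"
    proof (rule nn_integral_monotone_convergence_SUP)
      show "incseq (\<lambda>i \<omega>. U i \<omega> * k \<omega>)"
        using \<open>incseq U\<close> by (auto simp: incseq_def le_fun_def intro: mult_right_mono)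
    qed measurable
    finally show ?thesis .
  qed
  have "(SUP i. \<integral>\<^sup>+\<omega>. U i \<omega> * g \<omega> \<partial>M) \<le> (SUP i. \<integral>\<^sup>+\<omega>. U i \<omega> * h \<omega> \<partial>M)"
    by (rule SUP_mono') (rule seq.IH)
  then show ?case
    unfolding sup[OF g, symmetric] sup[OF h, symmetric] by (simp add: image_comp o_def)
qed

lemma nn_superI:
  assumes X: "regular X"
    and "\<And>s t B. 0 \<le> s \<Longrightarrow> s \<le> t \<Longrightarrow> B \<in> sets (F s) \<Longrightarrow>
      (\<integral>\<^sup>+\<omega>. indicator B \<omega> * ennreal (X t \<omega>) \<partial>M) \<le> (\<integral>\<^sup>+\<omega>. indicator B \<omega> * ennreal (X s \<omega>) \<partial>M)"
  shows "nn_super X"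
  unfolding nn_super_def
proof (intro allI impI)
  fix s t :: real and f :: "'a \<Rightarrow> ennreal"
  assume s: "0 \<le> s" "s \<le> t" and f: "f \<in> borel_measurable (F s)"
  then have t: "0 \<le> t" by simp
  have m: "(\<lambda>\<omega>. ennreal (X t \<omega>)) \<in> borel_measurable M" "(\<lambda>\<omega>. ennreal (X s \<omega>)) \<in> borel_measurable M"
    using regularD(6)[OF X s(1)] regularD(6)[OF X t] by measurable
  show "(\<integral>\<^sup>+\<omega>. f \<omega> * ennreal (X t \<omega>) \<partial>M) \<le> (\<integral>\<^sup>+\<omega>. f \<omega> * ennreal (X s \<omega>) \<partial>M)"
    by (rule weighted_le[OF subalgebra_F[OF s(1)] m _ f]) (rule assms(2)[OF s])
qed

lemma nn_martI:
  assumes X: "regular X"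
    and eq: "\<And>s t B. 0 \<le> s \<Longrightarrow> s \<le> t \<Longrightarrow> B \<in> sets (F s) \<Longrightarrow>
      (\<integral>\<^sup>+\<omega>. indicator B \<omega> * ennreal (X t \<omega>) \<partial>M) = (\<integral>\<^sup>+\<omega>. indicator B \<omega> * ennreal (X s \<omega>) \<partial>M)"
  shows "nn_mart X"
  unfolding nn_mart_def
proof (intro allI impI antisym)
  fix s t :: real and f :: "'a \<Rightarrow> ennreal"
  assume s: "0 \<le> s" "s \<le> t" and f: "f \<in> borel_measurable (F s)"
  then have t: "0 \<le> t" by simp
  have m: "(\<lambda>\<omega>. ennreal (X t \<omega>)) \<in> borel_measurable M" "(\<lambda>\<omega>. ennreal (X s \<omega>)) \<in> borel_measurable M"
    using regularD(6)[OF X s(1)] regularD(6)[OF X t] by measurable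
  show "(\<integral>\<^sup>+\<omega>. f \<omega> * ennreal (X t \<omega>) \<partial>M) \<le> (\<integral>\<^sup>+\<omega>. f \<omega> * ennreal (X s \<omega>) \<partial>M)"
    by (rule weighted_le[OF subalgebra_F[OF s(1)] m _ f]) (rule eq_refl, rule eq[OF s])
  show "(\<integral>\<^sup>+\<omega>. f \<omega> * ennreal (X s \<omega>) \<partial>M) \<le> (\<integral>\<^sup>+\<omega>. f \<omega> * ennreal (X t \<omega>) \<partial>M)"
    by (rule weighted_le[OF subalgebra_F[OF s(1)] m(2,1) _ f]) (rule eq_refl, rule eq[OF s, symmetric])
qed

text \<open>Where \<open>T \<le> s\<close> the stopped process no longer moves between
  \<open>s\<close> and \<open>t\<close>. On the rest \<open>B'\<close>, its value at
  \<open>t\<close> is an integral against \<open>time_indicator T\<close>, and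
  \<open>time_indicator T s\<close> is zero there.\<close>

lemma stopped_split:
  assumes X: "regular X" and T: "stop_time M F T" and s: "0 \<le> s" "s \<le> t" and B: "B \<in> sets (F s)"
  defines "B' \<equiv> B \<inter> {\<omega> \<in> space M. ennreal s < T \<omega>}"
  shows "B' \<in> sets (F s)"
    and "(\<integral>\<^sup>+\<omega>. indicator B \<omega> * ennreal (stopped T X t \<omega>) \<partial>M) =
      (\<integral>\<^sup>+\<omega>. indicator (B - B') \<omega> * ennreal (stopped T X s \<omega>) \<partial>M) +
      (\<integral>\<^sup>+\<omega>. indicator B' \<omega> * (sint X (time_indicator T) s t \<omega> + ennreal (X t \<omega>) * ennreal (1 - time_indicator T t \<omega>)) \<partial>M)"
    and "(\<integral>\<^sup>+\<omega>. indicator B \<omega> * ennreal (stopped T X s \<omega>) \<partial>M) =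
      (\<integral>\<^sup>+\<omega>. indicator (B - B') \<omega> * ennreal (stopped T X s \<omega>) \<partial>M) +
      (\<integral>\<^sup>+\<omega>. indicator B' \<omega> * (ennreal (X s \<omega>) * ennreal (1 - time_indicator T s \<omega>)) \<partial>M)"
proof -
  have t: "0 \<le> t" using s by simp
  show B': "B' \<in> sets (F s)"
    unfolding B'_def by (rule sets.Int[OF B stop_timeD_gt[OF T s(1)]])
  note R = regular_stopped[OF X T]
  have [measurable]: "B \<in> sets M" "B' \<in> sets M" using sets_F_M[OF s(1)] B B' by auto
  note [measurable] = regularD(6)[OF R s(1)] regularD(6)[OF R t]
  have BM: "B \<subseteq> space M" using sets.sets_into_space[OF B] s by simp
  have split: "(\<integral>\<^sup>+\<omega>. indicator B \<omega> * ennreal (stopped T X v \<omega>) \<partial>M) =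
      (\<integral>\<^sup>+\<omega>. indicator (B - B') \<omega> * ennreal (stopped T X v \<omega>) \<partial>M) + (\<integral>\<^sup>+\<omega>. indicator B' \<omega> * ennreal (stopped T X v \<omega>) \<partial>M)"
    if [measurable]: "stopped T X v \<in> borel_measurable M" for v
  proof -
    have "B' \<subseteq> B" by (auto simp: B'_def)
    then have "indicator B \<omega> = indicator (B - B') \<omega> + (indicator B' \<omega> :: ennreal)" for \<omega>
      by (auto simp: indicator_def)
    then have "(\<integral>\<^sup>+\<omega>. indicator B \<omega> * ennreal (stopped T X v \<omega>) \<partial>M) =
      (\<integral>\<^sup>+\<omega>. indicator (B - B') \<omega> * ennreal (stopped T X v \<omega>) + indicator B' \<omega> * ennreal (stopped T X v \<omega>) \<partial>M)"
      by (simp only: distrib_right)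
    also have "\<dots> = (\<integral>\<^sup>+\<omega>. indicator (B - B') \<omega> * ennreal (stopped T X v \<omega>) \<partial>M) + (\<integral>\<^sup>+\<omega>. indicator B' \<omega> * ennreal (stopped T X v \<omega>) \<partial>M)"
      by (rule nn_integral_add) measurable
    finally show ?thesis .
  qed
  have "(\<integral>\<^sup>+\<omega>. indicator (B - B') \<omega> * ennreal (stopped T X t \<omega>) \<partial>M) = (\<integral>\<^sup>+\<omega>. indicator (B - B') \<omega> * ennreal (stopped T X s \<omega>) \<partial>M)"
  proof (rule nn_integral_cong)
    fix \<omega> assume w: "\<omega> \<in> space M"
    show "indicator (B - B') \<omega> * ennreal (stopped T X t \<omega>) = indicator (B - B') \<omega> * ennreal (stopped T X s \<omega>)"
    proof (cases "\<omega> \<in> B - B'")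
      case True
      then have "T \<omega> \<le> ennreal s" using w by (auto simp: B'_def)
      moreover from this have "T \<omega> \<le> ennreal t" using s by (meson ennreal_leI order_trans)
      ultimately show ?thesis using s t by (simp add: stopped_eq)
    qed simp
  qed
  moreover have "indicator B' \<omega> * ennreal (stopped T X t \<omega>) =
      indicator B' \<omega> * (sint X (time_indicator T) s t \<omega> + ennreal (X t \<omega>) * ennreal (1 - time_indicator T t \<omega>))" for \<omega>
    using sint_time_indicator[OF s, of T \<omega> X] by (cases "\<omega> \<in> B'") (simp_all add: B'_def)
  ultimately show "(\<integral>\<^sup>+\<omega>. indicator B \<omega> * ennreal (stopped T X t \<omega>) \<partial>M) =
      (\<integral>\<^sup>+\<omega>. indicator (B - B') \<omega> * ennreal (stopped T X s \<omega>) \<partial>M) +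
      (\<integral>\<^sup>+\<omega>. indicator B' \<omega> * (sint X (time_indicator T) s t \<omega> + ennreal (X t \<omega>) * ennreal (1 - time_indicator T t \<omega>)) \<partial>M)"
    using split[OF regularD(6)[OF R t]] by simp
  have "indicator B' \<omega> * ennreal (stopped T X s \<omega>) =
      indicator B' \<omega> * (ennreal (X s \<omega>) * ennreal (1 - time_indicator T s \<omega>))" for \<omega>
    using s(1) by (cases "\<omega> \<in> B'") (auto simp: B'_def stopped_eq time_indicator_def)
  then show "(\<integral>\<^sup>+\<omega>. indicator B \<omega> * ennreal (stopped T X s \<omega>) \<partial>M) =
      (\<integral>\<^sup>+\<omega>. indicator (B - B') \<omega> * ennreal (stopped T X s \<omega>) \<partial>M) +
      (\<integral>\<^sup>+\<omega>. indicator B' \<omega> * (ennreal (X s \<omega>) * ennreal (1 - time_indicator T s \<omega>)) \<partial>M)"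
    using split[OF regularD(6)[OF R s(1)]] by simp
qed

text \<open>After the split, the moving part is an instance of \<open>parts_mart\<close>, so that
  \<open>T\<close> is never discretised.\<close>

lemma nn_mart_stopped:
  assumes X: "regular X" "nn_mart X" and T: "stop_time M F T"
  shows "nn_mart (stopped T X)"
proof (rule nn_martI[OF regular_stopped[OF X(1) T]])
  fix s t :: real and B assume s: "0 \<le> s" "s \<le> t" and B: "B \<in> sets (F s)"
  note split = stopped_split[OF X(1) T s B]
  show "(\<integral>\<^sup>+\<omega>. indicator B \<omega> * ennreal (stopped T X t \<omega>) \<partial>M) = (\<integral>\<^sup>+\<omega>. indicator B \<omega> * ennreal (stopped T X s \<omega>) \<partial>M)"
    unfolding split(2,3) parts_mart[OF X increasing_process_time_indicator[OF T] s split(1)] by (rule refl)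
qed

end

section \<open>Sampling at stopping times\<close>

context usual_filtration
begin

lemma sets_stop_sigma:
  assumes T: "stop_time M F T"
  shows "sets (stop_sigma M F T) = {A \<in> sets M. \<forall>t\<ge>0. {\<omega> \<in> A. T \<omega> \<le> ennreal t} \<in> sets (F t)}" (is "_ = ?S")
proof -
  have "sigma_algebra (space M) ?S"
    unfolding sigma_algebra_iff2
  proof (intro conjI ballI allI impI)
    show "?S \<subseteq> Pow (space M)" using sets.sets_into_space by blast
    show "{} \<in> ?S" by simp
  next
    fix A assume A: "A \<in> ?S"
    have "{\<omega> \<in> space M - A. T \<omega> \<le> ennreal t} \<in> sets (F t)" if "0 \<le> t" for t
    proof -
      have "{\<omega> \<in> space M - A. T \<omega> \<le> ennreal t} = {\<omega> \<in> space M. T \<omega> \<le> ennreal t} - {\<omega> \<in> A. T \<omega> \<le> ennreal t}"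
        by auto
      moreover have "{\<omega> \<in> A. T \<omega> \<le> ennreal t} \<in> sets (F t)" using A that by simp
      ultimately show ?thesis using stop_timeD[OF T that] by (simp only: sets.Diff)
    qed
    then show "space M - A \<in> ?S" using A by auto
  next
    fix A :: "nat \<Rightarrow> 'a set" assume A: "range A \<subseteq> ?S"
    have "{\<omega> \<in> (\<Union>i. A i). T \<omega> \<le> ennreal t} \<in> sets (F t)" if "0 \<le> t" for t
    proof -
      have "{\<omega> \<in> (\<Union>i. A i). T \<omega> \<le> ennreal t} = (\<Union>i. {\<omega> \<in> A i. T \<omega> \<le> ennreal t})" by auto
      moreover have "{\<omega> \<in> A i. T \<omega> \<le> ennreal t} \<in> sets (F t)" for i using A that by auto
      ultimately show ?thesis by auto
    qed
    then show "(\<Union>i. A i) \<in> ?S" using A by auto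
  qed
  then show ?thesis
    unfolding stop_sigma_def by (rule sigma_algebra.sets_measure_of_eq)
qed

lemma space_stop_sigma [simp]: "space (stop_sigma M F T) = space M"
  unfolding stop_sigma_def by (rule space_measure_of) (use sets.sets_into_space in blast)

lemma subalgebra_stop_sigma: "stop_time M F T \<Longrightarrow> subalgebra M (stop_sigma M F T)"
  by (auto simp: subalgebra_def sets_stop_sigma)

lemma sampled_measurable:
  assumes X: "adapted F X" "\<And>\<omega>. right_cont_path (\<lambda>t. X t \<omega>)" and T: "stop_time M F T"
  shows "(\<lambda>\<omega>. if T \<omega> < \<infinity> then X (enn2real (T \<omega>)) \<omega> else 0) \<in> borel_measurable (stop_sigma M F T)" (is "?f \<in> _")
proof (rule measurableI)
  fix B :: "real set" assume B: "B \<in> sets borel"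
  have m: "{\<omega> \<in> ?f -` B \<inter> space M. T \<omega> \<le> ennreal t} \<in> sets (F t)" if t: "0 \<le> t" for t
  proof -
    have "stopped T X t \<in> borel_measurable (F t)"
      using adapted_stopped[OF X T] t by (simp add: adapted_def)
    then have "stopped T X t -` B \<inter> space (F t) \<in> sets (F t)"
      using B by (rule measurable_sets)
    then have "(stopped T X t -` B \<inter> space (F t)) \<inter> {\<omega> \<in> space M. T \<omega> \<le> ennreal t} \<in> sets (F t)"
      by (rule sets.Int[OF _ stop_timeD[OF T t]])
    moreover have "(stopped T X t -` B \<inter> space (F t)) \<inter> {\<omega> \<in> space M. T \<omega> \<le> ennreal t} = {\<omega> \<in> ?f -` B \<inter> space M. T \<omega> \<le> ennreal t}"
    proof -
      have "stopped T X t \<omega> = ?f \<omega>" if "T \<omega> \<le> ennreal t" for \<omega>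
        using that t le_less_trans[OF that, of \<infinity>] by (simp add: stopped_eq)
      then show ?thesis using t by auto
    qed
    ultimately show ?thesis by simp
  qed
  have fin: "T \<omega> < \<infinity> \<longleftrightarrow> (\<exists>n. T \<omega> \<le> ennreal (real n))" for \<omega>
  proof
    assume "T \<omega> < \<infinity>"
    then obtain n where "T \<omega> < of_nat n" using ennreal_Ex_less_of_nat[of "T \<omega>"] by auto
    then show "\<exists>n. T \<omega> \<le> ennreal (real n)" by (auto simp: ennreal_of_nat_eq_real_of_nat intro: less_imp_le)
  next
    assume "\<exists>n. T \<omega> \<le> ennreal (real n)"
    then show "T \<omega> < \<infinity>" by (auto intro: le_less_trans)
  qed
  have inM: "{\<omega> \<in> ?f -` B \<inter> space M. T \<omega> \<le> ennreal (real n)} \<in> sets M" "{\<omega> \<in> space M. T \<omega> \<le> ennreal (real n)} \<in> sets M" for n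
    by (rule sets_F_M[OF of_nat_0_le_iff[of n]], rule m stop_timeD[OF T], simp)+
  have "?f -` B \<inter> space M = (\<Union>n. {\<omega> \<in> ?f -` B \<inter> space M. T \<omega> \<le> ennreal (real n)}) \<union>
    (if 0 \<in> B then space M - (\<Union>n. {\<omega> \<in> space M. T \<omega> \<le> ennreal (real n)}) else {})" (is "?l = ?r")
  proof (rule set_eqI)
    fix \<omega>
    show "\<omega> \<in> ?l \<longleftrightarrow> \<omega> \<in> ?r"
      using fin[of \<omega>] by (cases "T \<omega> < \<infinity>") auto
  qed
  moreover have "?r \<in> sets M"
  proof (rule sets.Un)
    show "(\<Union>n. {\<omega> \<in> ?f -` B \<inter> space M. T \<omega> \<le> ennreal (real n)}) \<in> sets M"
      by (intro sets.countable_nat_UN image_subsetI inM)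
    have "(\<Union>n. {\<omega> \<in> space M. T \<omega> \<le> ennreal (real n)}) \<in> sets M"
      by (intro sets.countable_nat_UN image_subsetI inM)
    then show "(if 0 \<in> B then space M - (\<Union>n. {\<omega> \<in> space M. T \<omega> \<le> ennreal (real n)}) else {}) \<in> sets M"
      by (cases "0 \<in> B") (simp_all only: if_True if_False sets.compl_sets sets.empty_sets)
  qed
  ultimately have "?f -` B \<inter> space M \<in> sets M" by (simp only:)
  then show "?f -` B \<inter> space (stop_sigma M F T) \<in> sets (stop_sigma M F T)"
    unfolding sets_stop_sigma[OF T] space_stop_sigma mem_Collect_eq using m by (intro conjI allI impI)
qed simp

lemma stop_time_measurable:
  assumes T: "stop_time M F T"
  shows "T \<in> borel_measurable M"
proof (rule borel_measurableI_le)
  fix y :: ennreal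
  have "{\<omega> \<in> space M. T \<omega> \<le> y} \<in> sets M"
  proof (cases y)
    case (real r)
    then show ?thesis using sets_F_M[OF _ stop_timeD[OF T]] by simp
  qed simp
  then show "{\<omega> \<in> space M. T \<omega> \<le> y} \<in> sets M" .
qed

lemma stop_time_const: "0 \<le> s \<Longrightarrow> stop_time M F (\<lambda>_. ennreal s)"
  unfolding stop_time_def
proof (intro allI impI)
  fix t :: real assume t: "0 \<le> t"
  then have "{\<omega> \<in> space M. ennreal s \<le> ennreal t} = (if ennreal s \<le> ennreal t then space (F t) else {})"
    by auto
  then show "{\<omega> \<in> space M. ennreal s \<le> ennreal t} \<in> sets (F t)"
    by (simp del: space_F)
qed

lemma stop_time_restrict:
  assumes s: "0 \<le> s" and B: "B \<in> sets (F s)"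
  shows "stop_time M F (\<lambda>\<omega>. if \<omega> \<in> B then ennreal s else \<infinity>)"
  unfolding stop_time_def
proof (intro allI impI)
  fix t :: real assume t: "0 \<le> t"
  have BM: "B \<subseteq> space M" using sets.sets_into_space[OF B] s by simp
  show "{\<omega> \<in> space M. (if \<omega> \<in> B then ennreal s else \<infinity>) \<le> ennreal t} \<in> sets (F t)"
  proof (cases "s \<le> t")
    case True
    then have "{\<omega> \<in> space M. (if \<omega> \<in> B then ennreal s else \<infinity>) \<le> ennreal t} = B"
      using BM by (auto simp: top_unique ennreal_leI split: if_splits)
    then show ?thesis using mono_F[OF s True] B by auto
  next
    case False
    then have "\<not> ennreal s \<le> ennreal t" using s t by (simp add: ennreal_le_iff)
    then have "{\<omega> \<in> space M. (if \<omega> \<in> B then ennreal s else \<infinity>) \<le> ennreal t} = {}"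
      by (auto simp: top_unique split: if_splits)
    then show ?thesis by (simp only: sets.empty_sets)
  qed
qed

lemma stop_time_min:
  assumes S: "stop_time M F S" and T: "stop_time M F T"
  shows "stop_time M F (\<lambda>\<omega>. min (S \<omega>) (T \<omega>))"
  unfolding stop_time_def
proof (intro allI impI)
  fix t :: real assume t: "0 \<le> t"
  have "{\<omega> \<in> space M. min (S \<omega>) (T \<omega>) \<le> ennreal t} = {\<omega> \<in> space M. S \<omega> \<le> ennreal t} \<union> {\<omega> \<in> space M. T \<omega> \<le> ennreal t}"
    by (auto simp: min_le_iff_disj)
  then show "{\<omega> \<in> space M. min (S \<omega>) (T \<omega>) \<le> ennreal t} \<in> sets (F t)"
    using sets.Un[OF stop_timeD[OF S t] stop_timeD[OF T t]] by simp
qed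

lemma stop_time_add:
  assumes T: "stop_time M F T" and d: "0 \<le> d"
  shows "stop_time M F (\<lambda>\<omega>. T \<omega> + ennreal d)"
  unfolding stop_time_def
proof (intro allI impI)
  fix t :: real assume t: "0 \<le> t"
  show "{\<omega> \<in> space M. T \<omega> + ennreal d \<le> ennreal t} \<in> sets (F t)"
  proof (cases "d \<le> t")
    case True
    have "T \<omega> + ennreal d \<le> ennreal t \<longleftrightarrow> T \<omega> \<le> ennreal (t - d)" for \<omega>
      using d True by (cases "T \<omega>") (auto simp: ennreal_plus[symmetric] ennreal_le_iff2 top_unique simp del: ennreal_plus)
    then show ?thesis
      using stop_timeD[OF T, of "t - d"] mono_F[of "t - d" t] True d by auto
  next
    case False
    have "\<not> T \<omega> + ennreal d \<le> ennreal t" for \<omega>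
    proof
      assume "T \<omega> + ennreal d \<le> ennreal t"
      then have "ennreal d \<le> ennreal t" by (metis add.commute le_iff_add order_trans)
      then show False using False t d by (simp add: ennreal_le_iff)
    qed
    then show ?thesis by simp
  qed
qed

lemma Opt_cadlag_measurable:
  assumes "adapted F X" "\<forall>\<omega>\<in>space M. cadlag_path (\<lambda>t. X t \<omega>)"
  shows "(\<lambda>(t, \<omega>). X t \<omega>) \<in> borel_measurable Opt"
proof (rule measurableI)
  fix B :: "real set" assume "B \<in> sets borel"
  from Opt_basic[OF assms this] show "(\<lambda>(t, \<omega>). X t \<omega>) -` B \<inter> space Opt \<in> sets Opt"
    by (auto simp: Int_def vimage_def case_prod_unfold conj_commute elim: back_subst[where P = "\<lambda>S. S \<in> sets Opt"])
qed simp

lemma cadlag_path_step: "cadlag_path (\<lambda>t. if T \<le> ennreal t then 1 else 0)" (is "cadlag_path ?f")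
  unfolding cadlag_path_def
proof (intro conjI allI impI)
  show "right_cont_path ?f"
    using increasing_path_step[of T] by (simp add: increasing_path_def)
  show "\<exists>l. (?f \<longlongrightarrow> l) (at_left t)" if "0 < t" for t :: real
    using increasing_path_left_lim[OF increasing_path_step that] by (rule exI)
qed

lemma Opt_ge:
  assumes T: "stop_time M F T"
  shows "{(t, \<omega>) \<in> {0..} \<times> space M. T \<omega> \<le> ennreal t} \<in> sets Opt"
proof -
  have "{(t, \<omega>) \<in> {0..} \<times> space M. time_indicator T t \<omega> \<in> {1}} \<in> sets Opt"
    by (rule Opt_basic[OF increasing_processD(1)[OF increasing_process_time_indicator[OF T]]])
      (simp_all add: time_indicator_def cadlag_path_step)
  moreover have "{(t, \<omega>) \<in> {0..} \<times> space M. time_indicator T t \<omega> \<in> {1}} = {(t, \<omega>) \<in> {0..} \<times> space M. T \<omega> \<le> ennreal t}"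
    by (auto simp: time_indicator_def)
  ultimately show ?thesis by (simp only:)
qed

lemma less_ennreal_iff_add:
  assumes "0 \<le> t"
  shows "x < ennreal t \<longleftrightarrow> (\<exists>n. x + ennreal (1 / real (Suc n)) \<le> ennreal t)"
proof
  assume x: "x < ennreal t"
  then obtain r where r: "x = ennreal r" "0 \<le> r" by (cases x) auto
  then have "0 < t - r" using x assms by (simp add: ennreal_less_iff)
  then obtain n where n: "1 / real (Suc n) < t - r" using nat_approx_posE by blast
  have "x + ennreal (1 / real (Suc n)) = ennreal (r + 1 / real (Suc n))"
    unfolding r(1) by (rule ennreal_plus[symmetric]) (use r(2) in simp_all)
  also have "\<dots> \<le> ennreal t"
    by (rule ennreal_leI) (use n in linarith)
  finally show "\<exists>n. x + ennreal (1 / real (Suc n)) \<le> ennreal t" by (rule exI)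
next
  assume "\<exists>n. x + ennreal (1 / real (Suc n)) \<le> ennreal t"
  then obtain n where n: "x + ennreal (1 / real (Suc n)) \<le> ennreal t" by (rule exE)
  then have "x \<noteq> \<infinity>" by (auto simp: top_unique)
  then obtain r where r: "x = ennreal r" "0 \<le> r" by (cases x) auto
  have pos: "0 < 1 / real (Suc n)" by simp
  have "ennreal r < ennreal (r + 1 / real (Suc n))"
    by (rule ennreal_lessI) (use r(2) pos in linarith)+
  also have "\<dots> = x + ennreal (1 / real (Suc n))"
    unfolding r(1) by (rule ennreal_plus) (use r(2) in simp_all)
  finally show "x < ennreal t" using n unfolding r(1) by (rule less_le_trans)
qed

text \<open>The indicator of the open stochastic interval is not right-continuous and hence no
  generator. It is a union of closed stochastic intervals that begin \<open>1 / Suc n\<close>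
  later.\<close>

lemma Opt_gt:
  assumes T: "stop_time M F T"
  shows "{(t, \<omega>) \<in> {0..} \<times> space M. T \<omega> < ennreal t} \<in> sets Opt"
proof -
  have "(\<Union>n. {(t, \<omega>) \<in> {0..} \<times> space M. T \<omega> + ennreal (1 / real (Suc n)) \<le> ennreal t}) \<in> sets Opt"
    using Opt_ge[OF stop_time_add[OF T]] by (intro sets.countable_nat_UN) auto
  moreover have "(\<Union>n. {(t, \<omega>) \<in> {0..} \<times> space M. T \<omega> + ennreal (1 / real (Suc n)) \<le> ennreal t}) =
    {(t, \<omega>) \<in> {0..} \<times> space M. T \<omega> < ennreal t}"
    using less_ennreal_iff_add by fastforce
  ultimately show ?thesis by simp
qed

lemma optional_indicator:
  assumes "E \<in> sets Opt"
  shows "optional M F (\<lambda>t \<omega>. indicator E (t, \<omega>))"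
  unfolding optional_def using assms by (simp add: case_prod_unfold)

lemma time_point_measurable:
  assumes "R \<in> borel_measurable M" "\<And>\<omega>. \<omega> \<in> space M \<Longrightarrow> 0 \<le> R \<omega>"
  shows "(\<lambda>\<omega>. (R \<omega> :: real, \<omega>)) \<in> measurable M Opt"
proof (rule measurableI)
  have m: "(\<lambda>\<omega>. (R \<omega>, \<omega>)) \<in> measurable M (borel \<Otimes>\<^sub>M M)"
    using assms(1) by measurable
  fix E assume "E \<in> sets Opt"
  then show "(\<lambda>\<omega>. (R \<omega>, \<omega>)) -` E \<inter> space M \<in> sets M"
    by (rule measurable_sets[OF m Opt_measurable])
qed (use assms(2) in auto)

lemma optional_measurable_path:
  assumes V: "optional M F V"
  shows "(\<lambda>(t, \<omega>). if 0 \<le> t then V t \<omega> else 0) \<in> borel_measurable (borel \<Otimes>\<^sub>M M)"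
proof -
  have "(\<lambda>p :: real \<times> 'a. (max 0 (fst p), snd p)) \<in> measurable (borel \<Otimes>\<^sub>M M) Opt"
  proof (rule measurableI)
    have m: "(\<lambda>p :: real \<times> 'a. (max 0 (fst p), snd p)) \<in> measurable (borel \<Otimes>\<^sub>M M) (borel \<Otimes>\<^sub>M M)"
      by measurable
    fix E assume "E \<in> sets Opt"
    then show "(\<lambda>p :: real \<times> 'a. (max 0 (fst p), snd p)) -` E \<inter> space (borel \<Otimes>\<^sub>M M) \<in> sets (borel \<Otimes>\<^sub>M M)"
      by (rule measurable_sets[OF m Opt_measurable])
  qed (auto simp: space_pair_measure)
  from measurable_compose[OF this V[unfolded optional_def]]
  have [measurable]: "(\<lambda>p. V (max 0 (fst p)) (snd p)) \<in> borel_measurable (borel \<Otimes>\<^sub>M M)"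
    by (simp add: case_prod_unfold)
  have "(\<lambda>p. if 0 \<le> fst p then V (max 0 (fst p)) (snd p) else 0) \<in> borel_measurable (borel \<Otimes>\<^sub>M M)"
    by measurable
  moreover have "(\<lambda>(t, \<omega>). if 0 \<le> t then V t \<omega> else 0) = (\<lambda>p. if 0 \<le> fst p then V (max 0 (fst p)) (snd p) else 0)"
    by (auto simp: fun_eq_iff)
  ultimately show ?thesis by simp
qed

lemma path_indicator_measurable:
  assumes X: "regular X" and s: "0 \<le> s"
  shows "(\<lambda>u. ennreal (X u \<omega>) * indicator {s<..t} u) \<in> borel_measurable (smeas k)"
proof (cases "s \<le> t")
  case True
  show ?thesis
  proof (rule borel_measurable_LIMSEQ_order[where u = "\<lambda>n. riemann_step s t (Suc n) (\<lambda>u. X u \<omega>)"])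
    show "(\<lambda>n. riemann_step s t (Suc n) (\<lambda>u. X u \<omega>) u) \<longlonglongrightarrow> ennreal (X u \<omega>) * indicator {s<..t} u" for u
      by (rule riemann_step_tendsto[OF regularD(3)[OF X] s True])
  qed (rule measurable_riemann_step)
qed simp

end

section \<open>The representation pair\<close>

text \<open>The setting in terms of regular versions. The local martingale property of
  \<open>L\<close> takes the form \<open>nn_super\<close>, and \<open>L_K\<close> is the vanishing
  of \<open>dK\<close> on \<open>{L = 0}\<close> written as a statement almost everywhere.\<close>

locale representation = usual_filtration M F for M :: "'a measure" and F :: "real \<Rightarrow> 'a measure" +
  fixes \<tau> :: "'a \<Rightarrow> ennreal" and K L :: "real \<Rightarrow> 'a \<Rightarrow> real"
  assumes tau_measurable [measurable]: "\<tau> \<in> borel_measurable M"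
    and tau_finite: "AE \<omega> in M. \<tau> \<omega> < \<infinity>"
    and K: "increasing_process K"
    and L: "regular L" "nn_super L"
    and L_0: "AE \<omega> in M. L 0 \<omega> = 1"
    and represent: "\<And>V. optional M F V \<Longrightarrow> (\<And>t \<omega>. 0 \<le> t \<Longrightarrow> \<omega> \<in> space M \<Longrightarrow> 0 \<le> V t \<omega>) \<Longrightarrow>
      (\<integral>\<^sup>+\<omega>. ennreal (V (enn2real (\<tau> \<omega>)) \<omega>) \<partial>M) =
      (\<integral>\<^sup>+\<omega>. (\<integral>\<^sup>+u. ennreal (V u \<omega> * L u \<omega>) * indicator {0..} u \<partial>smeas (\<lambda>t. K t \<omega>)) \<partial>M)"
    and L_K: "AE \<omega> in M. AE u in smeas (\<lambda>t. K t \<omega>). 0 \<le> u \<longrightarrow> L u \<omega> \<noteq> 0"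
begin

section \<open>Conditional survival probabilities of \<tau>\<close>

abbreviation "\<kappa> \<omega> \<equiv> smeas (\<lambda>t. K t \<omega>)"

text \<open>This will be identified with the Azema supermartingale. Unlike an optional projection,
  it has cadlag paths by construction.\<close>

definition Y :: "real \<Rightarrow> 'a \<Rightarrow> real" where
  "Y t \<omega> = L t \<omega> * (1 - K t \<omega>)"

lemma Y_nonneg: "0 \<le> t \<Longrightarrow> 0 \<le> Y t \<omega>"
  unfolding Y_def using regularD(4)[OF L(1)] increasing_processD(3)[OF K] by (intro mult_nonneg_nonneg) auto

lemma ennreal_Y: "0 \<le> t \<Longrightarrow> ennreal (Y t \<omega>) = ennreal (L t \<omega>) * ennreal (1 - K t \<omega>)"
  unfolding Y_def using regularD(4)[OF L(1)] increasing_processD(3)[OF K] by (intro ennreal_mult) auto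

lemma Y_measurable: "0 \<le> t \<Longrightarrow> Y t \<in> borel_measurable (F t)"
  using regularD(5)[OF L(1), of t] increasing_processD(4)[OF K, of t] unfolding Y_def[abs_def] by measurable

lemma Y_measurable_M: "0 \<le> t \<Longrightarrow> Y t \<in> borel_measurable M"
  using measurable_F_M Y_measurable by blast

lemma Y_cadlag: "cadlag_path (\<lambda>t. Y t \<omega>)"
  unfolding cadlag_path_def right_cont_path_def
proof (intro conjI allI impI)
  fix t :: real assume t: "0 \<le> t"
  have "((\<lambda>t. L t \<omega>) \<longlongrightarrow> L t \<omega>) (at_right t)" "((\<lambda>t. K t \<omega>) \<longlongrightarrow> K t \<omega>) (at_right t)"
    using regularD(3)[OF L(1), of \<omega>] increasing_processD(2)[OF K, of \<omega>] t
    by (simp_all add: right_cont_path_def increasing_path_def)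
  then show "((\<lambda>t. Y t \<omega>) \<longlongrightarrow> Y t \<omega>) (at_right t)"
    unfolding Y_def by (intro tendsto_intros)
next
  fix t :: real assume t: "0 < t"
  obtain l where "((\<lambda>t. L t \<omega>) \<longlongrightarrow> l) (at_left t)"
    using regularD(2)[OF L(1), of \<omega>] t unfolding cadlag_path_def by blast
  then have "((\<lambda>t. Y t \<omega>) \<longlongrightarrow> l * (1 - left_lim 0 (\<lambda>t. K t \<omega>) t)) (at_left t)"
    unfolding Y_def using increasing_path_left_lim[OF increasing_processD(2)[OF K] t, of \<omega>] by (intro tendsto_intros)
  then show "\<exists>l. ((\<lambda>t. Y t \<omega>) \<longlongrightarrow> l) (at_left t)" by (rule exI)
qed

lemma Y_adapted: "adapted F Y"
  using Y_measurable by (simp add: adapted_def)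

lemma Y_rc: "right_cont_path (\<lambda>t. Y t \<omega>)"
  using Y_cadlag by (simp add: cadlag_path_def)

text \<open>The product of \<open>B\<close> with the open half-line after \<open>s\<close>, written
  as the stochastic interval after the stopping time that equals \<open>s\<close> on
  \<open>B\<close> and infinity elsewhere, so that \<open>Opt_gt\<close> shows it to be
  optional.\<close>

definition after :: "real \<Rightarrow> 'a set \<Rightarrow> (real \<times> 'a) set" where
  "after s B = {(t, \<omega>) \<in> {0..} \<times> space M. (if \<omega> \<in> B then ennreal s else \<infinity>) < ennreal t}"

lemma after_Opt: "0 \<le> s \<Longrightarrow> B \<in> sets (F s) \<Longrightarrow> after s B \<in> sets Opt"
  unfolding after_def by (rule Opt_gt[OF stop_time_restrict])

lemma after_iff: "0 \<le> s \<Longrightarrow> 0 \<le> t \<Longrightarrow> \<omega> \<in> space M \<Longrightarrow> (t, \<omega>) \<in> after s B \<longleftrightarrow> \<omega> \<in> B \<and> s < t"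
  by (auto simp: after_def ennreal_less_iff)

lemma less_tau_iff: "\<tau> \<omega> < \<infinity> \<Longrightarrow> 0 \<le> s \<Longrightarrow> ennreal s < \<tau> \<omega> \<longleftrightarrow> s < enn2real (\<tau> \<omega>)"
  using le_ennreal_iff[of s "\<tau> \<omega>"] by (simp add: not_le[symmetric])

text \<open>The representation turns the left side into the expectation of the integral of
  \<open>L\<close> against \<open>K\<close> over times after \<open>s\<close>, on \<open>B\<close>.
  On the interval from \<open>s\<close> to \<open>s + n\<close> integration by parts bounds it by
  \<open>Y s\<close>, and \<open>n\<close> tends to infinity. The term of \<open>L (1 - K)\<close>
  at the right end is dropped, so this argument gives only an inequality.\<close>

lemma key_le:
  assumes s: "0 \<le> s" and B: "B \<in> sets (F s)"
  shows "(\<integral>\<^sup>+\<omega>. indicator B \<omega> * indicator {\<omega>. ennreal s < \<tau> \<omega>} \<omega> \<partial>M) \<le> (\<integral>\<^sup>+\<omega>. indicator B \<omega> * ennreal (Y s \<omega>) \<partial>M)"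
proof -
  have BM: "B \<subseteq> space M" using sets.sets_into_space[OF B] s by simp
  have [measurable]: "B \<in> sets M" by (rule sets_F_M[OF s B])
  let ?V = "\<lambda>t \<omega>. indicator (after s B) (t, \<omega>) :: real"
  have "(\<integral>\<^sup>+\<omega>. indicator B \<omega> * indicator {\<omega>. ennreal s < \<tau> \<omega>} \<omega> \<partial>M) = (\<integral>\<^sup>+\<omega>. ennreal (?V (enn2real (\<tau> \<omega>)) \<omega>) \<partial>M)"
  proof (rule nn_integral_cong_AE)
    show "AE \<omega> in M. indicator B \<omega> * indicator {\<omega>. ennreal s < \<tau> \<omega>} \<omega> = ennreal (?V (enn2real (\<tau> \<omega>)) \<omega>)"
      using tau_finite AE_space
    proof eventually_elim
      case (elim \<omega>)
      show ?case using after_iff[OF s enn2real_nonneg elim(2), of "\<tau> \<omega>" B] less_tau_iff[OF elim(1) s]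
        by (simp add: indicator_def)
    qed
  qed
  also have "\<dots> = (\<integral>\<^sup>+\<omega>. (\<integral>\<^sup>+u. ennreal (?V u \<omega> * L u \<omega>) * indicator {0..} u \<partial>\<kappa> \<omega>) \<partial>M)"
    by (rule represent[OF optional_indicator[OF after_Opt[OF s B]]]) simp
  also have "\<dots> = (\<integral>\<^sup>+\<omega>. (SUP n. indicator B \<omega> * sint L K s (s + real n) \<omega>) \<partial>M)"
  proof (rule nn_integral_cong)
    fix \<omega> assume w: "\<omega> \<in> space M"
    have "ennreal (?V u \<omega> * L u \<omega>) * indicator {0..} u = (SUP n. indicator B \<omega> * (ennreal (L u \<omega>) * indicator {s<..s + real n} u))" for u
    proof (cases "s < u \<and> \<omega> \<in> B")
      case True
      obtain n0 where n0: "u - s \<le> real n0" using real_arch_simple[of "u - s"] by (rule exE)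
      have "(SUP n. indicator B \<omega> * (ennreal (L u \<omega>) * indicator {s<..s + real n} u)) = ennreal (L u \<omega>)"
      proof (rule antisym)
        show "(SUP n. indicator B \<omega> * (ennreal (L u \<omega>) * indicator {s<..s + real n} u)) \<le> ennreal (L u \<omega>)"
          by (rule SUP_least) (simp add: indicator_def)
        show "ennreal (L u \<omega>) \<le> (SUP n. indicator B \<omega> * (ennreal (L u \<omega>) * indicator {s<..s + real n} u))"
          by (rule SUP_upper2[of n0]) (use n0 True in auto)
      qed
      then show ?thesis using True s w after_iff[OF s _ w, of u B] by simp
    next
      case False
      then have "indicator B \<omega> * (ennreal (L u \<omega>) * indicator {s<..s + real n} u) = 0" for n
        by (auto simp: indicator_def)
      moreover have "ennreal (?V u \<omega> * L u \<omega>) * indicator {0..} u = 0"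
        using False w after_iff[OF s _ w, of u B] by (auto simp: indicator_def)
      ultimately show ?thesis by (simp only: SUP_const[OF UNIV_not_empty])
    qed
    then have "(\<integral>\<^sup>+u. ennreal (?V u \<omega> * L u \<omega>) * indicator {0..} u \<partial>\<kappa> \<omega>) =
      (\<integral>\<^sup>+u. (SUP n. indicator B \<omega> * (ennreal (L u \<omega>) * indicator {s<..s + real n} u)) \<partial>\<kappa> \<omega>)"
      by (simp only:)
    also have "\<dots> = (SUP n. \<integral>\<^sup>+u. indicator B \<omega> * (ennreal (L u \<omega>) * indicator {s<..s + real n} u) \<partial>\<kappa> \<omega>)"
    proof (rule nn_integral_monotone_convergence_SUP)
      show "incseq (\<lambda>n u. indicator B \<omega> * (ennreal (L u \<omega>) * indicator {s<..s + real n} u))"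
        by (intro incseq_SucI le_funI mult_left_mono) (auto simp: indicator_def)
      show "(\<lambda>u. indicator B \<omega> * (ennreal (L u \<omega>) * indicator {s<..s + real n} u)) \<in> borel_measurable (\<kappa> \<omega>)" for n
        using path_indicator_measurable[OF L(1) s, of \<omega> "s + real n" "\<lambda>t. K t \<omega>"] s by measurable
    qed
    also have "\<dots> = (SUP n. indicator B \<omega> * sint L K s (s + real n) \<omega>)"
      unfolding sint_def using path_indicator_measurable[OF L(1) s]
      by (intro SUP_cong refl nn_integral_cmult) simp
    finally show "(\<integral>\<^sup>+u. ennreal (?V u \<omega> * L u \<omega>) * indicator {0..} u \<partial>\<kappa> \<omega>) = (SUP n. indicator B \<omega> * sint L K s (s + real n) \<omega>)" .
  qed
  also have "\<dots> = (SUP n. \<integral>\<^sup>+\<omega>. indicator B \<omega> * sint L K s (s + real n) \<omega> \<partial>M)"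
  proof (rule nn_integral_monotone_convergence_SUP)
    show "incseq (\<lambda>n \<omega>. indicator B \<omega> * sint L K s (s + real n) \<omega>)"
      unfolding sint_def by (intro incseq_SucI le_funI mult_left_mono nn_integral_mono) (auto simp: indicator_def)
    show "(\<lambda>\<omega>. indicator B \<omega> * sint L K s (s + real n) \<omega>) \<in> borel_measurable M" for n
      using sint_measurable[OF L(1) K s, of "s + real n"] by measurable
  qed
  also have "\<dots> \<le> (\<integral>\<^sup>+\<omega>. indicator B \<omega> * ennreal (Y s \<omega>) \<partial>M)"
  proof (rule SUP_least)
    fix n
    have "(\<integral>\<^sup>+\<omega>. indicator B \<omega> * sint L K s (s + real n) \<omega> \<partial>M) \<le>
      (\<integral>\<^sup>+\<omega>. indicator B \<omega> * (sint L K s (s + real n) \<omega> + ennreal (L (s + real n) \<omega>) * ennreal (1 - K (s + real n) \<omega>)) \<partial>M)"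
      by (intro nn_integral_mono mult_left_mono) (auto intro: add_increasing2)
    also have "\<dots> \<le> (\<integral>\<^sup>+\<omega>. indicator B \<omega> * ennreal (Y s \<omega>) \<partial>M)"
      using parts_super[OF L K s, of "s + real n", OF _ B] by (simp add: ennreal_Y[OF s])
    finally show "(\<integral>\<^sup>+\<omega>. indicator B \<omega> * sint L K s (s + real n) \<omega> \<partial>M) \<le> (\<integral>\<^sup>+\<omega>. indicator B \<omega> * ennreal (Y s \<omega>) \<partial>M)" .
  qed
  finally show ?thesis .
qed

text \<open>The reverse inequality for the whole space. By the representation, the probability of
  \<open>\<tau> \<le> s\<close> consists of \<open>L 0 * K 0\<close> and the integral of
  \<open>L\<close> against \<open>K\<close> over \<open>(0, s]\<close>. By parts, that integral and
  \<open>Y s\<close> together have expectation at most that of \<open>L 0 * (1 - K 0)\<close>. Since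
  \<open>L 0 = 1\<close>, everything adds up to at most one.\<close>

lemma key_total:
  assumes s: "0 \<le> s"
  shows "(\<integral>\<^sup>+\<omega>. ennreal (Y s \<omega>) \<partial>M) \<le> (\<integral>\<^sup>+\<omega>. indicator {\<omega>. ennreal s < \<tau> \<omega>} \<omega> \<partial>M)"
proof -
  note [measurable] = Y_measurable_M[OF s] sint_measurable[OF L(1) K order_refl] regularD(6)[OF L(1)] increasing_processD(5)[OF K]
  let ?E = "{0..} \<times> space M - after s (space M)"
  have top: "space M \<in> sets (F s)" using sets.top[of "F s"] s by simp
  have E: "?E \<in> sets Opt"
    using sets.compl_sets[OF after_Opt[OF s top]] by simp
  have E_iff: "(t, \<omega>) \<in> ?E \<longleftrightarrow> t \<le> s" if "0 \<le> t" "\<omega> \<in> space M" for t \<omega>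
    using after_iff[OF s that, of "space M"] that by auto
  let ?V = "\<lambda>t \<omega>. indicator ?E (t, \<omega>) :: real"
  have "(\<integral>\<^sup>+\<omega>. indicator {\<omega>. \<tau> \<omega> \<le> ennreal s} \<omega> \<partial>M) = (\<integral>\<^sup>+\<omega>. ennreal (?V (enn2real (\<tau> \<omega>)) \<omega>) \<partial>M)"
  proof (rule nn_integral_cong_AE)
    show "AE \<omega> in M. indicator {\<omega>. \<tau> \<omega> \<le> ennreal s} \<omega> = ennreal (?V (enn2real (\<tau> \<omega>)) \<omega>)"
      using tau_finite AE_space
    proof eventually_elim
      case (elim \<omega>)
      show ?case using E_iff[OF enn2real_nonneg elim(2), of "\<tau> \<omega>"] le_ennreal_iff[OF s elim(1)]
        by (simp add: indicator_def)
    qed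
  qed
  also have "\<dots> = (\<integral>\<^sup>+\<omega>. (\<integral>\<^sup>+u. ennreal (?V u \<omega> * L u \<omega>) * indicator {0..} u \<partial>\<kappa> \<omega>) \<partial>M)"
    by (rule represent[OF optional_indicator[OF E]]) simp
  also have "\<dots> = (\<integral>\<^sup>+\<omega>. ennreal (L 0 \<omega>) * ennreal (K 0 \<omega>) + sint L K 0 s \<omega> \<partial>M)"
  proof (rule nn_integral_cong)
    fix \<omega> assume w: "\<omega> \<in> space M"
    have "ennreal (?V u \<omega> * L u \<omega>) * indicator {0..} u = ennreal (L 0 \<omega>) * indicator {0} u + ennreal (L u \<omega>) * indicator {0<..s} u" for u
    proof -
      consider "u < 0" | "u = 0" | "0 < u" by linarith
      then show ?thesis
      proof cases
        case 3
        then show ?thesis using E_iff[of u \<omega>] w by (auto simp: indicator_def)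
      qed (use E_iff[of u \<omega>] w s in \<open>auto simp: indicator_def\<close>)
    qed
    then have "(\<integral>\<^sup>+u. ennreal (?V u \<omega> * L u \<omega>) * indicator {0..} u \<partial>\<kappa> \<omega>) =
      (\<integral>\<^sup>+u. ennreal (L 0 \<omega>) * indicator {0} u + ennreal (L u \<omega>) * indicator {0<..s} u \<partial>\<kappa> \<omega>)"
      by (simp only:)
    also have "\<dots> = (\<integral>\<^sup>+u. ennreal (L 0 \<omega>) * indicator {0} u \<partial>\<kappa> \<omega>) + sint L K 0 s \<omega>"
      unfolding sint_def by (rule nn_integral_add[OF _ path_indicator_measurable[OF L(1) order_refl]]) simp
    also have "(\<integral>\<^sup>+u. ennreal (L 0 \<omega>) * indicator {0} u \<partial>\<kappa> \<omega>) = ennreal (L 0 \<omega>) * ennreal (K 0 \<omega>)"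
      using emeasure_smeas_Icc0[OF increasing_processD(2)[OF K], of 0 \<omega>] by (subst nn_integral_cmult_indicator) simp_all
    finally show "(\<integral>\<^sup>+u. ennreal (?V u \<omega> * L u \<omega>) * indicator {0..} u \<partial>\<kappa> \<omega>) = ennreal (L 0 \<omega>) * ennreal (K 0 \<omega>) + sint L K 0 s \<omega>" .
  qed
  finally have P: "(\<integral>\<^sup>+\<omega>. indicator {\<omega>. \<tau> \<omega> \<le> ennreal s} \<omega> \<partial>M) = (\<integral>\<^sup>+\<omega>. ennreal (L 0 \<omega>) * ennreal (K 0 \<omega>) + sint L K 0 s \<omega> \<partial>M)" .
  have top0: "space M \<in> sets (F 0)" using sets.top[of "F 0"] by simp
  have ind: "(\<integral>\<^sup>+\<omega>. indicator (space M) \<omega> * f \<omega> \<partial>M) = (\<integral>\<^sup>+\<omega>. f \<omega> \<partial>M)" for f :: "'a \<Rightarrow> ennreal"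
    by (rule nn_integral_cong) simp
  have m1: "(\<lambda>\<omega>. ennreal (L 0 \<omega>) * ennreal (K 0 \<omega>)) \<in> borel_measurable M"
    "(\<lambda>\<omega>. ennreal (L 0 \<omega>) * ennreal (1 - K 0 \<omega>)) \<in> borel_measurable M"
    by measurable
  have m2: "sint L K 0 s \<in> borel_measurable M" and m3: "(\<lambda>\<omega>. ennreal (Y s \<omega>)) \<in> borel_measurable M"
    by measurable
  have "(\<integral>\<^sup>+\<omega>. sint L K 0 s \<omega> \<partial>M) + (\<integral>\<^sup>+\<omega>. ennreal (Y s \<omega>) \<partial>M) \<le> (\<integral>\<^sup>+\<omega>. ennreal (L 0 \<omega>) * ennreal (1 - K 0 \<omega>) \<partial>M)"
    using parts_super[OF L K order_refl s top0]
    unfolding ind ennreal_Y[OF s, symmetric] nn_integral_add[OF m2 m3] .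
  then have "(\<integral>\<^sup>+\<omega>. indicator {\<omega>. \<tau> \<omega> \<le> ennreal s} \<omega> \<partial>M) + (\<integral>\<^sup>+\<omega>. ennreal (Y s \<omega>) \<partial>M) \<le>
    (\<integral>\<^sup>+\<omega>. ennreal (L 0 \<omega>) * ennreal (K 0 \<omega>) \<partial>M) + (\<integral>\<^sup>+\<omega>. ennreal (L 0 \<omega>) * ennreal (1 - K 0 \<omega>) \<partial>M)"
    unfolding P nn_integral_add[OF m1(1) m2] add.assoc by (rule add_left_mono)
  also have "(\<integral>\<^sup>+\<omega>. ennreal (L 0 \<omega>) * ennreal (K 0 \<omega>) \<partial>M) + (\<integral>\<^sup>+\<omega>. ennreal (L 0 \<omega>) * ennreal (1 - K 0 \<omega>) \<partial>M) =
    (\<integral>\<^sup>+\<omega>. ennreal (L 0 \<omega>) * ennreal (K 0 \<omega>) + ennreal (L 0 \<omega>) * ennreal (1 - K 0 \<omega>) \<partial>M)"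
    by (rule nn_integral_add[OF m1, symmetric])
  also have "\<dots> = (\<integral>\<^sup>+\<omega>. ennreal (L 0 \<omega>) \<partial>M)"
  proof (rule nn_integral_cong)
    fix \<omega>
    have "ennreal (K 0 \<omega>) + ennreal (1 - K 0 \<omega>) = ennreal (K 0 \<omega> + (1 - K 0 \<omega>))"
      by (rule ennreal_plus[symmetric]) (use increasing_processD(3,6)[OF K, of 0 \<omega>] in simp_all)
    then show "ennreal (L 0 \<omega>) * ennreal (K 0 \<omega>) + ennreal (L 0 \<omega>) * ennreal (1 - K 0 \<omega>) = ennreal (L 0 \<omega>)"
      by (simp flip: distrib_left)
  qed
  also have "\<dots> = (\<integral>\<^sup>+\<omega>. 1 \<partial>M)"
    by (rule nn_integral_cong_AE) (use L_0 in eventually_elim, simp)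
  also have "\<dots> = (\<integral>\<^sup>+\<omega>. indicator {\<omega>. \<tau> \<omega> \<le> ennreal s} \<omega> + indicator {\<omega>. ennreal s < \<tau> \<omega>} \<omega> \<partial>M)"
    by (rule nn_integral_cong) (auto simp: indicator_def)
  also have "\<dots> = (\<integral>\<^sup>+\<omega>. indicator {\<omega>. \<tau> \<omega> \<le> ennreal s} \<omega> \<partial>M) + (\<integral>\<^sup>+\<omega>. indicator {\<omega>. ennreal s < \<tau> \<omega>} \<omega> \<partial>M)"
    by (rule nn_integral_add) measurable
  finally have le: "(\<integral>\<^sup>+\<omega>. indicator {\<omega>. \<tau> \<omega> \<le> ennreal s} \<omega> \<partial>M) + (\<integral>\<^sup>+\<omega>. ennreal (Y s \<omega>) \<partial>M) \<le>
    (\<integral>\<^sup>+\<omega>. indicator {\<omega>. \<tau> \<omega> \<le> ennreal s} \<omega> \<partial>M) + (\<integral>\<^sup>+\<omega>. indicator {\<omega>. ennreal s < \<tau> \<omega>} \<omega> \<partial>M)"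
    .
  have "(\<integral>\<^sup>+\<omega>. indicator {\<omega>. \<tau> \<omega> \<le> ennreal s} \<omega> \<partial>M) \<le> (\<integral>\<^sup>+\<omega>. 1 \<partial>M)"
    by (rule nn_integral_mono) (simp add: indicator_def)
  then have "(\<integral>\<^sup>+\<omega>. indicator {\<omega>. \<tau> \<omega> \<le> ennreal s} \<omega> \<partial>M) \<noteq> \<infinity>"
    by (auto simp: emeasure_space_1 top_unique)
  with le show ?thesis
    by (simp add: ennreal_add_left_cancel_le)
qed

text \<open>An inequality on every event and the opposite one for the total mass force equality on
  every event: use \<open>key_le\<close> on the complement of \<open>B\<close> and cancel, all terms
  being finite.\<close>

lemma key:
  assumes s: "0 \<le> s" and B: "B \<in> sets (F s)"
  shows "(\<integral>\<^sup>+\<omega>. indicator B \<omega> * indicator {\<omega>. ennreal s < \<tau> \<omega>} \<omega> \<partial>M) = (\<integral>\<^sup>+\<omega>. indicator B \<omega> * ennreal (Y s \<omega>) \<partial>M)"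
proof (rule antisym[OF key_le[OF s B]])
  let ?g = "\<lambda>\<omega>. indicator {\<omega>. ennreal s < \<tau> \<omega>} \<omega> :: ennreal" and ?h = "\<lambda>\<omega>. ennreal (Y s \<omega>)"
  have [measurable]: "B \<in> sets M" by (rule sets_F_M[OF s B])
  note [measurable] = Y_measurable_M[OF s]
  have Bc: "space M - B \<in> sets (F s)" using sets.compl_sets[OF B] s by simp
  have split: "(\<integral>\<^sup>+\<omega>. f \<omega> \<partial>M) = (\<integral>\<^sup>+\<omega>. indicator B \<omega> * f \<omega> \<partial>M) + (\<integral>\<^sup>+\<omega>. indicator (space M - B) \<omega> * f \<omega> \<partial>M)"
    if [measurable]: "f \<in> borel_measurable M" for f :: "'a \<Rightarrow> ennreal"
  proof -
    have "(\<integral>\<^sup>+\<omega>. f \<omega> \<partial>M) = (\<integral>\<^sup>+\<omega>. indicator B \<omega> * f \<omega> + indicator (space M - B) \<omega> * f \<omega> \<partial>M)"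
      by (rule nn_integral_cong) (simp add: indicator_def)
    also have "\<dots> = (\<integral>\<^sup>+\<omega>. indicator B \<omega> * f \<omega> \<partial>M) + (\<integral>\<^sup>+\<omega>. indicator (space M - B) \<omega> * f \<omega> \<partial>M)"
      by (rule nn_integral_add) measurable
    finally show ?thesis .
  qed
  have "(\<integral>\<^sup>+\<omega>. ?h \<omega> \<partial>M) \<le> (\<integral>\<^sup>+\<omega>. ?g \<omega> \<partial>M)" by (rule key_total[OF s])
  also have "\<dots> = (\<integral>\<^sup>+\<omega>. indicator B \<omega> * ?g \<omega> \<partial>M) + (\<integral>\<^sup>+\<omega>. indicator (space M - B) \<omega> * ?g \<omega> \<partial>M)"
    by (rule split) measurable
  also have "\<dots> \<le> (\<integral>\<^sup>+\<omega>. indicator B \<omega> * ?g \<omega> \<partial>M) + (\<integral>\<^sup>+\<omega>. indicator (space M - B) \<omega> * ?h \<omega> \<partial>M)"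
    by (rule add_left_mono[OF key_le[OF s Bc]])
  finally have le: "(\<integral>\<^sup>+\<omega>. indicator B \<omega> * ?h \<omega> \<partial>M) + (\<integral>\<^sup>+\<omega>. indicator (space M - B) \<omega> * ?h \<omega> \<partial>M) \<le>
    (\<integral>\<^sup>+\<omega>. indicator B \<omega> * ?g \<omega> \<partial>M) + (\<integral>\<^sup>+\<omega>. indicator (space M - B) \<omega> * ?h \<omega> \<partial>M)"
    using split[of ?h] by simp
  have "(\<integral>\<^sup>+\<omega>. indicator (space M - B) \<omega> * ?h \<omega> \<partial>M) \<le> (\<integral>\<^sup>+\<omega>. ?h \<omega> \<partial>M)"
    by (rule nn_integral_mono) (simp add: indicator_def)
  also have "\<dots> \<le> (\<integral>\<^sup>+\<omega>. 1 \<partial>M)"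
    by (rule order_trans[OF key_total[OF s]], rule nn_integral_mono) (simp add: indicator_def)
  finally have "(\<integral>\<^sup>+\<omega>. indicator (space M - B) \<omega> * ?h \<omega> \<partial>M) \<noteq> \<infinity>"
    by (auto simp: emeasure_space_1 top_unique)
  with le show "(\<integral>\<^sup>+\<omega>. indicator B \<omega> * ?h \<omega> \<partial>M) \<le> (\<integral>\<^sup>+\<omega>. indicator B \<omega> * ?g \<omega> \<partial>M)"
    by (simp add: add.commute[of _ "\<integral>\<^sup>+\<omega>. indicator (space M - B) \<omega> * ?h \<omega> \<partial>M"] ennreal_add_left_cancel_le)
qed

text \<open>\<open>Y s\<close> is a conditional probability by \<open>key\<close>. The bound serves
  as the dominating constant in \<open>key_stop\<close>.\<close>

lemma Y_le_1:
  assumes s: "0 \<le> s"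
  shows "AE \<omega> in M. Y s \<omega> \<le> 1"
proof -
  note [measurable] = Y_measurable[OF s] Y_measurable_M[OF s]
  define B where "B = {\<omega> \<in> space (F s). 1 < Y s \<omega>}"
  have B: "B \<in> sets (F s)" unfolding B_def by measurable
  have BM[measurable]: "B \<in> sets M" by (rule sets_F_M[OF s B])
  have "(\<integral>\<^sup>+\<omega>. indicator B \<omega> + indicator B \<omega> * ennreal (Y s \<omega> - 1) \<partial>M) = (\<integral>\<^sup>+\<omega>. indicator B \<omega> * ennreal (Y s \<omega>) \<partial>M)"
  proof (rule nn_integral_cong)
    fix \<omega>
    show "indicator B \<omega> + indicator B \<omega> * ennreal (Y s \<omega> - 1) = indicator B \<omega> * ennreal (Y s \<omega>)"
    proof (cases "\<omega> \<in> B")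
      case True
      have "1 + ennreal (Y s \<omega> - 1) = ennreal (1 + (Y s \<omega> - 1))"
        unfolding ennreal_1[symmetric] by (rule ennreal_plus[symmetric]) (use True in \<open>auto simp: B_def\<close>)
      then show ?thesis using True by simp
    qed simp
  qed
  also have "\<dots> = (\<integral>\<^sup>+\<omega>. indicator B \<omega> * indicator {\<omega>. ennreal s < \<tau> \<omega>} \<omega> \<partial>M)"
    by (rule key[OF s B, symmetric])
  also have "\<dots> \<le> (\<integral>\<^sup>+\<omega>. indicator B \<omega> \<partial>M)"
    by (rule nn_integral_mono) (simp add: indicator_def)
  finally have "(\<integral>\<^sup>+\<omega>. indicator B \<omega> \<partial>M) + (\<integral>\<^sup>+\<omega>. indicator B \<omega> * ennreal (Y s \<omega> - 1) \<partial>M) \<le> (\<integral>\<^sup>+\<omega>. indicator B \<omega> \<partial>M) + 0"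
    unfolding add_0_right
  proof (subst nn_integral_add[symmetric])
    show "indicator B \<in> borel_measurable M" "(\<lambda>\<omega>. indicator B \<omega> * ennreal (Y s \<omega> - 1)) \<in> borel_measurable M"
      by measurable
  qed
  moreover have "(\<integral>\<^sup>+\<omega>. indicator B \<omega> \<partial>M) \<noteq> \<infinity>"
    using nn_integral_indicator[OF BM] emeasure_finite[of B] by simp
  ultimately have "(\<integral>\<^sup>+\<omega>. indicator B \<omega> * ennreal (Y s \<omega> - 1) \<partial>M) \<le> 0"
    by (simp only: ennreal_add_left_cancel_le) simp
  then have "(\<integral>\<^sup>+\<omega>. indicator B \<omega> * ennreal (Y s \<omega> - 1) \<partial>M) = 0" by simp
  then have "AE \<omega> in M. indicator B \<omega> * ennreal (Y s \<omega> - 1) = 0"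
    by (subst (asm) nn_integral_0_iff_AE) measurable
  then show ?thesis
    using AE_space by eventually_elim (use s in \<open>auto simp: B_def indicator_def ennreal_eq_0_iff split: if_splits\<close>)
qed


lemma Y_at_measurable:
  assumes [measurable]: "R \<in> borel_measurable M" and R: "\<And>\<omega>. 0 \<le> R \<omega>"
  shows "(\<lambda>\<omega>. Y (R \<omega>) \<omega>) \<in> borel_measurable M"
proof -
  have "(\<lambda>\<omega>. (R \<omega>, \<omega>)) \<in> measurable M (borel \<Otimes>\<^sub>M M)" by measurable
  from measurable_compose[OF this measurable_path[OF Y_adapted Y_rc]] show ?thesis
    using R by simp
qed

text \<open>The time \<sigma> is approximated from above by times with values in a grid, and
  \<open>key\<close> is summed over the grid points. In the limit, approximation from above respects
  the strict condition \<open>\<sigma> < \<tau>\<close> as well as the right-continuity of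
  \<open>Y\<close>.\<close>

lemma key_stop:
  assumes \<sigma>: "stop_time M F \<sigma>" and B: "B \<in> sets (stop_sigma M F \<sigma>)"
  shows "(\<integral>\<^sup>+\<omega>. indicator B \<omega> * indicator {\<omega>. \<sigma> \<omega> < \<tau> \<omega>} \<omega> \<partial>M) =
    (\<integral>\<^sup>+\<omega>. indicator B \<omega> * (indicator {\<omega>. \<sigma> \<omega> < \<infinity>} \<omega> * ennreal (Y (enn2real (\<sigma> \<omega>)) \<omega>)) \<partial>M)"
proof -
  have BM[measurable]: "B \<in> sets M" and Bt: "\<And>t. 0 \<le> t \<Longrightarrow> {\<omega> \<in> B. \<sigma> \<omega> \<le> ennreal t} \<in> sets (F t)"
    using B by (simp_all add: sets_stop_sigma[OF \<sigma>])
  have [measurable]: "\<sigma> \<in> borel_measurable M" by (rule stop_time_measurable[OF \<sigma>])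
  define C where "C = B \<inter> {\<omega>. \<sigma> \<omega> < \<infinity>}"
  have C_eq: "C = B \<inter> {\<omega> \<in> space M. \<sigma> \<omega> < \<infinity>}"
    using sets.sets_into_space[OF BM] by (auto simp: C_def)
  have C_sets[measurable]: "C \<in> sets M" unfolding C_eq by measurable
  \<comment> \<open>Rounding up makes \<open>J n \<le> j\<close> equivalent to \<sigma> being at
    most the grid point \<open>q n j\<close>, an event known at that grid point. The part with
    \<open>\<sigma> = \<infinity>\<close> has been removed in \<open>C\<close>, since
    \<open>enn2real\<close> would send it to zero.\<close>
  define J where "J n \<omega> = nat \<lceil>enn2real (\<sigma> \<omega>) * real (Suc n)\<rceil>" for n \<omega>
  define q where "q n j = real j / real (Suc n)" for n j :: nat
  define A where "A n j = {\<omega> \<in> C. J n \<omega> = j}" for n j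
  have q0: "0 \<le> q n j" for n j by (simp add: q_def)
  have J_le: "J n \<omega> \<le> j \<longleftrightarrow> enn2real (\<sigma> \<omega>) \<le> q n j" for n j \<omega>
  proof -
    have "J n \<omega> \<le> j \<longleftrightarrow> \<lceil>enn2real (\<sigma> \<omega>) * real (Suc n)\<rceil> \<le> int j"
      unfolding J_def by (rule nat_le_iff)
    also have "\<dots> \<longleftrightarrow> enn2real (\<sigma> \<omega>) * real (Suc n) \<le> real j"
      by (simp add: ceiling_le_iff)
    also have "\<dots> \<longleftrightarrow> enn2real (\<sigma> \<omega>) \<le> q n j"
      unfolding q_def by (rule pos_le_divide_eq[symmetric]) simp
    finally show ?thesis .
  qed
  have c_sets: "{\<omega> \<in> C. J n \<omega> \<le> j} \<in> sets (F (q n j))" for n j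
  proof -
    have "{\<omega> \<in> C. J n \<omega> \<le> j} = {\<omega> \<in> B. \<sigma> \<omega> \<le> ennreal (q n j)}"
    proof (intro set_eqI iffI)
      fix \<omega> assume "\<omega> \<in> {\<omega> \<in> B. \<sigma> \<omega> \<le> ennreal (q n j)}"
      then have w: "\<omega> \<in> B" "\<sigma> \<omega> \<le> ennreal (q n j)" by auto
      then have "\<sigma> \<omega> < \<infinity>" by (auto intro: le_less_trans)
      then show "\<omega> \<in> {\<omega> \<in> C. J n \<omega> \<le> j}"
        using w le_ennreal_iff[OF q0] by (simp add: C_def J_le)
    next
      fix \<omega> assume "\<omega> \<in> {\<omega> \<in> C. J n \<omega> \<le> j}"
      then show "\<omega> \<in> {\<omega> \<in> B. \<sigma> \<omega> \<le> ennreal (q n j)}"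
        using le_ennreal_iff[OF q0, of "\<sigma> \<omega>" n j] by (simp add: C_def J_le)
    qed
    then show ?thesis using Bt[OF q0] by simp
  qed
  have A_sets: "A n j \<in> sets (F (q n j))" for n j
  proof (cases j)
    case 0
    then have "A n j = {\<omega> \<in> C. J n \<omega> \<le> 0}" by (simp add: A_def)
    then show ?thesis using c_sets[of n 0] 0 by simp
  next
    case (Suc i)
    have "q n i \<le> q n j" unfolding q_def Suc by (intro divide_right_mono) simp_all
    then have "{\<omega> \<in> C. J n \<omega> \<le> i} \<in> sets (F (q n j))"
      using c_sets[of n i] mono_F[OF q0, of n i "q n j"] by blast
    moreover have "A n j = {\<omega> \<in> C. J n \<omega> \<le> j} - {\<omega> \<in> C. J n \<omega> \<le> i}"
      unfolding A_def Suc by auto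
    ultimately show ?thesis using c_sets[of n j] by (simp only: sets.Diff)
  qed
  have A_M[measurable]: "A n j \<in> sets M" for n j by (rule sets_F_M[OF q0 A_sets])
  have sum_A: "(\<Sum>j. indicator (A n j) \<omega> * f j) = indicator C \<omega> * f (J n \<omega>)" for n \<omega> and f :: "nat \<Rightarrow> ennreal"
  proof -
    have "indicator (A n j) \<omega> * f j = (if j = J n \<omega> then indicator C \<omega> * f j else 0)" for j
      by (auto simp: A_def indicator_def)
    then have "(\<lambda>j. indicator (A n j) \<omega> * f j) sums (indicator C \<omega> * f (J n \<omega>))"
      by (simp only:) (rule sums_single)
    then show ?thesis by (rule sums_unique[symmetric])
  qed
  define r where "r n \<omega> = q n (J n \<omega>)" for n \<omega>
  have r_meas[measurable]: "r n \<in> borel_measurable M" for n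
    unfolding r_def q_def J_def by measurable
  have r0: "0 \<le> r n \<omega>" for n \<omega> by (simp add: r_def q0)
  have r_ge: "enn2real (\<sigma> \<omega>) \<le> r n \<omega>" for n \<omega>
    using J_le[of n \<omega> "J n \<omega>"] by (simp add: r_def)
  have r_le: "r n \<omega> \<le> enn2real (\<sigma> \<omega>) + 1 / real (Suc n)" for n \<omega>
  proof -
    let ?x = "enn2real (\<sigma> \<omega>) * real (Suc n)"
    have "0 \<le> ?x" by simp
    then have "0 \<le> \<lceil>?x\<rceil>" by linarith
    then have "real (J n \<omega>) = of_int \<lceil>?x\<rceil>" by (simp add: J_def)
    also have "\<dots> \<le> ?x + 1" by linarith
    finally have "real (J n \<omega>) / real (Suc n) \<le> (?x + 1) / real (Suc n)"
      by (rule divide_right_mono) simp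
    also have "\<dots> = enn2real (\<sigma> \<omega>) + 1 / real (Suc n)"
      by (simp add: add_divide_distrib del: of_nat_Suc)
    finally show ?thesis by (simp add: r_def q_def)
  qed
  have r_lim: "(\<lambda>n. r n \<omega>) \<longlonglongrightarrow> enn2real (\<sigma> \<omega>)" for \<omega>
  proof (rule tendsto_sandwich[where f = "\<lambda>_. enn2real (\<sigma> \<omega>)" and h = "\<lambda>n. enn2real (\<sigma> \<omega>) + 1 / real (Suc n)"])
    show "(\<lambda>n. enn2real (\<sigma> \<omega>) + 1 / real (Suc n)) \<longlonglongrightarrow> enn2real (\<sigma> \<omega>)"
      using tendsto_add[OF tendsto_const LIMSEQ_inverse_real_of_nat] by (simp add: inverse_eq_divide)
  qed (use r_ge r_le in simp_all)
  have eq: "(\<integral>\<^sup>+\<omega>. indicator C \<omega> * indicator {\<omega>. ennreal (r n \<omega>) < \<tau> \<omega>} \<omega> \<partial>M) = (\<integral>\<^sup>+\<omega>. indicator C \<omega> * ennreal (Y (r n \<omega>) \<omega>) \<partial>M)" for n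
  proof -
    have "(\<integral>\<^sup>+\<omega>. indicator C \<omega> * indicator {\<omega>. ennreal (r n \<omega>) < \<tau> \<omega>} \<omega> \<partial>M) =
      (\<integral>\<^sup>+\<omega>. (\<Sum>j. indicator (A n j) \<omega> * indicator {\<omega>. ennreal (q n j) < \<tau> \<omega>} \<omega>) \<partial>M)"
      unfolding sum_A by (simp add: r_def indicator_def)
    also have "\<dots> = (\<Sum>j. \<integral>\<^sup>+\<omega>. indicator (A n j) \<omega> * indicator {\<omega>. ennreal (q n j) < \<tau> \<omega>} \<omega> \<partial>M)"
      by (rule nn_integral_suminf) measurable
    also have "\<dots> = (\<Sum>j. \<integral>\<^sup>+\<omega>. indicator (A n j) \<omega> * ennreal (Y (q n j) \<omega>) \<partial>M)"
      by (simp only: key[OF q0 A_sets])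
    also have "\<dots> = (\<integral>\<^sup>+\<omega>. (\<Sum>j. indicator (A n j) \<omega> * ennreal (Y (q n j) \<omega>)) \<partial>M)"
    proof (rule nn_integral_suminf[symmetric])
      note [measurable] = Y_measurable_M[OF q0]
      show "(\<lambda>\<omega>. indicator (A n j) \<omega> * ennreal (Y (q n j) \<omega>)) \<in> borel_measurable M" for j by measurable
    qed
    also have "\<dots> = (\<integral>\<^sup>+\<omega>. indicator C \<omega> * ennreal (Y (r n \<omega>) \<omega>) \<partial>M)"
      by (simp only: sum_A[of _ _ "\<lambda>j. ennreal (Y (q _ j) _)"] r_def)
    finally show ?thesis .
  qed
  have one: "(\<integral>\<^sup>+\<omega>. 1 \<partial>M) < \<infinity>" by (simp add: emeasure_space_1)
  have "(\<lambda>n. \<integral>\<^sup>+\<omega>. indicator C \<omega> * indicator {\<omega>. ennreal (r n \<omega>) < \<tau> \<omega>} \<omega> \<partial>M) \<longlonglongrightarrow>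
    (\<integral>\<^sup>+\<omega>. indicator B \<omega> * indicator {\<omega>. \<sigma> \<omega> < \<tau> \<omega>} \<omega> \<partial>M)"
  proof (rule nn_integral_dominated_convergence[where w = "\<lambda>_. 1"])
    have "(\<lambda>n. indicator C \<omega> * indicator {\<omega>. ennreal (r n \<omega>) < \<tau> \<omega>} \<omega> :: ennreal) \<longlonglongrightarrow> indicator B \<omega> * indicator {\<omega>. \<sigma> \<omega> < \<tau> \<omega>} \<omega>" for \<omega>
    proof (cases "\<omega> \<in> C")
      case True
      then have fin: "\<sigma> \<omega> < \<infinity>" and B: "\<omega> \<in> B" by (auto simp: C_def)
      then have s: "\<sigma> \<omega> = ennreal (enn2real (\<sigma> \<omega>))" by simp
      show ?thesis
      proof (cases "\<sigma> \<omega> < \<tau> \<omega>")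
        case True
        have "(\<lambda>n. ennreal (r n \<omega>)) \<longlonglongrightarrow> \<sigma> \<omega>"
          using tendsto_ennrealI[OF r_lim[of \<omega>]] s by simp
        then have "\<forall>\<^sub>F n in sequentially. ennreal (r n \<omega>) < \<tau> \<omega>"
          using True by (rule order_tendstoD(2))
        then have "\<forall>\<^sub>F n in sequentially. (indicator C \<omega> * indicator {\<omega>. ennreal (r n \<omega>) < \<tau> \<omega>} \<omega> :: ennreal) = indicator B \<omega> * indicator {\<omega>. \<sigma> \<omega> < \<tau> \<omega>} \<omega>"
          by eventually_elim (use True B \<open>\<omega> \<in> C\<close> in simp)
        then show ?thesis by (rule tendsto_eventually)
      next
        case False
        have "\<sigma> \<omega> \<le> ennreal (r n \<omega>)" for n
          using ennreal_leI[OF r_ge[of \<omega> n]] s by simp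
        then have "\<not> ennreal (r n \<omega>) < \<tau> \<omega>" for n
          using False by (meson le_less_trans)
        then show ?thesis using False by simp
      qed
    next
      case False
      then have "\<not> (\<omega> \<in> B \<and> \<sigma> \<omega> < \<tau> \<omega>)"
        by (auto simp: C_def top.not_eq_extremum not_less top_unique)
      then show ?thesis using False by (auto simp: indicator_def)
    qed
    then show "AE \<omega> in M. (\<lambda>n. indicator C \<omega> * indicator {\<omega>. ennreal (r n \<omega>) < \<tau> \<omega>} \<omega> :: ennreal) \<longlonglongrightarrow> indicator B \<omega> * indicator {\<omega>. \<sigma> \<omega> < \<tau> \<omega>} \<omega>"
      by simp
    show "AE \<omega> in M. indicator C \<omega> * indicator {\<omega>. ennreal (r n \<omega>) < \<tau> \<omega>} \<omega> \<le> (1 :: ennreal)" for n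
      by (simp add: indicator_def)
  qed (measurable, rule one)
  moreover have "(\<lambda>n. \<integral>\<^sup>+\<omega>. indicator C \<omega> * ennreal (Y (r n \<omega>) \<omega>) \<partial>M) \<longlonglongrightarrow> (\<integral>\<^sup>+\<omega>. indicator C \<omega> * ennreal (Y (enn2real (\<sigma> \<omega>)) \<omega>) \<partial>M)"
  proof (rule nn_integral_dominated_convergence[where w = "\<lambda>_. 1"])
    note [measurable] = Y_at_measurable[OF r_meas r0]
    have [measurable]: "(\<lambda>\<omega>. Y (enn2real (\<sigma> \<omega>)) \<omega>) \<in> borel_measurable M"
      by (rule Y_at_measurable) simp_all
    show "(\<lambda>\<omega>. indicator C \<omega> * ennreal (Y (r n \<omega>) \<omega>)) \<in> borel_measurable M" for n by measurable
    show "(\<lambda>\<omega>. indicator C \<omega> * ennreal (Y (enn2real (\<sigma> \<omega>)) \<omega>)) \<in> borel_measurable M" by measurable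
    have "(\<lambda>n. indicator C \<omega> * ennreal (Y (r n \<omega>) \<omega>)) \<longlonglongrightarrow> indicator C \<omega> * ennreal (Y (enn2real (\<sigma> \<omega>)) \<omega>)" for \<omega>
    proof -
      have "(\<lambda>n. Y (r n \<omega>) \<omega>) \<longlonglongrightarrow> Y (enn2real (\<sigma> \<omega>)) \<omega>"
      proof (rule right_cont_seq[of "\<lambda>t. Y t \<omega>"])
        show "((\<lambda>t. Y t \<omega>) \<longlongrightarrow> Y (enn2real (\<sigma> \<omega>)) \<omega>) (at_right (enn2real (\<sigma> \<omega>)))"
          using Y_rc[of \<omega>] by (simp add: right_cont_path_def)
      qed (rule r_lim r_ge)+
      then show ?thesis by (cases "\<omega> \<in> C") (simp_all add: tendsto_ennrealI)
    qed
    then show "AE \<omega> in M. (\<lambda>n. indicator C \<omega> * ennreal (Y (r n \<omega>) \<omega>)) \<longlonglongrightarrow> indicator C \<omega> * ennreal (Y (enn2real (\<sigma> \<omega>)) \<omega>)"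
      by simp
    \<comment> \<open>The bound by one holds almost surely at each fixed time. Only the countably
      many grid times occur, so one null set is enough.\<close>
    have "AE \<omega> in M. \<forall>n j. Y (q n j) \<omega> \<le> 1"
      unfolding AE_all_countable using Y_le_1[OF q0] by blast
    then show "AE \<omega> in M. indicator C \<omega> * ennreal (Y (r n \<omega>) \<omega>) \<le> 1" for n
    proof eventually_elim
      case (elim \<omega>)
      then show ?case by (cases "\<omega> \<in> C") (simp_all add: r_def)
    qed
  qed (simp, rule one)
  ultimately have "(\<integral>\<^sup>+\<omega>. indicator B \<omega> * indicator {\<omega>. \<sigma> \<omega> < \<tau> \<omega>} \<omega> \<partial>M) = (\<integral>\<^sup>+\<omega>. indicator C \<omega> * ennreal (Y (enn2real (\<sigma> \<omega>)) \<omega>) \<partial>M)"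
    unfolding eq by (rule LIMSEQ_unique)
  also have "\<dots> = (\<integral>\<^sup>+\<omega>. indicator B \<omega> * (indicator {\<omega>. \<sigma> \<omega> < \<infinity>} \<omega> * ennreal (Y (enn2real (\<sigma> \<omega>)) \<omega>)) \<partial>M)"
    by (rule nn_integral_cong) (simp add: C_def indicator_def)
  finally show ?thesis .
qed

lemma key_weighted:
  assumes \<sigma>: "stop_time M F \<sigma>" and f: "f \<in> borel_measurable (stop_sigma M F \<sigma>)"
  shows "(\<integral>\<^sup>+\<omega>. f \<omega> * indicator {\<omega>. \<sigma> \<omega> < \<tau> \<omega>} \<omega> \<partial>M) =
    (\<integral>\<^sup>+\<omega>. f \<omega> * (indicator {\<omega>. \<sigma> \<omega> < \<infinity>} \<omega> * ennreal (Y (enn2real (\<sigma> \<omega>)) \<omega>)) \<partial>M)"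
proof -
  have [measurable]: "\<sigma> \<in> borel_measurable M" by (rule stop_time_measurable[OF \<sigma>])
  have [measurable]: "(\<lambda>\<omega>. Y (enn2real (\<sigma> \<omega>)) \<omega>) \<in> borel_measurable M"
    by (rule Y_at_measurable) simp_all
  have m1: "(\<lambda>\<omega>. indicator {\<omega>. \<sigma> \<omega> < \<tau> \<omega>} \<omega> :: ennreal) \<in> borel_measurable M" by measurable
  have m2: "(\<lambda>\<omega>. indicator {\<omega>. \<sigma> \<omega> < \<infinity>} \<omega> * ennreal (Y (enn2real (\<sigma> \<omega>)) \<omega>)) \<in> borel_measurable M" by measurable
  show ?thesis
    by (rule antisym) (rule weighted_le[OF subalgebra_stop_sigma[OF \<sigma>] _ _ _ f], (rule m1 m2 | (rule eq_refl, simp only: key_stop[OF \<sigma>]))+)+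
qed

section \<open>Positivity of \<open>L\<close> up to and including \<tau>\<close>

lemma L_tau: "AE \<omega> in M. L (enn2real (\<tau> \<omega>)) \<omega> \<noteq> 0"
proof -
  define E where "E = {(t, \<omega>) \<in> {0..} \<times> space M. L t \<omega> \<in> {0}}"
  have E: "E \<in> sets Opt"
    unfolding E_def by (rule Opt_basic) (use regularD[OF L(1)] in auto)
  have "(\<integral>\<^sup>+\<omega>. ennreal (indicator E (enn2real (\<tau> \<omega>), \<omega>)) \<partial>M) =
    (\<integral>\<^sup>+\<omega>. (\<integral>\<^sup>+u. ennreal (indicator E (u, \<omega>) * L u \<omega>) * indicator {0..} u \<partial>\<kappa> \<omega>) \<partial>M)"
    \<comment> \<open>The representation carries the factor \<open>L\<close>, which cancels the
      indicator of \<open>{L = 0}\<close> at every time.\<close>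
    by (rule represent[OF optional_indicator[OF E]]) simp
  also have "\<dots> = 0"
  proof -
    have z: "ennreal (indicator E (u, \<omega>) * L u \<omega>) * indicator {0..} u = 0" for u \<omega>
      by (auto simp: E_def indicator_def)
    show ?thesis by (simp only: z nn_integral_const mult_zero_left)
  qed
  finally have "(\<integral>\<^sup>+\<omega>. ennreal (indicator E (enn2real (\<tau> \<omega>), \<omega>)) \<partial>M) = 0" .
  moreover have "(\<lambda>\<omega>. ennreal (indicator E (enn2real (\<tau> \<omega>), \<omega>))) \<in> borel_measurable M"
  proof -
    have "(\<lambda>\<omega>. (enn2real (\<tau> \<omega>), \<omega>)) \<in> measurable M Opt"
      by (rule time_point_measurable) simp_all
    then show ?thesis using E by measurable
  qed
  ultimately have "AE \<omega> in M. ennreal (indicator E (enn2real (\<tau> \<omega>), \<omega>)) = 0"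
    by (simp only: nn_integral_0_iff_AE)
  then show ?thesis
    using AE_space
  proof eventually_elim
    case (elim \<omega>)
    then show ?case by (auto simp: E_def indicator_def split: if_splits)
  qed
qed

text \<open>The debut belongs to a strict inequality: before it \<open>L\<close> is at least
  \<open>1 / Suc n\<close>, while at it right-continuity gives only that \<open>L\<close> is at most
  \<open>1 / Suc n\<close>. A jump of \<open>L\<close> to zero at this very time is
  possible.\<close>

definition level :: "nat \<Rightarrow> 'a \<Rightarrow> ennreal" where
  "level n = debut {(t, \<omega>) \<in> {0..} \<times> space M. L t \<omega> \<in> {..<1 / real (Suc n)}}"

lemma stop_time_level: "stop_time M F (level n)"
  unfolding level_def by (intro stop_time_debut Opt_basic) (use regularD[OF L(1)] in auto)

lemma level_before:
  assumes "0 \<le> u" "ennreal u < level n \<omega>" "\<omega> \<in> space M"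
  shows "1 / real (Suc n) \<le> L u \<omega>"
proof (rule ccontr)
  assume "\<not> ?thesis"
  then have "ennreal u \<in> {ennreal t | t. (t, \<omega>) \<in> {(t, \<omega>) \<in> {0..} \<times> space M. L t \<omega> \<in> {..<1 / real (Suc n)}}}"
    using assms by auto
  then have "level n \<omega> \<le> ennreal u"
    unfolding level_def debut_def by (rule Inf_lower)
  then show False using assms(2) by simp
qed

lemma level_at:
  assumes "level n \<omega> < \<infinity>"
  shows "L (enn2real (level n \<omega>)) \<omega> \<le> 1 / real (Suc n)"
proof -
  let ?E = "{(t, \<omega>) \<in> {0..} \<times> space M. L t \<omega> \<in> {..<1 / real (Suc n)}}"
  let ?E' = "{(t, \<omega>) \<in> {0..} \<times> space M. L t \<omega> \<in> {..1 / real (Suc n)}}"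
  have "right_adherent ?E (enn2real (level n \<omega>)) \<omega>"
    using assms unfolding level_def by (intro right_adherent_debut) auto
  then have "right_adherent ?E' (enn2real (level n \<omega>)) \<omega>"
    by (rule right_adherent_mono) auto
  moreover have "right_closed ?E'"
    by (rule right_closed_vimage) (use regularD[OF L(1)] in auto)
  ultimately have "(enn2real (level n \<omega>), \<omega>) \<in> ?E'"
    by (intro right_closedD) auto
  then show ?thesis by simp
qed

lemma level_mono: "level n \<omega> \<le> level (Suc n) \<omega>"
proof -
  have "1 / real (Suc (Suc n)) \<le> 1 / real (Suc n)" by (simp add: frac_le)
  then show ?thesis
    unfolding level_def debut_def by (intro Inf_superset_mono) force
qed

text \<open>By \<open>key_weighted\<close> this probability is the expectation of \<open>Y\<close>
  at \<open>level n\<close>, and \<open>Y \<le> L\<close>.\<close>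

lemma level_less_tau: "emeasure M {\<omega> \<in> space M. level n \<omega> < \<tau> \<omega>} \<le> ennreal (1 / real (Suc n))"
proof -
  have [measurable]: "level n \<in> borel_measurable M" by (rule stop_time_measurable[OF stop_time_level])
  have "emeasure M {\<omega> \<in> space M. level n \<omega> < \<tau> \<omega>} = (\<integral>\<^sup>+\<omega>. indicator {\<omega> \<in> space M. level n \<omega> < \<tau> \<omega>} \<omega> \<partial>M)"
    by (rule nn_integral_indicator[symmetric]) measurable
  also have "\<dots> = (\<integral>\<^sup>+\<omega>. 1 * indicator {\<omega>. level n \<omega> < \<tau> \<omega>} \<omega> \<partial>M)"
    by (rule nn_integral_cong) (simp add: indicator_def)
  also have "\<dots> = (\<integral>\<^sup>+\<omega>. 1 * (indicator {\<omega>. level n \<omega> < \<infinity>} \<omega> * ennreal (Y (enn2real (level n \<omega>)) \<omega>)) \<partial>M)"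
    by (rule key_weighted[OF stop_time_level]) simp
  also have "\<dots> \<le> (\<integral>\<^sup>+\<omega>. ennreal (1 / real (Suc n)) \<partial>M)"
  proof (rule nn_integral_mono)
    fix \<omega>
    show "1 * (indicator {\<omega>. level n \<omega> < \<infinity>} \<omega> * ennreal (Y (enn2real (level n \<omega>)) \<omega>)) \<le> ennreal (1 / real (Suc n))"
    proof (cases "level n \<omega> < \<infinity>")
      case True
      have "Y (enn2real (level n \<omega>)) \<omega> \<le> L (enn2real (level n \<omega>)) \<omega> * 1"
        unfolding Y_def using regularD(4)[OF L(1)] increasing_processD(6)[OF K] by (intro mult_left_mono) simp_all
      also have "\<dots> \<le> 1 / real (Suc n)" using level_at[OF True] by simp
      finally show ?thesis using True by (simp add: ennreal_leI del: of_nat_Suc)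
    qed simp
  qed
  also have "\<dots> = ennreal (1 / real (Suc n))" by (simp add: emeasure_space_1)
  finally show ?thesis .
qed

text \<open>This says that \<open>L\<close> is bounded away from zero on \<open>[0, \<tau>)\<close>.
  Positivity of the values alone would not prevent a left limit equal to zero.\<close>

lemma tau_le_level: "AE \<omega> in M. \<exists>n. \<tau> \<omega> \<le> level n \<omega>"
proof -
  have [measurable]: "level n \<in> borel_measurable M" for n by (rule stop_time_measurable[OF stop_time_level])
  let ?N = "{\<omega> \<in> space M. \<forall>n. level n \<omega> < \<tau> \<omega>}"
  have N: "?N \<in> sets M" by measurable
  have "emeasure M ?N \<le> ennreal (1 / real (Suc n))" for n
  proof -
    have "emeasure M ?N \<le> emeasure M {\<omega> \<in> space M. level n \<omega> < \<tau> \<omega>}"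
      by (rule emeasure_mono) auto
    then show ?thesis using level_less_tau[of n] by (rule order_trans)
  qed
  moreover have "(\<lambda>n. ennreal (1 / real (Suc n))) \<longlonglongrightarrow> ennreal 0"
    by (rule tendsto_ennrealI) (use LIMSEQ_inverse_real_of_nat in \<open>simp add: inverse_eq_divide\<close>)
  ultimately have "emeasure M ?N \<le> ennreal 0"
    by (intro LIMSEQ_le_const) auto
  then have "?N \<in> null_sets M" using N by (intro null_setsI) simp_all
  then have "AE \<omega> in M. \<omega> \<notin> ?N" by (rule AE_not_in)
  then show ?thesis
    using AE_space by eventually_elim (auto simp: not_less)
qed

end

section \<open>From conditional expectations to inequalities between integrals\<close>

lemma AE_real_cond_exp_nonneg:
  assumes sub: "subalgebra M N" and sf: "sigma_finite_subalgebra M N" and f: "AE \<omega> in M. 0 \<le> f \<omega>" "f \<in> borel_measurable M"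
  shows "AE \<omega> in M. real_cond_exp M N f \<omega> = enn2real (nn_cond_exp M N (\<lambda>\<omega>. ennreal (f \<omega>)) \<omega>)"
proof -
  interpret sigma_finite_subalgebra M N by (rule sf)
  have "AE \<omega> in M. nn_cond_exp M N (\<lambda>\<omega>. ennreal (- f \<omega>)) \<omega> = nn_cond_exp M N (\<lambda>_. 0) \<omega>"
    by (rule nn_cond_exp_cong) (use f in \<open>auto elim: eventually_mono simp: ennreal_neg\<close>)
  moreover have "AE \<omega> in M. 0 = nn_cond_exp M N (\<lambda>_. 0) \<omega>"
    using nn_cond_exp_F_meas[of "\<lambda>_. 0"] by simp
  ultimately show ?thesis
    by eventually_elim (simp add: real_cond_exp_def)
qed

text \<open>The inequality is tested on the event where the claim fails. There the finite integral
  of \<open>g\<close> is cancelled, which leaves a nonnegative excess with integral zero.\<close>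

lemma nn_cond_exp_le:
  assumes sf: "sigma_finite_subalgebra M N" and f: "f \<in> borel_measurable M" and g: "g \<in> borel_measurable N"
    and fin: "(\<integral>\<^sup>+\<omega>. g \<omega> \<partial>M) < \<infinity>"
    and le: "\<And>B. B \<in> sets N \<Longrightarrow> (\<integral>\<^sup>+\<omega>. indicator B \<omega> * f \<omega> \<partial>M) \<le> (\<integral>\<^sup>+\<omega>. indicator B \<omega> * g \<omega> \<partial>M)"
  shows "AE \<omega> in M. nn_cond_exp M N f \<omega> \<le> g \<omega>"
proof -
  interpret sigma_finite_subalgebra M N by (rule sf)
  have sp: "space N = space M" using subalg by (simp add: subalgebra_def)
  note [measurable] = f g
  have gM[measurable]: "g \<in> borel_measurable M" by (rule measurable_from_subalg[OF subalg g])
  define n where "n = nn_cond_exp M N f"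
  have nN[measurable]: "n \<in> borel_measurable N" and nM[measurable]: "n \<in> borel_measurable M"
    unfolding n_def by measurable
  define B where "B = {\<omega> \<in> space N. g \<omega> < n \<omega>}"
  have B: "B \<in> sets N" unfolding B_def by measurable
  then have BM[measurable]: "B \<in> sets M" using subalg by (auto simp: subalgebra_def)
  have "(\<integral>\<^sup>+\<omega>. indicator B \<omega> * g \<omega> + indicator B \<omega> * (n \<omega> - g \<omega>) \<partial>M) = (\<integral>\<^sup>+\<omega>. indicator B \<omega> * n \<omega> \<partial>M)"
    by (rule nn_integral_cong) (auto simp: B_def indicator_def add_diff_eq_iff_ennreal intro!: diff_add_self_ennreal[THEN trans[OF add.commute]] dest: less_imp_le)
  also have "\<dots> = (\<integral>\<^sup>+\<omega>. indicator B \<omega> * f \<omega> \<partial>M)"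
    unfolding n_def using B by (intro nn_cond_exp_intg) simp_all
  also have "\<dots> \<le> (\<integral>\<^sup>+\<omega>. indicator B \<omega> * g \<omega> \<partial>M) + 0" using le[OF B] by simp
  finally have "(\<integral>\<^sup>+\<omega>. indicator B \<omega> * g \<omega> \<partial>M) + (\<integral>\<^sup>+\<omega>. indicator B \<omega> * (n \<omega> - g \<omega>) \<partial>M) \<le> (\<integral>\<^sup>+\<omega>. indicator B \<omega> * g \<omega> \<partial>M) + 0"
  proof (subst nn_integral_add[symmetric])
    show "(\<lambda>\<omega>. indicator B \<omega> * g \<omega>) \<in> borel_measurable M" "(\<lambda>\<omega>. indicator B \<omega> * (n \<omega> - g \<omega>)) \<in> borel_measurable M"
      by measurable
  qed
  moreover have "(\<integral>\<^sup>+\<omega>. indicator B \<omega> * g \<omega> \<partial>M) \<noteq> \<infinity>"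
  proof -
    have "(\<integral>\<^sup>+\<omega>. indicator B \<omega> * g \<omega> \<partial>M) \<le> (\<integral>\<^sup>+\<omega>. g \<omega> \<partial>M)"
      by (rule nn_integral_mono) (simp add: indicator_def)
    then show ?thesis using fin by auto
  qed
  ultimately have "(\<integral>\<^sup>+\<omega>. indicator B \<omega> * (n \<omega> - g \<omega>) \<partial>M) \<le> 0"
    by (simp only: ennreal_add_left_cancel_le) simp
  then have "(\<integral>\<^sup>+\<omega>. indicator B \<omega> * (n \<omega> - g \<omega>) \<partial>M) = 0" by simp
  then have "AE \<omega> in M. indicator B \<omega> * (n \<omega> - g \<omega>) = 0"
    by (subst (asm) nn_integral_0_iff_AE) measurable
  then show ?thesis
    using AE_space unfolding n_def[symmetric]
  proof eventually_elim
    case (elim \<omega>)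
    show ?case
    proof (rule ccontr)
      assume "\<not> n \<omega> \<le> g \<omega>"
      then have "g \<omega> < n \<omega>" by simp
      then have "0 < n \<omega> - g \<omega>" by (simp add: diff_gr0_ennreal)
      moreover have "\<omega> \<in> B" using \<open>g \<omega> < n \<omega>\<close> elim(2) sp by (simp add: B_def)
      ultimately show False using elim(1) by simp
    qed
  qed
qed

context usual_filtration
begin

lemma sigma_finite_subalgebraI: "subalgebra M N \<Longrightarrow> sigma_finite_subalgebra M N"
  by (intro finite_measure_subalgebra_is_sigma_finite finite_measure_subalgebra.intro finite_measure_subalgebra_axioms.intro)
    (unfold_locales)

lemma AE_nn_cond_exp:
  assumes sub: "subalgebra M N" and f: "integrable M f" "AE \<omega> in M. 0 \<le> f \<omega>"
  shows "AE \<omega> in M. nn_cond_exp M N (\<lambda>\<omega>. ennreal (f \<omega>)) \<omega> = ennreal (real_cond_exp M N f \<omega>)"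
proof -
  interpret sigma_finite_subalgebra M N by (rule sigma_finite_subalgebraI[OF sub])
  have [measurable]: "f \<in> borel_measurable M" using f(1) by simp
  have "(\<integral>\<^sup>+\<omega>. nn_cond_exp M N (\<lambda>\<omega>. ennreal (f \<omega>)) \<omega> \<partial>M) = (\<integral>\<^sup>+\<omega>. ennreal (f \<omega>) \<partial>M)"
    using nn_cond_exp_intg[of "\<lambda>_. 1" "\<lambda>\<omega>. ennreal (f \<omega>)"] by simp
  also have "\<dots> < \<infinity>"
    using nn_integral_eq_integral[OF f] by simp
  finally have "AE \<omega> in M. nn_cond_exp M N (\<lambda>\<omega>. ennreal (f \<omega>)) \<omega> \<noteq> \<infinity>"
    by (intro nn_integral_PInf_AE) simp_all
  moreover have "AE \<omega> in M. real_cond_exp M N f \<omega> = enn2real (nn_cond_exp M N (\<lambda>\<omega>. ennreal (f \<omega>)) \<omega>)"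
    by (rule AE_real_cond_exp_nonneg[OF sub sigma_finite_subalgebra_axioms f(2)]) simp
  ultimately show ?thesis
    by eventually_elim (simp add: top.not_eq_extremum)
qed

lemma nn_integral_cond_exp:
  assumes sub: "subalgebra M N" and f: "integrable M f" "AE \<omega> in M. 0 \<le> f \<omega>" and B: "B \<in> sets N"
  shows "(\<integral>\<^sup>+\<omega>. indicator B \<omega> * ennreal (f \<omega>) \<partial>M) = (\<integral>\<^sup>+\<omega>. indicator B \<omega> * ennreal (real_cond_exp M N f \<omega>) \<partial>M)"
proof -
  interpret sigma_finite_subalgebra M N by (rule sigma_finite_subalgebraI[OF sub])
  have "(\<integral>\<^sup>+\<omega>. indicator B \<omega> * ennreal (f \<omega>) \<partial>M) = (\<integral>\<^sup>+\<omega>. indicator B \<omega> * nn_cond_exp M N (\<lambda>\<omega>. ennreal (f \<omega>)) \<omega> \<partial>M)"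
    by (rule nn_cond_exp_intg[symmetric]) (use B f(1) in simp_all)
  also have "\<dots> = (\<integral>\<^sup>+\<omega>. indicator B \<omega> * ennreal (real_cond_exp M N f \<omega>) \<partial>M)"
    by (rule nn_integral_cong_AE) (use AE_nn_cond_exp[OF sub f] in eventually_elim, simp)
  finally show ?thesis .
qed

lemma supermartingale_nn_super:
  assumes X: "regular X" and sm: "\<And>s t. 0 \<le> s \<Longrightarrow> s \<le> t \<Longrightarrow> AE \<omega> in M. real_cond_exp M (F s) (X t) \<omega> \<le> X s \<omega>"
    and int: "\<And>t. 0 \<le> t \<Longrightarrow> integrable M (X t)"
  shows "nn_super X"
proof (rule nn_superI[OF X])
  fix s t B assume s: "(0::real) \<le> s" "s \<le> t" and B: "B \<in> sets (F s)"
  then have t: "0 \<le> t" by simp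
  have "(\<integral>\<^sup>+\<omega>. indicator B \<omega> * ennreal (X t \<omega>) \<partial>M) = (\<integral>\<^sup>+\<omega>. indicator B \<omega> * ennreal (real_cond_exp M (F s) (X t) \<omega>) \<partial>M)"
    by (rule nn_integral_cond_exp[OF subalgebra_F[OF s(1)] int[OF t] _ B]) (use regularD(4)[OF X t] in simp)
  also have "\<dots> \<le> (\<integral>\<^sup>+\<omega>. indicator B \<omega> * ennreal (X s \<omega>) \<partial>M)"
    by (rule nn_integral_mono_AE) (use sm[OF s] in eventually_elim, intro mult_left_mono ennreal_leI, simp_all)
  finally show "(\<integral>\<^sup>+\<omega>. indicator B \<omega> * ennreal (X t \<omega>) \<partial>M) \<le> (\<integral>\<^sup>+\<omega>. indicator B \<omega> * ennreal (X s \<omega>) \<partial>M)" .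
qed

lemma martingale_nn_mart:
  assumes X: "regular X" and sm: "\<And>s t. 0 \<le> s \<Longrightarrow> s \<le> t \<Longrightarrow> AE \<omega> in M. real_cond_exp M (F s) (X t) \<omega> = X s \<omega>"
    and int: "\<And>t. 0 \<le> t \<Longrightarrow> integrable M (X t)"
  shows "nn_mart X"
proof (rule nn_martI[OF X])
  fix s t B assume s: "(0::real) \<le> s" "s \<le> t" and B: "B \<in> sets (F s)"
  then have t: "0 \<le> t" by simp
  have "(\<integral>\<^sup>+\<omega>. indicator B \<omega> * ennreal (X t \<omega>) \<partial>M) = (\<integral>\<^sup>+\<omega>. indicator B \<omega> * ennreal (real_cond_exp M (F s) (X t) \<omega>) \<partial>M)"
    by (rule nn_integral_cond_exp[OF subalgebra_F[OF s(1)] int[OF t] _ B]) (use regularD(4)[OF X t] in simp)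
  also have "\<dots> = (\<integral>\<^sup>+\<omega>. indicator B \<omega> * ennreal (X s \<omega>) \<partial>M)"
    by (rule nn_integral_cong_AE) (use sm[OF s] in eventually_elim, simp)
  finally show "(\<integral>\<^sup>+\<omega>. indicator B \<omega> * ennreal (X t \<omega>) \<partial>M) = (\<integral>\<^sup>+\<omega>. indicator B \<omega> * ennreal (X s \<omega>) \<partial>M)" .
qed

text \<open>On \<open>{s < T n}\<close> the stopped process starts from \<open>X s\<close>; letting \<open>n\<close> tend to infinity is Fatou's lemma.\<close>

lemma nn_super_localised:
  assumes X: "regular X" and T: "\<And>n :: nat. stop_time M F (T n)" and lim: "AE \<omega> in M. (\<lambda>n. T n \<omega>) \<longlonglongrightarrow> \<infinity>"
    and mart: "\<And>n. nn_mart (stopped (T n) X)"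
  shows "nn_super X"
proof (rule nn_superI[OF X])
  fix s t B assume s: "(0::real) \<le> s" "s \<le> t" and B: "B \<in> sets (F s)"
  then have t: "0 \<le> t" by simp
  define Bn where "Bn n = B \<inter> {\<omega> \<in> space M. ennreal s < T n \<omega>}" for n
  have Bn: "Bn n \<in> sets (F s)" for n
    unfolding Bn_def by (rule sets.Int[OF B stop_timeD_gt[OF T s(1)]])
  have [measurable]: "Bn n \<in> sets M" "B \<in> sets M" for n by (rule sets_F_M[OF s(1)], rule Bn B)+
  note [measurable] = regularD(6)[OF regular_stopped[OF X T] t]
  have "(\<integral>\<^sup>+\<omega>. indicator B \<omega> * ennreal (X t \<omega>) \<partial>M) = (\<integral>\<^sup>+\<omega>. liminf (\<lambda>n. indicator (Bn n) \<omega> * ennreal (stopped (T n) X t \<omega>)) \<partial>M)"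
  proof (rule nn_integral_cong_AE)
    show "AE \<omega> in M. indicator B \<omega> * ennreal (X t \<omega>) = liminf (\<lambda>n. indicator (Bn n) \<omega> * ennreal (stopped (T n) X t \<omega>))"
      using lim AE_space
    proof eventually_elim
      case (elim \<omega>)
      have "\<forall>\<^sub>F n in sequentially. ennreal t < T n \<omega>"
        using elim(1) by (rule order_tendstoD(1)) simp
      then have "\<forall>\<^sub>F n in sequentially. indicator (Bn n) \<omega> * ennreal (stopped (T n) X t \<omega>) = indicator B \<omega> * ennreal (X t \<omega>)"
      proof eventually_elim
        case (elim n)
        then have "ennreal s < T n \<omega>" using ennreal_leI[OF s(2)] by (rule le_less_trans[rotated])
        moreover have "\<not> T n \<omega> \<le> ennreal t" using elim by (simp only: not_le)
        ultimately show ?case using t \<open>\<omega> \<in> space M\<close> by (simp add: Bn_def stopped_eq indicator_def)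
      qed
      then have "(\<lambda>n. indicator (Bn n) \<omega> * ennreal (stopped (T n) X t \<omega>)) \<longlonglongrightarrow> indicator B \<omega> * ennreal (X t \<omega>)"
        by (rule tendsto_eventually)
      then show ?case by (rule lim_imp_Liminf[OF sequentially_bot, symmetric])
    qed
  qed
  also have "\<dots> \<le> liminf (\<lambda>n. \<integral>\<^sup>+\<omega>. indicator (Bn n) \<omega> * ennreal (stopped (T n) X t \<omega>) \<partial>M)"
    by (rule nn_integral_liminf) measurable
  also have "\<dots> \<le> liminf (\<lambda>n. \<integral>\<^sup>+\<omega>. indicator B \<omega> * ennreal (X s \<omega>) \<partial>M)"
  proof (rule Liminf_mono, rule always_eventually, rule allI)
    fix n
    have "(\<integral>\<^sup>+\<omega>. indicator (Bn n) \<omega> * ennreal (stopped (T n) X t \<omega>) \<partial>M) = (\<integral>\<^sup>+\<omega>. indicator (Bn n) \<omega> * ennreal (stopped (T n) X s \<omega>) \<partial>M)"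
      by (rule nn_martD[OF mart s]) (use Bn in simp)
    also have "\<dots> \<le> (\<integral>\<^sup>+\<omega>. indicator B \<omega> * ennreal (X s \<omega>) \<partial>M)"
      by (rule nn_integral_mono) (use s in \<open>auto simp: Bn_def stopped_eq indicator_def not_le[symmetric]\<close>)
    finally show "(\<integral>\<^sup>+\<omega>. indicator (Bn n) \<omega> * ennreal (stopped (T n) X t \<omega>) \<partial>M) \<le> (\<integral>\<^sup>+\<omega>. indicator B \<omega> * ennreal (X s \<omega>) \<partial>M)" .
  qed
  also have "\<dots> = (\<integral>\<^sup>+\<omega>. indicator B \<omega> * ennreal (X s \<omega>) \<partial>M)"
    by (rule Liminf_const) simp
  finally show "(\<integral>\<^sup>+\<omega>. indicator B \<omega> * ennreal (X t \<omega>) \<partial>M) \<le> (\<integral>\<^sup>+\<omega>. indicator B \<omega> * ennreal (X s \<omega>) \<partial>M)" .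
qed

end

context representation
begin

text \<open>A stopping time whose graph lies where the processes differ must be infinite almost
  surely: at a finite stopping time both are versions of the same conditional probability,
  \<open>Z\<close> by the definition of the projection and \<open>Y\<close> by
  \<open>key_stop\<close>.\<close>

lemma azema_indistinguishable:
  assumes Z: "azema_supermartingale M F \<tau> Z"
  shows "AE \<omega> in M. \<forall>t\<ge>0. Z t \<omega> = Y t \<omega>"
proof -
  have Zo: "(\<lambda>(t, \<omega>). Z t \<omega>) \<in> borel_measurable Opt"
    using Z by (simp add: azema_supermartingale_def optional_projection_def optional_def)
  have Yo: "(\<lambda>(t, \<omega>). Y t \<omega>) \<in> borel_measurable Opt"
    by (rule Opt_cadlag_measurable[OF Y_adapted]) (simp add: Y_cadlag)
  define H where "H = {p \<in> space Opt. (case p of (t, \<omega>) \<Rightarrow> Z t \<omega>) \<noteq> (case p of (t, \<omega>) \<Rightarrow> Y t \<omega>)}"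
  have H: "H \<in> sets Opt" unfolding H_def using Zo Yo by measurable
  have "outer_measure_of M (snd ` H) = 0"
  proof (rule ccontr)
    assume "outer_measure_of M (snd ` H) \<noteq> 0"
    then have "0 < outer_measure_of M (snd ` H)" by (simp add: zero_less_iff_neq_zero)
    from optional_section[OF H this] obtain T where T: "stop_time M F T"
      and TH: "\<And>\<omega>. T \<omega> < \<infinity> \<Longrightarrow> (enn2real (T \<omega>), \<omega>) \<in> H" and pos: "0 < emeasure M {\<omega> \<in> space M. T \<omega> < \<infinity>}"
      by metis
    let ?N = "stop_sigma M F T"
    let ?f = "\<lambda>\<omega>. if T \<omega> < \<infinity> then at_time (\<lambda>t \<omega>. if ennreal t < \<tau> \<omega> then 1 else 0 :: real) T \<omega> else 0"
    let ?g = "\<lambda>\<omega>. if T \<omega> < \<infinity> then Y (enn2real (T \<omega>)) \<omega> else 0"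
    have sub: "subalgebra M ?N" by (rule subalgebra_stop_sigma[OF T])
    interpret N: sigma_finite_subalgebra M ?N by (rule sigma_finite_subalgebraI[OF sub])
    have [measurable]: "T \<in> borel_measurable M" by (rule stop_time_measurable[OF T])
    have f_eq: "?f \<omega> = indicator {\<omega>. T \<omega> < \<tau> \<omega>} \<omega>" for \<omega>
    proof (cases "T \<omega> < \<infinity>")
      case False
      then have "T \<omega> = \<infinity>" by (simp only: not_less infinity_ennreal_def top_unique)
      then show ?thesis by simp
    next
      case True
      then have "ennreal (enn2real (T \<omega>)) = T \<omega>" by (simp only: ennreal_enn2real infinity_ennreal_def)
      then show ?thesis using True by (simp add: at_time_def indicator_def)
    qed
    have fm: "?f \<in> borel_measurable M" unfolding f_eq by measurable
    have gm: "?g \<in> borel_measurable ?N" by (rule sampled_measurable[OF Y_adapted Y_rc T])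
    have "AE \<omega> in M. ennreal (?g \<omega>) = nn_cond_exp M ?N (\<lambda>\<omega>. ennreal (?f \<omega>)) \<omega>"
    proof (rule N.nn_cond_exp_charact)
      fix B assume B: "B \<in> sets ?N"
      have "(\<integral>\<^sup>+\<omega>\<in>B. ennreal (?f \<omega>) \<partial>M) = (\<integral>\<^sup>+\<omega>. indicator B \<omega> * indicator {\<omega>. T \<omega> < \<tau> \<omega>} \<omega> \<partial>M)"
        unfolding f_eq by (rule nn_integral_cong) (simp add: indicator_def)
      also have "\<dots> = (\<integral>\<^sup>+\<omega>. indicator B \<omega> * (indicator {\<omega>. T \<omega> < \<infinity>} \<omega> * ennreal (Y (enn2real (T \<omega>)) \<omega>)) \<partial>M)"
        by (rule key_stop[OF T B])
      also have "\<dots> = (\<integral>\<^sup>+\<omega>\<in>B. ennreal (?g \<omega>) \<partial>M)"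
        by (rule nn_integral_cong) (simp add: indicator_def)
      finally show "(\<integral>\<^sup>+\<omega>\<in>B. ennreal (?f \<omega>) \<partial>M) = (\<integral>\<^sup>+\<omega>\<in>B. ennreal (?g \<omega>) \<partial>M)" .
    qed (use fm gm in measurable)
    moreover have "AE \<omega> in M. real_cond_exp M ?N ?f \<omega> = enn2real (nn_cond_exp M ?N (\<lambda>\<omega>. ennreal (?f \<omega>)) \<omega>)"
      by (rule AE_real_cond_exp_nonneg[OF sub N.sigma_finite_subalgebra_axioms _ fm]) (unfold f_eq, simp)
    moreover have "AE \<omega> in M. T \<omega> < \<infinity> \<longrightarrow> at_time Z T \<omega> = real_cond_exp M ?N ?f \<omega>"
      by (rule Z[unfolded azema_supermartingale_def optional_projection_def, THEN conjunct2, THEN spec, THEN mp, OF T])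
    ultimately have "AE \<omega> in M. \<not> T \<omega> < \<infinity>"
    proof eventually_elim
      case (elim \<omega>)
      show ?case
      proof
        assume fin: "T \<omega> < \<infinity>"
        have "Z (enn2real (T \<omega>)) \<omega> = enn2real (ennreal (?g \<omega>))"
          unfolding elim(1) elim(2)[symmetric] using elim(3) fin by (simp add: at_time_def)
        also have "\<dots> = Y (enn2real (T \<omega>)) \<omega>" using fin Y_nonneg by simp
        finally show False using TH[OF fin] by (simp add: H_def)
      qed
    qed
    then have "emeasure M {\<omega> \<in> space M. T \<omega> < \<infinity>} = 0"
      by (subst (asm) AE_iff_measurable[OF _ refl]) simp_all
    then show False using pos by simp
  qed
  moreover have "snd ` H \<subseteq> space M" by (auto simp: H_def)
  ultimately obtain G where G: "G \<in> sets M" "snd ` H \<subseteq> G" "emeasure M G = 0"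
    using outer_measure_of_attain[of "snd ` H" M] by auto
  have "AE \<omega> in M. \<omega> \<notin> G" by (rule AE_not_in) (use G in auto)
  then show ?thesis
    using AE_space
  proof eventually_elim
    case (elim \<omega>)
    show ?case
    proof (intro allI impI)
      fix t :: real assume t: "0 \<le> t"
      have "\<omega> \<notin> snd ` H" using elim(1) G(2) by blast
      then have "(t, \<omega>) \<notin> H" by force
      then show "Z t \<omega> = Y t \<omega>" using t elim(2) by (simp add: H_def)
    qed
  qed
qed

end

section \<open>Integrals up to the enlarging time\<close>

context representation
begin

text \<open>Both processes are stopped at the minimum of \<tau> and \<open>T\<close>. Taking
  \<open>T\<close> infinite gives the quotient of the theorem, and other \<open>T\<close> give its
  localisations.\<close>

definition ratio :: "(real \<Rightarrow> 'a \<Rightarrow> real) \<Rightarrow> ('a \<Rightarrow> ennreal) \<Rightarrow> real \<Rightarrow> 'a \<Rightarrow> real" where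
  "ratio X T t \<omega> = stopped (\<lambda>\<omega>. min (\<tau> \<omega>) (T \<omega>)) X t \<omega> / stopped (\<lambda>\<omega>. min (\<tau> \<omega>) (T \<omega>)) L t \<omega>"

text \<open>The part of the mass of \<open>X\<close> that is left over when \<open>L\<close> reaches zero before \<open>K\<close> reaches one.\<close>

definition loss :: "(real \<Rightarrow> 'a \<Rightarrow> real) \<Rightarrow> ('a \<Rightarrow> ennreal) \<Rightarrow> real \<Rightarrow> 'a \<Rightarrow> ennreal" where
  "loss X T t \<omega> = (if stopped T L t \<omega> = 0 then ennreal (stopped T X t \<omega>) * ennreal (1 - stopped T K t \<omega>) else 0)"

lemma quotient_optional:
  assumes X: "regular X"
  shows "(\<lambda>(t, \<omega>). X t \<omega> / L t \<omega>) \<in> borel_measurable Opt"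
proof -
  have [measurable]: "(\<lambda>(t, \<omega>). X t \<omega>) \<in> borel_measurable Opt" "(\<lambda>(t, \<omega>). L t \<omega>) \<in> borel_measurable Opt"
    by (rule Opt_cadlag_measurable; use regularD[OF X] regularD[OF L(1)] in simp)+
  have "(\<lambda>p. (case p of (t, \<omega>) \<Rightarrow> X t \<omega>) / (case p of (t, \<omega>) \<Rightarrow> L t \<omega>)) \<in> borel_measurable Opt"
    by measurable
  then show ?thesis by (simp add: case_prod_unfold)
qed

lemma ratio_eq: "ratio X T t \<omega> = X (enn2real (min (min (\<tau> \<omega>) (T \<omega>)) (ennreal t))) \<omega> / L (enn2real (min (min (\<tau> \<omega>) (T \<omega>)) (ennreal t))) \<omega>"
  by (simp add: ratio_def stopped_def)

lemma ratio_measurable: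
  assumes X: "regular X" and T: "stop_time M F T"
  shows "ratio X T t \<in> borel_measurable M"
proof -
  have [measurable]: "T \<in> borel_measurable M" by (rule stop_time_measurable[OF T])
  have "(\<lambda>\<omega>. (enn2real (min (min (\<tau> \<omega>) (T \<omega>)) (ennreal t)), \<omega>)) \<in> measurable M Opt"
    by (rule time_point_measurable) simp_all
  from measurable_compose[OF this quotient_optional[OF X]] show ?thesis
    by (rule measurable_cong[THEN iffD1, rotated]) (simp add: ratio_eq)
qed

lemma stopped_measurable_M:
  assumes X: "regular X" and T: "stop_time M F T" and t: "0 \<le> t"
  shows "stopped T X t \<in> borel_measurable M"
  by (rule regularD(6)[OF regular_stopped[OF X T] t])

text \<open>After the minimum \<open>R\<close> of \<open>T\<close> and \<open>t\<close> the stopped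
  process stays at its value at \<open>R\<close>. The integral over \<open>(R, t]\<close> is this
  value times \<open>K t - K R\<close>, which merges with the factor \<open>1 - K t\<close> into
  \<open>1 - K R\<close>.\<close>

lemma sint_stopped:
  assumes X: "regular X" and s: "0 \<le> s" "s \<le> t" and T: "ennreal s < T \<omega>"
  shows "sint (stopped T X) K s t \<omega> + ennreal (stopped T X t \<omega>) * ennreal (1 - K t \<omega>) =
    (\<integral>\<^sup>+u. ennreal (X u \<omega>) * indicator {s<..enn2real (min (T \<omega>) (ennreal t))} u \<partial>\<kappa> \<omega>) +
    ennreal (stopped T X t \<omega>) * ennreal (1 - stopped T K t \<omega>)"
proof -
  define R where "R = enn2real (min (T \<omega>) (ennreal t))"
  have t: "0 \<le> t" using s by simp
  have sR: "s \<le> R" "R \<le> t" "0 \<le> R"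
  proof -
    have "ennreal R = min (T \<omega>) (ennreal t)" unfolding R_def by (rule ennreal_enn2real) (simp add: min_less_iff_disj)
    then have "ennreal s \<le> ennreal R" "ennreal R \<le> ennreal t"
      using T ennreal_leI[OF s(2)] by simp_all
    moreover show "0 \<le> R" by (simp add: R_def)
    ultimately show "s \<le> R" "R \<le> t" using t by (simp_all add: ennreal_le_iff)
  qed
  have W: "stopped T X u \<omega> = (if u \<le> R then X u \<omega> else X R \<omega>)" if "0 \<le> u" "u \<le> t" for u
  proof (cases "T \<omega> \<le> ennreal t")
    case True
    then have fin: "T \<omega> < \<infinity>" by (rule le_less_trans) simp
    have R: "R = enn2real (T \<omega>)" using True by (simp add: R_def min_def)
    show ?thesis unfolding stopped_eq[OF that(1)] le_ennreal_iff[OF that(1) fin] R by (auto simp: not_le)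
  next
    case False
    then have R: "R = t" using t by (simp add: R_def enn2real_min)
    have "ennreal u < T \<omega>" by (rule le_less_trans[OF ennreal_leI[OF that(2)]]) (use False in \<open>simp only: not_le\<close>)
    then show ?thesis using that R by (simp only: stopped_eq[OF that(1)] not_le[symmetric]) simp
  qed
  have Wt: "stopped T X t \<omega> = X R \<omega>" "stopped T K t \<omega> = K R \<omega>" by (simp_all add: stopped_def R_def)
  have "sint (stopped T X) K s t \<omega> = (\<integral>\<^sup>+u. ennreal (X u \<omega>) * indicator {s<..R} u + ennreal (X R \<omega>) * indicator {R<..t} u \<partial>\<kappa> \<omega>)"
    unfolding sint_def by (rule nn_integral_cong) (use s sR W in \<open>auto simp: indicator_def\<close>)
  also have "\<dots> = (\<integral>\<^sup>+u. ennreal (X u \<omega>) * indicator {s<..R} u \<partial>\<kappa> \<omega>) + (\<integral>\<^sup>+u. ennreal (X R \<omega>) * indicator {R<..t} u \<partial>\<kappa> \<omega>)"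
    by (rule nn_integral_add[OF path_indicator_measurable[OF X s(1)]]) simp
  also have "(\<integral>\<^sup>+u. ennreal (X R \<omega>) * indicator {R<..t} u \<partial>\<kappa> \<omega>) = ennreal (X R \<omega>) * ennreal (K t \<omega> - K R \<omega>)"
    by (simp add: nn_integral_cmult emeasure_smeas_Ioc[OF increasing_processD(2)[OF K] sR(3,2)])
  finally have "sint (stopped T X) K s t \<omega> + ennreal (stopped T X t \<omega>) * ennreal (1 - K t \<omega>) =
    (\<integral>\<^sup>+u. ennreal (X u \<omega>) * indicator {s<..R} u \<partial>\<kappa> \<omega>) + ennreal (X R \<omega>) * (ennreal (K t \<omega> - K R \<omega>) + ennreal (1 - K t \<omega>))"
    by (simp only: Wt distrib_left add.assoc)
  also have "ennreal (K t \<omega> - K R \<omega>) + ennreal (1 - K t \<omega>) = ennreal (1 - K R \<omega>)"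
    using increasing_processD(3)[OF K t] increasing_processD(7)[OF K sR(3,2)] by (simp add: ennreal_plus[symmetric] del: ennreal_plus)
  finally show ?thesis by (simp only: Wt R_def)
qed

text \<open>Let \<sigma> be the minimum of \<open>T\<close> and \<open>t\<close>. For
  \<open>s < \<tau> \<le> \<sigma>\<close> the representation is applied to \<open>X / L\<close> on
  the interval from \<open>s\<close> to \<sigma>; for \<open>\<sigma> < \<tau>\<close> the quotient
  at \<sigma> is known at \<sigma>, and \<open>key_weighted\<close> multiplies it by
  \<open>L (1 - K)\<close>. Where \<open>L\<close> is zero at \<sigma> this product is zero instead
  of \<open>X (1 - K)\<close>, and the loss accounts for the difference.\<close>

lemma ratio_integral:
  assumes X: "regular X" and T: "stop_time M F T" and s: "0 \<le> s" "s \<le> t" and B: "B \<in> sets (F s)"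
    and BT: "\<And>\<omega>. \<omega> \<in> B \<Longrightarrow> ennreal s < T \<omega>"
  shows "(\<integral>\<^sup>+\<omega>. indicator B \<omega> * (indicator {\<omega>. ennreal s < \<tau> \<omega>} \<omega> * ennreal (ratio X T t \<omega>)) \<partial>M) +
      (\<integral>\<^sup>+\<omega>. indicator B \<omega> * loss X T t \<omega> \<partial>M) =
    (\<integral>\<^sup>+\<omega>. indicator B \<omega> * (sint (stopped T X) K s t \<omega> + ennreal (stopped T X t \<omega>) * ennreal (1 - K t \<omega>)) \<partial>M)"
proof -
  have t: "0 \<le> t" using s by simp
  define \<sigma> where "\<sigma> \<omega> = min (T \<omega>) (ennreal t)" for \<omega>
  define R where "R \<omega> = enn2real (\<sigma> \<omega>)" for \<omega>
  have \<sigma>: "stop_time M F \<sigma>" unfolding \<sigma>_def by (rule stop_time_min[OF T stop_time_const[OF t]])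
  have \<sigma>_fin: "\<sigma> \<omega> < \<infinity>" for \<omega> by (simp add: \<sigma>_def min_less_iff_disj)
  have \<sigma>_R: "\<sigma> \<omega> = ennreal (R \<omega>)" for \<omega> unfolding R_def using \<sigma>_fin by simp
  have R0: "0 \<le> R \<omega>" for \<omega> by (simp add: R_def)
  have st: "stopped T Z t \<omega> = Z (R \<omega>) \<omega>" for Z :: "real \<Rightarrow> 'a \<Rightarrow> real" and \<omega>
    by (simp add: stopped_def R_def \<sigma>_def)
  have s\<sigma>: "ennreal s \<le> \<sigma> \<omega>" if "\<omega> \<in> B" for \<omega>
    using BT[OF that] ennreal_leI[OF s(2)] by (simp add: \<sigma>_def)
  have BM[measurable]: "B \<in> sets M" by (rule sets_F_M[OF s(1) B])
  \<comment> \<open>On \<open>B\<close> the time \<sigma> is at least \<open>s\<close>, so an event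
    of \<open>F s\<close> is also known at \<sigma> there.\<close>
  have BS: "B \<in> sets (stop_sigma M F \<sigma>)"
    unfolding sets_stop_sigma[OF \<sigma>]
  proof (rule CollectI, intro conjI allI impI, rule BM)
    fix u :: real assume u: "0 \<le> u"
    show "{\<omega> \<in> B. \<sigma> \<omega> \<le> ennreal u} \<in> sets (F u)"
    proof (cases "s \<le> u")
      case True
      have "B \<in> sets (F u)" using B mono_F[OF s(1) True] by blast
      then have "B \<inter> {\<omega> \<in> space M. \<sigma> \<omega> \<le> ennreal u} \<in> sets (F u)" by (rule sets.Int[OF _ stop_timeD[OF \<sigma> u]])
      moreover have "B \<inter> {\<omega> \<in> space M. \<sigma> \<omega> \<le> ennreal u} = {\<omega> \<in> B. \<sigma> \<omega> \<le> ennreal u}"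
        using sets.sets_into_space[OF BM] by auto
      ultimately show ?thesis by simp
    next
      case False
      then have "ennreal u < ennreal s" using u by (simp add: ennreal_less_iff)
      then have "{\<omega> \<in> B. \<sigma> \<omega> \<le> ennreal u} = {}"
        using s\<sigma> by (auto dest: order_trans[rotated] simp: not_le[symmetric])
      then show ?thesis by (simp only: sets.empty_sets)
    qed
  qed
  have [measurable]: "\<sigma> \<in> borel_measurable M" by (rule stop_time_measurable[OF \<sigma>])
  note [measurable] = stopped_measurable_M[OF X T t] stopped_measurable_M[OF L(1) T t]
  \<comment> \<open>On \<open>B\<close> this is the stochastic interval from \<open>s\<close>,
    excluded, to \<sigma>, included; off \<open>B\<close> it is empty.\<close>
  define E where "E = after s B - {(u, \<omega>) \<in> {0..} \<times> space M. \<sigma> \<omega> < ennreal u}"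
  have E: "E \<in> sets Opt" unfolding E_def by (intro sets.Diff after_Opt s B Opt_gt \<sigma>)
  have E_iff: "(u, \<omega>) \<in> E \<longleftrightarrow> \<omega> \<in> B \<and> s < u \<and> u \<le> R \<omega>" if "0 \<le> u" "\<omega> \<in> space M" for u \<omega>
    unfolding E_def Diff_iff after_iff[OF s(1) that] \<sigma>_R using that R0[of \<omega>] by (auto simp: ennreal_less_iff)
  define V where "V u \<omega> = indicator E (u, \<omega>) * (X u \<omega> / L u \<omega>)" for u \<omega>
  have V: "optional M F V"
  proof -
    have "(\<lambda>p. indicator E p * (case p of (u, \<omega>) \<Rightarrow> X u \<omega> / L u \<omega>)) \<in> borel_measurable Opt"
      using quotient_optional[OF X] E by measurable
    then show ?thesis by (simp add: optional_def V_def case_prod_unfold)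
  qed
  have V0: "0 \<le> V u \<omega>" if "0 \<le> u" for u \<omega>
    unfolding V_def using regularD(4)[OF X that] regularD(4)[OF L(1) that] by simp
  define J where "J \<omega> = (\<integral>\<^sup>+u. ennreal (V u \<omega> * L u \<omega>) * indicator {0..} u \<partial>\<kappa> \<omega>)" for \<omega>
  have J_meas[measurable]: "J \<in> borel_measurable M"
    unfolding J_def
  proof (rule measurable_sint[OF _ K])
    note [measurable] = optional_measurable_path[OF V] measurable_path[OF regularD(1)[OF L(1)] regularD(3)[OF L(1)]]
    have "(\<lambda>p. ennreal ((case p of (u, \<omega>) \<Rightarrow> if 0 \<le> u then V u \<omega> else 0) * (case p of (u, \<omega>) \<Rightarrow> if 0 \<le> u then L u \<omega> else 0)) * indicator {0..} (fst p)) \<in> borel_measurable (borel \<Otimes>\<^sub>M M)"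
      by measurable
    then show "(\<lambda>(u, \<omega>). ennreal (V u \<omega> * L u \<omega>) * indicator {0..} u) \<in> borel_measurable (borel \<Otimes>\<^sub>M M)"
      by (rule measurable_cong[THEN iffD1, rotated]) (auto simp: indicator_def)
  qed
  \<comment> \<open>The factor \<open>L\<close> cancels the denominator only where \<open>L\<close>
    does not vanish, which by \<open>L_K\<close> is almost everywhere for the measure of
    \<open>K\<close>.\<close>
  have J_eq: "AE \<omega> in M. J \<omega> = indicator B \<omega> * (\<integral>\<^sup>+u. ennreal (X u \<omega>) * indicator {s<..R \<omega>} u \<partial>\<kappa> \<omega>)"
    using L_K AE_space
  proof eventually_elim
    case (elim \<omega>)
    have "J \<omega> = (\<integral>\<^sup>+u. indicator B \<omega> * (ennreal (X u \<omega>) * indicator {s<..R \<omega>} u) \<partial>\<kappa> \<omega>)"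
      unfolding J_def
    proof (rule nn_integral_cong_AE)
      show "AE u in \<kappa> \<omega>. ennreal (V u \<omega> * L u \<omega>) * indicator {0..} u = indicator B \<omega> * (ennreal (X u \<omega>) * indicator {s<..R \<omega>} u)"
        using elim(1)
      proof eventually_elim
        case u: (elim u)
        show ?case
        proof (cases "0 \<le> u")
          case True
          have "V u \<omega> * L u \<omega> = indicator E (u, \<omega>) * X u \<omega>" using u True by (simp add: V_def)
          then show ?thesis using True E_iff[OF True elim(2)] by (simp add: indicator_def)
        qed (use s in simp)
      qed
    qed
    then show ?case by (simp add: nn_integral_cmult path_indicator_measurable[OF X s(1)])
  qed
  have part1: "(\<integral>\<^sup>+\<omega>. ennreal (V (enn2real (\<tau> \<omega>)) \<omega>) \<partial>M) = (\<integral>\<^sup>+\<omega>. J \<omega> \<partial>M)"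
    unfolding J_def by (rule represent[OF V V0])
  define f where "f \<omega> = indicator B \<omega> * ennreal (stopped T X t \<omega> / stopped T L t \<omega>)" for \<omega>
  have fS: "f \<in> borel_measurable (stop_sigma M F \<sigma>)"
  proof -
    have eq: "stopped T Z t = (\<lambda>\<omega>. if \<sigma> \<omega> < \<infinity> then Z (enn2real (\<sigma> \<omega>)) \<omega> else 0)" for Z :: "real \<Rightarrow> 'a \<Rightarrow> real"
      by (rule ext) (simp only: st R_def \<sigma>_fin if_True)
    have [measurable]: "stopped T X t \<in> borel_measurable (stop_sigma M F \<sigma>)" "stopped T L t \<in> borel_measurable (stop_sigma M F \<sigma>)"
      unfolding eq by (rule sampled_measurable[OF regularD(1,3)[OF X] \<sigma>] sampled_measurable[OF regularD(1,3)[OF L(1)] \<sigma>])+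
    show ?thesis unfolding f_def using BS by measurable
  qed
  have fM[measurable]: "f \<in> borel_measurable M"
    by (rule measurable_from_subalg[OF subalgebra_stop_sigma[OF \<sigma>] fS])
  have part2: "(\<integral>\<^sup>+\<omega>. f \<omega> * indicator {\<omega>. \<sigma> \<omega> < \<tau> \<omega>} \<omega> \<partial>M) = (\<integral>\<^sup>+\<omega>. f \<omega> * ennreal (Y (R \<omega>) \<omega>) \<partial>M)"
    unfolding key_weighted[OF \<sigma> fS] by (rule nn_integral_cong) (use \<sigma>_fin in \<open>simp only: R_def indicator_def mem_Collect_eq of_bool_eq mult_1_left\<close>)
  have [measurable]: "(\<lambda>\<omega>. V (enn2real (\<tau> \<omega>)) \<omega>) \<in> borel_measurable M"
  proof -
    have "(\<lambda>\<omega>. (enn2real (\<tau> \<omega>), \<omega>)) \<in> measurable M Opt" by (rule time_point_measurable) simp_all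
    from measurable_compose[OF this V[unfolded optional_def]] show ?thesis by simp
  qed
  have [measurable]: "(\<lambda>\<omega>. Y (R \<omega>) \<omega>) \<in> borel_measurable M"
    unfolding R_def by (rule Y_at_measurable) simp_all
  have [measurable]: "loss X T t \<in> borel_measurable M"
  proof -
    have K1: "(\<lambda>\<omega>. if \<sigma> \<omega> < \<infinity> then K (enn2real (\<sigma> \<omega>)) \<omega> else 0) \<in> borel_measurable (stop_sigma M F \<sigma>)"
      by (rule sampled_measurable[OF _ _ \<sigma>]) (use increasing_processD(1,2)[OF K] in \<open>simp_all add: increasing_path_def\<close>)
    have [measurable]: "stopped T K t \<in> borel_measurable M"
      by (rule measurable_cong[THEN iffD1, OF _ measurable_from_subalg[OF subalgebra_stop_sigma[OF \<sigma>] K1]])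
        (use \<sigma>_fin in \<open>simp only: st R_def if_True\<close>)
    show ?thesis unfolding loss_def by measurable
  qed
  have "(\<integral>\<^sup>+\<omega>. indicator B \<omega> * (indicator {\<omega>. ennreal s < \<tau> \<omega>} \<omega> * ennreal (ratio X T t \<omega>)) \<partial>M) =
    (\<integral>\<^sup>+\<omega>. ennreal (V (enn2real (\<tau> \<omega>)) \<omega>) + f \<omega> * indicator {\<omega>. \<sigma> \<omega> < \<tau> \<omega>} \<omega> \<partial>M)"
  proof (rule nn_integral_cong_AE)
    show "AE \<omega> in M. indicator B \<omega> * (indicator {\<omega>. ennreal s < \<tau> \<omega>} \<omega> * ennreal (ratio X T t \<omega>)) =
      ennreal (V (enn2real (\<tau> \<omega>)) \<omega>) + f \<omega> * indicator {\<omega>. \<sigma> \<omega> < \<tau> \<omega>} \<omega>"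
      using tau_finite AE_space
    proof eventually_elim
      case (elim \<omega>)
      let ?r = "enn2real (\<tau> \<omega>)"
      have r: "\<tau> \<omega> = ennreal ?r" using elim(1) by simp
      have lt: "ennreal s < \<tau> \<omega> \<longleftrightarrow> s < ?r" "\<sigma> \<omega> < \<tau> \<omega> \<longleftrightarrow> R \<omega> < ?r"
        using less_tau_iff[OF elim(1)] s(1) R0 by (simp_all add: \<sigma>_R)
      have mn: "min (min (\<tau> \<omega>) (T \<omega>)) (ennreal t) = min (\<tau> \<omega>) (\<sigma> \<omega>)" by (simp add: \<sigma>_def min.assoc)
      have Er: "indicator E (?r, \<omega>) = (if \<omega> \<in> B \<and> s < ?r \<and> ?r \<le> R \<omega> then 1 else 0 :: real)"
        using E_iff[OF enn2real_nonneg elim(2)] by (simp add: indicator_def)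
      show ?case
      proof (cases "\<omega> \<in> B")
        case False
        then show ?thesis by (simp add: V_def Er f_def)
      next
        case True
        have sR: "s \<le> R \<omega>" using s\<sigma>[OF True] R0[of \<omega>] by (simp add: \<sigma>_R ennreal_le_iff)
        show ?thesis
        proof (cases "R \<omega> < ?r")
          case False
          then have "min (\<tau> \<omega>) (\<sigma> \<omega>) = \<tau> \<omega>" using lt(2) by (simp add: min_def not_less)
          then show ?thesis using True False by (cases "s < ?r") (simp_all add: ratio_eq mn V_def Er lt)
        next
          case R: True
          then have "min (\<tau> \<omega>) (\<sigma> \<omega>) = \<sigma> \<omega>" using lt(2) by (simp add: min_def less_le_not_le)
          then have "ratio X T t \<omega> = X (R \<omega>) \<omega> / L (R \<omega>) \<omega>" by (simp add: ratio_eq mn R_def)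
          then show ?thesis using True R sR by (simp add: V_def Er lt f_def st)
        qed
      qed
    qed
  qed
  also have "\<dots> = (\<integral>\<^sup>+\<omega>. ennreal (V (enn2real (\<tau> \<omega>)) \<omega>) \<partial>M) + (\<integral>\<^sup>+\<omega>. f \<omega> * indicator {\<omega>. \<sigma> \<omega> < \<tau> \<omega>} \<omega> \<partial>M)"
    by (rule nn_integral_add) measurable
  also have "\<dots> = (\<integral>\<^sup>+\<omega>. J \<omega> \<partial>M) + (\<integral>\<^sup>+\<omega>. f \<omega> * ennreal (Y (R \<omega>) \<omega>) \<partial>M)"
    by (simp only: part1 part2)
  also have "\<dots> = (\<integral>\<^sup>+\<omega>. J \<omega> + f \<omega> * ennreal (Y (R \<omega>) \<omega>) \<partial>M)"
    by (rule nn_integral_add[symmetric]) measurable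
  finally have "(\<integral>\<^sup>+\<omega>. indicator B \<omega> * (indicator {\<omega>. ennreal s < \<tau> \<omega>} \<omega> * ennreal (ratio X T t \<omega>)) \<partial>M) +
      (\<integral>\<^sup>+\<omega>. indicator B \<omega> * loss X T t \<omega> \<partial>M) =
    (\<integral>\<^sup>+\<omega>. J \<omega> + f \<omega> * ennreal (Y (R \<omega>) \<omega>) \<partial>M) + (\<integral>\<^sup>+\<omega>. indicator B \<omega> * loss X T t \<omega> \<partial>M)" by simp
  also have "\<dots> = (\<integral>\<^sup>+\<omega>. J \<omega> + f \<omega> * ennreal (Y (R \<omega>) \<omega>) + indicator B \<omega> * loss X T t \<omega> \<partial>M)"
    by (rule nn_integral_add[symmetric]) measurable
  also have "\<dots> = (\<integral>\<^sup>+\<omega>. indicator B \<omega> * (sint (stopped T X) K s t \<omega> + ennreal (stopped T X t \<omega>) * ennreal (1 - K t \<omega>)) \<partial>M)"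
  proof (rule nn_integral_cong_AE)
    show "AE \<omega> in M. J \<omega> + f \<omega> * ennreal (Y (R \<omega>) \<omega>) + indicator B \<omega> * loss X T t \<omega> =
      indicator B \<omega> * (sint (stopped T X) K s t \<omega> + ennreal (stopped T X t \<omega>) * ennreal (1 - K t \<omega>))"
      using J_eq
    proof eventually_elim
      case (elim \<omega>)
      show ?case
      proof (cases "\<omega> \<in> B")
        case False
        then show ?thesis using elim by (simp add: f_def)
      next
        case True
        have nn: "0 \<le> X (R \<omega>) \<omega>" "0 \<le> L (R \<omega>) \<omega>" "0 \<le> 1 - K (R \<omega>) \<omega>"
          using regularD(4)[OF X R0] regularD(4)[OF L(1) R0] increasing_processD(3)[OF K R0] by simp_all
        \<comment> \<open>Exactly one of the two terms on the left can contribute: the first where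
          \<open>L\<close> is nonzero at \<open>R\<close>, and the loss where it is zero.\<close>
        have "f \<omega> * ennreal (Y (R \<omega>) \<omega>) + loss X T t \<omega> = ennreal (stopped T X t \<omega>) * ennreal (1 - stopped T K t \<omega>)"
          using True nn by (simp add: f_def loss_def st Y_def ennreal_mult'[symmetric])
        then show ?thesis
          unfolding sint_stopped[where T = T and \<omega> = \<omega>, OF X s BT[OF True]] elim using True by (simp add: add.assoc R_def \<sigma>_def)
      qed
    qed
  qed
  finally show ?thesis .
qed

end

section \<open>The quotient in the enlarged filtration\<close>

context usual_filtration
begin

text \<open>Testing on the whole space bounds the expectation at \<open>t\<close> by the initial
  one, so finiteness at time zero gives integrability throughout.\<close>

lemma supermartingaleI_nn:
  assumes sub: "\<And>t. 0 \<le> t \<Longrightarrow> subalgebra M (G t)" and ad: "adapted G V" and cad: "AE \<omega> in M. cadlag_path (\<lambda>t. V t \<omega>)"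
    and nonneg: "\<And>t. 0 \<le> t \<Longrightarrow> AE \<omega> in M. 0 \<le> V t \<omega>" and fin: "(\<integral>\<^sup>+\<omega>. ennreal (V 0 \<omega>) \<partial>M) < \<infinity>"
    and le: "\<And>s t A. 0 \<le> s \<Longrightarrow> s \<le> t \<Longrightarrow> A \<in> sets (G s) \<Longrightarrow>
      (\<integral>\<^sup>+\<omega>. indicator A \<omega> * ennreal (V t \<omega>) \<partial>M) \<le> (\<integral>\<^sup>+\<omega>. indicator A \<omega> * ennreal (V s \<omega>) \<partial>M)"
  shows "supermartingale M G V"
proof -
  have VG: "V t \<in> borel_measurable (G t)" if "0 \<le> t" for t using ad that by (simp add: adapted_def)
  have VM: "V t \<in> borel_measurable M" if "0 \<le> t" for t by (rule measurable_from_subalg[OF sub[OF that] VG[OF that]])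
  have fin_t: "(\<integral>\<^sup>+\<omega>. ennreal (V t \<omega>) \<partial>M) < \<infinity>" if t: "0 \<le> t" for t
  proof -
    have "space M \<in> sets (G 0)" using sub[of 0] sets.top[of "G 0"] by (simp add: subalgebra_def)
    from le[OF order_refl t this] have "(\<integral>\<^sup>+\<omega>. indicator (space M) \<omega> * ennreal (V t \<omega>) \<partial>M) \<le> (\<integral>\<^sup>+\<omega>. indicator (space M) \<omega> * ennreal (V 0 \<omega>) \<partial>M)" .
    also have "(\<integral>\<^sup>+\<omega>. indicator (space M) \<omega> * ennreal (V t \<omega>) \<partial>M) = (\<integral>\<^sup>+\<omega>. ennreal (V t \<omega>) \<partial>M)"
      by (rule nn_integral_cong) simp
    also have "(\<integral>\<^sup>+\<omega>. indicator (space M) \<omega> * ennreal (V 0 \<omega>) \<partial>M) = (\<integral>\<^sup>+\<omega>. ennreal (V 0 \<omega>) \<partial>M)"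
      by (rule nn_integral_cong) simp
    finally show ?thesis using fin by (rule le_less_trans)
  qed
  have int: "integrable M (V t)" if t: "0 \<le> t" for t
    by (rule integrableI_nonneg[OF VM[OF t] nonneg[OF t] fin_t[OF t]])
  show ?thesis
    unfolding supermartingale_def
  proof (intro conjI allI impI ad cad int)
    fix s t :: real assume s: "0 \<le> s" "s \<le> t"
    then have t: "0 \<le> t" by simp
    have "AE \<omega> in M. nn_cond_exp M (G s) (\<lambda>\<omega>. ennreal (V t \<omega>)) \<omega> \<le> ennreal (V s \<omega>)"
    proof (rule nn_cond_exp_le[OF sigma_finite_subalgebraI[OF sub[OF s(1)]]])
      show "(\<lambda>\<omega>. ennreal (V t \<omega>)) \<in> borel_measurable M" using VM[OF t] by measurable
      show "(\<lambda>\<omega>. ennreal (V s \<omega>)) \<in> borel_measurable (G s)" using VG[OF s(1)] by measurable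
    qed (rule fin_t[OF s(1)], rule le[OF s])
    then show "AE \<omega> in M. real_cond_exp M (G s) (V t) \<omega> \<le> V s \<omega>"
      using AE_nn_cond_exp[OF sub[OF s(1)] int[OF t] nonneg[OF t]] nonneg[OF s(1)]
      by eventually_elim (simp add: ennreal_le_iff)
  qed
qed

lemma martingaleI_nn:
  assumes sub: "\<And>t. 0 \<le> t \<Longrightarrow> subalgebra M (G t)" and ad: "adapted G V" and cad: "AE \<omega> in M. cadlag_path (\<lambda>t. V t \<omega>)"
    and nonneg: "\<And>t. 0 \<le> t \<Longrightarrow> AE \<omega> in M. 0 \<le> V t \<omega>" and fin: "(\<integral>\<^sup>+\<omega>. ennreal (V 0 \<omega>) \<partial>M) < \<infinity>"
    and eq: "\<And>s t A. 0 \<le> s \<Longrightarrow> s \<le> t \<Longrightarrow> A \<in> sets (G s) \<Longrightarrow>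
      (\<integral>\<^sup>+\<omega>. indicator A \<omega> * ennreal (V t \<omega>) \<partial>M) = (\<integral>\<^sup>+\<omega>. indicator A \<omega> * ennreal (V s \<omega>) \<partial>M)"
  shows "martingale M G V"
proof -
  have super: "supermartingale M G V"
    by (rule supermartingaleI_nn[OF sub ad cad nonneg fin]) (auto intro: eq_refl[OF eq])
  have VG: "V t \<in> borel_measurable (G t)" if "0 \<le> t" for t using ad that by (simp add: adapted_def)
  have VM: "V t \<in> borel_measurable M" if "0 \<le> t" for t by (rule measurable_from_subalg[OF sub[OF that] VG[OF that]])
  have "AE \<omega> in M. real_cond_exp M (G s) (V t) \<omega> = V s \<omega>" if s: "0 \<le> s" "s \<le> t" for s t
  proof -
    have t: "0 \<le> t" using s by simp
    interpret S: sigma_finite_subalgebra M "G s" by (rule sigma_finite_subalgebraI[OF sub[OF s(1)]])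
    have "AE \<omega> in M. ennreal (V s \<omega>) = nn_cond_exp M (G s) (\<lambda>\<omega>. ennreal (V t \<omega>)) \<omega>"
    proof (rule S.nn_cond_exp_charact)
      fix A assume A: "A \<in> sets (G s)"
      show "(\<integral>\<^sup>+\<omega>\<in>A. ennreal (V t \<omega>) \<partial>M) = (\<integral>\<^sup>+\<omega>\<in>A. ennreal (V s \<omega>) \<partial>M)"
        using eq[OF s A] by (simp only: mult.commute)
    next
      show "(\<lambda>\<omega>. ennreal (V t \<omega>)) \<in> borel_measurable M" using VM[OF t] by measurable
      show "(\<lambda>\<omega>. ennreal (V s \<omega>)) \<in> borel_measurable (G s)" using VG[OF s(1)] by measurable
    qed
    then show ?thesis
      using AE_real_cond_exp_nonneg[OF sub[OF s(1)] S.sigma_finite_subalgebra_axioms nonneg[OF t] VM[OF t]] nonneg[OF s(1)]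
      by eventually_elim (metis enn2real_ennreal)
  qed
  then show ?thesis using super by (simp add: martingale_def supermartingale_def)
qed

lemma AE_measurable_superalgebra:
  assumes f: "f \<in> measurable N S" and N: "space N = space M" "\<And>A. A \<in> sets (F 0) \<Longrightarrow> A \<in> sets N"
    and eq: "AE \<omega> in M. f \<omega> = g \<omega>" and g: "\<And>\<omega>. \<omega> \<in> space M \<Longrightarrow> g \<omega> \<in> space S"
  shows "g \<in> measurable N S"
proof (rule measurableI)
  fix B assume B: "B \<in> sets S"
  have "{\<omega> \<in> space M. f \<omega> \<noteq> g \<omega> \<and> f \<omega> \<in> B} \<in> sets N" "{\<omega> \<in> space M. f \<omega> \<noteq> g \<omega> \<and> g \<omega> \<in> B} \<in> sets N"
    by (rule N(2), rule null_F[OF eq order_refl], auto)+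
  then have "(f -` B \<inter> space N - {\<omega> \<in> space M. f \<omega> \<noteq> g \<omega> \<and> f \<omega> \<in> B}) \<union> {\<omega> \<in> space M. f \<omega> \<noteq> g \<omega> \<and> g \<omega> \<in> B} \<in> sets N"
    using measurable_sets[OF f B] by (intro sets.Un sets.Diff)
  moreover have "(f -` B \<inter> space N - {\<omega> \<in> space M. f \<omega> \<noteq> g \<omega> \<and> f \<omega> \<in> B}) \<union> {\<omega> \<in> space M. f \<omega> \<noteq> g \<omega> \<and> g \<omega> \<in> B} = g -` B \<inter> space N"
    unfolding N(1) by auto
  ultimately show "g -` B \<inter> space N \<in> sets N" by (simp only:)
qed (simp add: N g)

lemma sets_enlargement:
  assumes "0 \<le> t"
  shows "sets (progressive_enlargement M F \<tau> t) = {B \<in> sets M. \<exists>B'\<in>sets (F t).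
    B \<inter> {\<omega> \<in> space M. ennreal t < \<tau> \<omega>} = B' \<inter> {\<omega> \<in> space M. ennreal t < \<tau> \<omega>}}"
  by (rule sets_progressive_enlargement) (rule subalgebra_F[OF assms])

lemma subalgebra_enlargement:
  assumes "0 \<le> t"
  shows "subalgebra M (progressive_enlargement M F \<tau> t)"
proof -
  have "space (progressive_enlargement M F \<tau> t) = space M"
    unfolding progressive_enlargement_def by (rule space_measure_of) (use sets.sets_into_space in blast)
  then show ?thesis
    using sets_enlargement[OF assms, of \<tau>] by (auto simp: subalgebra_def)
qed

lemma F_sub_enlargement:
  assumes "0 \<le> t" "A \<in> sets (F t)"
  shows "A \<in> sets (progressive_enlargement M F \<tau> t)"
  using sets_F_M[OF assms] assms(2) by (auto simp: sets_enlargement[OF assms(1)])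

end

text \<open>The uniform lower bound passes to the left limits of \<open>g\<close>, so that the
  quotient has left limits too.\<close>

lemma cadlag_path_divide:
  assumes f: "cadlag_path f" and g: "cadlag_path g" and c: "0 < c" "\<And>t. 0 \<le> t \<Longrightarrow> c \<le> g t"
  shows "cadlag_path (\<lambda>t. f t / g t)"
  unfolding cadlag_path_def right_cont_path_def
proof (intro conjI allI impI)
  fix t :: real assume t: "0 \<le> t"
  show "((\<lambda>t. f t / g t) \<longlongrightarrow> f t / g t) (at_right t)"
    by (rule tendsto_divide) (use f g c(1) c(2)[OF t] t in \<open>auto simp: cadlag_path_def right_cont_path_def\<close>)
next
  fix t :: real assume t: "0 < t"
  obtain l where l: "(f \<longlongrightarrow> l) (at_left t)" using f t by (auto simp: cadlag_path_def)
  obtain m where m: "(g \<longlongrightarrow> m) (at_left t)" using g t by (auto simp: cadlag_path_def)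
  have "\<forall>\<^sub>F u in at_left t. c \<le> g u"
    by (rule eventually_at_leftI[of 0]) (use t c(2) in auto)
  then have "c \<le> m" by (rule tendsto_lowerbound[OF m]) simp
  then have "((\<lambda>t. f t / g t) \<longlongrightarrow> l / m) (at_left t)" using l m c(1) by (intro tendsto_divide) auto
  then show "\<exists>l. ((\<lambda>t. f t / g t) \<longlongrightarrow> l) (at_left t)" by (rule exI)
qed

context representation
begin

lemma ratio_nonneg:
  assumes X: "regular X"
  shows "0 \<le> ratio X T t \<omega>"
  unfolding ratio_eq by (intro divide_nonneg_nonneg regularD(4)[OF X] regularD(4)[OF L(1)]) simp_all

lemma ratio_cadlag:
  assumes X: "regular X"
  shows "AE \<omega> in M. cadlag_path (\<lambda>t. ratio X T t \<omega>)"
  using tau_le_level L_tau tau_finite AE_space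
proof eventually_elim
  case (elim \<omega>)
  obtain n where n: "\<tau> \<omega> \<le> level n \<omega>" using elim(1) by (rule exE)
  \<comment> \<open>Two bounds are needed: strictly before \<tau> the path of \<open>L\<close> is
    above \<open>1 / Suc n\<close>, because \<tau> is at most \<open>level n\<close>; at \<tau>
    itself, which may equal \<open>level n\<close>, the positivity comes from
    \<open>L_tau\<close>.\<close>
  define c where "c = min (1 / real (Suc n)) (L (enn2real (\<tau> \<omega>)) \<omega>)"
  have "0 \<le> L (enn2real (\<tau> \<omega>)) \<omega>" by (rule regularD(4)[OF L(1)]) simp
  then have c: "0 < c" using elim(2) by (simp add: c_def)
  show ?case
    unfolding ratio_def stopped_def
  proof (rule cadlag_path_divide[OF cadlag_path_stopped[OF regularD(2)[OF X]] cadlag_path_stopped[OF regularD(2)[OF L(1)]] c])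
    fix t :: real
    let ?m = "min (min (\<tau> \<omega>) (T \<omega>)) (ennreal t)"
    have le: "?m \<le> \<tau> \<omega>" by (simp add: min.coboundedI1)
    show "c \<le> L (enn2real ?m) \<omega>"
    proof (cases "?m = \<tau> \<omega>")
      case True
      then show ?thesis by (simp only: c_def min.cobounded2)
    next
      case False
      then have "?m < level n \<omega>" using le n by (simp only: order.strict_iff_order) (metis order_trans antisym)
      moreover have "ennreal (enn2real ?m) = ?m" by (rule ennreal_enn2real) (simp add: min_less_iff_disj)
      ultimately have "1 / real (Suc n) \<le> L (enn2real ?m) \<omega>"
        by (intro level_before[OF enn2real_nonneg _ elim(4)]) (simp only:)
      then show ?thesis unfolding c_def by (rule min.coboundedI1)
    qed
  qed
qed

text \<open>On \<open>{\<tau> > t}\<close> the ratio equals the quotient of the processes stopped at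
  \<open>T\<close> alone, which is known in \<open>F t\<close>. On the complement, the enlargement
  contains every event.\<close>

lemma ratio_adapted:
  assumes X: "regular X" and T: "stop_time M F T" and t: "0 \<le> t"
  shows "ratio X T t \<in> borel_measurable (progressive_enlargement M F \<tau> t)"
proof (rule measurableI)
  fix B :: "real set" assume B: "B \<in> sets borel"
  let ?D = "\<lambda>\<omega>. stopped T X t \<omega> / stopped T L t \<omega>"
  have sp: "space (progressive_enlargement M F \<tau> t) = space M"
    using subalgebra_enlargement[OF t] by (simp add: subalgebra_def)
  have D: "?D \<in> borel_measurable (F t)"
    using regularD(5)[OF regular_stopped[OF X T] t] regularD(5)[OF regular_stopped[OF L(1) T] t] by measurable
  have 1: "ratio X T t -` B \<inter> space M \<in> sets M" by (rule measurable_sets[OF ratio_measurable[OF X T] B])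
  have 2: "?D -` B \<inter> space M \<in> sets (F t)" using measurable_sets[OF D B] t by simp
  have "ratio X T t \<omega> = ?D \<omega>" if "ennreal t < \<tau> \<omega>" for \<omega>
  proof -
    have "min (min (\<tau> \<omega>) (T \<omega>)) (ennreal t) = min (T \<omega>) (ennreal t)"
      unfolding min.assoc by (rule min.absorb2) (use that in \<open>simp add: min.coboundedI2\<close>)
    then show ?thesis by (simp only: ratio_eq stopped_def)
  qed
  then have "(ratio X T t -` B \<inter> space M) \<inter> {\<omega> \<in> space M. ennreal t < \<tau> \<omega>} = (?D -` B \<inter> space M) \<inter> {\<omega> \<in> space M. ennreal t < \<tau> \<omega>}"
    by auto
  then show "ratio X T t -` B \<inter> space (progressive_enlargement M F \<tau> t) \<in> sets (progressive_enlargement M F \<tau> t)"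
    unfolding sp sets_enlargement[OF t] using 1 2 by blast
qed simp

text \<open>Off \<open>{s < \<tau>}\<close> and \<open>{s < T}\<close> the ratio is already frozen
  at time \<open>s\<close>. On their intersection \<open>A\<close> may be exchanged for an event of
  \<open>F s\<close>, and restricting that event to nonzero \<open>L s\<close> changes only a null
  set. The restriction makes the loss at the initial time \<open>s\<close> vanish.\<close>

lemma ratio_split:
  assumes X: "regular X" and T: "stop_time M F T" and s: "0 \<le> s" "s \<le> t" and A: "A \<in> sets M" and B': "B' \<in> sets (F s)"
    and AB: "A \<inter> {\<omega> \<in> space M. ennreal s < \<tau> \<omega>} = B' \<inter> {\<omega> \<in> space M. ennreal s < \<tau> \<omega>}"
  defines "B \<equiv> B' \<inter> {\<omega> \<in> space M. ennreal s < T \<omega>} \<inter> {\<omega> \<in> space M. L s \<omega> \<noteq> 0}"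
  shows "B \<in> sets (F s)"
    and "(\<integral>\<^sup>+\<omega>. indicator A \<omega> * ennreal (ratio X T t \<omega>) \<partial>M) =
      (\<integral>\<^sup>+\<omega>. indicator (A - {\<omega> \<in> space M. ennreal s < \<tau> \<omega>} \<inter> {\<omega> \<in> space M. ennreal s < T \<omega>}) \<omega> * ennreal (ratio X T s \<omega>) \<partial>M) +
      (\<integral>\<^sup>+\<omega>. indicator B \<omega> * (indicator {\<omega>. ennreal s < \<tau> \<omega>} \<omega> * ennreal (ratio X T t \<omega>)) \<partial>M)"
proof -
  have t: "0 \<le> t" using s by simp
  have L0: "{\<omega> \<in> space (F s). L s \<omega> \<noteq> 0} \<in> sets (F s)" "{\<omega> \<in> space (F s). L s \<omega> = 0} \<in> sets (F s)"
    using regularD(5)[OF L(1) s(1)] by measurable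
  show BF: "B \<in> sets (F s)"
    unfolding B_def using L0(1) s by (intro sets.Int B' stop_timeD_gt[OF T s(1)]) simp
  have [measurable]: "B \<in> sets M" "A \<in> sets M" by (rule sets_F_M[OF s(1) BF], rule A)
  have [measurable]: "T \<in> borel_measurable M" by (rule stop_time_measurable[OF T])
  note [measurable] = ratio_measurable[OF X T]
  have LM[measurable]: "{\<omega> \<in> space (F s). L s \<omega> = 0} \<in> sets M" by (rule sets_F_M[OF s(1) L0(2)])
  \<comment> \<open>Apply \<open>key\<close> to the event \<open>L s = 0\<close>, on which
    \<open>Y s\<close> vanishes: \<tau> exceeds \<open>s\<close> there with probability
    zero.\<close>
  have "(\<integral>\<^sup>+\<omega>. indicator {\<omega> \<in> space (F s). L s \<omega> = 0} \<omega> * indicator {\<omega>. ennreal s < \<tau> \<omega>} \<omega> \<partial>M) = (\<integral>\<^sup>+\<omega>. 0 \<partial>M)"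
    unfolding key[OF s(1) L0(2)] by (rule nn_integral_cong) (simp add: Y_def indicator_def)
  then have "AE \<omega> in M. indicator {\<omega> \<in> space (F s). L s \<omega> = 0} \<omega> * indicator {\<omega>. ennreal s < \<tau> \<omega>} \<omega> = (0 :: ennreal)"
    by (subst nn_integral_0_iff_AE[symmetric]) simp_all
  then have pos: "AE \<omega> in M. ennreal s < \<tau> \<omega> \<longrightarrow> L s \<omega> \<noteq> 0"
    using AE_space by eventually_elim (use s in \<open>auto simp: indicator_def split: if_splits\<close>)
  let ?C = "{\<omega> \<in> space M. ennreal s < \<tau> \<omega>} \<inter> {\<omega> \<in> space M. ennreal s < T \<omega>}"
  have "(\<integral>\<^sup>+\<omega>. indicator A \<omega> * ennreal (ratio X T t \<omega>) \<partial>M) =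
    (\<integral>\<^sup>+\<omega>. indicator (A - ?C) \<omega> * ennreal (ratio X T s \<omega>) +
      indicator B \<omega> * (indicator {\<omega>. ennreal s < \<tau> \<omega>} \<omega> * ennreal (ratio X T t \<omega>)) \<partial>M)"
  proof (rule nn_integral_cong_AE)
    show "AE \<omega> in M. indicator A \<omega> * ennreal (ratio X T t \<omega>) = indicator (A - ?C) \<omega> * ennreal (ratio X T s \<omega>) +
      indicator B \<omega> * (indicator {\<omega>. ennreal s < \<tau> \<omega>} \<omega> * ennreal (ratio X T t \<omega>))"
      using pos AE_space
    proof eventually_elim
      case (elim \<omega>)
      show ?case
      proof (cases "ennreal s < \<tau> \<omega> \<and> ennreal s < T \<omega>")
        case True
        then have "\<omega> \<in> A \<longleftrightarrow> \<omega> \<in> B" "\<omega> \<in> ?C" using AB elim by (auto simp: B_def)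
        then show ?thesis using True by (simp add: indicator_def)
      next
        case False
        then have le: "min (\<tau> \<omega>) (T \<omega>) \<le> ennreal s" by (auto simp: min_le_iff_disj not_less)
        have "min (min (\<tau> \<omega>) (T \<omega>)) (ennreal s) = min (\<tau> \<omega>) (T \<omega>)" using le by (rule min.absorb1)
        moreover have "min (min (\<tau> \<omega>) (T \<omega>)) (ennreal t) = min (\<tau> \<omega>) (T \<omega>)"
          by (rule min.absorb1[OF order_trans[OF le ennreal_leI[OF s(2)]]])
        ultimately have "ratio X T t \<omega> = ratio X T s \<omega>" by (simp only: ratio_eq)
        moreover have "\<omega> \<notin> ?C" "\<not> (\<omega> \<in> B \<and> ennreal s < \<tau> \<omega>)" using False by (auto simp: B_def)
        ultimately show ?thesis by (auto simp: indicator_def)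
      qed
    qed
  qed
  also have "\<dots> = (\<integral>\<^sup>+\<omega>. indicator (A - ?C) \<omega> * ennreal (ratio X T s \<omega>) \<partial>M) +
      (\<integral>\<^sup>+\<omega>. indicator B \<omega> * (indicator {\<omega>. ennreal s < \<tau> \<omega>} \<omega> * ennreal (ratio X T t \<omega>)) \<partial>M)"
    by (rule nn_integral_add) measurable
  finally show "(\<integral>\<^sup>+\<omega>. indicator A \<omega> * ennreal (ratio X T t \<omega>) \<partial>M) = \<dots>" .
qed

text \<open>This is \<open>ratio_integral\<close> with \<open>t = s\<close>: the integral runs over
  an empty interval, and there is no loss because \<open>L s\<close> is nonzero on
  \<open>B\<close>.\<close>

lemma ratio_start:
  assumes X: "regular X" and T: "stop_time M F T" and s: "0 \<le> s" and B: "B \<in> sets (F s)"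
    and BT: "\<And>\<omega>. \<omega> \<in> B \<Longrightarrow> ennreal s < T \<omega>" and BL: "\<And>\<omega>. \<omega> \<in> B \<Longrightarrow> L s \<omega> \<noteq> 0"
  shows "(\<integral>\<^sup>+\<omega>. indicator B \<omega> * (indicator {\<omega>. ennreal s < \<tau> \<omega>} \<omega> * ennreal (ratio X T s \<omega>)) \<partial>M) =
    (\<integral>\<^sup>+\<omega>. indicator B \<omega> * (ennreal (stopped T X s \<omega>) * ennreal (1 - K s \<omega>)) \<partial>M)"
proof -
  have z0: "indicator B \<omega> * loss X T s \<omega> = 0" for \<omega>
    using BT[of \<omega>] BL[of \<omega>] s by (cases "\<omega> \<in> B") (simp_all add: loss_def stopped_eq not_le[symmetric])
  have z: "(\<integral>\<^sup>+\<omega>. indicator B \<omega> * loss X T s \<omega> \<partial>M) = 0" by (simp only: z0 nn_integral_const mult_zero_left)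
  have "sint (stopped T X) K s s \<omega> = 0" for \<omega> by (simp add: sint_def)
  then show ?thesis using ratio_integral[OF X T s order_refl B BT] by (simp add: z)
qed

lemma enlargementE:
  assumes "0 \<le> s" "A \<in> sets (progressive_enlargement M F \<tau> s)"
  obtains B' where "A \<in> sets M" "B' \<in> sets (F s)"
    "A \<inter> {\<omega> \<in> space M. ennreal s < \<tau> \<omega>} = B' \<inter> {\<omega> \<in> space M. ennreal s < \<tau> \<omega>}"
  using assms(2) unfolding sets_enlargement[OF assms(1)] by blast

text \<open>The loss is nonnegative and can be given away for an inequality;
  \<open>parts_super\<close> does the rest.\<close>

lemma ratio_super:
  assumes X: "regular X" and T: "stop_time M F T" and super: "nn_super (stopped T X)"
    and s: "0 \<le> s" "s \<le> t" and A: "A \<in> sets (progressive_enlargement M F \<tau> s)"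
  shows "(\<integral>\<^sup>+\<omega>. indicator A \<omega> * ennreal (ratio X T t \<omega>) \<partial>M) \<le> (\<integral>\<^sup>+\<omega>. indicator A \<omega> * ennreal (ratio X T s \<omega>) \<partial>M)"
proof -
  obtain B' where AM: "A \<in> sets M" and B': "B' \<in> sets (F s)"
    and AB: "A \<inter> {\<omega> \<in> space M. ennreal s < \<tau> \<omega>} = B' \<inter> {\<omega> \<in> space M. ennreal s < \<tau> \<omega>}"
    using s(1) A by (rule enlargementE)
  define B where "B = B' \<inter> {\<omega> \<in> space M. ennreal s < T \<omega>} \<inter> {\<omega> \<in> space M. L s \<omega> \<noteq> 0}"
  have B: "B \<in> sets (F s)" unfolding B_def by (rule ratio_split(1)[OF X T s AM B' AB])
  have BT: "\<And>\<omega>. \<omega> \<in> B \<Longrightarrow> ennreal s < T \<omega>" and BL: "\<And>\<omega>. \<omega> \<in> B \<Longrightarrow> L s \<omega> \<noteq> 0" by (simp_all add: B_def)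
  have "(\<integral>\<^sup>+\<omega>. indicator B \<omega> * (indicator {\<omega>. ennreal s < \<tau> \<omega>} \<omega> * ennreal (ratio X T t \<omega>)) \<partial>M) \<le>
    (\<integral>\<^sup>+\<omega>. indicator B \<omega> * (indicator {\<omega>. ennreal s < \<tau> \<omega>} \<omega> * ennreal (ratio X T t \<omega>)) \<partial>M) + (\<integral>\<^sup>+\<omega>. indicator B \<omega> * loss X T t \<omega> \<partial>M)"
    by simp
  also have "\<dots> = (\<integral>\<^sup>+\<omega>. indicator B \<omega> * (sint (stopped T X) K s t \<omega> + ennreal (stopped T X t \<omega>) * ennreal (1 - K t \<omega>)) \<partial>M)"
    by (rule ratio_integral[OF X T s B BT])
  also have "\<dots> \<le> (\<integral>\<^sup>+\<omega>. indicator B \<omega> * (ennreal (stopped T X s \<omega>) * ennreal (1 - K s \<omega>)) \<partial>M)"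
    by (rule parts_super[OF regular_stopped[OF X T] super K s B])
  also have "\<dots> = (\<integral>\<^sup>+\<omega>. indicator B \<omega> * (indicator {\<omega>. ennreal s < \<tau> \<omega>} \<omega> * ennreal (ratio X T s \<omega>)) \<partial>M)"
    by (rule ratio_start[OF X T s(1) B BT BL, symmetric])
  finally show ?thesis
    unfolding ratio_split(2)[OF X T s AM B' AB] ratio_split(2)[OF X T s(1) order_refl AM B' AB] B_def[symmetric]
    by (rule add_left_mono)
qed

text \<open>The chain of \<open>ratio_super\<close> with equalities: the vanishing loss is inserted
  and \<open>parts_mart\<close> is used.\<close>

lemma ratio_mart:
  assumes X: "regular X" and T: "stop_time M F T" and mart: "nn_mart (stopped T X)"
    and s: "0 \<le> s" "s \<le> t" and A: "A \<in> sets (progressive_enlargement M F \<tau> s)"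
    and loss: "AE \<omega> in M. loss X T t \<omega> = 0"
  shows "(\<integral>\<^sup>+\<omega>. indicator A \<omega> * ennreal (ratio X T t \<omega>) \<partial>M) = (\<integral>\<^sup>+\<omega>. indicator A \<omega> * ennreal (ratio X T s \<omega>) \<partial>M)"
proof -
  obtain B' where AM: "A \<in> sets M" and B': "B' \<in> sets (F s)"
    and AB: "A \<inter> {\<omega> \<in> space M. ennreal s < \<tau> \<omega>} = B' \<inter> {\<omega> \<in> space M. ennreal s < \<tau> \<omega>}"
    using s(1) A by (rule enlargementE)
  define B where "B = B' \<inter> {\<omega> \<in> space M. ennreal s < T \<omega>} \<inter> {\<omega> \<in> space M. L s \<omega> \<noteq> 0}"
  have B: "B \<in> sets (F s)" unfolding B_def by (rule ratio_split(1)[OF X T s AM B' AB])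
  have BT: "\<And>\<omega>. \<omega> \<in> B \<Longrightarrow> ennreal s < T \<omega>" and BL: "\<And>\<omega>. \<omega> \<in> B \<Longrightarrow> L s \<omega> \<noteq> 0" by (simp_all add: B_def)
  have "(\<integral>\<^sup>+\<omega>. indicator B \<omega> * loss X T t \<omega> \<partial>M) = (\<integral>\<^sup>+\<omega>. 0 \<partial>M)"
    by (rule nn_integral_cong_AE) (use loss in eventually_elim, simp)
  then have "(\<integral>\<^sup>+\<omega>. indicator B \<omega> * (indicator {\<omega>. ennreal s < \<tau> \<omega>} \<omega> * ennreal (ratio X T t \<omega>)) \<partial>M) =
    (\<integral>\<^sup>+\<omega>. indicator B \<omega> * (indicator {\<omega>. ennreal s < \<tau> \<omega>} \<omega> * ennreal (ratio X T t \<omega>)) \<partial>M) + (\<integral>\<^sup>+\<omega>. indicator B \<omega> * loss X T t \<omega> \<partial>M)"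
    by simp
  also have "\<dots> = (\<integral>\<^sup>+\<omega>. indicator B \<omega> * (sint (stopped T X) K s t \<omega> + ennreal (stopped T X t \<omega>) * ennreal (1 - K t \<omega>)) \<partial>M)"
    by (rule ratio_integral[OF X T s B BT])
  also have "\<dots> = (\<integral>\<^sup>+\<omega>. indicator B \<omega> * (ennreal (stopped T X s \<omega>) * ennreal (1 - K s \<omega>)) \<partial>M)"
    by (rule parts_mart[OF regular_stopped[OF X T] mart K s B])
  also have "\<dots> = (\<integral>\<^sup>+\<omega>. indicator B \<omega> * (indicator {\<omega>. ennreal s < \<tau> \<omega>} \<omega> * ennreal (ratio X T s \<omega>)) \<partial>M)"
    by (rule ratio_start[OF X T s(1) B BT BL, symmetric])
  finally show ?thesis
    unfolding ratio_split(2)[OF X T s AM B' AB] ratio_split(2)[OF X T s(1) order_refl AM B' AB] B_def[symmetric]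
    by simp
qed

lemma ratio_0: "AE \<omega> in M. ratio X T 0 \<omega> = X 0 \<omega>"
  using L_0 by eventually_elim (simp add: ratio_eq)

lemma ratio_version_adapted:
  assumes X: "regular X" and T: "stop_time M F T" and V: "AE \<omega> in M. \<forall>t. V t \<omega> = ratio X T t \<omega>"
  shows "adapted (progressive_enlargement M F \<tau>) V"
  unfolding adapted_def
proof (intro allI impI)
  fix t :: real assume t: "0 \<le> t"
  show "V t \<in> borel_measurable (progressive_enlargement M F \<tau> t)"
  proof (rule AE_measurable_superalgebra[OF ratio_adapted[OF X T t]])
    show "space (progressive_enlargement M F \<tau> t) = space M"
      using subalgebra_enlargement[OF t] by (simp add: subalgebra_def)
    show "A \<in> sets (progressive_enlargement M F \<tau> t)" if "A \<in> sets (F 0)" for A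
      using that mono_F[OF order_refl t] by (intro F_sub_enlargement[OF t]) blast
    show "AE \<omega> in M. ratio X T t \<omega> = V t \<omega>" using V by eventually_elim simp
  qed simp
qed

lemma ratio_version_cadlag:
  assumes X: "regular X" and V: "AE \<omega> in M. \<forall>t. V t \<omega> = ratio X T t \<omega>"
  shows "AE \<omega> in M. cadlag_path (\<lambda>t. V t \<omega>)"
  using V ratio_cadlag[OF X, of T] by eventually_elim simp

lemma ratio_version_integral:
  assumes V: "AE \<omega> in M. \<forall>t. V t \<omega> = ratio X T t \<omega>"
  shows "(\<integral>\<^sup>+\<omega>. indicator A \<omega> * ennreal (V t \<omega>) \<partial>M) = (\<integral>\<^sup>+\<omega>. indicator A \<omega> * ennreal (ratio X T t \<omega>) \<partial>M)"
  by (rule nn_integral_cong_AE) (use V in eventually_elim, simp)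

lemma ratio_version_0:
  assumes V: "AE \<omega> in M. \<forall>t. V t \<omega> = ratio X T t \<omega>"
  shows "(\<integral>\<^sup>+\<omega>. ennreal (V 0 \<omega>) \<partial>M) = (\<integral>\<^sup>+\<omega>. ennreal (X 0 \<omega>) \<partial>M)"
  by (rule nn_integral_cong_AE) (use V ratio_0[of X T] in eventually_elim, simp)

lemma ratio_version_supermartingale:
  assumes X: "regular X" and T: "stop_time M F T" and super: "nn_super (stopped T X)"
    and V: "AE \<omega> in M. \<forall>t. V t \<omega> = ratio X T t \<omega>" and fin: "(\<integral>\<^sup>+\<omega>. ennreal (X 0 \<omega>) \<partial>M) < \<infinity>"
  shows "supermartingale M (progressive_enlargement M F \<tau>) V"
proof (rule supermartingaleI_nn[OF subalgebra_enlargement ratio_version_adapted[OF X T V] ratio_version_cadlag[OF X V]])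
  show "AE \<omega> in M. 0 \<le> V t \<omega>" for t using V by eventually_elim (simp add: ratio_nonneg[OF X])
qed (simp_all only: ratio_version_0[OF V] fin ratio_version_integral[OF V] ratio_super[OF X T super])

lemma ratio_version_martingale:
  assumes X: "regular X" and T: "stop_time M F T" and mart: "nn_mart (stopped T X)"
    and loss: "\<And>t. 0 \<le> t \<Longrightarrow> AE \<omega> in M. loss X T t \<omega> = 0"
    and V: "AE \<omega> in M. \<forall>t. V t \<omega> = ratio X T t \<omega>" and fin: "(\<integral>\<^sup>+\<omega>. ennreal (X 0 \<omega>) \<partial>M) < \<infinity>"
  shows "martingale M (progressive_enlargement M F \<tau>) V"
proof (rule martingaleI_nn[OF subalgebra_enlargement ratio_version_adapted[OF X T V] ratio_version_cadlag[OF X V]])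
  show "AE \<omega> in M. 0 \<le> V t \<omega>" for t using V by eventually_elim (simp add: ratio_nonneg[OF X])
  fix s t :: real and A assume s: "0 \<le> s" "s \<le> t" and A: "A \<in> sets (progressive_enlargement M F \<tau> s)"
  show "(\<integral>\<^sup>+\<omega>. indicator A \<omega> * ennreal (V t \<omega>) \<partial>M) = (\<integral>\<^sup>+\<omega>. indicator A \<omega> * ennreal (V s \<omega>) \<partial>M)"
    unfolding ratio_version_integral[OF V] by (rule ratio_mart[OF X T mart s A loss]) (use s in simp)
qed (simp_all only: ratio_version_0[OF V] fin)

end

section \<open>Vanishing of the loss\<close>

context representation
begin

text \<open>Since \<open>L\<close> is nonzero at \<tau>, the indicator of \<open>{L = 0}\<close>
  integrates to zero against the indicator of \<open>[[\<tau>, \<infinity>[[\<close>, and hence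
  against its dual projection \<open>A\<close>. A jump of \<open>A\<close> at \<open>R\<close> with
  \<open>L\<close> zero at \<open>R\<close> would be an atom of \<open>A\<close> in that
  set.\<close>

lemma jump_zero:
  assumes A: "dual_optional_projection M F (\<lambda>t \<omega>. if \<tau> \<omega> \<le> ennreal t then 1 else 0) A"
    and R[measurable]: "R \<in> borel_measurable M" and R0: "\<And>\<omega>. 0 \<le> R \<omega>"
  shows "AE \<omega> in M. 0 < R \<omega> \<and> L (R \<omega>) \<omega> = 0 \<longrightarrow> A (R \<omega>) \<omega> - left_lim 0 (\<lambda>t. A t \<omega>) (R \<omega>) = 0"
proof -
  have adA: "adapted F A" and incA: "AE \<omega> in M. increasing_path (\<lambda>t. A t \<omega>)"
    using A by (simp_all only: dual_optional_projection_def)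
  have c: "increasing_path (\<lambda>t. 0)" by (simp add: increasing_path_def right_cont_path_def mono_on_def)
  obtain A' where A': "adapted F A'" and inc: "\<And>\<omega>. increasing_path (\<lambda>t. A' t \<omega>)"
    and eq: "AE \<omega> in M. \<forall>t. A' t \<omega> = A t \<omega>"
    using regularise[where P = increasing_path and c = 0, OF adA incA c] by blast
  have rc: "right_cont_path (\<lambda>t. A' t \<omega>)" for \<omega> using inc[of \<omega>] by (simp add: increasing_path_def)
  have at: "(\<lambda>\<omega>. A' (S \<omega>) \<omega>) \<in> borel_measurable M" if S[measurable]: "S \<in> borel_measurable M" and "\<And>\<omega>. 0 \<le> S \<omega>" for S
  proof -
    have "(\<lambda>\<omega>. (S \<omega>, \<omega>)) \<in> measurable M (borel \<Otimes>\<^sub>M M)" by measurable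
    from measurable_compose[OF this measurable_path[OF A' rc]] show ?thesis using that(2) by simp
  qed
  have [measurable]: "(\<lambda>\<omega>. L (R \<omega>) \<omega>) \<in> borel_measurable M"
  proof -
    have "(\<lambda>\<omega>. (R \<omega>, \<omega>)) \<in> measurable M (borel \<Otimes>\<^sub>M M)" by measurable
    from measurable_compose[OF this measurable_path[OF regularD(1,3)[OF L(1)]]] show ?thesis using R0 by simp
  qed
  note [measurable] = at[OF R R0]
  have [measurable]: "(\<lambda>\<omega>. A' (max 0 (R \<omega> - 1 / real (Suc n))) \<omega>) \<in> borel_measurable M" for n
  proof -
    have "(\<lambda>\<omega>. max 0 (R \<omega> - 1 / real (Suc n))) \<in> borel_measurable M" using R by measurable
    then show ?thesis by (rule at) simp
  qed
  define E where "E = {(t, \<omega>) \<in> {0..} \<times> space M. L t \<omega> \<in> {0}}"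
  have E: "E \<in> sets Opt"
    unfolding E_def by (rule Opt_basic) (use regularD[OF L(1)] in auto)
  have "(\<integral>\<^sup>+\<omega>. stieltjes_integral (\<lambda>t. indicator E (t, \<omega>)) (\<lambda>t. A t \<omega>) \<partial>M) =
    (\<integral>\<^sup>+\<omega>. stieltjes_integral (\<lambda>t. indicator E (t, \<omega>)) (\<lambda>t. if \<tau> \<omega> \<le> ennreal t then 1 else 0) \<partial>M)"
    using A[unfolded dual_optional_projection_def, THEN conjunct2, THEN conjunct2, THEN spec, THEN mp, of "\<lambda>t \<omega>. indicator E (t, \<omega>)"]
      optional_indicator[OF E] by simp
  also have "\<dots> = (\<integral>\<^sup>+\<omega>. 0 \<partial>M)"
  proof (rule nn_integral_cong_AE)
    show "AE \<omega> in M. stieltjes_integral (\<lambda>t. indicator E (t, \<omega>)) (\<lambda>t. if \<tau> \<omega> \<le> ennreal t then 1 else 0) = 0"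
      using L_tau tau_finite
    proof eventually_elim
      case (elim \<omega>)
      have "stieltjes_integral (\<lambda>t. indicator E (t, \<omega>)) (\<lambda>t. if \<tau> \<omega> \<le> ennreal t then 1 else 0) =
        (\<integral>\<^sup>+u. 0 \<partial>smeas (\<lambda>t. if \<tau> \<omega> \<le> ennreal t then 1 else 0))"
        unfolding stieltjes_integral_smeas
      proof (rule nn_integral_cong_AE)
        show "AE u in smeas (\<lambda>t. if \<tau> \<omega> \<le> ennreal t then 1 else 0). ennreal (indicator E (u, \<omega>)) * indicator {0..} u = 0"
          using smeas_time(1)[OF elim(2)]
        proof eventually_elim
          case u: (elim u)
          have "(u, \<omega>) \<notin> E" using elim(1) u by (simp add: E_def)
          then show ?case by simp
        qed
      qed
      then show ?case by simp
    qed
  qed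
  finally have zero: "(\<integral>\<^sup>+\<omega>. stieltjes_integral (\<lambda>t. indicator E (t, \<omega>)) (\<lambda>t. A t \<omega>) \<partial>M) = 0" by simp
  \<comment> \<open>The jump written as a lower limit of increments over shrinking intervals, which
    makes it visibly measurable in the outcome.\<close>
  define D where "D \<omega> = liminf (\<lambda>n. ennreal (A' (R \<omega>) \<omega> - A' (max 0 (R \<omega> - 1 / real (Suc n))) \<omega>))" for \<omega>
  have [measurable]: "D \<in> borel_measurable M" unfolding D_def by measurable
  have D_eq: "D \<omega> = ennreal (A' (R \<omega>) \<omega> - left_lim 0 (\<lambda>t. A' t \<omega>) (R \<omega>))" if "0 < R \<omega>" for \<omega>
  proof -
    have "(\<lambda>n. A' (max 0 (R \<omega> - 1 / real (Suc n))) \<omega>) \<longlonglongrightarrow> left_lim 0 (\<lambda>t. A' t \<omega>) (R \<omega>)"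
      by (rule left_grid_tendsto[OF increasing_path_left_lim[OF inc that] that])
    then have "(\<lambda>n. ennreal (A' (R \<omega>) \<omega> - A' (max 0 (R \<omega> - 1 / real (Suc n))) \<omega>)) \<longlonglongrightarrow> ennreal (A' (R \<omega>) \<omega> - left_lim 0 (\<lambda>t. A' t \<omega>) (R \<omega>))"
      by (intro tendsto_ennrealI tendsto_diff tendsto_const)
    then show ?thesis unfolding D_def by (rule lim_imp_Liminf[OF sequentially_bot])
  qed
  define P where "P = {\<omega> \<in> space M. 0 < R \<omega> \<and> L (R \<omega>) \<omega> = 0}"
  have [measurable]: "P \<in> sets M" unfolding P_def by measurable
  have "(\<integral>\<^sup>+\<omega>. indicator P \<omega> * D \<omega> \<partial>M) \<le> (\<integral>\<^sup>+\<omega>. stieltjes_integral (\<lambda>t. indicator E (t, \<omega>)) (\<lambda>t. A t \<omega>) \<partial>M)"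
  proof (rule nn_integral_mono_AE)
    show "AE \<omega> in M. indicator P \<omega> * D \<omega> \<le> stieltjes_integral (\<lambda>t. indicator E (t, \<omega>)) (\<lambda>t. A t \<omega>)"
      using eq
    proof eventually_elim
      case (elim \<omega>)
      show ?case
      proof (cases "\<omega> \<in> P")
        case True
        then have r: "0 < R \<omega>" "(R \<omega>, \<omega>) \<in> E" by (simp_all add: P_def E_def)
        have "D \<omega> = emeasure (smeas (\<lambda>t. A' t \<omega>)) {R \<omega>}"
          unfolding D_eq[OF r(1)] by (rule emeasure_smeas_point[OF inc r(1), symmetric])
        also have "\<dots> = (\<integral>\<^sup>+u. indicator {R \<omega>} u \<partial>smeas (\<lambda>t. A' t \<omega>))" by (rule nn_integral_indicator[symmetric]) simp
        also have "\<dots> \<le> (\<integral>\<^sup>+u. ennreal (indicator E (u, \<omega>)) * indicator {0..} u \<partial>smeas (\<lambda>t. A' t \<omega>))"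
          by (rule nn_integral_mono) (use r in \<open>simp add: indicator_def\<close>)
        also have "\<dots> = stieltjes_integral (\<lambda>t. indicator E (t, \<omega>)) (\<lambda>t. A t \<omega>)"
          unfolding stieltjes_integral_smeas by (simp only: elim)
        finally show ?thesis using True by simp
      qed simp
    qed
  qed
  then have "(\<integral>\<^sup>+\<omega>. indicator P \<omega> * D \<omega> \<partial>M) = 0" unfolding zero by simp
  then have "AE \<omega> in M. indicator P \<omega> * D \<omega> = 0"
    by (subst nn_integral_0_iff_AE[symmetric]) measurable
  then show ?thesis
    using eq AE_space
  proof eventually_elim
    case (elim \<omega>)
    show ?case
    proof
      assume r: "0 < R \<omega> \<and> L (R \<omega>) \<omega> = 0"
      then have "D \<omega> = 0" using elim(1,3) by (simp add: P_def)
      then have "A' (R \<omega>) \<omega> - left_lim 0 (\<lambda>t. A' t \<omega>) (R \<omega>) \<le> 0" using r by (simp add: D_eq ennreal_eq_0_iff)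
      moreover have "left_lim 0 (\<lambda>t. A' t \<omega>) (R \<omega>) \<le> A' (R \<omega>) \<omega>"
      proof (rule tendsto_upperbound[OF increasing_path_left_lim[OF inc]])
        show "\<forall>\<^sub>F u in at_left (R \<omega>). A' u \<omega> \<le> A' (R \<omega>) \<omega>"
          by (rule eventually_at_leftI[of 0]) (use r in \<open>auto intro: increasing_path_mono[OF inc]\<close>)
      qed (use r in simp_all)
      ultimately show "A (R \<omega>) \<omega> - left_lim 0 (\<lambda>t. A t \<omega>) (R \<omega>) = 0" by (simp add: elim(2))
    qed
  qed
qed

text \<open>Before \<open>level n\<close> the process \<open>L\<close> is bounded away from zero.  Hence, if \<open>L\<close> vanishes at the stopped
  time while \<open>K\<close> is still below one, then \<open>Z\<close> jumps to zero there and \<open>A\<close> does not jump: this time is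
  \<open>\<eta>\<close>.\<close>

lemma loss_zero:
  assumes Z: "azema_supermartingale M F \<tau> Z"
    and A: "dual_optional_projection M F (\<lambda>t \<omega>. if \<tau> \<omega> \<le> ennreal t then 1 else 0) A"
    and X: "AE \<omega> in M. \<forall>t\<ge>0. eta_time Z A \<omega> \<le> ennreal t \<longrightarrow> X t \<omega> = 0"
    and T: "stop_time M F T" "\<And>\<omega>. T \<omega> \<le> level n \<omega>"
  shows "AE \<omega> in M. loss X T t \<omega> = 0"
proof -
  define R where "R \<omega> = enn2real (min (T \<omega>) (ennreal t))" for \<omega>
  have [measurable]: "T \<in> borel_measurable M" by (rule stop_time_measurable[OF T(1)])
  have R_meas: "R \<in> borel_measurable M" unfolding R_def by measurable
  have R0: "0 \<le> R \<omega>" for \<omega> by (simp add: R_def)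
  show ?thesis
    using jump_zero[OF A R_meas R0] azema_indistinguishable[OF Z] L_0 X AE_space
  proof eventually_elim
    case (elim \<omega>)
    show ?case
    proof (rule ccontr)
      assume "loss X T t \<omega> \<noteq> 0"
      then have LR: "L (R \<omega>) \<omega> = 0" and XR: "X (R \<omega>) \<omega> \<noteq> 0" and KR: "K (R \<omega>) \<omega> < 1"
        by (auto simp: loss_def stopped_def R_def ennreal_eq_0_iff split: if_splits)
      \<comment> \<open>\<open>L 0 = 1\<close> rules out time zero, where \<open>left_lim\<close> is
        a prescribed value and not a limit.\<close>
      have Rpos: "0 < R \<omega>" using R0[of \<omega>] LR elim(3) by (cases "R \<omega> = 0") auto
      have "ennreal (R \<omega>) = min (T \<omega>) (ennreal t)"
        unfolding R_def by (rule ennreal_enn2real) (simp add: min_less_iff_disj)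
      then have Rl: "ennreal (R \<omega>) \<le> level n \<omega>" using T(2)[of \<omega>] by (simp add: min.coboundedI1)
      \<comment> \<open>A positive lower bound for \<open>Y\<close> before \<open>R\<close>: there
        \<open>L\<close> has not gone below \<open>1 / Suc n\<close>, and \<open>K\<close> is at
        most its value at \<open>R\<close>, which is below one. It shows both that \<open>Z\<close>
        has no earlier zero and that its left limit at \<open>R\<close> is positive.\<close>
      define c where "c = 1 / real (Suc n) * (1 - K (R \<omega>) \<omega>)"
      have c: "0 < c" unfolding c_def using KR by (intro mult_pos_pos) simp_all
      have Y_ge: "c \<le> Y u \<omega>" if u: "0 \<le> u" "u < R \<omega>" for u
      proof -
        have "ennreal u < ennreal (R \<omega>)" using u by (simp add: ennreal_less_iff)
        then have "1 / real (Suc n) \<le> L u \<omega>" using Rl by (intro level_before[OF u(1) _ elim(5)]) (rule less_le_trans)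
        moreover have "1 - K (R \<omega>) \<omega> \<le> 1 - K u \<omega>" using increasing_processD(7)[OF K u(1) less_imp_le[OF u(2)], of \<omega>] by simp
        ultimately show ?thesis
          unfolding c_def Y_def by (rule mult_mono) (use KR regularD(4)[OF L(1) u(1)] in simp_all)
      qed
      have ZR: "Z (R \<omega>) \<omega> = 0" using elim(2) R0[of \<omega>] LR by (simp add: Y_def)
      have zt: "zero_time Z \<omega> = ennreal (R \<omega>)"
        unfolding zero_time_def
      proof (rule antisym)
        show "Inf {ennreal t |t. 0 \<le> t \<and> Z t \<omega> = 0} \<le> ennreal (R \<omega>)"
          by (rule Inf_lower) (use ZR R0[of \<omega>] in blast)
        show "ennreal (R \<omega>) \<le> Inf {ennreal t |t. 0 \<le> t \<and> Z t \<omega> = 0}"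
        proof (rule Inf_greatest)
          fix x assume "x \<in> {ennreal t |t. 0 \<le> t \<and> Z t \<omega> = 0}"
          then obtain u where u: "x = ennreal u" "0 \<le> u" "Z u \<omega> = 0" by auto
          have "\<not> u < R \<omega>" using Y_ge[OF u(2)] c elim(2) u by auto
          then show "ennreal (R \<omega>) \<le> x" unfolding u(1) by (intro ennreal_leI) simp
        qed
      qed
      obtain l where l: "((\<lambda>u. Y u \<omega>) \<longlongrightarrow> l) (at_left (R \<omega>))"
        using Y_cadlag[of \<omega>] Rpos by (auto simp: cadlag_path_def)
      have "\<forall>\<^sub>F u in at_left (R \<omega>). c \<le> Y u \<omega>"
        by (rule eventually_at_leftI[of 0]) (use Y_ge Rpos in auto)
      then have "c \<le> l" by (rule tendsto_lowerbound[OF l]) simp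
      moreover have "((\<lambda>u. Z u \<omega>) \<longlongrightarrow> l) (at_left (R \<omega>))"
      proof (rule Lim_transform_eventually[OF l])
        show "\<forall>\<^sub>F u in at_left (R \<omega>). Y u \<omega> = Z u \<omega>"
          by (rule eventually_at_leftI[of 0]) (use elim(2) Rpos in auto)
      qed
      then have "Lim (at_left (R \<omega>)) (\<lambda>u. Z u \<omega>) = l" by (rule tendsto_Lim[rotated]) simp
      ultimately have ll: "0 < left_lim (Z 0 \<omega>) (\<lambda>u. Z u \<omega>) (R \<omega>)" using c Rpos by (simp add: left_lim_def)
      have "eta_time Z A \<omega> = ennreal (R \<omega>)"
        unfolding eta_time_def zt Let_def using elim(1) ll LR Rpos R0[of \<omega>] by simp
      then show False using elim(4) R0[of \<omega>] XR by simp
    qed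
  qed
qed

end

section \<open>Regular versions\<close>

context usual_filtration
begin

lemma cadlag_path_const: "cadlag_path (\<lambda>t. c)"
  by (auto simp: cadlag_path_def right_cont_path_def)

lemma regular_version:
  assumes X: "adapted F X" "AE \<omega> in M. cadlag_path (\<lambda>t. X t \<omega>)" "nonneg_process M X"
  obtains X' where "regular X'" "AE \<omega> in M. \<forall>t. X' t \<omega> = X t \<omega>"
proof -
  have "AE \<omega> in M. cadlag_path (\<lambda>t. X t \<omega>) \<and> (\<forall>t\<ge>0. 0 \<le> X t \<omega>)"
    using X(2) X(3)[unfolded nonneg_process_def] by eventually_elim simp
  moreover have "cadlag_path (\<lambda>t. 0) \<and> (\<forall>t\<ge>0. (0::real) \<le> 0)" for t :: real by (simp add: cadlag_path_const)
  ultimately obtain X' where "adapted F X'" "\<And>\<omega>. cadlag_path (\<lambda>t. X' t \<omega>) \<and> (\<forall>t\<ge>0. 0 \<le> X' t \<omega>)" "AE \<omega> in M. \<forall>t. X' t \<omega> = X t \<omega>"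
    using regularise[where P = "\<lambda>f. cadlag_path f \<and> (\<forall>t\<ge>0. 0 \<le> f t)" and c = 0, OF X(1)] by blast
  then show thesis by (intro that[of X']) (simp_all add: regular_def)
qed

lemma version_super:
  assumes X: "regular X" and eq: "\<And>t. 0 \<le> t \<Longrightarrow> AE \<omega> in M. X t \<omega> = W t \<omega>" and W: "supermartingale M F W"
  shows "nn_super X"
proof (rule supermartingale_nn_super[OF X])
  have WM: "W t \<in> borel_measurable M" if "0 \<le> t" for t
    using W that by (auto simp: supermartingale_def)
  show "integrable M (X t)" if t: "0 \<le> t" for t
    using integrable_cong_AE[OF regularD(6)[OF X t] WM[OF t] eq[OF t]] W t by (simp add: supermartingale_def)
  fix s t :: real assume s: "0 \<le> s" "s \<le> t"
  then have t: "0 \<le> t" by simp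
  interpret S: sigma_finite_subalgebra M "F s" by (rule sigma_finite_subalgebraI[OF subalgebra_F[OF s(1)]])
  have "AE \<omega> in M. real_cond_exp M (F s) (W t) \<omega> \<le> W s \<omega>" using W s by (simp add: supermartingale_def)
  then show "AE \<omega> in M. real_cond_exp M (F s) (X t) \<omega> \<le> X s \<omega>"
    using S.real_cond_exp_cong[OF eq[OF t] regularD(6)[OF X t] WM[OF t]] eq[OF s(1)] by eventually_elim simp
qed

lemma version_mart:
  assumes X: "regular X" and eq: "\<And>t. 0 \<le> t \<Longrightarrow> AE \<omega> in M. X t \<omega> = W t \<omega>" and W: "martingale M F W"
  shows "nn_mart X"
proof (rule martingale_nn_mart[OF X])
  have WM: "W t \<in> borel_measurable M" if "0 \<le> t" for t
    using W that by (auto simp: martingale_def)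
  show "integrable M (X t)" if t: "0 \<le> t" for t
    using integrable_cong_AE[OF regularD(6)[OF X t] WM[OF t] eq[OF t]] W t by (simp add: martingale_def)
  fix s t :: real assume s: "0 \<le> s" "s \<le> t"
  then have t: "0 \<le> t" by simp
  interpret S: sigma_finite_subalgebra M "F s" by (rule sigma_finite_subalgebraI[OF subalgebra_F[OF s(1)]])
  have "AE \<omega> in M. real_cond_exp M (F s) (W t) \<omega> = W s \<omega>" using W s by (simp add: martingale_def)
  then show "AE \<omega> in M. real_cond_exp M (F s) (X t) \<omega> = X s \<omega>"
    using S.real_cond_exp_cong[OF eq[OF t] regularD(6)[OF X t] WM[OF t]] eq[OF s(1)] by eventually_elim simp
qed

lemma stopped_version: "AE \<omega> in M. \<forall>t. X' t \<omega> = X t \<omega> \<Longrightarrow> AE \<omega> in M. stopped T X' t \<omega> = stopped T X t \<omega>"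
  by (auto elim: eventually_mono simp: stopped_def)

lemma initial_integral_finite:
  assumes X: "regular X" and eq: "AE \<omega> in M. \<forall>t. X t \<omega> = W t \<omega>" and W: "integrable M (W 0)"
  shows "(\<integral>\<^sup>+\<omega>. ennreal (X 0 \<omega>) \<partial>M) < \<infinity>"
proof -
  have "integrable M (X 0)"
  proof (rule integrable_cong_AE[THEN iffD2, OF regularD(6)[OF X order_refl] borel_measurable_integrable[OF W] _ W])
    show "AE \<omega> in M. X 0 \<omega> = W 0 \<omega>" using eq by eventually_elim simp
  qed
  then show ?thesis
    using nn_integral_eq_integral[of M "X 0"] regularD(4)[OF X order_refl] by simp
qed

text \<open>Modifying null sets of paths changes none of the integrals. The localising sequence of
  \<open>L\<close> enters through \<open>nn_super_localised\<close>.\<close>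

lemma representation_version:
  assumes \<tau>: "\<tau> \<in> borel_measurable M" "measure M {\<omega> \<in> space M. \<tau> \<omega> = \<infinity>} = 0" and KL: "representation_pair M F \<tau> K L"
  obtains K' L' where "representation M F \<tau> K' L'" "AE \<omega> in M. \<forall>t. L' t \<omega> = L t \<omega>"
proof -
  have adK: "adapted F K" and PK: "AE \<omega> in M. increasing_path (\<lambda>t. K t \<omega>) \<and> (\<forall>t\<ge>0. 0 \<le> K t \<omega> \<and> K t \<omega> \<le> 1)"
    and locL: "local_martingale M F L" and posL: "nonneg_process M L" and L0: "AE \<omega> in M. L 0 \<omega> = 1"
    and rep: "\<And>V. optional M F V \<Longrightarrow> (\<forall>t\<ge>0. \<forall>\<omega>\<in>space M. 0 \<le> V t \<omega>) \<Longrightarrow>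
        (\<integral>\<^sup>+ \<omega>. ennreal (at_time V \<tau> \<omega>) \<partial>M) =
        (\<integral>\<^sup>+ \<omega>. stieltjes_integral (\<lambda>t. V t \<omega> * L t \<omega>) (\<lambda>t. K t \<omega>) \<partial>M)"
    and LK: "AE \<omega> in M. stieltjes_integral (\<lambda>t. if L t \<omega> = 0 then 1 else 0) (\<lambda>t. K t \<omega>) = 0"
    using KL unfolding representation_pair_def by blast+
  have adL: "adapted F L" and cadL: "AE \<omega> in M. cadlag_path (\<lambda>t. L t \<omega>)"
    using locL by (simp_all add: local_martingale_def)
  obtain T :: "nat \<Rightarrow> 'a \<Rightarrow> ennreal" where T: "\<And>n. stop_time M F (T n)"
    and lim: "AE \<omega> in M. incseq (\<lambda>n. T n \<omega>) \<and> (\<lambda>n. T n \<omega>) \<longlonglongrightarrow> \<infinity>" and mart: "\<And>n. martingale M F (stopped (T n) L)"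
    using locL unfolding local_martingale_def by blast
  have "AE \<omega> in M. increasing_path (\<lambda>t. K t \<omega>) \<and> (\<forall>t\<ge>0. K t \<omega> \<le> 1)" using PK by eventually_elim simp
  moreover have "increasing_path (\<lambda>t. 0) \<and> (\<forall>t\<ge>0. (0::real) \<le> 1)" for t :: real
    by (simp add: increasing_path_def right_cont_path_def mono_on_def)
  ultimately obtain K' where K': "adapted F K'" "\<And>\<omega>. increasing_path (\<lambda>t. K' t \<omega>) \<and> (\<forall>t\<ge>0. K' t \<omega> \<le> 1)"
    and eqK: "AE \<omega> in M. \<forall>t. K' t \<omega> = K t \<omega>"
    using regularise[where P = "\<lambda>f. increasing_path f \<and> (\<forall>t\<ge>0. f t \<le> 1)" and c = 0, OF adK] by blast
  obtain L' where L': "regular L'" and eqL: "AE \<omega> in M. \<forall>t. L' t \<omega> = L t \<omega>"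
    using adL cadL posL by (rule regular_version)
  have incK: "increasing_process K'" using K' by (simp add: increasing_process_def)
  have "representation M F \<tau> K' L'"
  proof (intro representation.intro representation_axioms.intro usual_filtration_axioms \<tau>(1) incK L')
    have "emeasure M {\<omega> \<in> space M. \<tau> \<omega> = \<infinity>} = 0" using \<tau>(2) by (simp add: emeasure_eq_measure)
    moreover have "{\<omega> \<in> space M. \<tau> \<omega> = \<infinity>} \<in> sets M" using \<tau>(1) by measurable
    ultimately have "AE \<omega> in M. \<omega> \<notin> {\<omega> \<in> space M. \<tau> \<omega> = \<infinity>}" by (intro AE_not_in null_setsI)
    then show "AE \<omega> in M. \<tau> \<omega> < \<infinity>" using AE_space by eventually_elim (simp add: less_top)
    show "nn_super L'"
    proof (rule nn_super_localised[OF L' T])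
      show "AE \<omega> in M. (\<lambda>n. T n \<omega>) \<longlonglongrightarrow> \<infinity>" using lim by eventually_elim simp
      show "nn_mart (stopped (T n) L')" for n
        by (rule version_mart[OF regular_stopped[OF L' T] stopped_version[OF eqL] mart])
    qed
    show "AE \<omega> in M. L' 0 \<omega> = 1" using L0 eqL by eventually_elim simp
  next
    fix V assume V: "optional M F V" "\<And>t \<omega>. 0 \<le> t \<Longrightarrow> \<omega> \<in> space M \<Longrightarrow> 0 \<le> V t \<omega>"
    have "(\<integral>\<^sup>+\<omega>. ennreal (V (enn2real (\<tau> \<omega>)) \<omega>) \<partial>M) = (\<integral>\<^sup>+ \<omega>. stieltjes_integral (\<lambda>t. V t \<omega> * L t \<omega>) (\<lambda>t. K t \<omega>) \<partial>M)"
      using rep[OF V(1)] V(2) by (simp add: at_time_def)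
    also have "\<dots> = (\<integral>\<^sup>+\<omega>. (\<integral>\<^sup>+u. ennreal (V u \<omega> * L' u \<omega>) * indicator {0..} u \<partial>smeas (\<lambda>t. K' t \<omega>)) \<partial>M)"
    proof (rule nn_integral_cong_AE)
      show "AE \<omega> in M. stieltjes_integral (\<lambda>t. V t \<omega> * L t \<omega>) (\<lambda>t. K t \<omega>) =
        (\<integral>\<^sup>+u. ennreal (V u \<omega> * L' u \<omega>) * indicator {0..} u \<partial>smeas (\<lambda>t. K' t \<omega>))"
        using eqK eqL by eventually_elim (simp only: stieltjes_integral_smeas)
    qed
    finally show "(\<integral>\<^sup>+\<omega>. ennreal (V (enn2real (\<tau> \<omega>)) \<omega>) \<partial>M) =
      (\<integral>\<^sup>+\<omega>. (\<integral>\<^sup>+u. ennreal (V u \<omega> * L' u \<omega>) * indicator {0..} u \<partial>smeas (\<lambda>t. K' t \<omega>)) \<partial>M)" .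
  next
    show "AE \<omega> in M. AE u in smeas (\<lambda>t. K' t \<omega>). 0 \<le> u \<longrightarrow> L' u \<omega> \<noteq> 0"
      using LK eqK eqL AE_space
    proof eventually_elim
      case (elim \<omega>)
      \<comment> \<open>Nothing is known about \<open>L'\<close> at negative times. The path is cut
        off at zero, and the indicator of \<open>{0..}\<close> makes the cut invisible.\<close>
      have [measurable]: "(\<lambda>u. if 0 \<le> u then L' u \<omega> else 0) \<in> borel_measurable borel"
      proof -
        have "(\<lambda>u. (u, \<omega>)) \<in> measurable borel (borel \<Otimes>\<^sub>M M)" using elim(4) by measurable
        from measurable_compose[OF this measurable_path[OF regularD(1,3)[OF L']]] show ?thesis by simp
      qed
      have eqf: "ennreal (if (if 0 \<le> u then L' u \<omega> else 0) = 0 then 1 else 0) * indicator {0..} u =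
        ennreal (if L' u \<omega> = 0 then 1 else 0) * indicator {0..} u" for u
        by (cases "0 \<le> u") simp_all
      have "(\<lambda>u. ennreal (if (if 0 \<le> u then L' u \<omega> else 0) = 0 then 1 else 0) * indicator {0..} u) \<in> borel_measurable borel"
        by measurable
      then have m: "(\<lambda>u. ennreal (if L' u \<omega> = 0 then 1 else 0) * indicator {0..} u) \<in> borel_measurable (smeas (\<lambda>t. K' t \<omega>))"
        unfolding eqf measurable_cong_sets[OF sets_smeas refl] .
      have "(\<integral>\<^sup>+u. ennreal (if L' u \<omega> = 0 then 1 else 0) * indicator {0..} u \<partial>smeas (\<lambda>t. K' t \<omega>)) = 0"
        using elim(1) unfolding stieltjes_integral_smeas by (simp only: elim(2,3))
      then have "AE u in smeas (\<lambda>t. K' t \<omega>). ennreal (if L' u \<omega> = 0 then 1 else 0) * indicator {0..} u = 0"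
        by (simp only: nn_integral_0_iff_AE[OF m])
      then show ?case by eventually_elim (auto split: if_splits)
    qed
  qed
  then show thesis using eqL by (rule that)
qed

end

section \<open>Localisation before the enlarging time\<close>

context representation
begin

lemma stop_time_top: "stop_time M F (\<lambda>_. \<infinity>)"
  by (simp add: stop_time_def top_unique)

lemma quotient_version:
  assumes L': "AE \<omega> in M. \<forall>t. L t \<omega> = L\<^sub>0 t \<omega>" and X': "AE \<omega> in M. \<forall>t. X t \<omega> = X\<^sub>0 t \<omega>"
  shows "AE \<omega> in M. \<forall>t. stopped \<tau> X\<^sub>0 t \<omega> / stopped \<tau> L\<^sub>0 t \<omega> = ratio X (\<lambda>_. \<infinity>) t \<omega>"
  using L' X' by eventually_elim (simp add: ratio_def stopped_def)

lemma quotient_supermartingale: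
  assumes L': "AE \<omega> in M. \<forall>t. L t \<omega> = L\<^sub>0 t \<omega>" and X: "supermartingale M F X" "nonneg_process M X"
  shows "supermartingale M (progressive_enlargement M F \<tau>) (\<lambda>t \<omega>. stopped \<tau> X t \<omega> / stopped \<tau> L\<^sub>0 t \<omega>)"
proof -
  have "adapted F X" "AE \<omega> in M. cadlag_path (\<lambda>t. X t \<omega>)"
    using X(1) by (simp_all add: supermartingale_def)
  then obtain X' where X': "regular X'" and eq: "AE \<omega> in M. \<forall>t. X' t \<omega> = X t \<omega>"
    using X(2) by (rule regular_version)
  show ?thesis
  proof (rule ratio_version_supermartingale[OF X' stop_time_top _ quotient_version[OF L' eq]])
    show "nn_super (stopped (\<lambda>_. \<infinity>) X')"
    proof (rule version_super[OF regular_stopped[OF X' stop_time_top] _ X(1)])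
      show "AE \<omega> in M. stopped (\<lambda>_. \<infinity>) X' t \<omega> = X t \<omega>" if "0 \<le> t" for t
        using eq by eventually_elim (use that in \<open>simp add: stopped_def\<close>)
    qed
    show "(\<integral>\<^sup>+\<omega>. ennreal (X' 0 \<omega>) \<partial>M) < \<infinity>"
      by (rule initial_integral_finite[OF X' eq]) (use X(1) in \<open>simp add: supermartingale_def\<close>)
  qed
qed

text \<open>Before \<open>\<tau>\<close>, stopping at \<open>before_tau n\<close> is stopping at \<open>level n\<close>; since \<open>\<tau> \<le> level n\<close> for large \<open>n\<close>,
  these times increase to infinity, whereas \<open>level n\<close> may stay bounded.\<close>

definition before_tau :: "nat \<Rightarrow> 'a \<Rightarrow> ennreal" where
  "before_tau n \<omega> = (if level n \<omega> < \<tau> \<omega> then level n \<omega> else \<infinity>)"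

text \<open>On \<open>{\<tau> > t}\<close>, the event that \<open>level n\<close> is before \<tau>
  and at most \<open>t\<close> reduces to \<open>level n \<le> t\<close>, which is known in
  \<open>F t\<close>. This is all that the enlargement asks for.\<close>

lemma stop_time_before_tau:
  assumes R: "stop_time M F R"
  shows "stop_time M (progressive_enlargement M F \<tau>) (\<lambda>\<omega>. min (R \<omega>) (before_tau n \<omega>))"
  unfolding stop_time_def
proof (intro allI impI)
  fix t :: real assume t: "0 \<le> t"
  have [measurable]: "level n \<in> borel_measurable M" by (rule stop_time_measurable[OF stop_time_level])
  let ?D = "{\<omega> \<in> space M. level n \<omega> < \<tau> \<omega> \<and> level n \<omega> \<le> ennreal t}"
  have "?D \<in> sets M" by measurable
  moreover have "{\<omega> \<in> space M. level n \<omega> \<le> ennreal t} \<in> sets (F t)" by (rule stop_timeD[OF stop_time_level t])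
  moreover have "?D \<inter> {\<omega> \<in> space M. ennreal t < \<tau> \<omega>} = {\<omega> \<in> space M. level n \<omega> \<le> ennreal t} \<inter> {\<omega> \<in> space M. ennreal t < \<tau> \<omega>}"
    by (auto intro: le_less_trans)
  ultimately have D: "?D \<in> sets (progressive_enlargement M F \<tau> t)"
    unfolding sets_enlargement[OF t] by blast
  have "{\<omega> \<in> space M. min (R \<omega>) (before_tau n \<omega>) \<le> ennreal t} = {\<omega> \<in> space M. R \<omega> \<le> ennreal t} \<union> ?D"
    by (auto simp: before_tau_def min_le_iff_disj top_unique split: if_splits)
  then show "{\<omega> \<in> space M. min (R \<omega>) (before_tau n \<omega>) \<le> ennreal t} \<in> sets (progressive_enlargement M F \<tau> t)"
    using D F_sub_enlargement[OF t stop_timeD[OF R t]] by (simp only: sets.Un)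
qed

lemma before_tau_mono: "incseq (\<lambda>n. before_tau n \<omega>)"
proof (rule incseq_SucI)
  fix n show "before_tau n \<omega> \<le> before_tau (Suc n) \<omega>"
    using level_mono[of n \<omega>] by (auto simp: before_tau_def intro: le_less_trans)
qed

lemma before_tau_eventually: "AE \<omega> in M. \<forall>\<^sub>F n in sequentially. before_tau n \<omega> = \<infinity>"
  using tau_le_level
proof eventually_elim
  case (elim \<omega>)
  then obtain n\<^sub>0 where n\<^sub>0: "\<tau> \<omega> \<le> level n\<^sub>0 \<omega>" by (rule exE)
  have "before_tau n \<omega> = \<infinity>" if "n\<^sub>0 \<le> n" for n
  proof -
    have "level n\<^sub>0 \<omega> \<le> level n \<omega>" using that by (rule lift_Suc_mono_le[of "\<lambda>n. level n \<omega>", OF level_mono])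
    with n\<^sub>0 have "\<tau> \<omega> \<le> level n \<omega>" by (rule order_trans)
    then have "\<not> level n \<omega> < \<tau> \<omega>" by (simp only: not_less)
    then show ?thesis by (simp add: before_tau_def)
  qed
  then show ?case unfolding eventually_sequentially by blast
qed

text \<open>The two times differ only if \<open>\<tau> \<le> level n\<close>, and then both have the
  minimum \<tau> with \<tau>. Hence a localisation in the enlarged filtration can be computed with
  stopping times of \<open>F\<close>.\<close>

lemma min_before_tau:
  "min (\<tau> \<omega>) (min (min R (before_tau n \<omega>)) t) = min (min (\<tau> \<omega>) (min R (level n \<omega>))) t"
proof -
  have "min (\<tau> \<omega>) (before_tau n \<omega>) = min (\<tau> \<omega>) (level n \<omega>)"
    by (simp add: before_tau_def min.absorb1 not_less)
  then show ?thesis by (metis min.assoc min.commute)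
qed

text \<open>The localising times belong to the enlarged filtration, but up to \<tau> they stop at
  the minimum of \<open>R n\<close> and \<open>level n\<close>, a stopping time of \<open>F\<close>.
  At it \<open>X\<close> stays a martingale by optional stopping, and the loss vanishes because this
  time does not exceed \<open>level n\<close>.\<close>

lemma quotient_local_martingale:
  assumes L': "AE \<omega> in M. \<forall>t. L t \<omega> = L\<^sub>0 t \<omega>"
    and Z: "azema_supermartingale M F \<tau> Z"
    and A: "dual_optional_projection M F (\<lambda>t \<omega>. if \<tau> \<omega> \<le> ennreal t then 1 else 0) A"
    and X: "local_martingale M F X" "nonneg_process M X" "AE \<omega> in M. \<forall>t\<ge>0. eta_time Z A \<omega> \<le> ennreal t \<longrightarrow> X t \<omega> = 0"
  shows "local_martingale M (progressive_enlargement M F \<tau>) (\<lambda>t \<omega>. stopped \<tau> X t \<omega> / stopped \<tau> L\<^sub>0 t \<omega>)"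
proof -
  have "adapted F X" "AE \<omega> in M. cadlag_path (\<lambda>t. X t \<omega>)"
    using X(1) by (simp_all add: local_martingale_def)
  then obtain X' where X': "regular X'" and eq: "AE \<omega> in M. \<forall>t. X' t \<omega> = X t \<omega>"
    using X(2) by (rule regular_version)
  obtain R :: "nat \<Rightarrow> 'a \<Rightarrow> ennreal" where R: "\<And>n. stop_time M F (R n)"
    and lim: "AE \<omega> in M. incseq (\<lambda>n. R n \<omega>) \<and> (\<lambda>n. R n \<omega>) \<longlonglongrightarrow> \<infinity>" and mart: "\<And>n. martingale M F (stopped (R n) X)"
    using X(1) unfolding local_martingale_def by blast
  have eta: "AE \<omega> in M. \<forall>t\<ge>0. eta_time Z A \<omega> \<le> ennreal t \<longrightarrow> X' t \<omega> = 0"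
    using X(3) eq by eventually_elim simp
  note V = quotient_version[OF L' eq]
  let ?V = "\<lambda>t \<omega>. stopped \<tau> X t \<omega> / stopped \<tau> L\<^sub>0 t \<omega>" and ?S = "\<lambda>n \<omega>. min (R n \<omega>) (before_tau n \<omega>)"
  have inc: "AE \<omega> in M. incseq (\<lambda>n. ?S n \<omega>) \<and> (\<lambda>n. ?S n \<omega>) \<longlonglongrightarrow> \<infinity>"
    using lim before_tau_eventually
  proof eventually_elim
    case (elim \<omega>)
    have "incseq (\<lambda>n. ?S n \<omega>)"
      using elim(1) before_tau_mono[of \<omega>] unfolding incseq_def by (meson min.mono)
    moreover have "(\<lambda>n. ?S n \<omega>) \<longlonglongrightarrow> \<infinity>"
    proof (rule Lim_transform_eventually)
      show "(\<lambda>n. R n \<omega>) \<longlonglongrightarrow> \<infinity>" using elim(1) by simp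
      show "\<forall>\<^sub>F n in sequentially. R n \<omega> = ?S n \<omega>" using elim(2) by eventually_elim simp
    qed
    ultimately show ?case by simp
  qed
  have "martingale M (progressive_enlargement M F \<tau>) (stopped (?S n) ?V)" for n
  proof -
    let ?T = "\<lambda>\<omega>. min (R n \<omega>) (level n \<omega>)"
    have T: "stop_time M F ?T" by (rule stop_time_min[OF R stop_time_level])
    have comp: "stopped (level n) (stopped (R n) X') = stopped ?T X'"
    proof (intro ext)
      fix t \<omega>
      have "ennreal (enn2real (min (level n \<omega>) (ennreal t))) = min (level n \<omega>) (ennreal t)"
        by (rule ennreal_enn2real) (simp add: min_less_iff_disj)
      then show "stopped (level n) (stopped (R n) X') t \<omega> = stopped ?T X' t \<omega>"
        by (simp only: stopped_def min.assoc)
    qed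
    have "nn_mart (stopped (R n) X')"
      by (rule version_mart[OF regular_stopped[OF X' R] stopped_version[OF eq] mart])
    from nn_mart_stopped[OF regular_stopped[OF X' R] this stop_time_level[of n]]
    have nn: "nn_mart (stopped ?T X')" by (simp only: comp)
    show ?thesis
    proof (rule ratio_version_martingale[OF X' T nn])
      show "AE \<omega> in M. loss X' ?T t \<omega> = 0" for t by (rule loss_zero[OF Z A eta T min.cobounded2])
      show "AE \<omega> in M. \<forall>t. stopped (?S n) ?V t \<omega> = ratio X' ?T t \<omega>"
        using V
      proof eventually_elim
        case (elim \<omega>)
        show ?case
        proof
          fix t
          have "ennreal (enn2real (min (?S n \<omega>) (ennreal t))) = min (?S n \<omega>) (ennreal t)"
            by (rule ennreal_enn2real) (simp add: min_less_iff_disj)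
          moreover have "stopped (?S n) ?V t \<omega> = ratio X' (\<lambda>_. \<infinity>) (enn2real (min (?S n \<omega>) (ennreal t))) \<omega>"
            unfolding stopped_def[of "?S n"] by (rule elim[THEN spec])
          ultimately show "stopped (?S n) ?V t \<omega> = ratio X' ?T t \<omega>"
            by (simp add: ratio_eq min_before_tau)
        qed
      qed
      have "integrable M (X 0)"
      proof -
        have "integrable M (stopped (R n) X 0)" using mart[of n] by (simp add: martingale_def)
        moreover have "stopped (R n) X 0 = X 0" by (rule ext) (simp add: stopped_def)
        ultimately show ?thesis by simp
      qed
      then show "(\<integral>\<^sup>+\<omega>. ennreal (X' 0 \<omega>) \<partial>M) < \<infinity>" by (rule initial_integral_finite[OF X' eq])
    qed
  qed
  then show ?thesis
    unfolding local_martingale_def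
    using ratio_version_adapted[OF X' stop_time_top V] ratio_version_cadlag[OF X' V] inc stop_time_before_tau[OF R]
    by (intro conjI exI[where x = ?S]) simp_all
qed

end

theorem proposition2p7:
  fixes M :: "'a measure" and F :: "real \<Rightarrow> 'a measure" and \<tau> :: "'a \<Rightarrow> ennreal"
    and K L Z A :: "real \<Rightarrow> 'a \<Rightarrow> real"
  assumes "usual_filtration M F"
    and "\<tau> \<in> borel_measurable M"
    and "measure M {\<omega> \<in> space M. \<tau> \<omega> = \<infinity>} = 0"
    and "representation_pair M F \<tau> K L"
    and "azema_supermartingale M F \<tau> Z"
    and "dual_optional_projection M F (\<lambda>t \<omega>. if \<tau> \<omega> \<le> ennreal t then 1 else 0) A"
  defines "G \<equiv> progressive_enlargement M F \<tau>"
    and "\<eta> \<equiv> eta_time Z A"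
  shows "(\<forall>X. supermartingale M F X \<and> nonneg_process M X \<longrightarrow>
            supermartingale M G (\<lambda>t \<omega>. stopped \<tau> X t \<omega> / stopped \<tau> L t \<omega>)) \<and>
         (\<forall>X. local_martingale M F X \<and> nonneg_process M X \<and>
              (AE \<omega> in M. \<forall>t\<ge>0. \<eta> \<omega> \<le> ennreal t \<longrightarrow> X t \<omega> = 0) \<longrightarrow>
            local_martingale M G (\<lambda>t \<omega>. stopped \<tau> X t \<omega> / stopped \<tau> L t \<omega>))"
proof -
  interpret usual_filtration M F by fact
  obtain K' L' where KL: "representation M F \<tau> K' L'" and L': "AE \<omega> in M. \<forall>t. L' t \<omega> = L t \<omega>"
    using assms(2,3,4) by (rule representation_version)
  interpret representation M F \<tau> K' L' by (rule KL)
  show ?thesis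
    unfolding G_def \<eta>_def
    by (intro conjI allI impI; elim conjE)
      (rule quotient_supermartingale[OF L'] quotient_local_martingale[OF L' assms(5,6)]; assumption)+
qed

end
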